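(* For $m=1$, $N > 1$ and $\mathrm{char}\,\mathbb{K} \neq 2$, $$\mathrm{HH}^*(\Lambda_N)/\mathcal{N}\cong \mathbb{K}[\chi_{2,0}, \chi_{2,2}, \chi_{4,2}]/(\chi_{2,0}\chi_{2,2}).$$ Hence $\mathrm{HH}^*(\Lambda_N)/\mathcal{N}$ is a commutative finitely generated algebra of Krull dimension $2$.
   Context: Let $\mathbb{K}$ be a field. For $m=1$, $\Lambda_N$ is the quotient of the path algebra of the quiver with one vertex and two loops $a,\bar a$ (i.e. the free algebra $\mathbb{K}\langle a,\bar a\rangle$) by the ideal generated by $a^2$, $\bar a^2$ and $(a\bar a)^N-(\bar aa)^N$. $\mathrm{HH}^*(\Lambda_N)=\mathrm{Ext}^*_{\Lambda_N^e}(\Lambda_N,\Lambda_N)$ with the Yoneda product; $\mathcal{N}$ is the ideal generated by all homogeneous nilpotent elements. Write $\otimes=\otimes_{\mathbb{K}}$. A minimal projective bimodule resolution of $\Lambda_N$ is $(P^*,\partial^* )$ with $P^n=\bigoplus_{r=0}^n\Lambda_N\otimes\Lambda_N$; write $1\otimes_r1$ for the generator of the $r$-th summand of $P^n$ (in $P^{n-1}$, set $1\otimes_{-1}1=0=1\otimes_n1$). $\partial^0$ is multiplication, and for $n\geq1$, $\partial^n(1\otimes_r1)$ is: if $n-2r>0$: $1\otimes_r a+(-1)^{n+r}a\otimes_r1+(-1)^{n+r}\bar a(a\bar a)^{N-1}\otimes_{r-1}1+(-1)^n1\otimes_{r-1}\bar a(a\bar a)^{N-1}$; if $n-2r<0$: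 $1\otimes_r a(\bar aa)^{N-1}+(-1)^{n+r}a(\bar aa)^{N-1}\otimes_r1+(-1)^{n+r}\bar a\otimes_{r-1}1+(-1)^n1\otimes_{r-1}\bar a$; if $n=2r$: $\sum_{k=0}^{N-1}\big((\bar aa)^k[1\otimes_ra+(-1)^r\bar a\otimes_{r-1}1](\bar aa)^{N-k-1}+(a\bar a)^k[(-1)^ra\otimes_r1+1\otimes_{r-1}\bar a](a\bar a)^{N-k-1}\big)$. Classes in $\mathrm{HH}^n(\Lambda_N)$ are represented by cocycles in $\mathrm{Hom}_{\Lambda_N^e}(P^n,\Lambda_N)$; only the non-zero images of generators are listed. $\chi_{n,r}\in\mathrm{HH}^n(\Lambda_N)$ is the class of the cocycle $1\otimes_r1\mapsto1$; it is used here for $(n,r)=(2,0),(2,2),(4,2)$. In the quotient, these symbols denote the images of the classes. *)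

theory Defs
  imports
    "HOL-Algebra.Generated_Rings"
    "HOL-Algebra.QuotRing"
    "HOL-Algebra.Module"
    "HOL-Library.Poly_Mapping"
    "HOL-Library.Extended_Nat"
begin

section \<open>Algebras over a field\<close>

text \<open>
  The ground field is the type \<open>'k\<close>. A \<open>'k\<close>-algebra is a record of type \<^typ>\<open>('k, 'a) module\<close>:
  a (not necessarily commutative) ring together with the scalar multiplication.
\<close>

definition quot_algebra :: "('k, 'a) module \<Rightarrow> 'a set \<Rightarrow> ('k, 'a set) module" where
  "quot_algebra A I =
    \<lparr>carrier = carrier (A Quot I), monoid.mult = monoid.mult (A Quot I), one = one (A Quot I),
     zero = zero (A Quot I), add = add (A Quot I),
     smult = (\<lambda>c X. \<Union>x\<in>X. I +>\<^bsub>A\<^esub> (c \<odot>\<^bsub>A\<^esub> x))\<rparr>"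

definition algebra_iso :: "('k, 'a) module \<Rightarrow> ('k, 'b) module \<Rightarrow> ('a \<Rightarrow> 'b) set" where
  "algebra_iso A B = {h \<in> ring_iso A B. \<forall>c. \<forall>x\<in>carrier A. h (c \<odot>\<^bsub>A\<^esub> x) = c \<odot>\<^bsub>B\<^esub> h x}"

definition finitely_generated_algebra :: "('k, 'a) module \<Rightarrow> bool" where
  "finitely_generated_algebra A \<longleftrightarrow>
    (\<exists>S. finite S \<and> S \<subseteq> carrier A \<and>
         generate_ring A (S \<union> range (\<lambda>c. c \<odot>\<^bsub>A\<^esub> \<one>\<^bsub>A\<^esub>)) = carrier A)"

definition krull_dim :: "('a, 'b) ring_scheme \<Rightarrow> enat" where
  "krull_dim R = Sup {enat n | n.
    \<exists>p. (\<forall>i\<le>n. primeideal (p i) R) \<and> (\<forall>i<n. p i \<subset> p (Suc i))}"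

text \<open>
  The monoid algebra. Free algebras arise from the monoid of words, polynomial rings from the
  monoid of monomials \<^typ>\<open>'v \<Rightarrow>\<^sub>0 nat\<close>.
\<close>

definition monoid_algebra :: "('k::field, 'm::monoid_add \<Rightarrow>\<^sub>0 'k) module" where
  "monoid_algebra =
    \<lparr>carrier = UNIV, monoid.mult = (*), one = 1, zero = 0, add = (+),
     smult = (\<lambda>c f. Poly_Mapping.map ((*) c) f)\<rparr>"


section \<open>Bimodules\<close>

text \<open>
  Modules over the enveloping algebra of a \<open>'k\<close>-algebra \<open>A\<close> are treated as \<open>A\<close>-\<open>A\<close>-bimodules on
  which the two induced actions of \<open>'k\<close> agree. As for \<^typ>\<open>('a, 'b) module\<close>, the
  multiplicative fields of the record have no meaning.
\<close>

record ('a, 'b) bimodule = "('a, 'b) module" +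
  rsmult :: "['b, 'a] \<Rightarrow> 'b" (infixl \<open>\<odot>\<^sup>r\<index>\<close> 70)

locale bimodule = A?: ring A + M?: abelian_group M
  for A :: "('k, 'a) module" (structure) and M :: "('a, 'm) bimodule" (structure) +
  assumes l_closed: "\<lbrakk>a \<in> carrier A; x \<in> carrier M\<rbrakk> \<Longrightarrow> a \<odot>\<^bsub>M\<^esub> x \<in> carrier M"
    and l_distr_scalar: "\<lbrakk>a \<in> carrier A; b \<in> carrier A; x \<in> carrier M\<rbrakk> \<Longrightarrow>
      (a \<oplus>\<^bsub>A\<^esub> b) \<odot>\<^bsub>M\<^esub> x = a \<odot>\<^bsub>M\<^esub> x \<oplus>\<^bsub>M\<^esub> b \<odot>\<^bsub>M\<^esub> x"
    and l_distr_vector: "\<lbrakk>a \<in> carrier A; x \<in> carrier M; y \<in> carrier M\<rbrakk> \<Longrightarrow>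
      a \<odot>\<^bsub>M\<^esub> (x \<oplus>\<^bsub>M\<^esub> y) = a \<odot>\<^bsub>M\<^esub> x \<oplus>\<^bsub>M\<^esub> a \<odot>\<^bsub>M\<^esub> y"
    and l_assoc: "\<lbrakk>a \<in> carrier A; b \<in> carrier A; x \<in> carrier M\<rbrakk> \<Longrightarrow>
      (a \<otimes>\<^bsub>A\<^esub> b) \<odot>\<^bsub>M\<^esub> x = a \<odot>\<^bsub>M\<^esub> (b \<odot>\<^bsub>M\<^esub> x)"
    and l_unit: "x \<in> carrier M \<Longrightarrow> \<one>\<^bsub>A\<^esub> \<odot>\<^bsub>M\<^esub> x = x"
    and r_closed: "\<lbrakk>a \<in> carrier A; x \<in> carrier M\<rbrakk> \<Longrightarrow> x \<odot>\<^sup>r\<^bsub>M\<^esub> a \<in> carrier M"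
    and r_distr_scalar: "\<lbrakk>a \<in> carrier A; b \<in> carrier A; x \<in> carrier M\<rbrakk> \<Longrightarrow>
      x \<odot>\<^sup>r\<^bsub>M\<^esub> (a \<oplus>\<^bsub>A\<^esub> b) = x \<odot>\<^sup>r\<^bsub>M\<^esub> a \<oplus>\<^bsub>M\<^esub> x \<odot>\<^sup>r\<^bsub>M\<^esub> b"
    and r_distr_vector: "\<lbrakk>a \<in> carrier A; x \<in> carrier M; y \<in> carrier M\<rbrakk> \<Longrightarrow>
      (x \<oplus>\<^bsub>M\<^esub> y) \<odot>\<^sup>r\<^bsub>M\<^esub> a = x \<odot>\<^sup>r\<^bsub>M\<^esub> a \<oplus>\<^bsub>M\<^esub> y \<odot>\<^sup>r\<^bsub>M\<^esub> a"
    and r_assoc: "\<lbrakk>a \<in> carrier A; b \<in> carrier A; x \<in> carrier M\<rbrakk> \<Longrightarrow>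
      x \<odot>\<^sup>r\<^bsub>M\<^esub> (a \<otimes>\<^bsub>A\<^esub> b) = (x \<odot>\<^sup>r\<^bsub>M\<^esub> a) \<odot>\<^sup>r\<^bsub>M\<^esub> b"
    and r_unit: "x \<in> carrier M \<Longrightarrow> x \<odot>\<^sup>r\<^bsub>M\<^esub> \<one>\<^bsub>A\<^esub> = x"
    and lr_assoc: "\<lbrakk>a \<in> carrier A; b \<in> carrier A; x \<in> carrier M\<rbrakk> \<Longrightarrow>
      (a \<odot>\<^bsub>M\<^esub> x) \<odot>\<^sup>r\<^bsub>M\<^esub> b = a \<odot>\<^bsub>M\<^esub> (x \<odot>\<^sup>r\<^bsub>M\<^esub> b)"
    and central: "x \<in> carrier M \<Longrightarrow> (c \<odot>\<^bsub>A\<^esub> \<one>\<^bsub>A\<^esub>) \<odot>\<^bsub>M\<^esub> x = x \<odot>\<^sup>r\<^bsub>M\<^esub> (c \<odot>\<^bsub>A\<^esub> \<one>\<^bsub>A\<^esub>)"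

text \<open>Homomorphisms are extensional, so that equality of homomorphisms is equality of functions.\<close>

definition bimod_hom ::
    "('k, 'a) module \<Rightarrow> ('a, 'm) bimodule \<Rightarrow> ('a, 'n) bimodule \<Rightarrow> ('m \<Rightarrow> 'n) set" where
  "bimod_hom A M N = {h \<in> carrier M \<rightarrow>\<^sub>E carrier N.
     (\<forall>x\<in>carrier M. \<forall>y\<in>carrier M. h (x \<oplus>\<^bsub>M\<^esub> y) = h x \<oplus>\<^bsub>N\<^esub> h y) \<and>
     (\<forall>a\<in>carrier A. \<forall>x\<in>carrier M.
        h (a \<odot>\<^bsub>M\<^esub> x) = a \<odot>\<^bsub>N\<^esub> h x \<and> h (x \<odot>\<^sup>r\<^bsub>M\<^esub> a) = h x \<odot>\<^sup>r\<^bsub>N\<^esub> a)}"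

definition hom_group ::
    "('k, 'a) module \<Rightarrow> ('a, 'm) bimodule \<Rightarrow> ('a, 'n) bimodule \<Rightarrow> ('m \<Rightarrow> 'n) ring" where
  "hom_group A M N =
    \<lparr>carrier = bimod_hom A M N, monoid.mult = undefined, one = undefined,
     zero = (\<lambda>x\<in>carrier M. \<zero>\<^bsub>N\<^esub>), add = (\<lambda>f g. \<lambda>x\<in>carrier M. f x \<oplus>\<^bsub>N\<^esub> g x)\<rparr>"

definition regular_bimod :: "('k, 'a) module \<Rightarrow> ('a, 'a) bimodule" where
  "regular_bimod A =
    \<lparr>carrier = carrier A, monoid.mult = undefined, one = undefined,
     zero = \<zero>\<^bsub>A\<^esub>, add = add A, smult = monoid.mult A, rsmult = monoid.mult A\<rparr>"

subsection \<open>The bimodule \<open>A \<otimes> A\<close>\<close>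

text \<open>
  The tensor product over \<open>'k\<close> is the vector space with basis \<open>A \<times> A\<close> modulo the
  subspace spanned by the bilinearity relations.
\<close>

type_synonym ('k, 'a) tens = "('a \<times> 'a \<Rightarrow>\<^sub>0 'k) set"

definition pair_space :: "('k::field, 'a) module \<Rightarrow> ('a \<times> 'a \<Rightarrow>\<^sub>0 'k) ring" where
  "pair_space A =
    \<lparr>carrier = {f. Poly_Mapping.keys f \<subseteq> carrier A \<times> carrier A},
     monoid.mult = undefined, one = undefined, zero = 0, add = (+)\<rparr>"

definition tens_rel :: "('k::field, 'a) module \<Rightarrow> ('k, 'a) tens" where
  "tens_rel A = (let e = (\<lambda>x y. Poly_Mapping.single (x, y) (1::'k)); s = (\<lambda>c. Poly_Mapping.map ((*) c)) in
     Modules.module.span s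
      ({e (x \<oplus>\<^bsub>A\<^esub> x') y - e x y - e x' y | x x' y.
          x \<in> carrier A \<and> x' \<in> carrier A \<and> y \<in> carrier A} \<union>
       {e x (y \<oplus>\<^bsub>A\<^esub> y') - e x y - e x y' | x y y'.
          x \<in> carrier A \<and> y \<in> carrier A \<and> y' \<in> carrier A} \<union>
       {e (c \<odot>\<^bsub>A\<^esub> x) y - s c (e x y) | c x y. x \<in> carrier A \<and> y \<in> carrier A} \<union>
       {e x (c \<odot>\<^bsub>A\<^esub> y) - s c (e x y) | c x y. x \<in> carrier A \<and> y \<in> carrier A}))"

definition tens_class :: "('k::field, 'a) module \<Rightarrow> ('a \<times> 'a \<Rightarrow>\<^sub>0 'k) \<Rightarrow> ('k, 'a) tens" where
  "tens_class A f = tens_rel A +>\<^bsub>pair_space A\<^esub> f"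

definition pure_tensor :: "('k::field, 'a) module \<Rightarrow> 'a \<Rightarrow> 'a \<Rightarrow> ('k, 'a) tens" where
  "pure_tensor A x y = tens_class A (Poly_Mapping.single (x, y) 1)"

definition push_keys :: "('b \<Rightarrow> 'c) \<Rightarrow> ('b \<Rightarrow>\<^sub>0 'k::comm_monoid_add) \<Rightarrow> ('c \<Rightarrow>\<^sub>0 'k)" where
  "push_keys h f =
    (\<Sum>p\<in>Poly_Mapping.keys f. Poly_Mapping.single (h p) (Poly_Mapping.lookup f p))"

definition tensor_bimod :: "('k::field, 'a) module \<Rightarrow> ('a, ('k, 'a) tens) bimodule" where
  "tensor_bimod A =
    \<lparr>carrier = a_rcosets\<^bsub>pair_space A\<^esub> (tens_rel A), monoid.mult = undefined, one = undefined,
     zero = tens_rel A, add = set_add (pair_space A),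
     smult = (\<lambda>a X. \<Union>f\<in>X. tens_class A (push_keys (\<lambda>(x, y). (a \<otimes>\<^bsub>A\<^esub> x, y)) f)),
     rsmult = (\<lambda>X a. \<Union>f\<in>X. tens_class A (push_keys (\<lambda>(x, y). (x, y \<otimes>\<^bsub>A\<^esub> a)) f))\<rparr>"

subsection \<open>Free and projective bimodules\<close>

definition free_bimod :: "('k::field, 'a) module \<Rightarrow> 'i set \<Rightarrow> ('a, 'i \<Rightarrow> ('k, 'a) tens) bimodule" where
  "free_bimod A I = (let T = tensor_bimod A in
    \<lparr>carrier = {u. (\<forall>i\<in>I. u i \<in> carrier T) \<and> (\<forall>i. i \<notin> I \<longrightarrow> u i = \<zero>\<^bsub>T\<^esub>) \<and>
                   finite {i. u i \<noteq> \<zero>\<^bsub>T\<^esub>}},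
     monoid.mult = undefined, one = undefined,
     zero = (\<lambda>i. \<zero>\<^bsub>T\<^esub>), add = (\<lambda>u v i. u i \<oplus>\<^bsub>T\<^esub> v i),
     smult = (\<lambda>a u i. a \<odot>\<^bsub>T\<^esub> u i), rsmult = (\<lambda>u a i. u i \<odot>\<^sup>r\<^bsub>T\<^esub> a)\<rparr>)"

text \<open>The element \<open>x \<otimes>\<^sub>i y\<close> of the \<open>i\<close>-th summand; it is zero if there is no such summand.\<close>

definition summand_tensor ::
    "('k::field, 'a) module \<Rightarrow> 'i set \<Rightarrow> 'i \<Rightarrow> 'a \<Rightarrow> 'a \<Rightarrow> ('i \<Rightarrow> ('k, 'a) tens)" where
  "summand_tensor A I i x y =
    (\<lambda>j. if j = i \<and> i \<in> I then pure_tensor A x y else \<zero>\<^bsub>tensor_bimod A\<^esub>)"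

text \<open>The unique homomorphism on a free bimodule with given values on the generators.\<close>

definition free_extend ::
    "('k::field, 'a) module \<Rightarrow> 'i set \<Rightarrow> ('a, 'n) bimodule \<Rightarrow> ('i \<Rightarrow> 'n) \<Rightarrow> (('i \<Rightarrow> ('k, 'a) tens) \<Rightarrow> 'n)" where
  "free_extend A I N v = (THE h. h \<in> bimod_hom A (free_bimod A I) N \<and>
      (\<forall>i\<in>I. h (summand_tensor A I i \<one>\<^bsub>A\<^esub> \<one>\<^bsub>A\<^esub>) = v i))"

text \<open>
  A bimodule is projective if it is a direct summand of a free one; it then is one of
  the free bimodule on its own elements.
\<close>

definition projective_bimod :: "('k::field, 'a) module \<Rightarrow> ('a, 'm) bimodule \<Rightarrow> bool" where
  "projective_bimod A M \<longleftrightarrow> bimodule A M \<and>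
    (\<exists>s \<in> bimod_hom A M (free_bimod A (carrier M)).
     \<exists>p \<in> bimod_hom A (free_bimod A (carrier M)) M. \<forall>x\<in>carrier M. p (s x) = x)"


section \<open>The algebra \<open>Ext(M, M)\<close> over the enveloping algebra\<close>

context
  fixes A :: "('k::field, 'a) module" and M :: "('a, 'm) bimodule"
    and P :: "nat \<Rightarrow> ('a, 'p) bimodule" and d :: "nat \<Rightarrow> 'p \<Rightarrow> 'p" and \<epsilon> :: "'p \<Rightarrow> 'm"
begin

text \<open>\<open>\<dots> \<rightarrow> P 2 \<rightarrow> P 1 \<rightarrow> P 0 \<rightarrow> M \<rightarrow> 0\<close>, where \<open>d n\<close> for \<open>n \<ge> 1\<close> maps \<open>P n\<close> to \<open>P (n - 1)\<close>.\<close>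

definition projective_resolution :: bool where
  "projective_resolution \<longleftrightarrow>
     bimodule A M \<and> (\<forall>n. projective_bimod A (P n)) \<and>
     (\<forall>n. d (Suc n) \<in> bimod_hom A (P (Suc n)) (P n)) \<and> \<epsilon> \<in> bimod_hom A (P 0) M \<and>
     \<epsilon> ` carrier (P 0) = carrier M \<and>
     a_kernel (P 0) M \<epsilon> = d 1 ` carrier (P 1) \<and>
     (\<forall>n. a_kernel (P (Suc n)) (P n) (d (Suc n)) = d (Suc (Suc n)) ` carrier (P (Suc (Suc n))))"

definition cocycles :: "nat \<Rightarrow> ('p \<Rightarrow> 'm) set" where
  "cocycles n = {f \<in> bimod_hom A (P n) M. \<forall>x\<in>carrier (P (Suc n)). f (d (Suc n) x) = \<zero>\<^bsub>M\<^esub>}"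

definition coboundaries :: "nat \<Rightarrow> ('p \<Rightarrow> 'm) set" where
  "coboundaries n = (if n = 0 then {\<zero>\<^bsub>hom_group A (P 0) M\<^esub>}
     else {compose (carrier (P n)) g (d n) | g. g \<in> bimod_hom A (P (n - 1)) M})"

definition coh_class :: "nat \<Rightarrow> ('p \<Rightarrow> 'm) \<Rightarrow> ('p \<Rightarrow> 'm) set" where
  "coh_class n f = coboundaries n +>\<^bsub>hom_group A (P n) M\<^esub> f"

definition ext_group :: "nat \<Rightarrow> ('p \<Rightarrow> 'm) set ring" where
  "ext_group n = \<lparr>carrier = coh_class n ` cocycles n, monoid.mult = undefined, one = undefined,
     zero = coboundaries n, add = set_add (hom_group A (P n) M)\<rparr>"

text \<open>The chain maps \<open>F i : P (n + i) \<rightarrow> P i\<close> lifting the cocycle \<open>g : P n \<rightarrow> M\<close>.\<close>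

definition chain_lifts :: "nat \<Rightarrow> ('p \<Rightarrow> 'm) \<Rightarrow> (nat \<Rightarrow> 'p \<Rightarrow> 'p) set" where
  "chain_lifts n g = {F. (\<forall>i. F i \<in> bimod_hom A (P (n + i)) (P i)) \<and>
     (\<forall>x\<in>carrier (P n). \<epsilon> (F 0 x) = g x) \<and>
     (\<forall>i. \<forall>x\<in>carrier (P (n + Suc i)). d (Suc i) (F (Suc i) x) = F i (d (n + Suc i) x))}"

text \<open>
  The Yoneda product of the classes of \<open>f : P m \<rightarrow> M\<close> and \<open>g : P n \<rightarrow> M\<close> is the class of
  \<open>f \<circ> F m\<close> for any lift \<open>F\<close> of \<open>g\<close>.
\<close>

definition yoneda :: "nat \<Rightarrow> nat \<Rightarrow> ('p \<Rightarrow> 'm) set \<Rightarrow> ('p \<Rightarrow> 'm) set \<Rightarrow> ('p \<Rightarrow> 'm) set" where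
  "yoneda m n X Y = (\<Union>f\<in>X. \<Union>g\<in>Y. \<Union>F\<in>chain_lifts n g.
     coh_class (m + n) (compose (carrier (P (m + n))) f (F m)))"

definition in_degree :: "nat \<Rightarrow> ('p \<Rightarrow> 'm) set \<Rightarrow> (nat \<Rightarrow> ('p \<Rightarrow> 'm) set)" where
  "in_degree n X = (\<lambda>i. if i = n then X else \<zero>\<^bsub>ext_group i\<^esub>)"

text \<open>
  The direct sum of all \<open>Ext\<^sup>n(M, M)\<close>. It is computed from a projective resolution, so it is
  left unspecified when \<open>(P, d, \<epsilon>)\<close> is not one.
\<close>

definition ext_algebra :: "('k, nat \<Rightarrow> ('p \<Rightarrow> 'm) set) module" where
  "ext_algebra = (if projective_resolution then
    \<lparr>carrier = {x. (\<forall>n. x n \<in> carrier (ext_group n)) \<and> finite {n. x n \<noteq> \<zero>\<^bsub>ext_group n\<^esub>}},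
     monoid.mult = (\<lambda>x y n. \<Oplus>\<^bsub>ext_group n\<^esub> i\<in>{..n}. yoneda i (n - i) (x i) (y (n - i))),
     one = in_degree 0 (coh_class 0 \<epsilon>),
     zero = (\<lambda>n. \<zero>\<^bsub>ext_group n\<^esub>),
     add = (\<lambda>x y n. x n \<oplus>\<^bsub>ext_group n\<^esub> y n),
     smult = (\<lambda>c x n. \<Union>f\<in>x n. coh_class n (\<lambda>u\<in>carrier (P n). (c \<odot>\<^bsub>A\<^esub> \<one>\<^bsub>A\<^esub>) \<odot>\<^bsub>M\<^esub> f u))\<rparr>
    else undefined)"

definition homogeneous :: "(nat \<Rightarrow> ('p \<Rightarrow> 'm) set) \<Rightarrow> bool" where
  "homogeneous x \<longleftrightarrow> (\<exists>n. \<forall>i. i \<noteq> n \<longrightarrow> x i = \<zero>\<^bsub>ext_group i\<^esub>)"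

definition nilpotent_ideal :: "(nat \<Rightarrow> ('p \<Rightarrow> 'm) set) set" where
  "nilpotent_ideal = Idl\<^bsub>ext_algebra\<^esub> {x \<in> carrier ext_algebra.
     homogeneous x \<and> (\<exists>k::nat. x [^]\<^bsub>ext_algebra\<^esub> k = \<zero>\<^bsub>ext_algebra\<^esub>)}"

end


section \<open>The algebra \<open>\<Lambda>\<^sub>N\<close> for \<open>m = 1\<close>\<close>

datatype arrow = Arr | Arr_bar

datatype path = Path "arrow list"

instantiation path :: monoid_add
begin

fun plus_path :: "path \<Rightarrow> path \<Rightarrow> path" where
  "plus_path (Path u) (Path v) = Path (u @ v)"

definition zero_path :: path where
  "zero_path = Path []"

instance
proof
  fix p q r :: path
  show "p + q + r = p + (q + r)" by (cases p; cases q; cases r) simp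
  show "0 + p = p" by (cases p) (simp add: zero_path_def)
  show "p + 0 = p" by (cases p) (simp add: zero_path_def)
qed

end

definition path_elt :: "arrow list \<Rightarrow> (path \<Rightarrow>\<^sub>0 'k::field)" where
  "path_elt w = Poly_Mapping.single (Path w) 1"

definition Lambda_ideal :: "nat \<Rightarrow> (path \<Rightarrow>\<^sub>0 'k::field) set" where
  "Lambda_ideal N = (let a = path_elt [Arr]; a' = path_elt [Arr_bar] in
     Idl\<^bsub>monoid_algebra\<^esub> {a * a, a' * a', (a * a') ^ N - (a' * a) ^ N})"

definition Lambda :: "nat \<Rightarrow> ('k::field, (path \<Rightarrow>\<^sub>0 'k) set) module" where
  "Lambda N = quot_algebra monoid_algebra (Lambda_ideal N)"

definition Lambda_arrow :: "nat \<Rightarrow> arrow \<Rightarrow> (path \<Rightarrow>\<^sub>0 'k::field) set" where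
  "Lambda_arrow N x = Lambda_ideal N +>\<^bsub>monoid_algebra\<^esub> path_elt [x]"

subsection \<open>The resolution\<close>

type_synonym 'k lam = "(path \<Rightarrow>\<^sub>0 'k) set"

text \<open>
  The summands of \<open>P\<^sup>n\<close> are indexed by integers, so that the generators
  \<open>1 \<otimes>\<^sub>-\<^sub>1 1\<close> and \<open>1 \<otimes>\<^sub>n 1\<close> of \<open>P\<^sup>n\<^sup>-\<^sup>1\<close> make sense; they are zero.
\<close>

abbreviation res_index :: "nat \<Rightarrow> int set" where
  "res_index n \<equiv> {0..int n}"

definition res_mod :: "nat \<Rightarrow> nat \<Rightarrow> ('k::field lam, int \<Rightarrow> ('k, 'k lam) tens) bimodule" where
  "res_mod N n = free_bimod (Lambda N) (res_index n)"

definition alt_sign :: "('a, 'b) ring_scheme \<Rightarrow> int \<Rightarrow> 'a \<Rightarrow> 'a" where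
  "alt_sign M k x = (if even k then x else \<ominus>\<^bsub>M\<^esub> x)"

definition res_diff_gen :: "nat \<Rightarrow> nat \<Rightarrow> int \<Rightarrow> (int \<Rightarrow> ('k::field, 'k lam) tens)" where
  "res_diff_gen N n r =
    (let L = Lambda N; M = res_mod N (n - 1);
         a = Lambda_arrow N Arr; a' = Lambda_arrow N Arr_bar;
         t = summand_tensor L (res_index (n - 1)); sgn = alt_sign M;
         w = a \<otimes>\<^bsub>L\<^esub> (a' \<otimes>\<^bsub>L\<^esub> a) [^]\<^bsub>L\<^esub> (N - 1);
         w' = a' \<otimes>\<^bsub>L\<^esub> (a \<otimes>\<^bsub>L\<^esub> a') [^]\<^bsub>L\<^esub> (N - 1)
     in
      if int n - 2 * r > 0 then
        t r \<one>\<^bsub>L\<^esub> a \<oplus>\<^bsub>M\<^esub> sgn (int n + r) (t r a \<one>\<^bsub>L\<^esub>)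
          \<oplus>\<^bsub>M\<^esub> sgn (int n + r) (t (r - 1) w' \<one>\<^bsub>L\<^esub>) \<oplus>\<^bsub>M\<^esub> sgn (int n) (t (r - 1) \<one>\<^bsub>L\<^esub> w')
      else if int n - 2 * r < 0 then
        t r \<one>\<^bsub>L\<^esub> w \<oplus>\<^bsub>M\<^esub> sgn (int n + r) (t r w \<one>\<^bsub>L\<^esub>)
          \<oplus>\<^bsub>M\<^esub> sgn (int n + r) (t (r - 1) a' \<one>\<^bsub>L\<^esub>) \<oplus>\<^bsub>M\<^esub> sgn (int n) (t (r - 1) \<one>\<^bsub>L\<^esub> a')
      else
        (\<Oplus>\<^bsub>M\<^esub> k\<in>{..N - 1}.
          (((a' \<otimes>\<^bsub>L\<^esub> a) [^]\<^bsub>L\<^esub> k) \<odot>\<^bsub>M\<^esub> (t r \<one>\<^bsub>L\<^esub> a \<oplus>\<^bsub>M\<^esub> sgn r (t (r - 1) a' \<one>\<^bsub>L\<^esub>)))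
             \<odot>\<^sup>r\<^bsub>M\<^esub> ((a' \<otimes>\<^bsub>L\<^esub> a) [^]\<^bsub>L\<^esub> (N - k - 1))
          \<oplus>\<^bsub>M\<^esub>
          (((a \<otimes>\<^bsub>L\<^esub> a') [^]\<^bsub>L\<^esub> k) \<odot>\<^bsub>M\<^esub> (sgn r (t r a \<one>\<^bsub>L\<^esub>) \<oplus>\<^bsub>M\<^esub> t (r - 1) \<one>\<^bsub>L\<^esub> a'))
             \<odot>\<^sup>r\<^bsub>M\<^esub> ((a \<otimes>\<^bsub>L\<^esub> a') [^]\<^bsub>L\<^esub> (N - k - 1))))"

definition res_diff ::
    "nat \<Rightarrow> nat \<Rightarrow> (int \<Rightarrow> ('k::field, 'k lam) tens) \<Rightarrow> (int \<Rightarrow> ('k, 'k lam) tens)" where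
  "res_diff N n = free_extend (Lambda N) (res_index n) (res_mod N (n - 1)) (res_diff_gen N n)"

text \<open>The multiplication map, that is, the bimodule homomorphism with \<open>1 \<otimes> 1 \<mapsto> 1\<close>.\<close>

definition res_aug :: "nat \<Rightarrow> (int \<Rightarrow> ('k::field, 'k lam) tens) \<Rightarrow> 'k lam" where
  "res_aug N = free_extend (Lambda N) (res_index 0) (regular_bimod (Lambda N)) (\<lambda>_. \<one>\<^bsub>Lambda N\<^esub>)"

subsection \<open>Hochschild cohomology\<close>

type_synonym 'k hoch = "nat \<Rightarrow> ((int \<Rightarrow> ('k, 'k lam) tens) \<Rightarrow> 'k lam) set"

definition HH :: "nat \<Rightarrow> ('k::field, 'k hoch) module" where
  "HH N = ext_algebra (Lambda N) (regular_bimod (Lambda N)) (res_mod N) (res_diff N) (res_aug N)"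

definition HH_nil :: "nat \<Rightarrow> 'k::field hoch set" where
  "HH_nil N =
    nilpotent_ideal (Lambda N) (regular_bimod (Lambda N)) (res_mod N) (res_diff N) (res_aug N)"

definition HH_red :: "nat \<Rightarrow> ('k::field, 'k hoch set) module" where
  "HH_red N = quot_algebra (HH N) (HH_nil N)"

definition chi :: "nat \<Rightarrow> nat \<Rightarrow> int \<Rightarrow> 'k::field hoch" where
  "chi N n r = (let L = Lambda N; M = regular_bimod L in
     in_degree L M (res_mod N) (res_diff N) n
      (coh_class L M (res_mod N) (res_diff N) n
        (free_extend L (res_index n) M (\<lambda>s. if s = r then \<one>\<^bsub>L\<^esub> else \<zero>\<^bsub>L\<^esub>))))"

definition chi_red :: "nat \<Rightarrow> nat \<Rightarrow> int \<Rightarrow> 'k::field hoch set" where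
  "chi_red N n r = HH_nil N +>\<^bsub>HH N\<^esub> chi N n r"


section \<open>The polynomial ring in three variables modulo one relation\<close>

datatype indet = X20 | X22 | X42

definition indet_poly :: "indet \<Rightarrow> ((indet \<Rightarrow>\<^sub>0 nat) \<Rightarrow>\<^sub>0 'k::field)" where
  "indet_poly v = Poly_Mapping.single (Poly_Mapping.single v 1) 1"

definition rel_ideal :: "((indet \<Rightarrow>\<^sub>0 nat) \<Rightarrow>\<^sub>0 'k::field) set" where
  "rel_ideal = Idl\<^bsub>monoid_algebra\<^esub> {indet_poly X20 * indet_poly X22}"

definition poly_quot :: "('k::field, ((indet \<Rightarrow>\<^sub>0 nat) \<Rightarrow>\<^sub>0 'k) set) module" where
  "poly_quot = quot_algebra monoid_algebra rel_ideal"

definition poly_class :: "indet \<Rightarrow> ((indet \<Rightarrow>\<^sub>0 nat) \<Rightarrow>\<^sub>0 'k::field) set" where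
  "poly_class v = rel_ideal +>\<^bsub>monoid_algebra\<^esub> indet_poly v"

end

theory Submission
  imports Defs
begin

text \<open>
  Filter the bimodules \<open>P\<^sup>n\<close> by the radical degree of the right tensor factors. To leading order the
  differential is that of the one-sided resolution of the simple module, which has an explicit
  contraction; since the radical is nilpotent, \<open>(P, \<partial>)\<close> is exact.

  Attach to a cocycle \<open>f\<close> of degree \<open>n\<close> the constant terms of the values \<open>f (1 \<otimes>\<^sub>r 1)\<close>; they depend only on
  its class. Comparing the coefficients of the words \<open>a\<close>, \<open>a'\<close> and of the two words of length \<open>2 N - 1\<close> in the
  equations for a lift of \<open>f\<close> to a chain map, the constant terms of the lift are, up to sign, either
  zero or those of \<open>f\<close>. In the cocycle condition the same coefficients show, for characteristic \<open>\<noteq> 2\<close>,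
  that the constant terms vanish unless \<open>n\<close> and \<open>r\<close> are even. Hence recording the constant terms is a
  homomorphism onto \<open>K[x, y, z] / (x y)\<close>, which sends the \<open>\<chi>\<^sub>n\<^sub>,\<^sub>r\<close> to monomials. A cocycle without constant
  terms lifts to a chain map that raises the filtration, so its class is nilpotent; as the target is
  reduced, the kernel is exactly \<open>\<N>\<close>.

  For the Krull dimension, modulo \<open>x\<close> or \<open>y\<close> any three polynomials are algebraically dependent by a
  count of monomials. The lexicographically lowest term of such a relation contradicts the existence
  of a chain of four primes.
\<close>

\<comment> \<open>The value of \<open>ext_algebra\<close> is specified only for a projective
  resolution, so exactness of the given complex has to precede every statement about
  \<open>HH\<close>. Two-sided coefficients are hard to control; the remedy, used twice, is to make
  the right factors trivial. For exactness this holds up to deeper steps of the filtration. For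
  chain maps it is achieved by the bimodule \<open>TB\<close>, on which right factors act through
  their constant term: the equation for a lift then becomes an equation in \<Lambda> in which every
  unknown is multiplied by a single word. N > 1 makes the two lengths 1 and 2N - 1 of these words
  different. If the word read off equals the multiplier, its coefficient is the constant term of the
  other factor, and a longer multiplier contributes nothing. So constant terms can be followed along
  a lift without computing the lift. A product of two constant terms survives if both bidegrees lie
  on the same side of the diagonal n = 2r; this is where the relation \<chi>_{2,0} \<chi>_{2,2} = 0
  comes from.\<close>
syntax "_index" :: "logic => index" ("\<^sub>_" [1000] 1000)

abbreviation "lookup \<equiv> Poly_Mapping.lookup"
abbreviation "single \<equiv> Poly_Mapping.single"
abbreviation "keys \<equiv> Poly_Mapping.keys"

section \<open>Additive maps and quotients\<close>

text \<open>Unlike \<open>bimod_hom\<close>, this asks neither for extensionality nor for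
  compatibility with an action. Composites of one-sided multiplications and bimodule homomorphisms
  can thus be written as plain functions and compared on generators.\<close>

definition add_hom :: "('a, 'c) ring_scheme => ('b, 'd) ring_scheme => ('a => 'b) set" where
  "add_hom G H = {f \<in> carrier G \<rightarrow> carrier H.
     \<forall>x\<in>carrier G. \<forall>y\<in>carrier G. f (x \<oplus>\<^sub>G y) = f x \<oplus>\<^sub>H f y}"

lemma add_homI:
  assumes "\<And>x. x \<in> carrier G ==> f x \<in> carrier H"
    and "\<And>x y. x \<in> carrier G ==> y \<in> carrier G ==> f (x \<oplus>\<^sub>G y) = f x \<oplus>\<^sub>H f y"
  shows "f \<in> add_hom G H"
  using assms unfolding add_hom_def by auto

lemma add_hom_closed: "f \<in> add_hom G H ==> x \<in> carrier G ==> f x \<in> carrier H"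
  unfolding add_hom_def by auto

lemma add_hom_add:
  "f \<in> add_hom G H ==> x \<in> carrier G ==> y \<in> carrier G ==> f (x \<oplus>\<^sub>G y) = f x \<oplus>\<^sub>H f y"
  unfolding add_hom_def by auto

lemma add_hom_abelian_group_hom:
  assumes "abelian_group G" "abelian_group H" "f \<in> add_hom G H"
  shows "abelian_group_hom G H f"
  using assms unfolding add_hom_def
  by (intro abelian_group_homI group_hom.intro)
    (auto intro!: group_hom_axioms.intro abelian_group.a_group simp: hom_def)

lemma add_hom_zero:
  assumes "abelian_group G" "abelian_group H" "f \<in> add_hom G H"
  shows "f \<zero>\<^sub>G = \<zero>\<^sub>H"
  using abelian_group_hom.hom_zero[OF add_hom_abelian_group_hom[OF assms]] .

lemma add_hom_inv:
  assumes "abelian_group G" "abelian_group H" "f \<in> add_hom G H" "x \<in> carrier G"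
  shows "f (\<ominus>\<^sub>G x) = \<ominus>\<^sub>H f x"
  using abelian_group_hom.hom_a_inv[OF add_hom_abelian_group_hom[OF assms(1-3)] assms(4)] .

lemma add_hom_minus:
  assumes "abelian_group G" "abelian_group H" "f \<in> add_hom G H" "x \<in> carrier G" "y \<in> carrier G"
  shows "f (x \<ominus>\<^sub>G y) = f x \<ominus>\<^sub>H f y"
  using assms by (simp add: a_minus_def add_hom_add add_hom_inv abelian_group.a_inv_closed)

lemma add_hom_finsum:
  assumes "abelian_group G" "abelian_group H" "f \<in> add_hom G H" "g \<in> S \<rightarrow> carrier G"
  shows "f (finsum G g S) = (\<Oplus>\<^bsub>H\<^esub>i\<in>S. f (g i))"
proof -
  interpret G: abelian_group G by fact
  interpret H: abelian_group H by fact
  show ?thesis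
  proof (cases "finite S")
    case True
    then show ?thesis using assms(4)
    proof (induction S)
      case empty
      then show ?case using add_hom_zero[OF assms(1-3)] by simp
    next
      case (insert x F)
      have *: "g x \<in> carrier G" "g \<in> F \<rightarrow> carrier G" "finsum G g F \<in> carrier G"
        "(\<lambda>i. f (g i)) \<in> F \<rightarrow> carrier H" "f (g x) \<in> carrier H"
        using insert add_hom_closed[OF assms(3)] by auto
      show ?case using insert * by (simp add: add_hom_add[OF assms(3)])
    qed
  next
    case False
    then show ?thesis using add_hom_zero[OF assms(1-3)]
      by (simp add: G.finsum_infinite H.finsum_infinite)
  qed
qed

lemma add_hom_comp:
  assumes "f \<in> add_hom G H" "g \<in> add_hom H K"
  shows "(\<lambda>x. g (f x)) \<in> add_hom G K"
  using assms unfolding add_hom_def by (auto simp: Pi_iff)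

lemma add_hom_plus:
  assumes "abelian_group H" "f \<in> add_hom G H" "g \<in> add_hom G H"
  shows "(\<lambda>x. f x \<oplus>\<^sub>H g x) \<in> add_hom G H"
proof -
  interpret H: abelian_group H by fact
  show ?thesis using assms(2,3) unfolding add_hom_def by (auto simp: H.a_ac Pi_iff)
qed

lemma abelian_subgroup_of_additive:
  assumes "abelian_group G" "additive_subgroup B G"
  shows "abelian_subgroup B G"
  using assms by (rule abelian_subgroupI3[rotated])

lemma coset_eq_iff:
  assumes "abelian_group G" "additive_subgroup B G" "x \<in> carrier G" "y \<in> carrier G"
  shows "B +>\<^sub>G x = B +>\<^sub>G y \<longleftrightarrow> x \<ominus>\<^sub>G y \<in> B"
proof -
  interpret S: abelian_subgroup B G by (rule abelian_subgroup_of_additive[OF assms(1,2)])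
  have "x \<ominus>\<^sub>G y \<in> B \<longleftrightarrow> x \<in> B +>\<^sub>G y"
    using S.a_rcos_module[OF assms(4,3)] by (simp add: a_minus_def)
  also have "\<dots> \<longleftrightarrow> B +>\<^sub>G x = B +>\<^sub>G y"
    using S.a_repr_independence' S.a_rcos_self[OF assms(3)] assms by metis
  finally show ?thesis by simp
qed

lemma coset_add:
  assumes "abelian_group G" "additive_subgroup B G" "x \<in> carrier G" "y \<in> carrier G"
  shows "set_add G (B +>\<^sub>G x) (B +>\<^sub>G y) = B +>\<^sub>G (x \<oplus>\<^sub>G y)"
  using abelian_subgroup.a_rcos_sum[OF abelian_subgroup_of_additive[OF assms(1,2)] assms(3,4)] .

lemma coset_zero:
  assumes "abelian_group G" "additive_subgroup B G"
  shows "B +>\<^sub>G \<zero>\<^sub>G = B"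
  using assms abelian_group.a_coset_add_zero[OF assms(1)] additive_subgroup.a_subset[OF assms(2)]
  by auto

text \<open>One proof for two quotients: \<open>tensor_bimod\<close>, with \<open>C\<close> the
  whole group, and \<open>ext_group\<close>, with \<open>C\<close> the cocycles.\<close>

lemma abelian_group_cosets:
  fixes G :: "('a, 'c) ring_scheme" and Q :: "('a set, 'd) ring_scheme"
  assumes G: "abelian_group G" and B: "additive_subgroup B G" and C: "additive_subgroup C G"
    and Q: "carrier Q = (\<lambda>f. B +>\<^sub>G f) ` C" "zero Q = B" "add Q = set_add G"
  shows "abelian_group Q"
proof -
  interpret G: abelian_group G by fact
  interpret C: additive_subgroup C G by fact
  note add = coset_add[OF G B]
  have sub: "x \<in> carrier G" if "x \<in> C" for x using that C.a_subset by auto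
  have zero: "B = B +>\<^sub>G \<zero>\<^sub>G" using coset_zero[OF G B] by simp
  show ?thesis
  proof (rule abelian_groupI)
    show "\<zero>\<^sub>Q \<in> carrier Q" using Q zero C.zero_closed by auto
  next
    fix X assume "X \<in> carrier Q"
    then obtain x where x: "x \<in> C" "X = B +>\<^sub>G x" using Q by auto
    have "(B +>\<^sub>G (\<ominus>\<^sub>G x)) \<oplus>\<^sub>Q X = \<zero>\<^sub>Q"
      using x Q sub zero by (simp add: add G.l_neg)
    then show "\<exists>Y\<in>carrier Q. Y \<oplus>\<^sub>Q X = \<zero>\<^sub>Q" using x Q C.a_inv_closed by blast
    show "\<zero>\<^sub>Q \<oplus>\<^sub>Q X = X" using x Q sub zero add[OF G.zero_closed, of x] by simp
  next
    fix X Y assume XY: "X \<in> carrier Q" "Y \<in> carrier Q"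
    then obtain x y where xy: "x \<in> C" "X = B +>\<^sub>G x" "y \<in> C" "Y = B +>\<^sub>G y" using Q by auto
    then have e: "X \<oplus>\<^sub>Q Y = B +>\<^sub>G (x \<oplus>\<^sub>G y)" using Q sub by (simp add: add)
    then show "X \<oplus>\<^sub>Q Y \<in> carrier Q" using xy Q(1) C.a_closed by auto
    show "X \<oplus>\<^sub>Q Y = Y \<oplus>\<^sub>Q X" using xy Q sub e by (simp add: add G.a_comm)
    fix Z assume "Z \<in> carrier Q"
    then obtain z where "z \<in> C" "Z = B +>\<^sub>G z" using Q by auto
    then show "X \<oplus>\<^sub>Q Y \<oplus>\<^sub>Q Z = X \<oplus>\<^sub>Q (Y \<oplus>\<^sub>Q Z)"
      using xy sub Q by (simp add: add G.a_assoc)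
  qed
qed

lemma additive_subgroupI':
  assumes G: "abelian_group G" and "C \<subseteq> carrier G" "\<zero>\<^sub>G \<in> C"
    and "\<And>x y. x \<in> C ==> y \<in> C ==> x \<oplus>\<^sub>G y \<in> C" "\<And>x. x \<in> C ==> \<ominus>\<^sub>G x \<in> C"
  shows "additive_subgroup C G"
proof -
  interpret G: abelian_group G by fact
  show ?thesis
    by (intro additive_subgroupI subgroup.intro)
      (use assms in \<open>auto simp flip: a_inv_def\<close>)
qed

section \<open>Algebras and quotient algebras\<close>

text \<open>The ground field is a type. The axioms amount to a ring homomorphism from it to the
  centre, sending c to \<open>c \<odot> \<one>\<close>; linearity then reduces to ring
  distributivity.\<close>

locale k_algebra = ring A for A :: "('k::field, 'a) module" (structure) +
  assumes smult_closed: "x \<in> carrier A ==> c \<odot> x \<in> carrier A"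
    and smult_left: "x \<in> carrier A ==> c \<odot> x = (c \<odot> \<one>) \<otimes> x"
    and smult_right: "x \<in> carrier A ==> c \<odot> x = x \<otimes> (c \<odot> \<one>)"
    and smult_add: "x \<in> carrier A ==> (c + d) \<odot> x = c \<odot> x \<oplus> d \<odot> x"
    and smult_mult: "x \<in> carrier A ==> (c * d) \<odot> x = c \<odot> (d \<odot> x)"
    and smult_one: "x \<in> carrier A ==> 1 \<odot> x = x"
begin

lemma unit_smult_closed [simp, intro]: "c \<odot> \<one> \<in> carrier A"
  by (simp add: smult_closed)

lemma smult_distrib: "x \<in> carrier A ==> y \<in> carrier A ==> c \<odot> (x \<oplus> y) = c \<odot> x \<oplus> c \<odot> y"
  by (subst (1 2 3) smult_left) (auto simp: r_distr)

lemma smult_zero_left: "x \<in> carrier A ==> 0 \<odot> x = \<zero>"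
  using smult_add[of x 0 0] smult_closed[of x 0] by (simp add: add.l_cancel_one')

lemma smult_zero_right: "c \<odot> \<zero> = \<zero>"
  by (subst smult_left) auto

lemma smult_mult_left: "x \<in> carrier A ==> y \<in> carrier A ==> (c \<odot> x) \<otimes> y = c \<odot> (x \<otimes> y)"
  by (subst (1 2) smult_left) (auto simp: m_assoc)

lemma smult_mult_right: "x \<in> carrier A ==> y \<in> carrier A ==> x \<otimes> (c \<odot> y) = c \<odot> (x \<otimes> y)"
  by (subst (1 2) smult_right) (auto simp: m_assoc)

lemma smult_minus_one: "x \<in> carrier A ==> (-1) \<odot> x = \<ominus> x"
proof -
  assume x: "x \<in> carrier A"
  have "(-1) \<odot> x \<oplus> x = \<zero>"
    using smult_add[OF x, of "-1" 1] smult_zero_left[OF x] smult_one[OF x] by simp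
  then show ?thesis using x smult_closed[OF x] by (simp add: minus_equality)
qed

lemma smult_neg: "x \<in> carrier A ==> c \<odot> (\<ominus> x) = \<ominus> (c \<odot> x)"
  using smult_mult_right[of x "\<ominus> \<one>" c]
  by (metis a_inv_closed add.inv_closed mult.commute smult_closed smult_minus_one smult_mult)

end

lemma monoid_algebra_simps [simp]:
  "carrier monoid_algebra = UNIV" "x \<otimes>\<^sub>monoid_algebra y = x * y"
  "x \<oplus>\<^sub>monoid_algebra y = x + y" "\<zero>\<^sub>monoid_algebra = 0" "\<one>\<^sub>monoid_algebra = 1"
  unfolding monoid_algebra_def by simp_all

lemma monoid_algebra_smult [simp]: "c \<odot>\<^sub>monoid_algebra f = single 0 c * f"
  unfolding monoid_algebra_def by (simp add: mult_map_scale_conv_mult)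

lemma poly_mapping_sum_single:
  "f = (\<Sum>k\<in>keys f. single k (lookup f k))"
  by (rule poly_mapping_eqI)
    (auto simp: lookup_sum lookup_single when_def not_in_keys_iff_lookup_eq_zero)

text \<open>The bound \<open>K\<close> on the support is carried through the induction because
  formal tensors are supported on pairs from the carrier of an algebra.\<close>

lemma poly_mapping_add_induct [consumes 1, case_names zero single add]:
  fixes f :: "'a \<Rightarrow>\<^sub>0 'b::comm_monoid_add"
  assumes keys: "keys f \<subseteq> K"
    and zero: "P 0" and single: "\<And>k c. k \<in> K ==> P (single k c)"
    and add: "\<And>f g. keys f \<subseteq> K ==> keys g \<subseteq> K ==> P f ==> P g ==> P (f + g)"
  shows "P f"
proof -
  have "P (\<Sum>k\<in>S. single k (lookup f k)) \<and>
      keys (\<Sum>k\<in>S. single k (lookup f k)) \<subseteq> K"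
    if "finite S" "S \<subseteq> K" for S
    using that
  proof (induction S)
    case (insert x F)
    let ?s = "single x (lookup f x)"
    let ?g = "\<Sum>k\<in>F. single k (lookup f k)"
    have "keys ?s \<subseteq> K" using insert by auto
    moreover have "keys ?g \<subseteq> K" "P ?g" "P ?s" using insert single by auto
    ultimately have "P (?s + ?g)" "keys (?s + ?g) \<subseteq> K"
      using add[of ?s ?g] keys_add[of ?s ?g] by blast+
    then show ?case using insert by simp
  qed (simp add: zero)
  from this[OF finite_keys keys] show ?thesis by (simp flip: poly_mapping_sum_single)
qed

text \<open>The monoid may be noncommutative, but scalars are supported at its neutral
  element.\<close>

lemma single_zero_commute:
  fixes f :: "'m::monoid_add \<Rightarrow>\<^sub>0 'k::comm_semiring_1"
  shows "f * single 0 c = single 0 c * f"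
  using subset_UNIV[of "keys f"]
  by (induction f rule: poly_mapping_add_induct)
    (auto simp: mult_single mult.commute distrib_left distrib_right)

interpretation monoid_algebra: k_algebra monoid_algebra
proof -
  have "ring (monoid_algebra :: ('k::field, 'm::monoid_add \<Rightarrow>\<^sub>0 'k) module)"
  proof (rule ringI)
    show "abelian_group (monoid_algebra :: ('k, 'm \<Rightarrow>\<^sub>0 'k) module)"
    proof (rule abelian_groupI)
      fix x :: "'m \<Rightarrow>\<^sub>0 'k"
      have "- x \<oplus>\<^sub>monoid_algebra x = \<zero>\<^sub>monoid_algebra" by simp
      then show "\<exists>y\<in>carrier monoid_algebra. y \<oplus>\<^sub>monoid_algebra x = \<zero>\<^sub>monoid_algebra"
        by (metis UNIV_I monoid_algebra_simps(1))
    qed (simp_all add: add.assoc add.commute)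
    show "monoid (monoid_algebra :: ('k, 'm \<Rightarrow>\<^sub>0 'k) module)"
      by (rule monoidI) (simp_all add: mult.assoc)
  qed (simp_all add: distrib_left distrib_right)
  then show "k_algebra (monoid_algebra :: ('k::field, 'm::monoid_add \<Rightarrow>\<^sub>0 'k) module)"
  proof (rule k_algebra.intro, unfold_locales)
    fix c d :: 'k and x :: "'m \<Rightarrow>\<^sub>0 'k"
    have "single (0::'m) (c * d) = single 0 c * single 0 d"
      by (simp add: mult_single)
    then show "(c * d) \<odot>\<^sub>monoid_algebra x = c \<odot>\<^sub>monoid_algebra (d \<odot>\<^sub>monoid_algebra x)"
      by (simp add: mult.assoc)
    show "1 \<odot>\<^sub>monoid_algebra x = x" by simp
    show "(c + d) \<odot>\<^sub>monoid_algebra x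
        = c \<odot>\<^sub>monoid_algebra x \<oplus>\<^sub>monoid_algebra d \<odot>\<^sub>monoid_algebra x"
      by (simp add: single_add distrib_right)
  qed (simp_all add: single_zero_commute)
qed

lemma monoid_algebra_uminus [simp]: "\<ominus>\<^sub>monoid_algebra x = - x"
  by (rule monoid_algebra.minus_equality) auto

lemma monoid_algebra_minus [simp]: "x \<ominus>\<^sub>monoid_algebra y = x - y"
  by (simp add: a_minus_def)

text \<open>The scalar multiple of a coset is a union over its elements. All cosets in this union
  are equal, since the ideal is stable under multiplication by
  \<open>c \<odot>\<^sub>A \<one>\<^sub>A\<close>.\<close>

lemma quot_algebra_smult:
  assumes "k_algebra A" "ideal I A" "x \<in> carrier A"
  shows "c \<odot>\<^sub>(quot_algebra A I) (I +>\<^sub>A x) = I +>\<^sub>A (c \<odot>\<^sub>A x)"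
proof -
  interpret k_algebra A by fact
  interpret I: ideal I A by fact
  have "I +>\<^sub>A (c \<odot>\<^sub>A y) = I +>\<^sub>A (c \<odot>\<^sub>A x)" if y: "y \<in> I +>\<^sub>A x" for y
  proof -
    have yc: "y \<in> carrier A" using y assms(3) I.a_subset
      by (meson a_r_coset_subset_G subsetD)
    have "y \<ominus>\<^sub>A x \<in> I"
      using y yc assms(3) I.a_rcos_module_minus[OF ring_axioms] by blast
    then have "(c \<odot>\<^sub>A \<one>\<^sub>A) \<otimes>\<^sub>A (y \<ominus>\<^sub>A x) \<in> I" by (simp add: I.I_l_closed)
    then have "c \<odot>\<^sub>A y \<ominus>\<^sub>A c \<odot>\<^sub>A x \<in> I"
      using yc assms(3)
      by (simp add: smult_left[symmetric] a_minus_def smult_distrib smult_neg)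
    then show ?thesis
      using coset_eq_iff[OF is_abelian_group I.additive_subgroup_axioms
          smult_closed[OF yc, of c] smult_closed[OF assms(3), of c]] by blast
  qed
  moreover have "x \<in> I +>\<^sub>A x" using assms(3) by (rule I.a_rcos_self)
  ultimately have "(\<Union>y\<in>I +>\<^sub>A x. I +>\<^sub>A (c \<odot>\<^sub>A y)) = I +>\<^sub>A (c \<odot>\<^sub>A x)"
    by blast
  then show ?thesis unfolding quot_algebra_def module.simps .
qed

lemma quot_algebra_simps:
  assumes "ring A" "ideal I A"
  shows "carrier (quot_algebra A I) = (\<lambda>x. I +>\<^sub>A x) ` carrier A"
    and "\<zero>\<^sub>(quot_algebra A I) = I" "\<one>\<^sub>(quot_algebra A I) = I +>\<^sub>A \<one>\<^sub>A"
    and "x \<in> carrier A ==> y \<in> carrier A ==>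
      (I +>\<^sub>A x) \<oplus>\<^sub>(quot_algebra A I) (I +>\<^sub>A y) = I +>\<^sub>A (x \<oplus>\<^sub>A y)"
    and "x \<in> carrier A ==> y \<in> carrier A ==>
      (I +>\<^sub>A x) \<otimes>\<^sub>(quot_algebra A I) (I +>\<^sub>A y) = I +>\<^sub>A (x \<otimes>\<^sub>A y)"
proof -
  interpret ring A by fact
  interpret I: ideal I A by fact
  show "carrier (quot_algebra A I) = (\<lambda>x. I +>\<^sub>A x) ` carrier A"
    unfolding quot_algebra_def FactRing_def A_RCOSETS_def' by auto
  show "\<zero>\<^sub>(quot_algebra A I) = I" "\<one>\<^sub>(quot_algebra A I) = I +>\<^sub>A \<one>\<^sub>A"
    unfolding quot_algebra_def FactRing_def by auto
  show "x \<in> carrier A ==> y \<in> carrier A ==>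
      (I +>\<^sub>A x) \<oplus>\<^sub>(quot_algebra A I) (I +>\<^sub>A y) = I +>\<^sub>A (x \<oplus>\<^sub>A y)"
    unfolding quot_algebra_def FactRing_def
    using coset_add[OF is_abelian_group I.additive_subgroup_axioms] by simp
  show "x \<in> carrier A ==> y \<in> carrier A ==>
      (I +>\<^sub>A x) \<otimes>\<^sub>(quot_algebra A I) (I +>\<^sub>A y) = I +>\<^sub>A (x \<otimes>\<^sub>A y)"
    unfolding quot_algebra_def FactRing_def using I.rcoset_mult_add by simp
qed

text \<open>\<open>quot_algebra\<close> moves the operations of the factor ring into a record of
  another type; the ring axioms see only the fields listed here.\<close>

lemma ring_cong:
  fixes R :: "('a, 'c) ring_scheme" and S :: "('a, 'd) ring_scheme"
  assumes R: "ring R" and "carrier S = carrier R" "monoid.mult S = monoid.mult R"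
    "one S = one R" "zero S = zero R" "add S = add R"
  shows "ring S"
proof -
  interpret ring R by fact
  note eqs = assms(2-)
  have "abelian_group S"
  proof (rule abelian_groupI)
    fix x assume "x \<in> carrier S"
    then show "\<exists>y\<in>carrier S. y \<oplus>\<^sub>S x = \<zero>\<^sub>S"
      unfolding eqs by (rule add.l_inv_ex)
  qed (simp_all add: eqs a_ac)
  moreover have "monoid S" by (rule monoidI) (simp_all add: eqs m_assoc)
  ultimately show ?thesis by (rule ringI) (simp_all add: eqs l_distr r_distr)
qed

lemma quot_algebra_ring: "ring A ==> ideal I A ==> ring (quot_algebra A I)"
  by (rule ring_cong[OF ideal.quotient_is_ring[of I A]]) (simp_all add: quot_algebra_def)

lemma quot_algebra_k_algebra:
  assumes A: "k_algebra A" and I: "ideal I A"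
  shows "k_algebra (quot_algebra A I)"
proof -
  interpret k_algebra A by fact
  interpret Q: ring "quot_algebra A I" by (rule quot_algebra_ring[OF ring_axioms I])
  note qs = quot_algebra_simps[OF ring_axioms I] quot_algebra_smult[OF A I]
  show ?thesis
    by unfold_locales
      (auto simp: qs smult_closed smult_add smult_mult smult_one
        simp flip: smult_left smult_right)
qed

section \<open>Bimodules over an algebra\<close>

text \<open>The field \<open>smult\<close> of a bimodule is the left action of the algebra, so
  scalars have to act through multiples of its unit.\<close>

definition scal :: "('k, 'a) module => ('a, 'm) bimodule => 'k => 'm => 'm" where
  "scal A M c x = (c \<odot>\<^sub>A \<one>\<^sub>A) \<odot>\<^sub>M x"

locale k_bimodule = k_algebra A + bimodule A M
  for A :: "('k::field, 'a) module" (structure) and M :: "('a, 'm) bimodule" (structure)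
begin

lemma l_add_hom: "a \<in> carrier A ==> (\<lambda>x. a \<odot>\<^sub>M x) \<in> add_hom M M"
  by (rule add_homI) (auto simp: l_closed l_distr_vector)

lemma r_add_hom: "a \<in> carrier A ==> (\<lambda>x. x \<odot>\<^sup>r\<^sub>M a) \<in> add_hom M M"
  by (rule add_homI) (auto simp: r_closed r_distr_vector)

lemma l_zero_vec: "a \<in> carrier A ==> a \<odot>\<^sub>M \<zero>\<^sub>M = \<zero>\<^sub>M"
  using add_hom_zero[OF M.abelian_group_axioms M.abelian_group_axioms l_add_hom] by simp

lemma r_zero_vec: "a \<in> carrier A ==> \<zero>\<^sub>M \<odot>\<^sup>r\<^sub>M a = \<zero>\<^sub>M"
  using add_hom_zero[OF M.abelian_group_axioms M.abelian_group_axioms r_add_hom] by simp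

lemma l_zero_scalar:
  assumes x: "x \<in> carrier M"
  shows "\<zero>\<^sub>A \<odot>\<^sub>M x = \<zero>\<^sub>M"
proof -
  have "(\<lambda>a. a \<odot>\<^sub>M x) \<in> add_hom A M"
    using x by (intro add_homI) (auto simp: l_closed l_distr_scalar)
  then show ?thesis using add_hom_zero[OF is_abelian_group M.abelian_group_axioms] by fastforce
qed

abbreviation sc :: "'k => 'm => 'm" where "sc \<equiv> scal A M"

lemma sc_add_hom: "sc c \<in> add_hom M M"
  unfolding scal_def[abs_def] by (rule l_add_hom) auto

lemma sc_closed [simp, intro]: "x \<in> carrier M ==> sc c x \<in> carrier M"
  unfolding scal_def by (simp add: l_closed)

lemma sc_distr: "x \<in> carrier M ==> y \<in> carrier M ==> sc c (x \<oplus>\<^sub>M y) = sc c x \<oplus>\<^sub>M sc c y"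
  unfolding scal_def by (simp add: l_distr_vector)

lemma sc_add: "x \<in> carrier M ==> sc (c + d) x = sc c x \<oplus>\<^sub>M sc d x"
  unfolding scal_def by (simp add: smult_add l_distr_scalar)

lemma sc_mult: "x \<in> carrier M ==> sc (c * d) x = sc c (sc d x)"
  unfolding scal_def
  by (simp add: smult_mult l_assoc[symmetric] smult_left[symmetric] smult_closed)

lemma sc_one [simp]: "x \<in> carrier M ==> sc 1 x = x"
  unfolding scal_def by (simp add: smult_one l_unit)

lemma sc_zero [simp]: "x \<in> carrier M ==> sc 0 x = \<zero>\<^sub>M"
  unfolding scal_def by (simp add: smult_zero_left l_zero_scalar)

lemma sc_zero_vec [simp]: "sc c \<zero>\<^sub>M = \<zero>\<^sub>M"
  unfolding scal_def by (simp add: l_zero_vec)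

lemma sc_minus_one: "x \<in> carrier M ==> sc (-1) x = \<ominus>\<^sub>M x"
proof -
  assume x: "x \<in> carrier M"
  have "sc (-1) x \<oplus>\<^sub>M x = \<zero>\<^sub>M" using sc_add[OF x, of "-1" 1] x by simp
  then show ?thesis using M.minus_equality x by fastforce
qed

lemma sc_left: "a \<in> carrier A ==> x \<in> carrier M ==> a \<odot>\<^sub>M sc c x = sc c (a \<odot>\<^sub>M x)"
  unfolding scal_def by (simp add: l_assoc[symmetric] smult_left[symmetric] smult_right[symmetric])

lemma sc_right: "a \<in> carrier A ==> x \<in> carrier M ==> sc c x \<odot>\<^sup>r\<^sub>M a = sc c (x \<odot>\<^sup>r\<^sub>M a)"
  unfolding scal_def by (simp add: lr_assoc)

lemma sc_smult: "a \<in> carrier A ==> x \<in> carrier M ==> (c \<odot>\<^sub>A a) \<odot>\<^sub>M x = sc c (a \<odot>\<^sub>M x)"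
  unfolding scal_def by (subst smult_left) (auto simp: l_assoc)

lemma sc_rsmult: "a \<in> carrier A ==> x \<in> carrier M ==> x \<odot>\<^sup>r\<^sub>M (c \<odot>\<^sub>A a) = sc c (x \<odot>\<^sup>r\<^sub>M a)"
  unfolding scal_def by (subst smult_left) (auto simp: r_assoc central[symmetric] lr_assoc)

end

text \<open>The identity gives the regular bimodule, the augmentation a bimodule on which right
  factors count only through their constant term.\<close>

definition twist_bimod :: "('k, 'a) module => ('a => 'a) => ('a, 'a) bimodule" where
  "twist_bimod A \<eta> =
    \<lparr>carrier = carrier A, monoid.mult = undefined, one = undefined,
     zero = \<zero>\<^sub>A, add = add A, smult = monoid.mult A, rsmult = (\<lambda>x a. x \<otimes>\<^sub>A \<eta> a)\<rparr>"

lemma regular_bimod_twist: "regular_bimod A = twist_bimod A (\<lambda>a. a)"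
  unfolding regular_bimod_def twist_bimod_def by simp

lemma twist_bimod_simps [simp]:
  "carrier (twist_bimod A \<eta>) = carrier A" "\<zero>\<^sub>(twist_bimod A \<eta>) = \<zero>\<^sub>A"
  "x \<oplus>\<^sub>(twist_bimod A \<eta>) y = x \<oplus>\<^sub>A y" "a \<odot>\<^sub>(twist_bimod A \<eta>) x = a \<otimes>\<^sub>A x"
  "x \<odot>\<^sup>r\<^sub>(twist_bimod A \<eta>) a = x \<otimes>\<^sub>A \<eta> a"
  unfolding twist_bimod_def by simp_all

lemma regular_bimod_simps [simp]:
  "carrier (regular_bimod A) = carrier A" "\<zero>\<^sub>(regular_bimod A) = \<zero>\<^sub>A"
  "x \<oplus>\<^sub>(regular_bimod A) y = x \<oplus>\<^sub>A y" "a \<odot>\<^sub>(regular_bimod A) x = a \<otimes>\<^sub>A x"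
  "x \<odot>\<^sup>r\<^sub>(regular_bimod A) a = x \<otimes>\<^sub>A a"
  unfolding regular_bimod_def by simp_all

lemma (in k_algebra) twist_k_bimodule:
  assumes "\<eta> \<in> ring_hom A A" "\<And>c. \<eta> (c \<odot> \<one>) = c \<odot> \<one>"
  shows "k_bimodule A (twist_bimod A \<eta>)"
proof -
  have cl: "\<And>a. a \<in> carrier A ==> \<eta> a \<in> carrier A" using assms(1) by (rule ring_hom_closed)
  have "abelian_group (twist_bimod A \<eta>)"
  proof (rule abelian_groupI)
    fix x assume "x \<in> carrier (twist_bimod A \<eta>)"
    then show "\<exists>y\<in>carrier (twist_bimod A \<eta>). y \<oplus>\<^sub>(twist_bimod A \<eta>) x = \<zero>\<^sub>(twist_bimod A \<eta>)"
      using add.l_inv_ex by simp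
  qed (simp_all add: a_ac)
  then interpret M: abelian_group "twist_bimod A \<eta>" .
  show ?thesis
    by (intro k_bimodule.intro k_algebra_axioms bimodule.intro ring_axioms
        M.abelian_group_axioms bimodule_axioms.intro)
      (simp_all add: cl l_distr r_distr m_assoc ring_hom_add[OF assms(1)]
        ring_hom_mult[OF assms(1)] ring_hom_one[OF assms(1)] assms(2)
        smult_left[symmetric] smult_right[symmetric])
qed

lemma (in k_algebra) regular_k_bimodule: "k_bimodule A (regular_bimod A)"
  unfolding regular_bimod_twist by (rule twist_k_bimodule) (auto simp: ring_hom_def)

subsection \<open>Linear combinations\<close>

lemma lookup_map_scale [simp]:
  "lookup (Poly_Mapping.map ((*) c) f) k = c * lookup f k"
  for c :: "'k::semiring_0"
  by (simp add: map.rep_eq when_def)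

definition lincomb ::
    "('k::field, 'a) module => ('a, 'm) bimodule => ('x => 'm) => ('x \<Rightarrow>\<^sub>0 'k) => 'm" where
  "lincomb A M \<beta> f = (\<Oplus>\<^sub>M p\<in>keys f. scal A M (lookup f p) (\<beta> p))"

context k_bimodule
begin

context
  fixes \<beta> :: "'x => 'm" and K :: "'x set"
  assumes \<beta>: "\<And>p. p \<in> K ==> \<beta> p \<in> carrier M"
begin

lemma lincomb_superset:
  assumes "finite S" "keys f \<subseteq> S" "S \<subseteq> K"
  shows "lincomb A M \<beta> f = (\<Oplus>\<^sub>M p\<in>S. sc (lookup f p) (\<beta> p))"
  unfolding lincomb_def
  by (rule M.add.finprod_mono_neutral_cong_left)
    (use assms \<beta> in \<open>auto simp: not_in_keys_iff_lookup_eq_zero subset_iff\<close>)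

lemma lincomb_closed: "keys f \<subseteq> K ==> lincomb A M \<beta> f \<in> carrier M"
  unfolding lincomb_def using \<beta> by (intro M.finsum_closed) auto

lemma lincomb_add:
  assumes "keys f \<subseteq> K" "keys g \<subseteq> K"
  shows "lincomb A M \<beta> (f + g) = lincomb A M \<beta> f \<oplus>\<^sub>M lincomb A M \<beta> g"
proof -
  let ?S = "keys f \<union> keys g"
  have S: "finite ?S" "?S \<subseteq> K" using assms by auto
  have *: "\<And>p. p \<in> ?S ==> \<beta> p \<in> carrier M" using S \<beta> by auto
  have "lincomb A M \<beta> (f + g) = (\<Oplus>\<^sub>M p\<in>?S. sc (lookup f p) (\<beta> p)
      \<oplus>\<^sub>M sc (lookup g p) (\<beta> p))"
    unfolding lincomb_superset[OF S(1) keys_add[of f g] S(2)]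
    by (rule M.finsum_cong') (use * in \<open>auto simp: lookup_add sc_add\<close>)
  also have "\<dots> = (\<Oplus>\<^sub>M p\<in>?S. sc (lookup f p) (\<beta> p))
      \<oplus>\<^sub>M (\<Oplus>\<^sub>M p\<in>?S. sc (lookup g p) (\<beta> p))"
    using * by (intro M.finsum_addf) auto
  finally show ?thesis
    using lincomb_superset[OF S(1) _ S(2), of f] lincomb_superset[OF S(1) _ S(2), of g] by simp
qed

lemma lincomb_scale:
  assumes "keys f \<subseteq> K"
  shows "lincomb A M \<beta> (Poly_Mapping.map ((*) c) f) = sc c (lincomb A M \<beta> f)"
proof -
  have *: "\<And>p. p \<in> keys f ==> \<beta> p \<in> carrier M" using assms \<beta> by auto
  have "keys (Poly_Mapping.map ((*) c) f) \<subseteq> keys f"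
    by (auto simp: in_keys_iff)
  from lincomb_superset[OF finite_keys this assms]
  have "lincomb A M \<beta> (Poly_Mapping.map ((*) c) f)
      = (\<Oplus>\<^sub>M p\<in>keys f. sc c (sc (lookup f p) (\<beta> p)))"
    using * by (auto simp: sc_mult intro!: M.finsum_cong')
  also have "\<dots> = sc c (lincomb A M \<beta> f)"
    unfolding lincomb_def
    by (subst add_hom_finsum[OF M.abelian_group_axioms M.abelian_group_axioms sc_add_hom])
      (use * in auto)
  finally show ?thesis .
qed

lemma lincomb_single: "p \<in> K ==> lincomb A M \<beta> (single p c) = sc c (\<beta> p)"
  using lincomb_superset[of "{p}" "single p c"] \<beta>[of p]
  by (simp add: M.finsum_insert)

end

lemma lincomb_zero [simp]: "lincomb A M \<beta> 0 = \<zero>\<^sub>M"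
  unfolding lincomb_def by simp

lemma lincomb_uminus:
  assumes "\<And>p. p \<in> K ==> \<beta> p \<in> carrier M" "keys f \<subseteq> K"
  shows "lincomb A M \<beta> (- f) = \<ominus>\<^sub>M lincomb A M \<beta> f"
proof -
  have "- f = Poly_Mapping.map ((*) (-1)) f" by (rule poly_mapping_eqI) simp
  then show ?thesis
    using lincomb_scale[of K \<beta>, OF assms] lincomb_closed[of K \<beta>, OF assms]
    by (simp add: sc_minus_one)
qed

end

definition balanced ::
    "('k::field, 'a) module => ('a, 'm) bimodule => ('a => 'a => 'm) => bool" where
  "balanced A M \<beta> \<longleftrightarrow>
    (\<forall>x\<in>carrier A. \<forall>y\<in>carrier A. \<beta> x y \<in> carrier M) \<and>
    (\<forall>x\<in>carrier A. \<forall>x'\<in>carrier A. \<forall>y\<in>carrier A. \<beta> (x \<oplus>\<^sub>A x') y = \<beta> x y \<oplus>\<^sub>M \<beta> x' y) \<and>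
    (\<forall>x\<in>carrier A. \<forall>y\<in>carrier A. \<forall>y'\<in>carrier A. \<beta> x (y \<oplus>\<^sub>A y') = \<beta> x y \<oplus>\<^sub>M \<beta> x y') \<and>
    (\<forall>c. \<forall>x\<in>carrier A. \<forall>y\<in>carrier A. \<beta> (c \<odot>\<^sub>A x) y = scal A M c (\<beta> x y) \<and>
       \<beta> x (c \<odot>\<^sub>A y) = scal A M c (\<beta> x y))"

lemma balancedI:
  assumes "\<And>x y. x \<in> carrier A ==> y \<in> carrier A ==> \<beta> x y \<in> carrier M"
    and "\<And>x x' y. x \<in> carrier A ==> x' \<in> carrier A ==> y \<in> carrier A ==>
      \<beta> (x \<oplus>\<^sub>A x') y = \<beta> x y \<oplus>\<^sub>M \<beta> x' y"
    and "\<And>x y y'. x \<in> carrier A ==> y \<in> carrier A ==> y' \<in> carrier A ==>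
      \<beta> x (y \<oplus>\<^sub>A y') = \<beta> x y \<oplus>\<^sub>M \<beta> x y'"
    and "\<And>c x y. x \<in> carrier A ==> y \<in> carrier A ==> \<beta> (c \<odot>\<^sub>A x) y = scal A M c (\<beta> x y)"
    and "\<And>c x y. x \<in> carrier A ==> y \<in> carrier A ==> \<beta> x (c \<odot>\<^sub>A y) = scal A M c (\<beta> x y)"
  shows "balanced A M \<beta>"
  unfolding balanced_def by (intro conjI ballI allI) (rule assms; assumption)+

lemma balancedD:
  assumes "balanced A M \<beta>"
  shows "\<And>x y. x \<in> carrier A ==> y \<in> carrier A ==> \<beta> x y \<in> carrier M"
    and "\<And>x x' y. x \<in> carrier A ==> x' \<in> carrier A ==> y \<in> carrier A ==>
      \<beta> (x \<oplus>\<^sub>A x') y = \<beta> x y \<oplus>\<^sub>M \<beta> x' y"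
    and "\<And>x y y'. x \<in> carrier A ==> y \<in> carrier A ==> y' \<in> carrier A ==>
      \<beta> x (y \<oplus>\<^sub>A y') = \<beta> x y \<oplus>\<^sub>M \<beta> x y'"
    and "\<And>c x y. x \<in> carrier A ==> y \<in> carrier A ==> \<beta> (c \<odot>\<^sub>A x) y = scal A M c (\<beta> x y)"
    and "\<And>c x y. x \<in> carrier A ==> y \<in> carrier A ==> \<beta> x (c \<odot>\<^sub>A y) = scal A M c (\<beta> x y)"
  using assms unfolding balanced_def by blast+

lemma (in k_bimodule) balanced_sandwich:
  assumes "v \<in> carrier M"
  shows "balanced A M (\<lambda>x y. x \<odot>\<^sub>M v \<odot>\<^sup>r\<^sub>M y)"
  by (rule balancedI)
    (simp_all add: assms l_closed r_closed l_distr_scalar r_distr_vector r_distr_scalar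
      sc_smult sc_rsmult sc_right)

section \<open>The bimodule of tensors\<close>

interpretation pm: Modules.module "\<lambda>(c::'k::field) (f :: 'x \<Rightarrow>\<^sub>0 'k). Poly_Mapping.map ((*) c) f"
  by unfold_locales (rule poly_mapping_eqI, simp add: lookup_add algebra_simps)+

definition tens_gens :: "('k::field, 'a) module => ('k, 'a) tens" where
  "tens_gens A = (let e = (\<lambda>x y. single (x, y) (1::'k)); s = (\<lambda>c. Poly_Mapping.map ((*) c)) in
      {e (x \<oplus>\<^sub>A x') y - e x y - e x' y | x x' y.
          x \<in> carrier A \<and> x' \<in> carrier A \<and> y \<in> carrier A} \<union>
       {e x (y \<oplus>\<^sub>A y') - e x y - e x y' | x y y'.
          x \<in> carrier A \<and> y \<in> carrier A \<and> y' \<in> carrier A} \<union>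
       {e (c \<odot>\<^sub>A x) y - s c (e x y) | c x y. x \<in> carrier A \<and> y \<in> carrier A} \<union>
       {e x (c \<odot>\<^sub>A y) - s c (e x y) | c x y. x \<in> carrier A \<and> y \<in> carrier A})"

lemma tens_rel_span: "tens_rel A = pm.span (tens_gens A)"
  unfolding tens_rel_def tens_gens_def Let_def by simp

lemma map_scale_single [simp]:
  "Poly_Mapping.map ((*) c) (single k d) = single k (c * d)"
  for c :: "'k::semiring_0"
  by (rule poly_mapping_eqI) (simp add: lookup_single when_def)

lemma pair_space_simps [simp]:
  "carrier (pair_space A) = {f. keys f \<subseteq> carrier A \<times> carrier A}"
  "f \<oplus>\<^sub>(pair_space A) g = f + g" "\<zero>\<^sub>(pair_space A) = 0"
  unfolding pair_space_def by simp_all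

lemma keys_add_subset:
  "keys f \<subseteq> K ==> keys g \<subseteq> K ==> keys (f + g) \<subseteq> K"
  using keys_add[of f g] by blast

lemma keys_uminus_subset: "keys f \<subseteq> K ==> keys (- f) \<subseteq> K"
  for f :: "'x \<Rightarrow>\<^sub>0 'b::ab_group_add"
  by (auto simp: in_keys_iff subset_iff)

lemma keys_diff_subset:
  "keys f \<subseteq> K ==> keys g \<subseteq> K ==> keys (f - g) \<subseteq> K"
  for f :: "'x \<Rightarrow>\<^sub>0 'b::ab_group_add"
  using keys_add_subset[of f K "- g"] keys_uminus_subset[of g K] by simp

lemma keys_scale_subset:
  "keys f \<subseteq> K ==> keys (Poly_Mapping.map ((*) c) f) \<subseteq> K"
  for c :: "'k::semiring_0"
  by (auto simp: in_keys_iff subset_iff) (metis mult_zero_right)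

lemma pair_space_abelian_group:
  fixes A :: "('k::field, 'a) module"
  shows "abelian_group (pair_space A)"
proof (rule abelian_groupI)
  fix f :: "'a \<times> 'a \<Rightarrow>\<^sub>0 'k" assume f: "f \<in> carrier (pair_space A)"
  then have "- f \<in> carrier (pair_space A)" by (simp add: keys_uminus_subset)
  moreover have "- f \<oplus>\<^sub>(pair_space A) f = \<zero>\<^sub>(pair_space A)" by simp
  ultimately show "\<exists>g\<in>carrier (pair_space A). g \<oplus>\<^sub>(pair_space A) f = \<zero>\<^sub>(pair_space A)" by blast
qed (simp_all add: keys_add_subset add.assoc add.commute)

lemma pair_space_minus:
  fixes A :: "('k::field, 'a) module"
  assumes "f \<in> carrier (pair_space A)" "g \<in> carrier (pair_space A)"
  shows "f \<ominus>\<^sub>(pair_space A) g = f - g"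
proof -
  interpret abelian_group "pair_space A" by (rule pair_space_abelian_group)
  have "- g \<in> carrier (pair_space A)" using assms by (simp add: keys_uminus_subset)
  then have "\<ominus>\<^sub>(pair_space A) g = - g" using assms by (intro minus_equality) auto
  then show ?thesis by (simp add: a_minus_def)
qed

lemma push_keys_superset:
  assumes "finite S" "keys f \<subseteq> S"
  shows "push_keys h f = (\<Sum>p\<in>S. single (h p) (lookup f p))"
  unfolding push_keys_def using assms
  by (intro sum.mono_neutral_left) (auto simp: not_in_keys_iff_lookup_eq_zero)

lemma push_keys_add: "push_keys h (f + g) = push_keys h f + push_keys h g"
proof -
  let ?S = "keys f \<union> keys g"
  show ?thesis
    using push_keys_superset[of ?S "f + g" h] push_keys_superset[of ?S f h]
      push_keys_superset[of ?S g h] keys_add[of f g]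
    by (simp add: lookup_add single_add sum.distrib)
qed

lemma push_keys_single [simp]: "push_keys h (single p c) = single (h p) c"
  using push_keys_superset[of "{p}" "single p c" h] by simp

lemma push_keys_zero [simp]: "push_keys h 0 = 0"
  unfolding push_keys_def by simp

lemma map_scale_zero [simp]: "Poly_Mapping.map ((*) c) 0 = (0 :: 'x \<Rightarrow>\<^sub>0 'k::semiring_0)"
  by (rule poly_mapping_eqI) simp

lemma map_scale_add [simp]:
  "Poly_Mapping.map ((*) c) (f + g) = Poly_Mapping.map ((*) c) f + Poly_Mapping.map ((*) c) g"
  for c :: "'k::semiring_0"
  by (rule poly_mapping_eqI) (simp add: lookup_add distrib_left)

lemma push_keys_scale:
  "push_keys h (Poly_Mapping.map ((*) c) f) = Poly_Mapping.map ((*) c) (push_keys h f)"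
  for c :: "'k::semiring_0"
  using subset_UNIV[of "keys f"]
  by (induction f rule: poly_mapping_add_induct) (simp_all add: push_keys_add)

lemma push_keys_diff: "push_keys h (f - g) = push_keys h f - push_keys h g"
  for f :: "'x \<Rightarrow>\<^sub>0 'b::ab_group_add"
  using push_keys_add[of h "f - g" g] by simp

context k_algebra
begin

lemma tens_gens_carrier: "f \<in> tens_gens A ==> f \<in> carrier (pair_space A)"
  unfolding tens_gens_def Let_def Un_iff mem_Collect_eq
  by (elim disjE exE conjE) (simp_all add: keys_diff_subset smult_closed)

lemma tens_rel_carrier: "f \<in> tens_rel A ==> f \<in> carrier (pair_space A)"
  unfolding tens_rel_span
  by (induction rule: pm.span_induct_alt)
    (use tens_gens_carrier in \<open>simp_all add: keys_add_subset keys_scale_subset\<close>)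

lemma tens_rel_subgroup: "additive_subgroup (tens_rel A) (pair_space A)"
proof (rule additive_subgroupI'[OF pair_space_abelian_group])
  show "tens_rel A \<subseteq> carrier (pair_space A)" using tens_rel_carrier by blast
  fix f assume f: "f \<in> tens_rel A"
  have "\<ominus>\<^sub>(pair_space A) f = - f"
    using pair_space_minus[of 0 A f] tens_rel_carrier[OF f] abelian_group.a_inv_closed[OF pair_space_abelian_group, of f A]
    by (simp add: a_minus_def)
  then show "\<ominus>\<^sub>(pair_space A) f \<in> tens_rel A" using f unfolding tens_rel_span by (simp add: pm.span_neg)
qed (simp_all add: tens_rel_span pm.span_zero pm.span_add)

abbreviation T where "T \<equiv> tensor_bimod A"

lemma T_simps:
  "carrier T = tens_class A ` carrier (pair_space A)" "\<zero>\<^sub>T = tens_rel A"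
  "X \<oplus>\<^sub>T Y = set_add (pair_space A) X Y"
  unfolding tensor_bimod_def A_RCOSETS_def' tens_class_def by auto

lemma T_abelian_group: "abelian_group T"
proof (rule abelian_group_cosets[OF pair_space_abelian_group tens_rel_subgroup])
  interpret P: abelian_group "pair_space A" by (rule pair_space_abelian_group)
  show "additive_subgroup (carrier (pair_space A)) (pair_space A)"
    using P.zero_closed P.a_closed P.a_inv_closed
    by (intro additive_subgroupI'[OF pair_space_abelian_group]) blast+
  show "carrier T = (\<lambda>f. tens_rel A +>\<^sub>(pair_space A) f) ` carrier (pair_space A)"
    unfolding T_simps tens_class_def ..
qed (simp_all add: tensor_bimod_def)

lemma tens_class_add:
  assumes "f \<in> carrier (pair_space A)" "g \<in> carrier (pair_space A)"
  shows "tens_class A (f + g) = tens_class A f \<oplus>\<^sub>T tens_class A g"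
  unfolding tens_class_def T_simps
  using coset_add[OF pair_space_abelian_group tens_rel_subgroup assms] by simp

lemma tens_class_eq_iff:
  assumes "f \<in> carrier (pair_space A)" "g \<in> carrier (pair_space A)"
  shows "tens_class A f = tens_class A g \<longleftrightarrow> f - g \<in> tens_rel A"
  unfolding tens_class_def
  using coset_eq_iff[OF pair_space_abelian_group tens_rel_subgroup assms] pair_space_minus[OF assms] by simp

lemma mem_tens_class_iff:
  assumes "f \<in> carrier (pair_space A)"
  shows "g \<in> tens_class A f \<longleftrightarrow> g \<in> carrier (pair_space A) \<and> tens_class A g = tens_class A f"
proof -
  interpret S: abelian_subgroup "tens_rel A" "pair_space A"
    by (rule abelian_subgroup_of_additive[OF pair_space_abelian_group tens_rel_subgroup])
  show ?thesis unfolding tens_class_def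
    using S.a_repr_independence'[of g f] S.a_rcos_self[of g] assms
      S.a_elemrcos_carrier[OF _ , of f g] by metis
qed

lemma tens_class_self: "f \<in> carrier (pair_space A) ==> f \<in> tens_class A f"
  using mem_tens_class_iff by blast

lemma pure_tensor_closed [simp, intro]:
  "x \<in> carrier A ==> y \<in> carrier A ==> pure_tensor A x y \<in> carrier T"
  unfolding pure_tensor_def T_simps by (intro imageI) auto

lemma tens_class_single:
  assumes "x \<in> carrier A" "y \<in> carrier A"
  shows "tens_class A (single (x, y) c) = pure_tensor A (c \<odot> x) y"
    and "tens_class A (single (x, y) c) = pure_tensor A x (c \<odot> y)"
proof -
  let ?e = "\<lambda>x y. single (x, y) (1::'k)"
  have "?e (c \<odot> x) y - Poly_Mapping.map ((*) c) (?e x y) \<in> tens_gens A"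
    "?e x (c \<odot> y) - Poly_Mapping.map ((*) c) (?e x y) \<in> tens_gens A"
    unfolding tens_gens_def Let_def using assms by blast+
  then have "?e (c \<odot> x) y - single (x, y) c \<in> tens_rel A"
    "?e x (c \<odot> y) - single (x, y) c \<in> tens_rel A"
    unfolding tens_rel_span by (auto intro: pm.span_base)
  then show "tens_class A (single (x, y) c) = pure_tensor A (c \<odot> x) y"
    "tens_class A (single (x, y) c) = pure_tensor A x (c \<odot> y)"
    unfolding pure_tensor_def using assms
    by (subst eq_commute, subst tens_class_eq_iff; auto simp: smult_closed)+
qed

text \<open>A scalar multiple of a pure tensor is again pure, because the scalar moves into a
  factor, and zero is the tensor of two zeros.\<close>

lemma T_induct [consumes 1, case_names pure add]:
  assumes "X \<in> carrier T"
    and pure: "\<And>x y. x \<in> carrier A ==> y \<in> carrier A ==> P (pure_tensor A x y)"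
    and add: "\<And>X Y. X \<in> carrier T ==> Y \<in> carrier T ==> P X ==> P Y ==> P (X \<oplus>\<^sub>T Y)"
  shows "P X"
proof -
  obtain f where f: "keys f \<subseteq> carrier A \<times> carrier A" "X = tens_class A f"
    using assms(1) by (auto simp: T_simps)
  have "P (tens_class A f)" using f(1)
  proof (induction f rule: poly_mapping_add_induct)
    case zero
    have "tens_class A (single (\<zero>, \<zero>) 0) = pure_tensor A \<zero> \<zero>"
      using tens_class_single(1)[of \<zero> \<zero> 0] by (simp add: smult_zero_right)
    then show ?case using pure[of \<zero> \<zero>] by simp
  next
    case (single k c)
    then show ?case using tens_class_single(1)[of "fst k" "snd k" c] pure smult_closed
      by (auto simp: mem_Times_iff)
  next
    case (add f g)
    then show ?case using assms(3) tens_class_add[of f g] by (simp add: T_simps)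
  qed
  then show ?thesis using f by simp
qed

lemma pure_tensor_add:
  assumes "x \<in> carrier A" "x' \<in> carrier A" "y \<in> carrier A" "y' \<in> carrier A"
  shows "pure_tensor A (x \<oplus> x') y = pure_tensor A x y \<oplus>\<^sub>T pure_tensor A x' y"
    and "pure_tensor A x (y \<oplus> y') = pure_tensor A x y \<oplus>\<^sub>T pure_tensor A x y'"
proof -
  let ?e = "\<lambda>x y. single (x, y) (1::'k)"
  have "?e (x \<oplus> x') y - ?e x y - ?e x' y \<in> tens_gens A" "?e x (y \<oplus> y') - ?e x y - ?e x y' \<in> tens_gens A"
    unfolding tens_gens_def Let_def using assms by blast+
  then have "?e (x \<oplus> x') y - (?e x y + ?e x' y) \<in> tens_rel A" "?e x (y \<oplus> y') - (?e x y + ?e x y') \<in> tens_rel A"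
    unfolding tens_rel_span by (auto intro: pm.span_base simp: diff_diff_eq)
  moreover have "?e x y \<in> carrier (pair_space A)" "?e x' y \<in> carrier (pair_space A)" "?e x y' \<in> carrier (pair_space A)"
    "?e (x \<oplus> x') y \<in> carrier (pair_space A)" "?e x (y \<oplus> y') \<in> carrier (pair_space A)"
    using assms by auto
  moreover have "?e x y + ?e x' y \<in> carrier (pair_space A)" "?e x y + ?e x y' \<in> carrier (pair_space A)"
    using calculation by (simp_all add: keys_add_subset)
  ultimately show "pure_tensor A (x \<oplus> x') y = pure_tensor A x y \<oplus>\<^sub>T pure_tensor A x' y"
    "pure_tensor A x (y \<oplus> y') = pure_tensor A x y \<oplus>\<^sub>T pure_tensor A x y'"
    unfolding pure_tensor_def by (simp_all only: tens_class_eq_iff flip: tens_class_add)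
qed

text \<open>Both actions on tensors are of the form f on the left and g on the right factor. Such a
  map carries each of the four families of generating relations into itself, hence also their
  span.\<close>

lemma push_tens_rel:
  assumes h: "\<And>x y. x \<in> carrier A ==> y \<in> carrier A ==> h (x, y) = (f x, g y)"
    and f: "f \<in> add_hom A A" "\<And>c x. x \<in> carrier A ==> f (c \<odot> x) = c \<odot> f x"
    and g: "g \<in> add_hom A A" "\<And>c x. x \<in> carrier A ==> g (c \<odot> x) = c \<odot> g x"
    and t: "t \<in> tens_rel A"
  shows "push_keys h t \<in> tens_rel A"
proof -
  have gens: "push_keys h t \<in> tens_gens A" if "t \<in> tens_gens A" for t
    using that unfolding tens_gens_def Let_def Un_iff mem_Collect_eq
  proof (elim disjE exE conjE, goal_cases)
    case (1 x x' y)
    then show ?case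
      by (intro disjI1 exI[of _ "f x"] exI[of _ "f x'"] exI[of _ "g y"])
        (auto simp: push_keys_diff h add_hom_add[OF f(1)] add_hom_closed[OF f(1)] add_hom_closed[OF g(1)])
  next
    case (2 x y y')
    then show ?case
      by (rule_tac disjI1, rule_tac disjI1, rule_tac disjI2)
        (intro exI[of _ "f x"] exI[of _ "g y"] exI[of _ "g y'"],
        auto simp: push_keys_diff h add_hom_add[OF g(1)] add_hom_closed[OF f(1)] add_hom_closed[OF g(1)])
  next
    case (3 c x y)
    then show ?case
      by (rule_tac disjI1, rule_tac disjI2) (intro exI[of _ c] exI[of _ "f x"] exI[of _ "g y"],
        auto simp: push_keys_diff h f smult_closed add_hom_closed[OF f(1)] add_hom_closed[OF g(1)])
  next
    case (4 c x y)
    then show ?case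
      by (rule_tac disjI2) (intro exI[of _ c] exI[of _ "f x"] exI[of _ "g y"],
        auto simp: push_keys_diff h g smult_closed add_hom_closed[OF f(1)] add_hom_closed[OF g(1)])
  qed
  show ?thesis using t unfolding tens_rel_span
  proof (induction rule: pm.span_induct_alt)
    case (step c x y)
    then show ?case unfolding push_keys_add push_keys_scale
      using pm.span_add[OF pm.span_scale[OF pm.span_base[OF gens]]] by blast
  qed (simp add: pm.span_zero)
qed

lemma push_tens_class:
  assumes h: "\<And>x y. x \<in> carrier A ==> y \<in> carrier A ==> h (x, y) = (f x, g y)"
    and f: "f \<in> add_hom A A" "\<And>c x. x \<in> carrier A ==> f (c \<odot> x) = c \<odot> f x"
    and g: "g \<in> add_hom A A" "\<And>c x. x \<in> carrier A ==> g (c \<odot> x) = c \<odot> g x"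
    and t: "t \<in> carrier (pair_space A)"
  shows "(\<Union>s\<in>tens_class A t. tens_class A (push_keys h s)) = tens_class A (push_keys h t)"
    and "push_keys h t \<in> carrier (pair_space A)"
proof -
  have cl: "push_keys h s \<in> carrier (pair_space A)" if "s \<in> carrier (pair_space A)" for s
    using that unfolding pair_space_simps mem_Collect_eq
    by (induction s rule: poly_mapping_add_induct)
      (simp, clarsimp simp: h add_hom_closed[OF f(1)] add_hom_closed[OF g(1)],
       simp add: push_keys_add keys_add_subset)
  then show "push_keys h t \<in> carrier (pair_space A)" using t .
  have "tens_class A (push_keys h s) = tens_class A (push_keys h t)" if "s \<in> tens_class A t" for s
  proof -
    have s: "s \<in> carrier (pair_space A)" "s - t \<in> tens_rel A"
      using that mem_tens_class_iff[OF t] tens_class_eq_iff t by blast+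
    then show ?thesis
      using tens_class_eq_iff[OF cl[OF s(1)] cl[OF t]] push_tens_rel[OF h f g s(2)]
      by (simp add: push_keys_diff)
  qed
  then show "(\<Union>s\<in>tens_class A t. tens_class A (push_keys h s)) = tens_class A (push_keys h t)"
    using tens_class_self[OF t] by blast
qed

end

lemma (in abelian_group) add_minus_cancel_both:
  assumes "x \<in> carrier G" "y \<in> carrier G"
  shows "x \<oplus> y \<ominus> x \<ominus> y = \<zero>"
proof -
  have "x \<oplus> y \<ominus> x \<ominus> y = (x \<oplus> y) \<oplus> \<ominus> (x \<oplus> y)"
    using assms by (simp add: minus_eq minus_add a_assoc)
  then show ?thesis using assms by (simp add: r_neg)
qed

context k_algebra
begin

lemma T_smult_class:
  assumes "a \<in> carrier A" "f \<in> carrier (pair_space A)"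
  shows "a \<odot>\<^sub>T tens_class A f = tens_class A (push_keys (\<lambda>(x, y). (a \<otimes> x, y)) f)"
    and "push_keys (\<lambda>(x, y). (a \<otimes> x, y)) f \<in> carrier (pair_space A)"
    and "tens_class A f \<odot>\<^sup>r\<^sub>T a = tens_class A (push_keys (\<lambda>(x, y). (x, y \<otimes> a)) f)"
    and "push_keys (\<lambda>(x, y). (x, y \<otimes> a)) f \<in> carrier (pair_space A)"
proof -
  have id: "(\<lambda>x. x) \<in> add_hom A A" by (auto simp: add_hom_def)
  have l: "(\<lambda>x. a \<otimes> x) \<in> add_hom A A" "(\<lambda>x. x \<otimes> a) \<in> add_hom A A"
    using assms(1) by (auto simp: add_hom_def r_distr l_distr)
  have "\<And>c x. x \<in> carrier A ==> a \<otimes> (c \<odot> x) = c \<odot> (a \<otimes> x)"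
    "\<And>c x. x \<in> carrier A ==> (c \<odot> x) \<otimes> a = c \<odot> (x \<otimes> a)"
    using assms(1) by (simp_all add: smult_mult_left smult_mult_right)
  note * = push_tens_class[OF _ l(1) this(1) id _ assms(2), of "\<lambda>(x, y). (a \<otimes> x, y)"]
    push_tens_class[OF _ id _ l(2) this(2) assms(2), of "\<lambda>(x, y). (x, y \<otimes> a)"]
  show "a \<odot>\<^sub>T tens_class A f = tens_class A (push_keys (\<lambda>(x, y). (a \<otimes> x, y)) f)"
    "push_keys (\<lambda>(x, y). (a \<otimes> x, y)) f \<in> carrier (pair_space A)"
    "tens_class A f \<odot>\<^sup>r\<^sub>T a = tens_class A (push_keys (\<lambda>(x, y). (x, y \<otimes> a)) f)"
    "push_keys (\<lambda>(x, y). (x, y \<otimes> a)) f \<in> carrier (pair_space A)"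
    using * unfolding tensor_bimod_def by simp_all
qed

lemma T_smult_pure:
  assumes "a \<in> carrier A" "x \<in> carrier A" "y \<in> carrier A"
  shows "a \<odot>\<^sub>T pure_tensor A x y = pure_tensor A (a \<otimes> x) y"
    and "pure_tensor A x y \<odot>\<^sup>r\<^sub>T a = pure_tensor A x (y \<otimes> a)"
  using assms T_smult_class[OF assms(1), of "single (x, y) 1"]
  unfolding pure_tensor_def by simp_all

lemma T_smult_add_hom:
  assumes a: "a \<in> carrier A"
  shows "(\<lambda>X. a \<odot>\<^sub>T X) \<in> add_hom T T" "(\<lambda>X. X \<odot>\<^sup>r\<^sub>T a) \<in> add_hom T T"
proof -
  have cl: "f + g \<in> carrier (pair_space A)" if "f \<in> carrier (pair_space A)" "g \<in> carrier (pair_space A)"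
    for f g using that by (simp add: keys_add_subset)
  note * = T_smult_class[OF a]
  show "(\<lambda>X. a \<odot>\<^sub>T X) \<in> add_hom T T"
  proof (rule add_homI)
    fix X assume "X \<in> carrier T"
    then show "a \<odot>\<^sub>T X \<in> carrier T" using * unfolding T_simps by blast
    fix Y assume "Y \<in> carrier T"
    then show "a \<odot>\<^sub>T (X \<oplus>\<^sub>T Y) = a \<odot>\<^sub>T X \<oplus>\<^sub>T a \<odot>\<^sub>T Y"
      using \<open>X \<in> carrier T\<close> cl * by (auto simp only: T_simps(1) tens_class_add[symmetric] push_keys_add)
  qed
  show "(\<lambda>X. X \<odot>\<^sup>r\<^sub>T a) \<in> add_hom T T"
  proof (rule add_homI)
    fix X assume "X \<in> carrier T"
    then show "X \<odot>\<^sup>r\<^sub>T a \<in> carrier T" using * unfolding T_simps by blast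
    fix Y assume "Y \<in> carrier T"
    then show "(X \<oplus>\<^sub>T Y) \<odot>\<^sup>r\<^sub>T a = X \<odot>\<^sup>r\<^sub>T a \<oplus>\<^sub>T Y \<odot>\<^sup>r\<^sub>T a"
      using \<open>X \<in> carrier T\<close> cl * by (auto simp only: T_simps(1) tens_class_add[symmetric] push_keys_add)
  qed
qed

lemma T_hom_eq:
  assumes "f \<in> add_hom T G" "g \<in> add_hom T G" "X \<in> carrier T"
    and "\<And>x y. x \<in> carrier A ==> y \<in> carrier A ==> f (pure_tensor A x y) = g (pure_tensor A x y)"
  shows "f X = g X"
  using assms(3) by (induction rule: T_induct) (simp_all add: assms(4) add_hom_add[OF assms(1)] add_hom_add[OF assms(2)])

lemma T_k_bimodule: "k_bimodule A T"
proof -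
  interpret T: abelian_group T by (rule T_abelian_group)
  note hl = T_smult_add_hom(1) and hr = T_smult_add_hom(2)
  have id: "(\<lambda>X. X) \<in> add_hom T T" by (auto simp: add_hom_def)
  show ?thesis
  proof (intro k_bimodule.intro k_algebra_axioms bimodule.intro ring_axioms T.abelian_group_axioms
        bimodule_axioms.intro)
    fix a X assume aX: "a \<in> carrier A" "X \<in> carrier T"
    show "a \<odot>\<^sub>T X \<in> carrier T" by (rule add_hom_closed[OF hl[OF aX(1)] aX(2)])
    show "X \<odot>\<^sup>r\<^sub>T a \<in> carrier T" by (rule add_hom_closed[OF hr[OF aX(1)] aX(2)])
    fix Y assume Y: "Y \<in> carrier T"
    show "a \<odot>\<^sub>T (X \<oplus>\<^sub>T Y) = a \<odot>\<^sub>T X \<oplus>\<^sub>T a \<odot>\<^sub>T Y"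
      by (rule add_hom_add[OF hl[OF aX(1)] aX(2) Y])
    show "(X \<oplus>\<^sub>T Y) \<odot>\<^sup>r\<^sub>T a = X \<odot>\<^sup>r\<^sub>T a \<oplus>\<^sub>T Y \<odot>\<^sup>r\<^sub>T a"
      by (rule add_hom_add[OF hr[OF aX(1)] aX(2) Y])
  next
    fix a b X assume ab: "a \<in> carrier A" "b \<in> carrier A" and X: "X \<in> carrier T"
    show "(a \<oplus> b) \<odot>\<^sub>T X = a \<odot>\<^sub>T X \<oplus>\<^sub>T b \<odot>\<^sub>T X"
      by (rule T_hom_eq[OF hl add_hom_plus[OF T_abelian_group hl hl] X])
        (use ab in \<open>simp_all add: T_smult_pure l_distr pure_tensor_add\<close>)
    show "X \<odot>\<^sup>r\<^sub>T (a \<oplus> b) = X \<odot>\<^sup>r\<^sub>T a \<oplus>\<^sub>T X \<odot>\<^sup>r\<^sub>T b"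
      by (rule T_hom_eq[OF hr add_hom_plus[OF T_abelian_group hr hr] X])
        (use ab in \<open>simp_all add: T_smult_pure r_distr pure_tensor_add\<close>)
    show "a \<otimes> b \<odot>\<^sub>T X = a \<odot>\<^sub>T (b \<odot>\<^sub>T X)"
      by (rule T_hom_eq[OF hl add_hom_comp[OF hl hl] X]) (use ab in \<open>simp_all add: T_smult_pure m_assoc\<close>)
    show "X \<odot>\<^sup>r\<^sub>T (a \<otimes> b) = X \<odot>\<^sup>r\<^sub>T a \<odot>\<^sup>r\<^sub>T b"
      by (rule T_hom_eq[OF hr add_hom_comp[OF hr hr] X]) (use ab in \<open>simp_all add: T_smult_pure m_assoc\<close>)
    show "a \<odot>\<^sub>T X \<odot>\<^sup>r\<^sub>T b = a \<odot>\<^sub>T (X \<odot>\<^sup>r\<^sub>T b)"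
      by (rule T_hom_eq[OF add_hom_comp[OF hl hr] add_hom_comp[OF hr hl] X])
        (use ab in \<open>simp_all add: T_smult_pure\<close>)
  next
    fix X c assume X: "X \<in> carrier T"
    show "\<one> \<odot>\<^sub>T X = X" by (rule T_hom_eq[OF hl id X]) (simp_all add: T_smult_pure)
    show "X \<odot>\<^sup>r\<^sub>T \<one> = X" by (rule T_hom_eq[OF hr id X]) (simp_all add: T_smult_pure)
    show "c \<odot> \<one> \<odot>\<^sub>T X = X \<odot>\<^sup>r\<^sub>T (c \<odot> \<one>)"
    proof (rule T_hom_eq[OF hl hr X])
      fix x y assume xy: "x \<in> carrier A" "y \<in> carrier A"
      then show "c \<odot> \<one> \<odot>\<^sub>T pure_tensor A x y = pure_tensor A x y \<odot>\<^sup>r\<^sub>T (c \<odot> \<one>)"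
        using tens_class_single[OF xy, of c]
        by (simp add: T_smult_pure smult_left[symmetric] smult_right[symmetric])
    qed auto
  qed
qed

subsection \<open>The universal property\<close>

definition tens_lift where
  "tens_lift M \<beta> X = lincomb A M (\<lambda>(x, y). \<beta> x y) (SOME f. f \<in> X)"

text \<open>The lift is computed from an arbitrary representative. The choice does not matter, since
  a balanced map kills the four families of generating relations and with them their span.\<close>

lemma tens_lift_class:
  assumes M: "k_bimodule A M" and \<beta>: "balanced A M \<beta>" and f: "f \<in> carrier (pair_space A)"
  shows "tens_lift M \<beta> (tens_class A f) = lincomb A M (\<lambda>(x, y). \<beta> x y) f"
proof -
  interpret M: k_bimodule A M by fact
  let ?\<beta> = "\<lambda>(x, y). \<beta> x y" and ?K = "carrier A \<times> carrier A"
  have cl: "?\<beta> p \<in> carrier M" if "p \<in> ?K" for p using that balancedD(1)[OF \<beta>] by auto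
  note add = M.lincomb_add[of ?K ?\<beta>, OF cl] and lcl = M.lincomb_closed[of ?K ?\<beta>, OF cl]
    and single = M.lincomb_single[of ?K ?\<beta>, OF cl] and scale = M.lincomb_scale[of ?K ?\<beta>, OF cl]
    and um = M.lincomb_uminus[of ?K ?\<beta>, OF cl]
  have diff: "lincomb A M ?\<beta> (g - h) = lincomb A M ?\<beta> g \<ominus>\<^sub>M lincomb A M ?\<beta> h"
    if "keys g \<subseteq> ?K" "keys h \<subseteq> ?K" for g h
    using add[of g "- h"] um[of h] that by (simp add: keys_uminus_subset a_minus_def)
  have gens: "lincomb A M ?\<beta> t = \<zero>\<^sub>M" if "t \<in> tens_gens A" for t
    using that unfolding tens_gens_def Let_def Un_iff mem_Collect_eq
    by (elim disjE exE conjE)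
      (simp_all add: diff single keys_diff_subset smult_closed balancedD[OF \<beta>]
        M.M.add_minus_cancel_both M.M.r_neg[folded M.M.minus_eq])
  have rel: "lincomb A M ?\<beta> t = \<zero>\<^sub>M" if "t \<in> tens_rel A" for t
  proof -
    have "lincomb A M ?\<beta> t = \<zero>\<^sub>M \<and> t \<in> carrier (pair_space A)"
      using that unfolding tens_rel_span
    proof (induction rule: pm.span_induct_alt)
      case (step c x y)
      then show ?case using tens_gens_carrier[OF step(1)] gens[OF step(1)]
        by (simp add: add scale keys_scale_subset keys_add_subset)
    qed simp
    then show ?thesis by simp
  qed
  have "(SOME g. g \<in> tens_class A f) \<in> tens_class A f" using tens_class_self[OF f] by (rule someI)
  then have s: "(SOME g. g \<in> tens_class A f) \<in> carrier (pair_space A)"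
    "(SOME g. g \<in> tens_class A f) - f \<in> tens_rel A"
    using mem_tens_class_iff[OF f] tens_class_eq_iff f by blast+
  have "lincomb A M ?\<beta> ((SOME g. g \<in> tens_class A f) - f + f) = lincomb A M ?\<beta> f"
    using rel[OF s(2)] tens_rel_carrier[OF s(2)] f lcl by (subst add) auto
  then show ?thesis unfolding tens_lift_def by simp
qed

lemma tens_lift_add_hom:
  assumes M: "k_bimodule A M" and \<beta>: "balanced A M \<beta>"
  shows "tens_lift M \<beta> \<in> add_hom T M"
proof -
  interpret M: k_bimodule A M by fact
  let ?\<beta> = "\<lambda>(x, y). \<beta> x y" and ?K = "carrier A \<times> carrier A"
  have cl: "?\<beta> p \<in> carrier M" if "p \<in> ?K" for p using that balancedD(1)[OF \<beta>] by auto
  note add = M.lincomb_add[of ?K ?\<beta>, OF cl] and lcl = M.lincomb_closed[of ?K ?\<beta>, OF cl]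
  show ?thesis
  proof (rule add_homI)
    fix X assume "X \<in> carrier T"
    then obtain f where f: "f \<in> carrier (pair_space A)" "X = tens_class A f" by (auto simp: T_simps)
    show "tens_lift M \<beta> X \<in> carrier M" using f lcl by (simp add: tens_lift_class[OF M \<beta>])
    fix Y assume "Y \<in> carrier T"
    then obtain g where g: "g \<in> carrier (pair_space A)" "Y = tens_class A g" by (auto simp: T_simps)
    have fg: "f + g \<in> carrier (pair_space A)" using f g by (simp add: keys_add_subset)
    show "tens_lift M \<beta> (X \<oplus>\<^sub>T Y) = tens_lift M \<beta> X \<oplus>\<^sub>M tens_lift M \<beta> Y"
      using f g tens_class_add[OF f(1) g(1)] tens_lift_class[OF M \<beta> fg]
        tens_lift_class[OF M \<beta> f(1)] tens_lift_class[OF M \<beta> g(1)] add[of f g] by simp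
  qed
qed

lemma tens_lift_pure:
  assumes M: "k_bimodule A M" and \<beta>: "balanced A M \<beta>" and "x \<in> carrier A" "y \<in> carrier A"
  shows "tens_lift M \<beta> (pure_tensor A x y) = \<beta> x y"
proof -
  interpret M: k_bimodule A M by fact
  have "tens_lift M \<beta> (pure_tensor A x y) = lincomb A M (\<lambda>(x, y). \<beta> x y) (single (x, y) 1)"
    unfolding pure_tensor_def using assms(3,4) by (intro tens_lift_class[OF M \<beta>]) auto
  then show ?thesis
    using M.lincomb_single[of "{(x, y)}" "\<lambda>(x, y). \<beta> x y"] balancedD(1)[OF \<beta> assms(3,4)] by simp
qed

section \<open>Free bimodules\<close>

lemma free_bimod_simps:
  "carrier (free_bimod A I) = {u. (\<forall>i\<in>I. u i \<in> carrier T) \<and> (\<forall>i. i \<notin> I \<longrightarrow> u i = \<zero>\<^sub>T) \<and>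
      finite {i. u i \<noteq> \<zero>\<^sub>T}}"
  "\<zero>\<^sub>(free_bimod A I) = (\<lambda>i. \<zero>\<^sub>T)"
  "u \<oplus>\<^sub>(free_bimod A I) v = (\<lambda>i. u i \<oplus>\<^sub>T v i)"
  "a \<odot>\<^sub>(free_bimod A I) u = (\<lambda>i. a \<odot>\<^sub>T u i)"
  "u \<odot>\<^sup>r\<^sub>(free_bimod A I) a = (\<lambda>i. u i \<odot>\<^sup>r\<^sub>T a)"
  unfolding free_bimod_def Let_def by simp_all

lemma free_bimod_component:
  assumes "u \<in> carrier (free_bimod A I)"
  shows "u i \<in> carrier T"
proof -
  interpret T: abelian_group T by (rule T_abelian_group)
  show ?thesis using assms by (cases "i \<in> I") (auto simp: free_bimod_simps)
qed

lemma free_k_bimodule: "k_bimodule A (free_bimod A I)"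
proof -
  interpret T: k_bimodule A T by (rule T_k_bimodule)
  note comp = free_bimod_component
  have fin: "finite {i. u i \<oplus>\<^sub>T v i \<noteq> \<zero>\<^sub>T}"
    if "finite {i. u i \<noteq> \<zero>\<^sub>T}" "finite {i. v i \<noteq> \<zero>\<^sub>T}" for u v :: "'i => ('k, 'a) tens"
    by (rule finite_subset[OF _ finite_UnI[OF that]]) auto
  have fin1: "finite {i. h (u i) \<noteq> \<zero>\<^sub>T}"
    if "finite {i. u i \<noteq> \<zero>\<^sub>T}" "h \<zero>\<^sub>T = \<zero>\<^sub>T" for h and u :: "'i => ('k, 'a) tens"
    by (rule finite_subset[OF _ that(1)]) (use that(2) in auto)
  have "abelian_group (free_bimod A I)"
  proof (rule abelian_groupI)
    fix u assume u: "u \<in> carrier (free_bimod A I)"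
    let ?v = "\<lambda>i. \<ominus>\<^sub>T u i"
    have "?v \<in> carrier (free_bimod A I)" "?v \<oplus>\<^sub>(free_bimod A I) u = \<zero>\<^sub>(free_bimod A I)"
      using u comp[OF u] by (auto simp: free_bimod_simps T.M.l_neg intro!: fin1[of u])
    then show "\<exists>v\<in>carrier (free_bimod A I). v \<oplus>\<^sub>(free_bimod A I) u = \<zero>\<^sub>(free_bimod A I)" by blast
  next
    fix u v w assume uvw: "u \<in> carrier (free_bimod A I)" "v \<in> carrier (free_bimod A I)"
      "w \<in> carrier (free_bimod A I)"
    show "u \<oplus>\<^sub>(free_bimod A I) v \<oplus>\<^sub>(free_bimod A I) w = u \<oplus>\<^sub>(free_bimod A I) (v \<oplus>\<^sub>(free_bimod A I) w)"
      unfolding free_bimod_simps using comp[OF uvw(1)] comp[OF uvw(2)] comp[OF uvw(3)]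
      by (simp add: T.M.a_assoc)
  next
    fix u v assume uv: "u \<in> carrier (free_bimod A I)" "v \<in> carrier (free_bimod A I)"
    show "u \<oplus>\<^sub>(free_bimod A I) v \<in> carrier (free_bimod A I)"
      using uv fin by (auto simp: free_bimod_simps)
    show "u \<oplus>\<^sub>(free_bimod A I) v = v \<oplus>\<^sub>(free_bimod A I) u"
      unfolding free_bimod_simps using comp[OF uv(1)] comp[OF uv(2)] by (simp add: T.M.a_comm)
    show "\<zero>\<^sub>(free_bimod A I) \<oplus>\<^sub>(free_bimod A I) u = u"
      unfolding free_bimod_simps using comp[OF uv(1)] by simp
  qed (auto simp: free_bimod_simps)
  then interpret F: abelian_group "free_bimod A I" .
  show ?thesis
  proof (intro k_bimodule.intro k_algebra_axioms bimodule.intro ring_axioms F.abelian_group_axioms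
        bimodule_axioms.intro)
    fix a u assume au: "a \<in> carrier A" "u \<in> carrier (free_bimod A I)"
    show "a \<odot>\<^sub>(free_bimod A I) u \<in> carrier (free_bimod A I)"
      "u \<odot>\<^sup>r\<^sub>(free_bimod A I) a \<in> carrier (free_bimod A I)"
      using au T.l_zero_vec[OF au(1)] T.r_zero_vec[OF au(1)]
        fin1[of u "\<lambda>X. a \<odot>\<^sub>T X"] fin1[of u "\<lambda>X. X \<odot>\<^sup>r\<^sub>T a"]
      by (auto simp: free_bimod_simps T.l_closed T.r_closed)
    fix v assume v: "v \<in> carrier (free_bimod A I)"
    show "a \<odot>\<^sub>(free_bimod A I) (u \<oplus>\<^sub>(free_bimod A I) v)
        = a \<odot>\<^sub>(free_bimod A I) u \<oplus>\<^sub>(free_bimod A I) a \<odot>\<^sub>(free_bimod A I) v"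
      "(u \<oplus>\<^sub>(free_bimod A I) v) \<odot>\<^sup>r\<^sub>(free_bimod A I) a
        = u \<odot>\<^sup>r\<^sub>(free_bimod A I) a \<oplus>\<^sub>(free_bimod A I) v \<odot>\<^sup>r\<^sub>(free_bimod A I) a"
      unfolding free_bimod_simps using comp[OF au(2)] comp[OF v] au(1)
      by (simp_all add: T.l_distr_vector T.r_distr_vector)
  next
    fix a b u assume ab: "a \<in> carrier A" "b \<in> carrier A" and u: "u \<in> carrier (free_bimod A I)"
    show "(a \<oplus> b) \<odot>\<^sub>(free_bimod A I) u = a \<odot>\<^sub>(free_bimod A I) u \<oplus>\<^sub>(free_bimod A I) b \<odot>\<^sub>(free_bimod A I) u"
      "u \<odot>\<^sup>r\<^sub>(free_bimod A I) (a \<oplus> b) = u \<odot>\<^sup>r\<^sub>(free_bimod A I) a \<oplus>\<^sub>(free_bimod A I) u \<odot>\<^sup>r\<^sub>(free_bimod A I) b"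
      "a \<otimes> b \<odot>\<^sub>(free_bimod A I) u = a \<odot>\<^sub>(free_bimod A I) (b \<odot>\<^sub>(free_bimod A I) u)"
      "u \<odot>\<^sup>r\<^sub>(free_bimod A I) (a \<otimes> b) = u \<odot>\<^sup>r\<^sub>(free_bimod A I) a \<odot>\<^sup>r\<^sub>(free_bimod A I) b"
      "a \<odot>\<^sub>(free_bimod A I) u \<odot>\<^sup>r\<^sub>(free_bimod A I) b = a \<odot>\<^sub>(free_bimod A I) (u \<odot>\<^sup>r\<^sub>(free_bimod A I) b)"
      unfolding free_bimod_simps using comp[OF u] ab
      by (simp_all add: T.l_distr_scalar T.r_distr_scalar T.l_assoc T.r_assoc T.lr_assoc)
  next
    fix u c assume u: "u \<in> carrier (free_bimod A I)"
    show "\<one> \<odot>\<^sub>(free_bimod A I) u = u" "u \<odot>\<^sup>r\<^sub>(free_bimod A I) \<one> = u"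
      "c \<odot> \<one> \<odot>\<^sub>(free_bimod A I) u = u \<odot>\<^sup>r\<^sub>(free_bimod A I) (c \<odot> \<one>)"
      unfolding free_bimod_simps using comp[OF u] by (simp_all add: T.l_unit T.r_unit T.central)
  qed
qed

lemma summand_tensor_closed [simp, intro]:
  assumes "x \<in> carrier A" "y \<in> carrier A"
  shows "summand_tensor A I i x y \<in> carrier (free_bimod A I)"
proof -
  interpret T: abelian_group T by (rule T_abelian_group)
  have "finite {j. summand_tensor A I i x y j \<noteq> \<zero>\<^sub>T}"
    by (rule finite_subset[of _ "{i}"]) (auto simp: summand_tensor_def)
  then show ?thesis using assms by (auto simp: free_bimod_simps summand_tensor_def)
qed

lemma summand_tensor_outside: "i \<notin> I ==> summand_tensor A I i x y = \<zero>\<^sub>(free_bimod A I)"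
  by (simp add: summand_tensor_def free_bimod_simps)

lemma summand_tensor_smult:
  assumes "a \<in> carrier A" "x \<in> carrier A" "y \<in> carrier A"
  shows "a \<odot>\<^sub>(free_bimod A I) summand_tensor A I i x y = summand_tensor A I i (a \<otimes> x) y"
    and "summand_tensor A I i x y \<odot>\<^sup>r\<^sub>(free_bimod A I) a = summand_tensor A I i x (y \<otimes> a)"
proof -
  interpret T: k_bimodule A T by (rule T_k_bimodule)
  show "a \<odot>\<^sub>(free_bimod A I) summand_tensor A I i x y = summand_tensor A I i (a \<otimes> x) y"
    "summand_tensor A I i x y \<odot>\<^sup>r\<^sub>(free_bimod A I) a = summand_tensor A I i x (y \<otimes> a)"
    using assms T_smult_pure[OF assms] T.l_zero_vec T.r_zero_vec
    unfolding free_bimod_simps by (auto simp: summand_tensor_def fun_eq_iff)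
qed

lemma summand_tensor_balanced: "balanced A (free_bimod A I) (summand_tensor A I i)"
proof -
  interpret T: k_bimodule A T by (rule T_k_bimodule)
  interpret F: k_bimodule A "free_bimod A I" by (rule free_k_bimodule)
  have 1: "summand_tensor A I i (c \<odot> x) y = F.sc c (summand_tensor A I i x y)"
    if "x \<in> carrier A" "y \<in> carrier A" for c x y
    using that by (simp add: scal_def smult_left[symmetric] summand_tensor_smult)
  have 2: "summand_tensor A I i x (c \<odot> y) = F.sc c (summand_tensor A I i x y)"
    if "x \<in> carrier A" "y \<in> carrier A" for c x y
    using that F.central[of "summand_tensor A I i x y" c]
    by (simp add: scal_def smult_right[symmetric] summand_tensor_smult(2))
  show ?thesis
    by (rule balancedI; (intro summand_tensor_closed 1 2)?)
      (auto simp: summand_tensor_def pure_tensor_add free_bimod_simps(3) fun_eq_iff)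
qed

text \<open>An element is the sum of its finitely many non-zero coordinates, and each of these is a
  sum of pure tensors.\<close>

lemma free_induct [consumes 1, case_names zero tensor add]:
  assumes u: "u \<in> carrier (free_bimod A I)"
    and zero: "P \<zero>\<^sub>(free_bimod A I)"
    and tensor: "\<And>i x y. i \<in> I ==> x \<in> carrier A ==> y \<in> carrier A ==> P (summand_tensor A I i x y)"
    and add: "\<And>u v. u \<in> carrier (free_bimod A I) ==> v \<in> carrier (free_bimod A I) ==> P u ==> P v
      ==> P (u \<oplus>\<^sub>(free_bimod A I) v)"
  shows "P u"
proof -
  interpret T: k_bimodule A T by (rule T_k_bimodule)
  define cut where "cut S = (\<lambda>i. if i \<in> S then u i else \<zero>\<^sub>T)" for S
  have one: "P (\<lambda>j. if j = i then X else \<zero>\<^sub>T) \<and> (\<lambda>j. if j = i then X else \<zero>\<^sub>T) \<in> carrier (free_bimod A I)"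
    if "X \<in> carrier T" "i \<in> I" for X i
    using that(1)
  proof (induction rule: T_induct)
    case (pure x y)
    have "(\<lambda>j. if j = i then pure_tensor A x y else \<zero>\<^sub>T) = summand_tensor A I i x y"
      using that by (auto simp: summand_tensor_def)
    then show ?case using tensor[OF that(2)] pure summand_tensor_closed by metis
  next
    case (add X Y)
    let ?f = "\<lambda>X j. if j = i then X else \<zero>\<^sub>T"
    have e: "?f (X \<oplus>\<^sub>T Y) = ?f X \<oplus>\<^sub>(free_bimod A I) ?f Y"
      by (auto simp: free_bimod_simps(3) fun_eq_iff)
    interpret F: k_bimodule A "free_bimod A I" by (rule free_k_bimodule)
    show ?case unfolding e using assms(4)[of "?f X" "?f Y"] add F.M.a_closed by blast
  qed
  have "P (cut S) \<and> cut S \<in> carrier (free_bimod A I)" if "finite S" "S \<subseteq> I" for S using that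
  proof (induction S)
    case empty
    interpret F: k_bimodule A "free_bimod A I" by (rule free_k_bimodule)
    have "cut {} = \<zero>\<^sub>(free_bimod A I)" by (simp add: cut_def free_bimod_simps)
    then show ?case using zero by simp
  next
    case (insert i S)
    let ?f = "\<lambda>j. if j = i then u i else \<zero>\<^sub>T"
    have e: "cut (insert i S) = ?f \<oplus>\<^sub>(free_bimod A I) cut S"
      using insert free_bimod_component[OF u] by (auto simp: free_bimod_simps(3) cut_def fun_eq_iff)
    interpret F: k_bimodule A "free_bimod A I" by (rule free_k_bimodule)
    show ?case unfolding e using add[of ?f "cut S"] insert one[of "u i" i] free_bimod_component[OF u]
      F.M.a_closed by blast
  qed
  moreover have "cut {i\<in>I. u i \<noteq> \<zero>\<^sub>T} = u" using u by (auto simp: cut_def free_bimod_simps fun_eq_iff)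
  moreover have "finite {i\<in>I. u i \<noteq> \<zero>\<^sub>T}"
    using u by (auto simp: free_bimod_simps intro: finite_subset[rotated])
  ultimately show ?thesis by (metis (no_types, lifting) mem_Collect_eq subsetI)
qed

definition free_lift where
  "free_lift I M \<beta> u = (\<Oplus>\<^sub>M i\<in>{i\<in>I. u i \<noteq> \<zero>\<^sub>T}. tens_lift M (\<beta> i) (u i))"

context
  fixes I :: "'i set" and M :: "('a, 'm) bimodule" and \<beta> :: "'i => 'a => 'a => 'm"
  assumes M: "k_bimodule A M" and \<beta>: "\<And>i. i \<in> I ==> balanced A M (\<beta> i)"
begin

lemma free_lift_superset:
  assumes "u \<in> carrier (free_bimod A I)" "finite S" "{i\<in>I. u i \<noteq> \<zero>\<^sub>T} \<subseteq> S" "S \<subseteq> I"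
  shows "free_lift I M \<beta> u = (\<Oplus>\<^sub>M i\<in>S. tens_lift M (\<beta> i) (u i))"
proof -
  interpret M: k_bimodule A M by (rule M)
  show ?thesis unfolding free_lift_def
    by (rule M.M.add.finprod_mono_neutral_cong_left)
      (use assms add_hom_closed[OF tens_lift_add_hom[OF M \<beta>]]
        add_hom_zero[OF T_abelian_group M.M.abelian_group_axioms tens_lift_add_hom[OF M \<beta>]]
        free_bimod_component[OF assms(1)] in \<open>auto 0 4\<close>)
qed

lemma free_lift_add_hom: "free_lift I M \<beta> \<in> add_hom (free_bimod A I) M"
proof (rule add_homI)
  interpret M: k_bimodule A M by (rule M)
  interpret F: k_bimodule A "free_bimod A I" by (rule free_k_bimodule)
  fix u assume u: "u \<in> carrier (free_bimod A I)"
  show "free_lift I M \<beta> u \<in> carrier M"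
    unfolding free_lift_def
    using add_hom_closed[OF tens_lift_add_hom[OF M \<beta>] free_bimod_component[OF u]]
    by (intro M.M.finsum_closed) auto
  fix v assume v: "v \<in> carrier (free_bimod A I)"
  let ?S = "{i\<in>I. u i \<noteq> \<zero>\<^sub>T} \<union> {i\<in>I. v i \<noteq> \<zero>\<^sub>T}"
  have S: "finite ?S" "?S \<subseteq> I"
    using u v by (auto simp: free_bimod_simps intro: finite_subset[rotated])
  interpret T: k_bimodule A T by (rule T_k_bimodule)
  have uv: "u \<oplus>\<^sub>(free_bimod A I) v \<in> carrier (free_bimod A I)" using u v by simp
  have "{i\<in>I. (u \<oplus>\<^sub>(free_bimod A I) v) i \<noteq> \<zero>\<^sub>T} \<subseteq> ?S"
    by (auto simp: free_bimod_simps)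
  from free_lift_superset[OF uv S(1) this S(2)]
  have "free_lift I M \<beta> (u \<oplus>\<^sub>(free_bimod A I) v) =
      (\<Oplus>\<^sub>M i\<in>?S. tens_lift M (\<beta> i) ((u \<oplus>\<^sub>(free_bimod A I) v) i))" .
  also have "\<dots> = (\<Oplus>\<^sub>M i\<in>?S. tens_lift M (\<beta> i) (u i) \<oplus>\<^sub>M tens_lift M (\<beta> i) (v i))"
    by (rule M.M.finsum_cong')
      (use S(2) free_bimod_component[OF u] free_bimod_component[OF v]
        add_hom_closed[OF tens_lift_add_hom[OF M \<beta>]] add_hom_add[OF tens_lift_add_hom[OF M \<beta>]]
       in \<open>auto simp: free_bimod_simps(3)\<close>)
  also have "\<dots> = (\<Oplus>\<^sub>M i\<in>?S. tens_lift M (\<beta> i) (u i)) \<oplus>\<^sub>M (\<Oplus>\<^sub>M i\<in>?S. tens_lift M (\<beta> i) (v i))"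
    by (rule M.M.finsum_addf)
      (use S(2) free_bimod_component[OF u] free_bimod_component[OF v]
        add_hom_closed[OF tens_lift_add_hom[OF M \<beta>]] in auto)
  finally show "free_lift I M \<beta> (u \<oplus>\<^sub>(free_bimod A I) v) = free_lift I M \<beta> u \<oplus>\<^sub>M free_lift I M \<beta> v"
    using free_lift_superset[OF u S(1) _ S(2)] free_lift_superset[OF v S(1) _ S(2)] by simp
qed

lemma free_lift_tensor:
  assumes "i \<in> I" "x \<in> carrier A" "y \<in> carrier A"
  shows "free_lift I M \<beta> (summand_tensor A I i x y) = \<beta> i x y"
proof -
  interpret M: k_bimodule A M by (rule M)
  have "free_lift I M \<beta> (summand_tensor A I i x y)
      = (\<Oplus>\<^sub>M j\<in>{i}. tens_lift M (\<beta> j) (summand_tensor A I i x y j))"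
    using assms by (intro free_lift_superset summand_tensor_closed) (auto simp: summand_tensor_def)
  also have "\<dots> = tens_lift M (\<beta> i) (pure_tensor A x y)"
    using assms add_hom_closed[OF tens_lift_add_hom[OF M \<beta>[OF assms(1)]]]
    by (subst M.M.finsum_insert) (auto simp: summand_tensor_def)
  finally show ?thesis using assms by (simp add: tens_lift_pure[OF M \<beta>])
qed

end

lemma free_hom_eq:
  assumes "abelian_group G" "f \<in> add_hom (free_bimod A I) G" "g \<in> add_hom (free_bimod A I) G"
    "u \<in> carrier (free_bimod A I)"
    and "\<And>i x y. i \<in> I ==> x \<in> carrier A ==> y \<in> carrier A ==>
      f (summand_tensor A I i x y) = g (summand_tensor A I i x y)"
  shows "f u = g u"
proof -
  interpret F: k_bimodule A "free_bimod A I" by (rule free_k_bimodule)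
  show ?thesis using assms(4)
    by (induction rule: free_induct)
      (simp_all add: assms(5) add_hom_add[OF assms(2)] add_hom_add[OF assms(3)]
        add_hom_zero[OF F.M.abelian_group_axioms assms(1)] assms(2,3))
qed

end

section \<open>Homomorphisms of bimodules\<close>

lemma bimod_homI:
  assumes "\<And>x. x \<in> carrier M ==> h x \<in> carrier N" "h \<in> extensional (carrier M)"
    and "\<And>x y. x \<in> carrier M ==> y \<in> carrier M ==> h (x \<oplus>\<^sub>M y) = h x \<oplus>\<^sub>N h y"
    and "\<And>a x. a \<in> carrier A ==> x \<in> carrier M ==> h (a \<odot>\<^sub>M x) = a \<odot>\<^sub>N h x"
    and "\<And>a x. a \<in> carrier A ==> x \<in> carrier M ==> h (x \<odot>\<^sup>r\<^sub>M a) = h x \<odot>\<^sup>r\<^sub>N a"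
  shows "h \<in> bimod_hom A M N"
  using assms unfolding bimod_hom_def by (auto simp: PiE_iff)

lemma bimod_homD:
  assumes "h \<in> bimod_hom A M N"
  shows "\<And>x. x \<in> carrier M ==> h x \<in> carrier N" "h \<in> extensional (carrier M)"
    and "\<And>x y. x \<in> carrier M ==> y \<in> carrier M ==> h (x \<oplus>\<^sub>M y) = h x \<oplus>\<^sub>N h y"
    and "\<And>a x. a \<in> carrier A ==> x \<in> carrier M ==> h (a \<odot>\<^sub>M x) = a \<odot>\<^sub>N h x"
    and "\<And>a x. a \<in> carrier A ==> x \<in> carrier M ==> h (x \<odot>\<^sup>r\<^sub>M a) = h x \<odot>\<^sup>r\<^sub>N a"
  using assms unfolding bimod_hom_def by (auto simp: PiE_iff)

lemma bimod_hom_add_hom: "h \<in> bimod_hom A M N ==> h \<in> add_hom M N"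
  unfolding bimod_hom_def add_hom_def by (auto simp: PiE_iff)

lemma bimod_hom_eqI:
  assumes "f \<in> bimod_hom A M N" "g \<in> bimod_hom A M N" "\<And>x. x \<in> carrier M ==> f x = g x"
  shows "f = g"
  using bimod_homD(2)[OF assms(1)] bimod_homD(2)[OF assms(2)] assms(3) by (rule extensionalityI)

lemma bimod_hom_compose:
  assumes M: "k_bimodule A M" and f: "f \<in> bimod_hom A M N" and g: "g \<in> bimod_hom A N L"
  shows "compose (carrier M) g f \<in> bimod_hom A M L"
proof -
  interpret M: k_bimodule A M by fact
  show ?thesis
    by (rule bimod_homI)
      (simp_all add: compose_eq bimod_homD[OF f] bimod_homD[OF g] M.l_closed M.r_closed)
qed

lemma bimod_hom_restrict:
  assumes M: "k_bimodule A M"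
    and "\<And>x. x \<in> carrier M ==> h x \<in> carrier N"
    and "\<And>x y. x \<in> carrier M ==> y \<in> carrier M ==> h (x \<oplus>\<^sub>M y) = h x \<oplus>\<^sub>N h y"
    and "\<And>a x. a \<in> carrier A ==> x \<in> carrier M ==> h (a \<odot>\<^sub>M x) = a \<odot>\<^sub>N h x"
    and "\<And>a x. a \<in> carrier A ==> x \<in> carrier M ==> h (x \<odot>\<^sup>r\<^sub>M a) = h x \<odot>\<^sup>r\<^sub>N a"
  shows "restrict h (carrier M) \<in> bimod_hom A M N"
proof -
  interpret M: k_bimodule A M by fact
  show ?thesis by (rule bimod_homI) (simp_all add: assms(2-5) M.l_closed M.r_closed)
qed

lemma hom_group_simps [simp]:
  "carrier (hom_group A M N) = bimod_hom A M N"
  "\<zero>\<^sub>(hom_group A M N) = (\<lambda>x\<in>carrier M. \<zero>\<^sub>N)"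
  "f \<oplus>\<^sub>(hom_group A M N) g = (\<lambda>x\<in>carrier M. f x \<oplus>\<^sub>N g x)"
  unfolding hom_group_def by simp_all

lemma bimod_hom_zero:
  assumes "k_bimodule A M" "k_bimodule A N"
  shows "(\<lambda>x\<in>carrier M. \<zero>\<^sub>N) \<in> bimod_hom A M N"
proof -
  interpret N: k_bimodule A N by fact
  show ?thesis
    by (rule bimod_hom_restrict[OF assms(1)]) (simp_all add: N.l_zero_vec N.r_zero_vec)
qed

lemma bimod_hom_plus:
  assumes "k_bimodule A M" "k_bimodule A N" and f: "f \<in> bimod_hom A M N" and g: "g \<in> bimod_hom A M N"
  shows "(\<lambda>x\<in>carrier M. f x \<oplus>\<^sub>N g x) \<in> bimod_hom A M N"
proof -
  interpret N: k_bimodule A N by fact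
  show ?thesis
    by (rule bimod_hom_restrict[OF assms(1)])
      (simp_all add: bimod_homD[OF f] bimod_homD[OF g] N.l_distr_vector N.r_distr_vector N.M.a_ac)
qed

lemma bimod_hom_scale:
  assumes "k_bimodule A M" "k_bimodule A N" and f: "f \<in> bimod_hom A M N"
  shows "(\<lambda>x\<in>carrier M. scal A N c (f x)) \<in> bimod_hom A M N"
proof -
  interpret N: k_bimodule A N by fact
  show ?thesis
    by (rule bimod_hom_restrict[OF assms(1)])
      (simp_all add: bimod_homD[OF f] N.sc_distr N.sc_left N.sc_right)
qed

lemma bimod_hom_uminus:
  assumes M: "k_bimodule A M" and N: "k_bimodule A N" and f: "f \<in> bimod_hom A M N"
  shows "(\<lambda>x\<in>carrier M. \<ominus>\<^sub>N f x) \<in> bimod_hom A M N"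
proof -
  interpret N: k_bimodule A N by fact
  have "(\<lambda>x\<in>carrier M. \<ominus>\<^sub>N f x) = (\<lambda>x\<in>carrier M. scal A N (-1) (f x))"
    by (intro restrict_ext) (simp add: N.sc_minus_one bimod_homD[OF f])
  then show ?thesis using bimod_hom_scale[OF M N f] by simp
qed

lemma hom_group_abelian_group:
  assumes M: "k_bimodule A M" and N: "k_bimodule A N"
  shows "abelian_group (hom_group A M N)"
proof (rule abelian_groupI)
  interpret N: k_bimodule A N by fact
  fix f assume f: "f \<in> carrier (hom_group A M N)"
  then have f': "f \<in> bimod_hom A M N" by simp
  have "(\<lambda>x\<in>carrier M. \<ominus>\<^sub>N f x) \<oplus>\<^sub>(hom_group A M N) f = \<zero>\<^sub>(hom_group A M N)"
    by (auto simp: N.M.l_neg bimod_homD[OF f'] fun_eq_iff)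
  then show "\<exists>g\<in>carrier (hom_group A M N). g \<oplus>\<^sub>(hom_group A M N) f = \<zero>\<^sub>(hom_group A M N)"
    using bimod_hom_uminus[OF M N f'] by (metis hom_group_simps(1))
  show "\<zero>\<^sub>(hom_group A M N) \<oplus>\<^sub>(hom_group A M N) f = f"
    unfolding hom_group_simps
    by (rule bimod_hom_eqI[OF bimod_hom_plus[OF M N bimod_hom_zero[OF M N] f'] f'])
      (simp add: bimod_homD[OF f'])
next
  interpret N: k_bimodule A N by fact
  fix f g assume "f \<in> carrier (hom_group A M N)" "g \<in> carrier (hom_group A M N)"
  then have f: "f \<in> bimod_hom A M N" and g: "g \<in> bimod_hom A M N" by simp_all
  then show "f \<oplus>\<^sub>(hom_group A M N) g \<in> carrier (hom_group A M N)"
    by (simp add: bimod_hom_plus[OF M N])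
  show "f \<oplus>\<^sub>(hom_group A M N) g = g \<oplus>\<^sub>(hom_group A M N) f"
    unfolding hom_group_simps
    by (rule restrict_ext) (simp add: N.M.a_comm bimod_homD[OF f] bimod_homD[OF g])
  fix h assume "h \<in> carrier (hom_group A M N)"
  then have h: "h \<in> bimod_hom A M N" by simp
  show "f \<oplus>\<^sub>(hom_group A M N) g \<oplus>\<^sub>(hom_group A M N) h
      = f \<oplus>\<^sub>(hom_group A M N) (g \<oplus>\<^sub>(hom_group A M N) h)"
    unfolding hom_group_simps
    by (rule restrict_ext) (simp add: N.M.a_assoc bimod_homD[OF f] bimod_homD[OF g] bimod_homD[OF h])
qed (simp add: bimod_hom_zero[OF M N])

lemma hom_group_minus:
  assumes M: "k_bimodule A M" and N: "k_bimodule A N"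
    and f: "f \<in> bimod_hom A M N" and g: "g \<in> bimod_hom A M N"
  shows "f \<ominus>\<^sub>(hom_group A M N) g = (\<lambda>x\<in>carrier M. f x \<ominus>\<^sub>N g x)"
proof -
  interpret H: abelian_group "hom_group A M N" by (rule hom_group_abelian_group[OF M N])
  interpret N: k_bimodule A N by fact
  have "(\<lambda>x\<in>carrier M. \<ominus>\<^sub>N g x) \<oplus>\<^sub>(hom_group A M N) g = \<zero>\<^sub>(hom_group A M N)"
    by (auto simp: N.M.l_neg bimod_homD[OF g] fun_eq_iff)
  then have "\<ominus>\<^sub>(hom_group A M N) g = (\<lambda>x\<in>carrier M. \<ominus>\<^sub>N g x)"
    using bimod_hom_uminus[OF M N g] g by (intro H.minus_equality) auto
  then show ?thesis
    unfolding a_minus_def hom_group_simps by (auto simp: fun_eq_iff)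
qed

lemma bimod_hom_minus:
  assumes M: "k_bimodule A M" and N: "k_bimodule A N"
    and f: "f \<in> bimod_hom A M N" and g: "g \<in> bimod_hom A M N"
  shows "(\<lambda>x\<in>carrier M. f x \<ominus>\<^sub>N g x) \<in> bimod_hom A M N"
  using hom_group_minus[OF assms] abelian_group.minus_closed[OF hom_group_abelian_group[OF M N], of f g] f g
  by simp

context k_algebra
begin

text \<open>This is what makes the \<open>THE\<close> in \<open>free_extend\<close> meaningful. For
  existence, \<open>x \<odot>\<^sub>M v i \<odot>\<^sup>r\<^sub>M y\<close> is balanced in x and y,
  and the resulting additive map commutes with both actions because it does so on tensors.\<close>

lemma free_extend_unique:
  assumes M: "k_bimodule A M" and v: "\<And>i. i \<in> I ==> v i \<in> carrier M"
  shows "\<exists>!h. h \<in> bimod_hom A (free_bimod A I) M \<and> (\<forall>i\<in>I. h (summand_tensor A I i \<one> \<one>) = v i)"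
proof -
  interpret M: k_bimodule A M by fact
  interpret F: k_bimodule A "free_bimod A I" by (rule free_k_bimodule)
  let ?\<beta> = "\<lambda>i x y. x \<odot>\<^sub>M v i \<odot>\<^sup>r\<^sub>M y"
  have \<beta>: "balanced A M (?\<beta> i)" if "i \<in> I" for i using M.balanced_sandwich v that by blast
  let ?h = "free_lift I M ?\<beta>"
  note ah = free_lift_add_hom[OF M \<beta>] and te = free_lift_tensor[OF M \<beta>]
  have l: "?h (a \<odot>\<^sub>(free_bimod A I) u) = a \<odot>\<^sub>M ?h u"
    if a: "a \<in> carrier A" and u: "u \<in> carrier (free_bimod A I)" for a u
    by (rule free_hom_eq[OF M.M.abelian_group_axioms add_hom_comp[OF F.l_add_hom[OF a] ah]
          add_hom_comp[OF ah M.l_add_hom[OF a]] u])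
      (auto simp: summand_tensor_smult te a v M.l_assoc M.lr_assoc M.r_closed M.l_closed)
  have r: "?h (u \<odot>\<^sup>r\<^sub>(free_bimod A I) a) = ?h u \<odot>\<^sup>r\<^sub>M a"
    if a: "a \<in> carrier A" and u: "u \<in> carrier (free_bimod A I)" for a u
    by (rule free_hom_eq[OF M.M.abelian_group_axioms add_hom_comp[OF F.r_add_hom[OF a] ah]
          add_hom_comp[OF ah M.r_add_hom[OF a]] u])
      (auto simp: summand_tensor_smult te a v M.r_assoc M.r_closed M.l_closed)
  have hom: "restrict ?h (carrier (free_bimod A I)) \<in> bimod_hom A (free_bimod A I) M"
    by (rule bimod_hom_restrict[OF free_k_bimodule])
      (auto simp: add_hom_closed[OF ah] add_hom_add[OF ah] l r)
  have uniq: "h = h'"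
    if "h \<in> bimod_hom A (free_bimod A I) M" "\<forall>i\<in>I. h (summand_tensor A I i \<one> \<one>) = v i"
      "h' \<in> bimod_hom A (free_bimod A I) M" "\<forall>i\<in>I. h' (summand_tensor A I i \<one> \<one>) = v i" for h h'
  proof (rule bimod_hom_eqI[OF that(1,3)])
    fix u assume u: "u \<in> carrier (free_bimod A I)"
    have *: "g (summand_tensor A I i x y) = x \<odot>\<^sub>M v i \<odot>\<^sup>r\<^sub>M y"
      if g: "g \<in> bimod_hom A (free_bimod A I) M" "\<forall>i\<in>I. g (summand_tensor A I i \<one> \<one>) = v i"
        and "i \<in> I" "x \<in> carrier A" "y \<in> carrier A" for g i x y
      using that bimod_homD(4)[OF g(1), of x "summand_tensor A I i \<one> \<one>"]
        bimod_homD(5)[OF g(1), of y "summand_tensor A I i x \<one>"]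
      by (simp add: summand_tensor_smult)
    show "h u = h' u"
      by (rule free_hom_eq[OF M.M.abelian_group_axioms bimod_hom_add_hom[OF that(1)]
            bimod_hom_add_hom[OF that(3)] u]) (simp add: * that)
  qed
  show ?thesis
  proof (rule ex1I[of _ "restrict ?h (carrier (free_bimod A I))"])
    show "restrict ?h (carrier (free_bimod A I)) \<in> bimod_hom A (free_bimod A I) M \<and>
      (\<forall>i\<in>I. restrict ?h (carrier (free_bimod A I)) (summand_tensor A I i \<one> \<one>) = v i)"
      using hom by (auto simp: te v M.l_unit M.r_unit)
  qed (use uniq hom in \<open>auto simp: te v M.l_unit M.r_unit\<close>)
qed

lemma free_extend:
  assumes M: "k_bimodule A M" and v: "\<And>i. i \<in> I ==> v i \<in> carrier M"
  shows "free_extend A I M v \<in> bimod_hom A (free_bimod A I) M"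
    and "i \<in> I ==> free_extend A I M v (summand_tensor A I i \<one> \<one>) = v i"
proof -
  have "\<exists>!h. h \<in> bimod_hom A (free_bimod A I) M \<and> (\<forall>i\<in>I. h (summand_tensor A I i \<one> \<one>) = v i)"
    by (rule free_extend_unique[OF M v])
  from theI'[OF this, folded free_extend_def]
  show "free_extend A I M v \<in> bimod_hom A (free_bimod A I) M"
    "i \<in> I ==> free_extend A I M v (summand_tensor A I i \<one> \<one>) = v i" by simp_all
qed

lemma free_hom_tensor:
  assumes h: "h \<in> bimod_hom A (free_bimod A I) M" and "x \<in> carrier A" "y \<in> carrier A"
  shows "h (summand_tensor A I i x y) = x \<odot>\<^sub>M h (summand_tensor A I i \<one> \<one>) \<odot>\<^sup>r\<^sub>M y"
  using assms bimod_homD(4)[OF h, of x "summand_tensor A I i \<one> \<one>"]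
    bimod_homD(5)[OF h, of y "summand_tensor A I i x \<one>"]
  by (simp add: summand_tensor_smult)

lemma free_bimod_hom_eq:
  assumes M: "k_bimodule A M" and "h \<in> bimod_hom A (free_bimod A I) M" "h' \<in> bimod_hom A (free_bimod A I) M"
    and "\<And>i. i \<in> I ==> h (summand_tensor A I i \<one> \<one>) = h' (summand_tensor A I i \<one> \<one>)"
  shows "h = h'"
  using free_extend_unique[OF M, of I "\<lambda>i. h' (summand_tensor A I i \<one> \<one>)"]
    bimod_homD(1)[OF assms(3)] assms by (metis summand_tensor_closed one_closed)

lemma free_projective: "projective_bimod A (free_bimod A I)"
proof -
  interpret F: k_bimodule A "free_bimod A I" by (rule free_k_bimodule)
  let ?C = "carrier (free_bimod A I)"
  let ?g = "\<lambda>i. summand_tensor A I i \<one> \<one>"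
  \<comment> \<open>\<open>projective_bimod\<close> asks for a splitting of the free bimodule on all
    elements. The section sends a generator to the basis element indexed by that generator, and
    evaluation sends this one back.\<close>
  let ?s = "free_extend A I (free_bimod A ?C) (\<lambda>i. summand_tensor A ?C (?g i) \<one> \<one>)"
  let ?p = "free_extend A ?C (free_bimod A I) (\<lambda>u. u)"
  have s: "?s \<in> bimod_hom A (free_bimod A I) (free_bimod A ?C)"
    "\<And>i. i \<in> I ==> ?s (?g i) = summand_tensor A ?C (?g i) \<one> \<one>"
    by (rule free_extend[OF free_k_bimodule]; simp)+
  have p: "?p \<in> bimod_hom A (free_bimod A ?C) (free_bimod A I)"
    "\<And>u. u \<in> ?C ==> ?p (summand_tensor A ?C u \<one> \<one>) = u"
    by (rule free_extend[OF free_k_bimodule]; simp)+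
  have eq: "compose ?C ?p ?s = (\<lambda>u\<in>?C. u)"
    by (rule free_bimod_hom_eq[OF free_k_bimodule bimod_hom_compose[OF free_k_bimodule s(1) p(1)]
          bimod_hom_restrict[OF free_k_bimodule]])
      (auto simp: compose_eq s(2) p(2))
  have ps: "?p (?s u) = u" if "u \<in> ?C" for u
    using fun_cong[OF eq, of u] that by (simp add: compose_eq)
  show ?thesis unfolding projective_bimod_def
    by (intro conjI F.bimodule_axioms bexI[OF _ s(1)] bexI[OF _ p(1)] ballI ps)
qed

lemma free_lifting:
  assumes Q: "k_bimodule A Q" and \<phi>: "\<phi> \<in> bimod_hom A (free_bimod A I) R" and \<delta>: "\<delta> \<in> bimod_hom A Q R"
    and R: "k_bimodule A R"
    and v: "\<And>i. i \<in> I ==> v i \<in> carrier Q"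
      "\<And>i. i \<in> I ==> \<delta> (v i) = \<phi> (summand_tensor A I i \<one> \<one>)"
    and u: "u \<in> carrier (free_bimod A I)"
  shows "\<delta> (free_extend A I Q v u) = \<phi> u"
proof -
  note fe = free_extend[OF Q v(1)]
  have "compose (carrier (free_bimod A I)) \<delta> (free_extend A I Q v) = \<phi>"
    by (rule free_bimod_hom_eq[OF R bimod_hom_compose[OF free_k_bimodule fe(1) \<delta>] \<phi>])
      (auto simp: compose_eq fe v(2))
  then show ?thesis using u compose_eq by metis
qed

text \<open>Lift along the free cover, where the values on generators can be chosen independently,
  and precompose with the section.\<close>

lemma projective_lifting:
  assumes P: "projective_bimod A P" and Q: "k_bimodule A Q" and R: "k_bimodule A R"
    and \<phi>: "\<phi> \<in> bimod_hom A P R" and \<delta>: "\<delta> \<in> bimod_hom A Q R"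
    and im: "\<And>x. x \<in> carrier P ==> \<phi> x \<in> \<delta> ` carrier Q"
  shows "\<exists>\<psi> \<in> bimod_hom A P Q. \<forall>x\<in>carrier P. \<delta> (\<psi> x) = \<phi> x"
proof -
  have P': "k_bimodule A P" using P k_algebra_axioms unfolding projective_bimod_def k_bimodule_def by blast
  let ?F = "free_bimod A (carrier P)"
  obtain s p where s: "s \<in> bimod_hom A P ?F" and p: "p \<in> bimod_hom A ?F P"
    and ps: "\<And>x. x \<in> carrier P ==> p (s x) = x" using P unfolding projective_bimod_def by blast
  let ?\<phi> = "compose (carrier ?F) \<phi> p"
  have \<phi>': "?\<phi> \<in> bimod_hom A ?F R" by (rule bimod_hom_compose[OF free_k_bimodule p \<phi>])
  have "\<exists>q\<in>carrier Q. \<delta> q = ?\<phi> (summand_tensor A (carrier P) i \<one> \<one>)" for i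
    using im[OF bimod_homD(1)[OF p, of "summand_tensor A (carrier P) i \<one> \<one>"]]
    by (force simp: compose_eq)
  then obtain v where v: "\<And>i. v i \<in> carrier Q"
    "\<And>i. \<delta> (v i) = ?\<phi> (summand_tensor A (carrier P) i \<one> \<one>)" by metis
  let ?\<psi> = "free_extend A (carrier P) Q v"
  have \<psi>: "?\<psi> \<in> bimod_hom A ?F Q" by (rule free_extend[OF Q v(1)])
  have "\<delta> (compose (carrier P) ?\<psi> s x) = \<phi> x" if x: "x \<in> carrier P" for x
    using x bimod_homD(1)[OF s x] free_lifting[OF Q \<phi>' \<delta> R, of v "s x"] v ps
    by (simp add: compose_eq)
  then show ?thesis using bimod_hom_compose[OF P' s \<psi>] by blast
qed

end

lemma mem_coset_iff:
  assumes "abelian_group G" "additive_subgroup B G" "y \<in> carrier G"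
  shows "x \<in> B +>\<^sub>G y \<longleftrightarrow> x \<in> carrier G \<and> x \<ominus>\<^sub>G y \<in> B"
proof -
  interpret S: abelian_subgroup B G by (rule abelian_subgroup_of_additive[OF assms(1,2)])
  have "x \<in> carrier G" if "x \<in> B +>\<^sub>G y" using S.a_elemrcos_carrier[OF assms(3) that] .
  moreover have "x \<in> B +>\<^sub>G y \<longleftrightarrow> x \<ominus>\<^sub>G y \<in> B" if "x \<in> carrier G"
    using S.a_rcos_module[OF assms(3) that] by (simp add: a_minus_def)
  ultimately show ?thesis by blast
qed

lemma additive_subgroup_minusI:
  assumes G: "abelian_group G" and "C \<subseteq> carrier G" "\<zero>\<^sub>G \<in> C"
    and minus: "\<And>x y. x \<in> C ==> y \<in> C ==> x \<ominus>\<^sub>G y \<in> C"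
  shows "additive_subgroup C G"
proof -
  interpret G: abelian_group G by fact
  have neg: "\<ominus>\<^sub>G x \<in> C" if "x \<in> C" for x
    using minus[OF assms(3) that] that assms(2) by (auto simp: a_minus_def)
  have "x \<oplus>\<^sub>G y \<in> C" if "x \<in> C" "y \<in> C" for x y
  proof -
    have "x \<ominus>\<^sub>G (\<ominus>\<^sub>G y) = x \<oplus>\<^sub>G y" using that assms(2) by (auto simp: a_minus_def)
    then show ?thesis using minus[OF that(1) neg[OF that(2)]] by simp
  qed
  then show ?thesis using assms neg by (intro additive_subgroupI') auto
qed

lemma (in abelian_group) minus_add_cancel_right: "x \<in> carrier G ==> y \<in> carrier G ==> x \<ominus> y \<oplus> y = x"
  by (simp add: minus_eq a_assoc l_neg)

lemma (in abelian_group) minus_eq_zero: "x \<in> carrier G ==> y \<in> carrier G ==> x \<ominus> y = \<zero> \<longleftrightarrow> x = y"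
  using minus_add_cancel_right[of x y] by (auto simp: minus_eq r_neg)

section \<open>The Ext algebra of a projective resolution\<close>

locale ext_resolution = k_algebra A for A :: "('k::field, 'a) module" (structure) +
  fixes M :: "('a, 'm) bimodule" and P :: "nat => ('a, 'p) bimodule"
    and d :: "nat => 'p => 'p" and \<epsilon> :: "'p => 'm"
  assumes res: "projective_resolution A M P d \<epsilon>"
begin

lemmas res_conjs = res[unfolded projective_resolution_def]

lemma M_bimodule: "k_bimodule A M"
  by (rule k_bimodule.intro[OF k_algebra_axioms res_conjs[THEN conjunct1]])

lemma P_projective: "projective_bimod A (P n)"
  by (rule res_conjs[THEN conjunct2, THEN conjunct1, rule_format])

lemma P_bimodule: "k_bimodule A (P n)"
  by (rule k_bimodule.intro[OF k_algebra_axioms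
        P_projective[unfolded projective_bimod_def, THEN conjunct1]])

sublocale M: k_bimodule A M by (rule M_bimodule)

lemma P_group: "abelian_group (P n)"
proof -
  interpret P: k_bimodule A "P n" by (rule P_bimodule)
  show ?thesis by (rule P.M.abelian_group_axioms)
qed

lemma d_hom: "d (Suc n) \<in> bimod_hom A (P (Suc n)) (P n)"
  by (rule res_conjs[THEN conjunct2, THEN conjunct2, THEN conjunct1, rule_format])

lemma eps_hom: "\<epsilon> \<in> bimod_hom A (P 0) M"
  by (rule res_conjs[THEN conjunct2, THEN conjunct2, THEN conjunct2, THEN conjunct1])

lemma eps_surj: "\<epsilon> ` carrier (P 0) = carrier M"
  by (rule res_conjs[THEN conjunct2, THEN conjunct2, THEN conjunct2, THEN conjunct2, THEN conjunct1])

lemma exact_zero: "x \<in> carrier (P 0) \<and> \<epsilon> x = \<zero>\<^sub>M \<longleftrightarrow> x \<in> d (Suc 0) ` carrier (P (Suc 0))"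
proof -
  have "a_kernel (P 0) M \<epsilon> = d (Suc 0) ` carrier (P (Suc 0))"
    using res_conjs[THEN conjunct2, THEN conjunct2, THEN conjunct2, THEN conjunct2, THEN conjunct2,
        THEN conjunct1] by simp
  from this[unfolded a_kernel_def', symmetric] show ?thesis by simp
qed

lemma exact_Suc: "x \<in> carrier (P (Suc n)) \<and> d (Suc n) x = \<zero>\<^sub>(P n)
    \<longleftrightarrow> x \<in> d (Suc (Suc n)) ` carrier (P (Suc (Suc n)))"
proof -
  have "a_kernel (P (Suc n)) (P n) (d (Suc n)) = d (Suc (Suc n)) ` carrier (P (Suc (Suc n)))"
    by (rule res_conjs[THEN conjunct2, THEN conjunct2, THEN conjunct2, THEN conjunct2, THEN conjunct2,
          THEN conjunct2, rule_format])
  from this[unfolded a_kernel_def', symmetric] show ?thesis by simp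
qed

lemma d_closed: "x \<in> carrier (P (Suc n)) ==> d (Suc n) x \<in> carrier (P n)"
  by (rule bimod_homD(1)[OF d_hom])

lemma d_d: "x \<in> carrier (P (Suc (Suc n))) ==> d (Suc n) (d (Suc (Suc n)) x) = \<zero>\<^sub>(P n)"
  using exact_Suc by blast

lemma eps_d: "x \<in> carrier (P (Suc 0)) ==> \<epsilon> (d (Suc 0) x) = \<zero>\<^sub>M"
  using exact_zero by blast

lemma hom_zero: "f \<in> bimod_hom A (P n) (P m) ==> f \<zero>\<^sub>(P n) = \<zero>\<^sub>(P m)"
  by (rule add_hom_zero[OF P_group P_group bimod_hom_add_hom])

lemma homM_zero: "f \<in> bimod_hom A (P n) M ==> f \<zero>\<^sub>(P n) = \<zero>\<^sub>M"
  by (rule add_hom_zero[OF P_group M.M.abelian_group_axioms bimod_hom_add_hom])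

lemma hom_minus:
  "f \<in> bimod_hom A (P n) (P m) ==> x \<in> carrier (P n) ==> y \<in> carrier (P n) ==>
    f (x \<ominus>\<^sub>(P n) y) = f x \<ominus>\<^sub>(P m) f y"
  by (rule add_hom_minus[OF P_group P_group bimod_hom_add_hom])

lemma homM_minus:
  "f \<in> bimod_hom A (P n) M ==> x \<in> carrier (P n) ==> y \<in> carrier (P n) ==>
    f (x \<ominus>\<^sub>(P n) y) = f x \<ominus>\<^sub>M f y"
  by (rule add_hom_minus[OF P_group M.M.abelian_group_axioms bimod_hom_add_hom])

abbreviation "Hom n \<equiv> bimod_hom A (P n) M"
abbreviation "HG n \<equiv> hom_group A (P n) M"
abbreviation "Z \<equiv> cocycles A M P d"
abbreviation "B \<equiv> coboundaries A M P d"
abbreviation "cls \<equiv> coh_class A M P d"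
abbreviation "ExtG \<equiv> ext_group A M P d"
abbreviation "lifts \<equiv> chain_lifts A P d \<epsilon>"
abbreviation "yon \<equiv> yoneda A M P d \<epsilon>"

lemma HG_group: "abelian_group (HG n)"
  by (rule hom_group_abelian_group[OF P_bimodule M_bimodule])

lemma HG_minus: "f \<in> Hom n ==> g \<in> Hom n ==> f \<ominus>\<^sub>(HG n) g = (\<lambda>x\<in>carrier (P n). f x \<ominus>\<^sub>M g x)"
  by (rule hom_group_minus[OF P_bimodule M_bimodule])

lemma HG_zero: "(\<lambda>x\<in>carrier (P n). \<zero>\<^sub>M) \<in> Hom n"
  by (rule bimod_hom_zero[OF P_bimodule M_bimodule])

lemma HG_minus_hom: "f \<in> Hom n ==> g \<in> Hom n ==> f \<ominus>\<^sub>(HG n) g \<in> Hom n"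
  using abelian_group.minus_closed[OF HG_group, of f n g] by simp

lemma mem_cocycles: "f \<in> Z n \<longleftrightarrow> f \<in> Hom n \<and> (\<forall>x\<in>carrier (P (Suc n)). f (d (Suc n) x) = \<zero>\<^sub>M)"
  unfolding cocycles_def by simp

lemma cocycles_subgroup: "additive_subgroup (Z n) (HG n)"
proof (rule additive_subgroup_minusI[OF HG_group])
  show "\<zero>\<^sub>(HG n) \<in> Z n"
    using HG_zero[of n] by (simp add: mem_cocycles d_closed)
  fix f g assume "f \<in> Z n" "g \<in> Z n"
  then show "f \<ominus>\<^sub>(HG n) g \<in> Z n"
    using HG_minus_hom[of f n g] by (simp add: mem_cocycles HG_minus d_closed M.M.minus_eq)
qed (auto simp: mem_cocycles)

lemma mem_coboundaries_0: "f \<in> B 0 \<longleftrightarrow> f \<in> Hom 0 \<and> (\<forall>x\<in>carrier (P 0). f x = \<zero>\<^sub>M)"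
proof
  assume "f \<in> B 0"
  then show "f \<in> Hom 0 \<and> (\<forall>x\<in>carrier (P 0). f x = \<zero>\<^sub>M)"
    unfolding coboundaries_def using HG_zero[of 0] by simp
next
  assume f: "f \<in> Hom 0 \<and> (\<forall>x\<in>carrier (P 0). f x = \<zero>\<^sub>M)"
  have "f = \<zero>\<^sub>(HG 0)"
    by (rule bimod_hom_eqI[of f A "P 0" M])
      (use f HG_zero[of 0] in auto)
  then show "f \<in> B 0" unfolding coboundaries_def by simp
qed

lemma mem_coboundaries_Suc:
  "f \<in> B (Suc n) \<longleftrightarrow> f \<in> Hom (Suc n) \<and> (\<exists>g\<in>Hom n. \<forall>x\<in>carrier (P (Suc n)). f x = g (d (Suc n) x))"
proof
  assume "f \<in> B (Suc n)"
  then obtain g where g: "g \<in> Hom n" "f = compose (carrier (P (Suc n))) g (d (Suc n))"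
    unfolding coboundaries_def by auto
  then show "f \<in> Hom (Suc n) \<and> (\<exists>g\<in>Hom n. \<forall>x\<in>carrier (P (Suc n)). f x = g (d (Suc n) x))"
    using bimod_hom_compose[OF P_bimodule d_hom g(1)] by (auto simp: compose_eq)
next
  assume f: "f \<in> Hom (Suc n) \<and> (\<exists>g\<in>Hom n. \<forall>x\<in>carrier (P (Suc n)). f x = g (d (Suc n) x))"
  then obtain g where g: "g \<in> Hom n" "\<forall>x\<in>carrier (P (Suc n)). f x = g (d (Suc n) x)" by blast
  have "f = compose (carrier (P (Suc n))) g (d (Suc n))"
    using f g bimod_hom_compose[OF P_bimodule d_hom g(1)]
    by (intro bimod_hom_eqI[of f A "P (Suc n)" M]) (auto simp: compose_eq)
  then show "f \<in> B (Suc n)" using g(1) unfolding coboundaries_def by auto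
qed

lemma coboundaries_subgroup: "additive_subgroup (B n) (HG n)"
proof (rule additive_subgroup_minusI[OF HG_group])
  note z = HG_zero
  show "B n \<subseteq> carrier (HG n)" by (cases n) (auto simp: mem_coboundaries_0 mem_coboundaries_Suc)
  show "\<zero>\<^sub>(HG n) \<in> B n"
  proof (cases n)
    case (Suc k)
    then show ?thesis using z[of n] z[of k] d_closed
      by (auto simp: mem_coboundaries_Suc intro!: bexI[OF _ z[of k]])
  qed (use z[of 0] in \<open>simp add: mem_coboundaries_0\<close>)
  fix f g assume fg: "f \<in> B n" "g \<in> B n"
  show "f \<ominus>\<^sub>(HG n) g \<in> B n"
  proof (cases n)
    case 0
    then show ?thesis using fg HG_minus_hom[of f 0 g]
      by (auto simp: mem_coboundaries_0 HG_minus M.M.minus_eq)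
  next
    case (Suc k)
    then obtain f' g' where fg': "f \<in> Hom n" "g \<in> Hom n" "f' \<in> Hom k" "g' \<in> Hom k"
      "\<forall>x\<in>carrier (P n). f x = f' (d n x)" "\<forall>x\<in>carrier (P n). g x = g' (d n x)"
      using fg by (auto simp: mem_coboundaries_Suc)
    have "\<forall>x\<in>carrier (P n). (f \<ominus>\<^sub>(HG n) g) x = (f' \<ominus>\<^sub>(HG k) g') (d n x)"
      using fg' Suc d_closed by (simp add: HG_minus)
    then show ?thesis using HG_minus_hom[OF fg'(3,4)] HG_minus_hom[OF fg'(1,2)] Suc
      by (auto simp: mem_coboundaries_Suc simp del: hom_group_simps)
  qed
qed

lemma coboundaries_hom: "f \<in> B n ==> f \<in> Hom n"
  using additive_subgroup.a_subset[OF coboundaries_subgroup, of n] by auto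

lemma coboundary_cocycle: "f \<in> B n ==> f \<in> Z n"
proof (cases n)
  case (Suc k)
  assume "f \<in> B n"
  then show ?thesis using d_d homM_zero unfolding Suc mem_coboundaries_Suc mem_cocycles
    by (metis d_closed)
qed (simp add: mem_coboundaries_0 mem_cocycles d_closed)

lemma cocycle_hom: "f \<in> Z n ==> f \<in> Hom n"
  by (simp add: mem_cocycles)

lemma ext_group_simps:
  "carrier (ExtG n) = cls n ` Z n" "\<zero>\<^sub>(ExtG n) = B n" "X \<oplus>\<^sub>(ExtG n) Y = set_add (HG n) X Y"
  unfolding ext_group_def by simp_all

lemma ext_group_abelian: "abelian_group (ExtG n)"
  by (rule abelian_group_cosets[OF HG_group coboundaries_subgroup cocycles_subgroup])
    (auto simp: ext_group_def coh_class_def)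

lemma cls_eq_iff: "f \<in> Hom n ==> g \<in> Hom n ==> cls n f = cls n g \<longleftrightarrow> f \<ominus>\<^sub>(HG n) g \<in> B n"
  unfolding coh_class_def by (rule coset_eq_iff[OF HG_group coboundaries_subgroup]) auto

lemma mem_cls_iff: "f \<in> Hom n ==> g \<in> cls n f \<longleftrightarrow> g \<in> Hom n \<and> g \<ominus>\<^sub>(HG n) f \<in> B n"
  unfolding coh_class_def using mem_coset_iff[OF HG_group coboundaries_subgroup, of f n g] by simp

lemma cls_self: "f \<in> Hom n ==> f \<in> cls n f"
  using cls_eq_iff mem_cls_iff by blast

lemma cls_add: "f \<in> Hom n ==> g \<in> Hom n ==> cls n (f \<oplus>\<^sub>(HG n) g) = cls n f \<oplus>\<^sub>(ExtG n) cls n g"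
  unfolding coh_class_def ext_group_simps
  using coset_add[OF HG_group coboundaries_subgroup, of f n g] by simp

lemma cls_zero: "cls n (\<zero>\<^sub>(HG n)) = \<zero>\<^sub>(ExtG n)"
  unfolding coh_class_def ext_group_simps by (rule coset_zero[OF HG_group coboundaries_subgroup])

lemma cls_closed: "f \<in> Z n ==> cls n f \<in> carrier (ExtG n)"
  by (simp add: ext_group_simps)

lemma mem_cls_cocycle:
  assumes "f \<in> Z n" "g \<in> cls n f"
  shows "g \<in> Z n" "cls n g = cls n f"
proof -
  interpret S: additive_subgroup "Z n" "HG n" by (rule cocycles_subgroup)
  interpret H: abelian_group "HG n" by (rule HG_group)
  have g: "g \<in> Hom n" "g \<ominus>\<^sub>(HG n) f \<in> B n" using assms mem_cls_iff cocycle_hom by blast+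
  then show "cls n g = cls n f" using cls_eq_iff assms(1) cocycle_hom by blast
  have "(g \<ominus>\<^sub>(HG n) f) \<oplus>\<^sub>(HG n) f \<in> Z n"
    using coboundary_cocycle[OF g(2)] assms(1) by (rule S.a_closed)
  moreover have "(g \<ominus>\<^sub>(HG n) f) \<oplus>\<^sub>(HG n) f = g"
    using g(1) cocycle_hom[OF assms(1)] H.minus_add_cancel_right[of g f]
    by (simp del: hom_group_simps(2,3))
  ultimately show "g \<in> Z n" by simp
qed

lemma compose_d_closed:
  assumes "f \<in> bimod_hom A (P n) Q" "g \<in> bimod_hom A (P k) (P n)"
  shows "compose (carrier (P k)) f g \<in> bimod_hom A (P k) Q"
  by (rule bimod_hom_compose[OF P_bimodule assms(2,1)])

subsection \<open>Chain maps lifting cocycles\<close>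

lemma mem_lifts: "F \<in> lifts n g \<longleftrightarrow> (\<forall>i. F i \<in> bimod_hom A (P (n + i)) (P i)) \<and>
    (\<forall>x\<in>carrier (P n). \<epsilon> (F 0 x) = g x) \<and>
    (\<forall>i. \<forall>x\<in>carrier (P (n + Suc i)). d (Suc i) (F (Suc i) x) = F i (d (n + Suc i) x))"
  unfolding chain_lifts_def by simp

text \<open>\<open>C i\<close> prescribes an additional property of the i-th component. In
  \<open>lifts_exist\<close> it allows every homomorphism; in \<open>radical_lift\<close> it demands
  values in the radical part of the filtration.\<close>

lemma lifts_exist_in:
  assumes g: "g \<in> Z n"
    and hom: "\<And>i. C i \<subseteq> bimod_hom A (P (n + i)) (P i)"
    and C0: "\<exists>F\<in>C 0. \<forall>x\<in>carrier (P n). \<epsilon> (F x) = g x"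
    and CS: "\<And>i F. F \<in> C i ==>
      (\<And>x. x \<in> carrier (P (n + Suc i)) ==> F (d (n + Suc i) x) \<in> d (Suc i) ` carrier (P (Suc i))) ==>
      \<exists>F'\<in>C (Suc i). \<forall>x\<in>carrier (P (n + Suc i)). d (Suc i) (F' x) = F (d (n + Suc i) x)"
  shows "\<exists>F\<in>lifts n g. \<forall>i. F i \<in> C i"
proof -
  \<comment> \<open>The last clause is the consequence of exactness that the next step consumes: the
    map to be lifted takes values in boundaries.\<close>
  define Q where "Q i F \<longleftrightarrow> F \<in> C i \<and> (i = 0 \<longrightarrow> (\<forall>x\<in>carrier (P n). \<epsilon> (F x) = g x)) \<and>
    (\<forall>x\<in>carrier (P (n + Suc i)). F (d (n + Suc i) x) \<in> d (Suc i) ` carrier (P (Suc i)))" for i F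
  define R where "R i F F' \<longleftrightarrow>
    (\<forall>x\<in>carrier (P (n + Suc i)). d (Suc i) (F' x) = F (d (n + Suc i) x))" for i F F'
  have "\<exists>F. Q 0 F"
  proof -
    obtain F where F: "F \<in> C 0" "\<And>x. x \<in> carrier (P n) ==> \<epsilon> (F x) = g x" using C0 by blast
    have Fh: "F \<in> bimod_hom A (P n) (P 0)" using F(1) hom[of 0] by auto
    have "F (d (Suc n) x) \<in> d (Suc 0) ` carrier (P (Suc 0))" if x: "x \<in> carrier (P (Suc n))" for x
    proof -
      have "\<epsilon> (F (d (Suc n) x)) = \<zero>\<^sub>M" using F(2)[OF d_closed[OF x]] g x by (simp add: mem_cocycles)
      then show ?thesis using exact_zero bimod_homD(1)[OF Fh d_closed[OF x]] by blast
    qed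
    then show ?thesis using F unfolding Q_def by auto
  qed
  moreover have "\<exists>F'. Q (Suc i) F' \<and> R i F F'" if Q: "Q i F" for F i
  proof -
    have F: "F \<in> C i" using Q unfolding Q_def by blast
    then have Fh: "F \<in> bimod_hom A (P (n + i)) (P i)" using hom by blast
    obtain F' where F': "F' \<in> C (Suc i)"
      "\<And>x. x \<in> carrier (P (n + Suc i)) ==> d (Suc i) (F' x) = F (d (n + Suc i) x)"
      using CS[OF F] Q unfolding Q_def by blast
    have Fh': "F' \<in> bimod_hom A (P (n + Suc i)) (P (Suc i))" using F'(1) hom by blast
    have "F' (d (n + Suc (Suc i)) x) \<in> d (Suc (Suc i)) ` carrier (P (Suc (Suc i)))"
      if x: "x \<in> carrier (P (n + Suc (Suc i)))" for x
    proof -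
      have dx: "d (n + Suc (Suc i)) x \<in> carrier (P (n + Suc i))" using d_closed x by simp
      have "d (Suc i) (F' (d (n + Suc (Suc i)) x)) = F (d (n + Suc i) (d (n + Suc (Suc i)) x))"
        by (rule F'(2)[OF dx])
      also have "\<dots> = \<zero>\<^sub>(P i)" using d_d x hom_zero[OF Fh] by simp
      finally show ?thesis using exact_Suc bimod_homD(1)[OF Fh' dx] by blast
    qed
    then show ?thesis using F' unfolding Q_def R_def by blast
  qed
  ultimately obtain F where F: "\<And>i. Q i (F i) \<and> R i (F i) (F (Suc i))"
    using dependent_nat_choice[of Q R] by blast
  have "F \<in> lifts n g"
    using F hom unfolding mem_lifts Q_def R_def by blast
  then show ?thesis using F unfolding Q_def by blast
qed

lemma lift_step:
  assumes "\<phi> \<in> bimod_hom A (P k) (P i)"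
    "\<And>x. x \<in> carrier (P k) ==> \<phi> x \<in> d (Suc i) ` carrier (P (Suc i))"
  shows "\<exists>\<psi>\<in>bimod_hom A (P k) (P (Suc i)). \<forall>x\<in>carrier (P k). d (Suc i) (\<psi> x) = \<phi> x"
  by (rule projective_lifting[OF P_projective P_bimodule P_bimodule assms(1) d_hom assms(2)])

lemma lifts_exist:
  assumes g: "g \<in> Z n"
  shows "\<exists>F. F \<in> lifts n g"
proof -
  have "\<exists>F\<in>lifts n g. \<forall>i. F i \<in> bimod_hom A (P (n + i)) (P i)"
  proof (rule lifts_exist_in[OF g])
    show "\<exists>F\<in>bimod_hom A (P (n + 0)) (P 0). \<forall>x\<in>carrier (P n). \<epsilon> (F x) = g x"
      using projective_lifting[OF P_projective P_bimodule M_bimodule cocycle_hom[OF g] eps_hom]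
        eps_surj bimod_homD(1)[OF cocycle_hom[OF g]] by simp
    fix i F assume F: "F \<in> bimod_hom A (P (n + i)) (P i)"
      "\<And>x. x \<in> carrier (P (n + Suc i)) ==> F (d (n + Suc i) x) \<in> d (Suc i) ` carrier (P (Suc i))"
    have dh: "d (n + Suc i) \<in> bimod_hom A (P (n + Suc i)) (P (n + i))" using d_hom[of "n + i"] by simp
    show "\<exists>F'\<in>bimod_hom A (P (n + Suc i)) (P (Suc i)).
        \<forall>x\<in>carrier (P (n + Suc i)). d (Suc i) (F' x) = F (d (n + Suc i) x)"
      using lift_step[OF compose_d_closed[OF F(1) dh]] F(2) by (simp add: compose_eq)
  qed simp
  then show ?thesis by blast
qed

text \<open>As u kills boundaries, u in degree 0 continued by zero is itself a chain map. It lies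
  over the same map as F, and the \<open>t i\<close> form a homotopy between the two.\<close>

lemma chain_homotopy:
  assumes F: "\<And>i. F i \<in> bimod_hom A (P (n + i)) (P i)"
    and comm: "\<And>i x. x \<in> carrier (P (n + Suc i)) ==> d (Suc i) (F (Suc i) x) = F i (d (n + Suc i) x)"
    and u: "u \<in> bimod_hom A (P n) (P 0)" "\<And>x. x \<in> carrier (P n) ==> \<epsilon> (u x) = \<epsilon> (F 0 x)"
      "\<And>x. x \<in> carrier (P (Suc n)) ==> u (d (Suc n) x) = \<zero>\<^sub>(P 0)"
  shows "\<exists>t. (\<forall>i. t i \<in> bimod_hom A (P (n + i)) (P (Suc i))) \<and>
    (\<forall>x\<in>carrier (P n). d (Suc 0) (t 0 x) = F 0 x \<ominus>\<^sub>(P 0) u x) \<and>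
    (\<forall>i. \<forall>x\<in>carrier (P (n + Suc i)).
      d (Suc (Suc i)) (t (Suc i) x) = F (Suc i) x \<ominus>\<^sub>(P (Suc i)) t i (d (n + Suc i) x))"
proof -
  have dh: "d (n + Suc i) \<in> bimod_hom A (P (n + Suc i)) (P (n + i))" for i using d_hom[of "n + i"] by simp
  define Q where "Q i t \<longleftrightarrow> t \<in> bimod_hom A (P (n + i)) (P (Suc i)) \<and>
    (i = 0 \<longrightarrow> (\<forall>x\<in>carrier (P n). d (Suc 0) (t x) = F 0 x \<ominus>\<^sub>(P 0) u x)) \<and>
    (\<forall>x\<in>carrier (P (n + Suc i)). d (Suc i) (t (d (n + Suc i) x)) = F i (d (n + Suc i) x))" for i t
  define R where "R i t t' \<longleftrightarrow> (\<forall>x\<in>carrier (P (n + Suc i)).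
      d (Suc (Suc i)) (t' x) = F (Suc i) x \<ominus>\<^sub>(P (Suc i)) t (d (n + Suc i) x))" for i t t'
  have "\<exists>t. Q 0 t"
  proof -
    interpret P0: k_bimodule A "P 0" by (rule P_bimodule)
    have F0: "F 0 \<in> bimod_hom A (P n) (P 0)" using F[of 0] by simp
    let ?\<phi> = "\<lambda>x\<in>carrier (P n). F 0 x \<ominus>\<^sub>(P 0) u x"
    have \<phi>: "?\<phi> \<in> bimod_hom A (P n) (P 0)"
      by (rule bimod_hom_minus[OF P_bimodule P_bimodule F0 u(1)])
    have "?\<phi> x \<in> d (Suc 0) ` carrier (P (Suc 0))" if x: "x \<in> carrier (P n)" for x
    proof -
      have "\<epsilon> (?\<phi> x) = \<zero>\<^sub>M"
        using x homM_minus[OF eps_hom, of "F 0 x" "u x"] bimod_homD(1)[OF F0 x] bimod_homD(1)[OF u(1) x]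
          bimod_homD(1)[OF eps_hom] u(2)[OF x] by (simp add: M.M.minus_eq M.M.r_neg)
      then show ?thesis using exact_zero bimod_homD(1)[OF \<phi> x] by blast
    qed
    from lift_step[OF \<phi> this] obtain t where t: "t \<in> bimod_hom A (P n) (P (Suc 0))"
      "\<And>x. x \<in> carrier (P n) ==> d (Suc 0) (t x) = ?\<phi> x" by blast
    have "d (Suc 0) (t (d (Suc n) x)) = F 0 (d (Suc n) x)" if x: "x \<in> carrier (P (Suc n))" for x
      using t(2)[OF d_closed[OF x]] d_closed[OF x] u(3)[OF x] bimod_homD(1)[OF F0 d_closed[OF x]]
      by (simp add: a_minus_def)
    then show ?thesis using t unfolding Q_def by auto
  qed
  moreover have "\<exists>t'. Q (Suc i) t' \<and> R i t t'" if Q: "Q i t" for t i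
  proof -
    interpret P1: k_bimodule A "P (Suc i)" by (rule P_bimodule)
    interpret P0: k_bimodule A "P i" by (rule P_bimodule)
    have t: "t \<in> bimod_hom A (P (n + i)) (P (Suc i))"
      "\<And>x. x \<in> carrier (P (n + Suc i)) ==> d (Suc i) (t (d (n + Suc i) x)) = F i (d (n + Suc i) x)"
      using Q unfolding Q_def by blast+
    have dx: "d (n + Suc i) x \<in> carrier (P (n + i))" if "x \<in> carrier (P (n + Suc i))" for x
      using bimod_homD(1)[OF dh that] .
    let ?\<phi> = "\<lambda>x\<in>carrier (P (n + Suc i)). F (Suc i) x \<ominus>\<^sub>(P (Suc i))
      compose (carrier (P (n + Suc i))) t (d (n + Suc i)) x"
    have \<phi>: "?\<phi> \<in> bimod_hom A (P (n + Suc i)) (P (Suc i))"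
      by (rule bimod_hom_minus[OF P_bimodule P_bimodule F compose_d_closed[OF t(1) dh]])
    have \<phi>': "?\<phi> x = F (Suc i) x \<ominus>\<^sub>(P (Suc i)) t (d (n + Suc i) x)" if "x \<in> carrier (P (n + Suc i))" for x
      using that by (simp add: compose_eq)
    have "?\<phi> x \<in> d (Suc (Suc i)) ` carrier (P (Suc (Suc i)))" if x: "x \<in> carrier (P (n + Suc i))" for x
    proof -
      have "d (Suc i) (?\<phi> x) = F i (d (n + Suc i) x) \<ominus>\<^sub>(P i) F i (d (n + Suc i) x)"
        unfolding \<phi>'[OF x] using hom_minus[OF d_hom bimod_homD(1)[OF F x] bimod_homD(1)[OF t(1) dx[OF x]]]
          comm[OF x] t(2)[OF x] by simp
      then have "d (Suc i) (?\<phi> x) = \<zero>\<^sub>(P i)"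
        using bimod_homD(1)[OF F dx[OF x]] by (simp add: P0.M.minus_eq P0.M.r_neg)
      then show ?thesis using exact_Suc bimod_homD(1)[OF \<phi> x] by blast
    qed
    from lift_step[OF \<phi> this] obtain t' where t': "t' \<in> bimod_hom A (P (n + Suc i)) (P (Suc (Suc i)))"
      "\<And>x. x \<in> carrier (P (n + Suc i)) ==> d (Suc (Suc i)) (t' x) = ?\<phi> x" by blast
    have "d (Suc (Suc i)) (t' (d (n + Suc (Suc i)) x)) = F (Suc i) (d (n + Suc (Suc i)) x)"
      if x: "x \<in> carrier (P (n + Suc (Suc i)))" for x
    proof -
      have dx': "d (n + Suc (Suc i)) x \<in> carrier (P (n + Suc i))" using d_closed x by simp
      have "d (n + Suc i) (d (n + Suc (Suc i)) x) = \<zero>\<^sub>(P (n + i))" using d_d x by simp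
      then show ?thesis
        using t'(2)[OF dx'] \<phi>'[OF dx'] hom_zero[OF t(1)] bimod_homD(1)[OF F dx'] by (simp add: a_minus_def)
    qed
    then show ?thesis using t' \<phi>' unfolding Q_def R_def by auto
  qed
  ultimately obtain t where "\<And>i. Q i (t i) \<and> R i (t i) (t (Suc i))"
    using dependent_nat_choice[of Q R] by blast
  then show ?thesis unfolding Q_def R_def by blast
qed

text \<open>The independence of the product from the lift and from the right representative rests on
  this. If \<epsilon> after \<open>F 0\<close> is g d, lift g along \<epsilon> to s; then F is
  homotopic to s d placed in degree 0. So the composite with f is the coboundary of f t for m > 0
  and of f s for m = 0. For n = 0 the coboundary is zero and u is taken to be zero.\<close>

lemma null_chain_map:
  assumes F: "\<And>i. F i \<in> bimod_hom A (P (n + i)) (P i)"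
    and comm: "\<And>i x. x \<in> carrier (P (n + Suc i)) ==> d (Suc i) (F (Suc i) x) = F i (d (n + Suc i) x)"
    and null: "compose (carrier (P n)) \<epsilon> (F 0) \<in> B n" and f: "f \<in> Z m"
  shows "compose (carrier (P (n + m))) f (F m) \<in> B (n + m)"
proof -
  have F0: "F 0 \<in> bimod_hom A (P n) (P 0)" using F[of 0] by simp
  have dh: "d (n + Suc i) \<in> bimod_hom A (P (n + Suc i)) (P (n + i))" for i using d_hom[of "n + i"] by simp
  interpret P0: k_bimodule A "P 0" by (rule P_bimodule)
  have "\<exists>u\<in>bimod_hom A (P n) (P 0). (\<forall>x\<in>carrier (P n). \<epsilon> (u x) = \<epsilon> (F 0 x)) \<and>
    (\<forall>x\<in>carrier (P (Suc n)). u (d (Suc n) x) = \<zero>\<^sub>(P 0)) \<and>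
    (\<forall>f\<in>Hom 0. compose (carrier (P n)) f u \<in> B n)"
  proof (cases n)
    case 0
    let ?u = "\<lambda>x\<in>carrier (P 0). \<zero>\<^sub>(P 0)"
    have u: "?u \<in> bimod_hom A (P 0) (P 0)" by (rule bimod_hom_zero[OF P_bimodule P_bimodule])
    have 1: "\<forall>x\<in>carrier (P n). \<epsilon> (?u x) = \<epsilon> (F 0 x)"
      using null 0 homM_zero[OF eps_hom] by (simp add: mem_coboundaries_0 compose_eq)
    have 2: "compose (carrier (P n)) f ?u \<in> B n" if f: "f \<in> Hom 0" for f
      using 0 compose_d_closed[OF f u] homM_zero[OF f] by (simp add: mem_coboundaries_0 compose_eq)
    show ?thesis using 0 u 1 2 d_closed by (intro bexI[of _ ?u]) auto
  next
    case (Suc k)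
    obtain g where g: "g \<in> Hom k" "\<And>x. x \<in> carrier (P n) ==> \<epsilon> (F 0 x) = g (d n x)"
      using null unfolding Suc mem_coboundaries_Suc by (auto simp: compose_eq)
    obtain s where s: "s \<in> bimod_hom A (P k) (P 0)" "\<And>x. x \<in> carrier (P k) ==> \<epsilon> (s x) = g x"
      using projective_lifting[OF P_projective P_bimodule M_bimodule g(1) eps_hom]
        eps_surj bimod_homD(1)[OF g(1)] by blast
    have dn: "d n \<in> bimod_hom A (P n) (P k)" using d_hom Suc by simp
    let ?u = "compose (carrier (P n)) s (d n)"
    have u: "?u \<in> bimod_hom A (P n) (P 0)" by (rule compose_d_closed[OF s(1) dn])
    have 1: "\<forall>x\<in>carrier (P n). \<epsilon> (?u x) = \<epsilon> (F 0 x)"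
      using g(2) s(2) bimod_homD(1)[OF dn] by (simp add: compose_eq)
    have 2: "\<forall>x\<in>carrier (P (Suc n)). ?u (d (Suc n) x) = \<zero>\<^sub>(P 0)"
      using d_closed d_d[of _ k] hom_zero[OF s(1)] Suc by (simp add: compose_eq)
    have 3: "compose (carrier (P n)) f ?u \<in> B n" if f: "f \<in> Hom 0" for f
    proof -
      have "compose (carrier (P n)) f ?u \<in> Hom n" by (rule compose_d_closed[OF f u])
      moreover have "compose (carrier (P k)) f s \<in> Hom k" by (rule compose_d_closed[OF f s(1)])
      moreover have "\<forall>x\<in>carrier (P n). compose (carrier (P n)) f ?u x = compose (carrier (P k)) f s (d n x)"
        using bimod_homD(1)[OF dn] by (simp add: compose_eq)
      ultimately show ?thesis unfolding Suc mem_coboundaries_Suc by blast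
    qed
    show ?thesis using u 1 2 3 by (intro bexI[of _ ?u]) auto
  qed
  then obtain u where u: "u \<in> bimod_hom A (P n) (P 0)" "\<And>x. x \<in> carrier (P n) ==> \<epsilon> (u x) = \<epsilon> (F 0 x)"
    "\<And>x. x \<in> carrier (P (Suc n)) ==> u (d (Suc n) x) = \<zero>\<^sub>(P 0)"
    "\<And>f. f \<in> Hom 0 ==> compose (carrier (P n)) f u \<in> B n" by blast
  obtain t where t: "\<And>i. t i \<in> bimod_hom A (P (n + i)) (P (Suc i))"
    "\<And>x. x \<in> carrier (P n) ==> d (Suc 0) (t 0 x) = F 0 x \<ominus>\<^sub>(P 0) u x"
    "\<And>i x. x \<in> carrier (P (n + Suc i)) ==>
      d (Suc (Suc i)) (t (Suc i) x) = F (Suc i) x \<ominus>\<^sub>(P (Suc i)) t i (d (n + Suc i) x)"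
    using chain_homotopy[OF F comm u(1-3)] by blast
  have fh: "f \<in> Hom m" and fd: "\<And>x. x \<in> carrier (P (Suc m)) ==> f (d (Suc m) x) = \<zero>\<^sub>M"
    using f by (auto simp: mem_cocycles)
  \<comment> \<open>A cocycle takes the same value on elements that differ by a boundary.\<close>
  have eq: "f x = f y" if "x \<in> carrier (P m)" "y \<in> carrier (P m)" "w \<in> carrier (P (Suc m))"
    "d (Suc m) w = x \<ominus>\<^sub>(P m) y" for x y w
  proof -
    have "f x \<ominus>\<^sub>M f y = \<zero>\<^sub>M" using fd[OF that(3)] homM_minus[OF fh that(1,2)] that(4) by simp
    then show ?thesis using M.M.minus_eq_zero[of "f x" "f y"] bimod_homD(1)[OF fh] that(1,2) by simp
  qed
  show ?thesis
  proof (cases m)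
    case 0
    have "compose (carrier (P n)) f (F 0) = compose (carrier (P n)) f u"
    proof (rule bimod_hom_eqI[OF compose_d_closed[OF _ F0] compose_d_closed[OF _ u(1)]])
      fix x assume x: "x \<in> carrier (P n)"
      have "t 0 x \<in> carrier (P (Suc 0))" using bimod_homD(1)[OF t(1)[of 0]] x by simp
      then show "compose (carrier (P n)) f (F 0) x = compose (carrier (P n)) f u x"
        using eq[of "F 0 x" "u x" "t 0 x"] x 0 t(2)[OF x] bimod_homD(1)[OF F0 x] bimod_homD(1)[OF u(1) x]
        by (simp add: compose_eq)
    qed (use fh 0 in auto)
    then show ?thesis using u(4) fh 0 by simp
  next
    case (Suc k)
    have tk: "t k \<in> bimod_hom A (P (n + k)) (P m)" using t(1)[of k] Suc by simp
    have "compose (carrier (P (n + m))) f (F m) x = compose (carrier (P (n + k))) f (t k) (d (n + Suc k) x)"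
      if x: "x \<in> carrier (P (n + Suc k))" for x
    proof -
      have dx: "d (n + Suc k) x \<in> carrier (P (n + k))" by (rule bimod_homD(1)[OF dh x])
      show ?thesis
        using eq[OF bimod_homD(1)[OF F, of x] bimod_homD(1)[OF tk dx], of "t m x"] t(3)[OF x]
          bimod_homD(1)[OF t(1)[of m]] x Suc dx by (simp add: compose_eq)
    qed
    moreover have "compose (carrier (P (n + k))) f (t k) \<in> Hom (n + k)" by (rule compose_d_closed[OF fh tk])
    moreover have "compose (carrier (P (n + m))) f (F m) \<in> Hom (n + m)" by (rule compose_d_closed[OF fh F])
    ultimately show ?thesis using mem_coboundaries_Suc[of _ "n + k"] Suc by auto
  qed
qed

end

context ext_resolution
begin

subsection \<open>The Yoneda product\<close>

lemma liftsD:
  assumes "F \<in> lifts n g"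
  shows "\<And>i. F i \<in> bimod_hom A (P (n + i)) (P i)" "\<And>x. x \<in> carrier (P n) ==> \<epsilon> (F 0 x) = g x"
    and "\<And>i x. x \<in> carrier (P (n + Suc i)) ==> d (Suc i) (F (Suc i) x) = F i (d (n + Suc i) x)"
  using assms unfolding mem_lifts by blast+

lemma d_hom': "d (n + Suc i) \<in> bimod_hom A (P (n + Suc i)) (P (n + i))"
  using d_hom[of "n + i"] by simp

lemma d_closed': "x \<in> carrier (P (n + Suc i)) ==> d (n + Suc i) x \<in> carrier (P (n + i))"
  by (rule bimod_homD(1)[OF d_hom'])

lemma lift_cocycle:
  assumes F: "F \<in> lifts n g" and f: "f \<in> Z m"
  shows "compose (carrier (P (n + m))) f (F m) \<in> Z (n + m)"
proof -
  have "compose (carrier (P (n + m))) f (F m) (d (Suc (n + m)) x) = \<zero>\<^sub>M"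
    if x: "x \<in> carrier (P (Suc (n + m)))" for x
    using liftsD(3)[OF F, of x m, symmetric] bimod_homD(1)[OF liftsD(1)[OF F], of x "Suc m"] x
      d_closed'[of x n m] f
    by (simp add: compose_eq mem_cocycles)
  then show ?thesis
    using compose_d_closed[OF cocycle_hom[OF f] liftsD(1)[OF F]] by (simp add: mem_cocycles)
qed

text \<open>The difference of the two lifts is a chain map over a coboundary, so
  \<open>null_chain_map\<close> applies to it.\<close>

lemma lift_class_indep:
  assumes f: "f \<in> Z m" and g: "g \<in> Z n" "g' \<in> Z n" "cls n g = cls n g'"
    and F: "F \<in> lifts n g" and F': "F' \<in> lifts n g'"
  shows "cls (n + m) (compose (carrier (P (n + m))) f (F m))
       = cls (n + m) (compose (carrier (P (n + m))) f (F' m))"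
proof -
  define D where "D i = (\<lambda>x\<in>carrier (P (n + i)). F i x \<ominus>\<^sub>(P i) F' i x)" for i
  note Fh = liftsD(1)[OF F] and Fh' = liftsD(1)[OF F']
  have D: "D i \<in> bimod_hom A (P (n + i)) (P i)" for i
    unfolding D_def by (rule bimod_hom_minus[OF P_bimodule P_bimodule Fh Fh'])
  have comm: "d (Suc i) (D (Suc i) x) = D i (d (n + Suc i) x)" if x: "x \<in> carrier (P (n + Suc i))" for i x
    using x d_closed'[OF x] hom_minus[OF d_hom bimod_homD(1)[OF Fh x] bimod_homD(1)[OF Fh' x]]
      liftsD(3)[OF F x] liftsD(3)[OF F' x]
    by (simp add: D_def)
  have gg: "g \<ominus>\<^sub>(HG n) g' \<in> B n"
    using cls_eq_iff[OF cocycle_hom[OF g(1)] cocycle_hom[OF g(2)]] g(3) by blast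
  have D0: "D 0 \<in> bimod_hom A (P n) (P 0)" using D[of 0] by simp
  have "compose (carrier (P n)) \<epsilon> (D 0) = g \<ominus>\<^sub>(HG n) g'"
  proof (rule bimod_hom_eqI[OF compose_d_closed[OF eps_hom D0] coboundaries_hom[OF gg]])
    fix x assume x: "x \<in> carrier (P n)"
    then show "compose (carrier (P n)) \<epsilon> (D 0) x = (g \<ominus>\<^sub>(HG n) g') x"
      using homM_minus[OF eps_hom bimod_homD(1)[OF Fh, of x 0] bimod_homD(1)[OF Fh', of x 0]]
        liftsD(2)[OF F x] liftsD(2)[OF F' x]
      by (simp add: compose_eq D_def HG_minus[OF cocycle_hom[OF g(1)] cocycle_hom[OF g(2)]])
  qed
  then have null: "compose (carrier (P (n + m))) f (D m) \<in> B (n + m)"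
    using null_chain_map[OF D comm _ f] gg by simp
  note c = compose_d_closed[OF cocycle_hom[OF f] Fh] compose_d_closed[OF cocycle_hom[OF f] Fh']
  have "compose (carrier (P (n + m))) f (F m) \<ominus>\<^sub>(HG (n + m)) compose (carrier (P (n + m))) f (F' m)
      = compose (carrier (P (n + m))) f (D m)"
    by (rule bimod_hom_eqI[OF HG_minus_hom[OF c] coboundaries_hom[OF null]])
      (simp add: HG_minus[OF c] compose_eq D_def homM_minus[OF cocycle_hom[OF f]
        bimod_homD(1)[OF Fh] bimod_homD(1)[OF Fh']])
  then show ?thesis using null cls_eq_iff[OF c] by simp
qed

text \<open>If f - f' is h d, then composing it with a component of F gives h F d, because F
  commutes with the differential.\<close>

lemma left_class_indep:
  assumes f: "f \<in> Z m" "f' \<in> Z m" "cls m f = cls m f'" and F: "F \<in> lifts n g"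
  shows "cls (n + m) (compose (carrier (P (n + m))) f (F m))
       = cls (n + m) (compose (carrier (P (n + m))) f' (F m))"
proof -
  note Fh = liftsD(1)[OF F, of m] and fh = cocycle_hom[OF f(1)] cocycle_hom[OF f(2)]
  note c = compose_d_closed[OF fh(1) Fh] compose_d_closed[OF fh(2) Fh]
  have ff: "f \<ominus>\<^sub>(HG m) f' \<in> B m" using cls_eq_iff[OF fh] f(3) by blast
  let ?D = "compose (carrier (P (n + m))) f (F m) \<ominus>\<^sub>(HG (n + m)) compose (carrier (P (n + m))) f' (F m)"
  have D: "?D x = (f \<ominus>\<^sub>(HG m) f') (F m x)" if "x \<in> carrier (P (n + m))" for x
    using that bimod_homD(1)[OF Fh that] by (simp add: HG_minus[OF c] HG_minus[OF fh] compose_eq)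
  have Dh: "?D \<in> Hom (n + m)" by (rule HG_minus_hom[OF c])
  have "?D \<in> B (n + m)"
  proof (cases m)
    case 0
    have z: "\<forall>x\<in>carrier (P (n + m)). ?D x = \<zero>\<^sub>M"
      using D ff bimod_homD(1)[OF Fh] 0 by (simp add: mem_coboundaries_0)
    have "?D = (\<lambda>x\<in>carrier (P (n + m)). \<zero>\<^sub>M)"
      by (rule bimod_hom_eqI[OF Dh HG_zero]) (use z in auto)
    then show ?thesis using additive_subgroup.zero_closed[OF coboundaries_subgroup, of "n + m"] by simp
  next
    case (Suc k)
    obtain h where h: "h \<in> Hom k" "\<And>x. x \<in> carrier (P m) ==> (f \<ominus>\<^sub>(HG m) f') x = h (d m x)"
      using ff unfolding Suc mem_coboundaries_Suc by blast
    have "?D x = compose (carrier (P (n + k))) h (F k) (d (Suc (n + k)) x)"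
      if x: "x \<in> carrier (P (Suc (n + k)))" for x
      using D[of x] h(2)[OF bimod_homD(1)[OF Fh, of x]] x liftsD(3)[OF F, of x k] Suc d_closed'[of x n k]
      by (simp add: compose_eq)
    then show ?thesis
      using Dh compose_d_closed[OF h(1) liftsD(1)[OF F]] mem_coboundaries_Suc[of ?D "n + k"] Suc by auto
  qed
  then show ?thesis using cls_eq_iff[OF c] by blast
qed

text \<open>The union in \<open>yoneda\<close> runs over all representatives and lifts; by
  independence it is a union of copies of one class.\<close>

lemma yoneda_eq:
  assumes f: "f \<in> Z m" and g: "g \<in> Z n" and F: "F \<in> lifts n g"
  shows "yon m n (cls m f) (cls n g) = cls (n + m) (compose (carrier (P (n + m))) f (F m))"
proof -
  have eq: "cls (n + m) (compose (carrier (P (n + m))) f' (F' m))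
      = cls (n + m) (compose (carrier (P (n + m))) f (F m))"
    if "f' \<in> cls m f" "g' \<in> cls n g" "F' \<in> lifts n g'" for f' g' F'
    using left_class_indep[OF mem_cls_cocycle(1)[OF f that(1)] f mem_cls_cocycle(2)[OF f that(1)] that(3)]
      lift_class_indep[OF f mem_cls_cocycle(1)[OF g that(2)] g mem_cls_cocycle(2)[OF g that(2)] that(3) F]
    by simp
  show ?thesis unfolding yoneda_def add.commute[of m n]
  proof (intro equalityI UN_least)
    show "cls (n + m) (compose (carrier (P (n + m))) f (F m)) \<subseteq> (\<Union>f\<in>cls m f. \<Union>g\<in>cls n g. \<Union>F\<in>lifts n g.
      cls (n + m) (compose (carrier (P (n + m))) f (F m)))"
      using cls_self[OF cocycle_hom[OF f]] cls_self[OF cocycle_hom[OF g]] F by blast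
  qed (simp add: eq)
qed

lemma ext_group_cases:
  assumes "X \<in> carrier (ExtG n)"
  obtains f where "f \<in> Z n" "X = cls n f"
  using assms by (auto simp: ext_group_simps(1))

lemma yoneda_closed:
  assumes X: "X \<in> carrier (ExtG m)" and Y: "Y \<in> carrier (ExtG n)"
  shows "yon m n X Y \<in> carrier (ExtG (m + n))"
proof -
  obtain f g F where "f \<in> Z m" "X = cls m f" "g \<in> Z n" "Y = cls n g" "F \<in> lifts n g"
    using ext_group_cases[OF X] ext_group_cases[OF Y] lifts_exist by metis
  then show ?thesis using yoneda_eq lift_cocycle by (simp add: cls_closed add.commute[of m n])
qed

lemma HG_plus_cocycle: "f \<in> Z n ==> g \<in> Z n ==> (\<lambda>x\<in>carrier (P n). f x \<oplus>\<^sub>M g x) \<in> Z n"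
  using additive_subgroup.a_closed[OF cocycles_subgroup, of f n g] by simp

lemma cls_plus:
  "f \<in> Hom n ==> g \<in> Hom n ==> cls n f \<oplus>\<^sub>(ExtG n) cls n g = cls n (\<lambda>x\<in>carrier (P n). f x \<oplus>\<^sub>M g x)"
  using cls_add[of f n g] by simp

lemma yoneda_add_left:
  assumes X: "X \<in> carrier (ExtG m)" "X' \<in> carrier (ExtG m)" and Y: "Y \<in> carrier (ExtG n)"
  shows "yon m n (X \<oplus>\<^sub>(ExtG m) X') Y = yon m n X Y \<oplus>\<^sub>(ExtG (m + n)) yon m n X' Y"
proof -
  obtain f f' g F where f: "f \<in> Z m" "X = cls m f" "f' \<in> Z m" "X' = cls m f'" "g \<in> Z n" "Y = cls n g"
    and F: "F \<in> lifts n g"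
    using ext_group_cases[OF X(1)] ext_group_cases[OF X(2)] ext_group_cases[OF Y] lifts_exist by metis
  note Fh = liftsD(1)[OF F, of m] and h = cocycle_hom[OF f(1)] cocycle_hom[OF f(3)]
  have "compose (carrier (P (n + m))) (\<lambda>x\<in>carrier (P m). f x \<oplus>\<^sub>M f' x) (F m)
      = (\<lambda>x\<in>carrier (P (n + m)). compose (carrier (P (n + m))) f (F m) x
          \<oplus>\<^sub>M compose (carrier (P (n + m))) f' (F m) x)"
    using bimod_homD(1)[OF Fh] by (auto simp: compose_def fun_eq_iff)
  then show ?thesis
    using yoneda_eq[OF HG_plus_cocycle[OF f(1,3)] f(5) F] yoneda_eq[OF f(1,5) F] yoneda_eq[OF f(3,5) F]
      cls_plus[OF h] cls_plus[OF compose_d_closed[OF h(1) Fh] compose_d_closed[OF h(2) Fh]]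
    by (simp add: f add.commute[of m n])
qed

lemma yoneda_add_right:
  assumes X: "X \<in> carrier (ExtG m)" and Y: "Y \<in> carrier (ExtG n)" "Y' \<in> carrier (ExtG n)"
  shows "yon m n X (Y \<oplus>\<^sub>(ExtG n) Y') = yon m n X Y \<oplus>\<^sub>(ExtG (m + n)) yon m n X Y'"
proof -
  obtain f g g' F F' where f: "f \<in> Z m" "X = cls m f" "g \<in> Z n" "Y = cls n g" "g' \<in> Z n" "Y' = cls n g'"
    and F: "F \<in> lifts n g" and F': "F' \<in> lifts n g'"
    using ext_group_cases[OF X] ext_group_cases[OF Y(1)] ext_group_cases[OF Y(2)] lifts_exist by metis
  note Fh = liftsD(1)[OF F] and Fh' = liftsD(1)[OF F']
  note fh = cocycle_hom[OF f(1)]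
  define S where "S i = (\<lambda>x\<in>carrier (P (n + i)). F i x \<oplus>\<^sub>(P i) F' i x)" for i
  have S: "S \<in> lifts n (\<lambda>x\<in>carrier (P n). g x \<oplus>\<^sub>M g' x)"
    unfolding mem_lifts
  proof (intro conjI allI ballI)
    show "S i \<in> bimod_hom A (P (n + i)) (P i)" for i
      unfolding S_def by (rule bimod_hom_plus[OF P_bimodule P_bimodule Fh Fh'])
    show "\<epsilon> (S 0 x) = (\<lambda>x\<in>carrier (P n). g x \<oplus>\<^sub>M g' x) x" if x: "x \<in> carrier (P n)" for x
      using x bimod_homD(3)[OF eps_hom bimod_homD(1)[OF Fh, of x 0] bimod_homD(1)[OF Fh', of x 0]]
        liftsD(2)[OF F x] liftsD(2)[OF F' x] by (simp add: S_def)
    show "d (Suc i) (S (Suc i) x) = S i (d (n + Suc i) x)" if x: "x \<in> carrier (P (n + Suc i))" for i x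
      using x bimod_homD(3)[OF d_hom bimod_homD(1)[OF Fh x] bimod_homD(1)[OF Fh' x]] d_closed'[OF x]
        liftsD(3)[OF F x] liftsD(3)[OF F' x] by (simp add: S_def)
  qed
  have "compose (carrier (P (n + m))) f (S m)
      = (\<lambda>x\<in>carrier (P (n + m)). compose (carrier (P (n + m))) f (F m) x
          \<oplus>\<^sub>M compose (carrier (P (n + m))) f (F' m) x)"
    using bimod_homD(3)[OF fh bimod_homD(1)[OF Fh] bimod_homD(1)[OF Fh']]
    by (auto simp: compose_def S_def fun_eq_iff)
  then show ?thesis
    using yoneda_eq[OF f(1) HG_plus_cocycle[OF f(3,5)] S] yoneda_eq[OF f(1,3) F] yoneda_eq[OF f(1,5) F']
      cls_plus[OF cocycle_hom[OF f(3)] cocycle_hom[OF f(5)]]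
      cls_plus[OF compose_d_closed[OF fh Fh] compose_d_closed[OF fh Fh']]
    by (simp add: f add.commute[of m n])
qed

text \<open>If G lifts g and H lifts h, then the composites of G with the shifted H lift the cocycle
  that represents the product of the classes of g and h.\<close>

lemma yoneda_assoc:
  assumes X: "X \<in> carrier (ExtG l)" and Y: "Y \<in> carrier (ExtG m)" and W: "W \<in> carrier (ExtG n)"
  shows "yon (l + m) n (yon l m X Y) W = yon l (m + n) X (yon m n Y W)"
proof -
  obtain f g h G H where f: "f \<in> Z l" "X = cls l f" "g \<in> Z m" "Y = cls m g" "h \<in> Z n" "W = cls n h"
    and G: "G \<in> lifts m g" and H: "H \<in> lifts n h"
    using ext_group_cases[OF X] ext_group_cases[OF Y] ext_group_cases[OF W] lifts_exist by metis
  note Gh = liftsD(1)[OF G] and Hh = liftsD(1)[OF H]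
  define K where "K i = compose (carrier (P (n + m + i))) (G i) (H (m + i))" for i
  have Hh': "H (m + i) \<in> bimod_hom A (P (n + m + i)) (P (m + i))" for i
    using Hh[of "m + i"] by (simp add: add.assoc)
  have K: "K \<in> lifts (n + m) (compose (carrier (P (n + m))) g (H m))"
    unfolding mem_lifts
  proof (intro conjI allI ballI)
    show "K i \<in> bimod_hom A (P (n + m + i)) (P i)" for i
      unfolding K_def by (rule compose_d_closed[OF Gh Hh'])
    show "\<epsilon> (K 0 x) = compose (carrier (P (n + m))) g (H m) x" if x: "x \<in> carrier (P (n + m))" for x
      using x liftsD(2)[OF G bimod_homD(1)[OF Hh x]] by (simp add: K_def compose_eq)
    show "d (Suc i) (K (Suc i) x) = K i (d (n + m + Suc i) x)" if x: "x \<in> carrier (P (n + m + Suc i))" for i x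
      using x liftsD(3)[OF G bimod_homD(1)[OF Hh'[of "Suc i"] x]] liftsD(3)[OF H, of x "m + i"]
        d_closed'[OF x] by (simp add: K_def compose_eq add.assoc)
  qed
  have gH: "compose (carrier (P (n + m))) g (H m) \<in> Z (n + m)" by (rule lift_cocycle[OF H f(3)])
  have fG: "compose (carrier (P (m + l))) f (G l) \<in> Z (m + l)" by (rule lift_cocycle[OF G f(1)])
  have "yon (l + m) n (yon l m X Y) W
      = cls (n + (m + l)) (compose (carrier (P (n + (m + l)))) (compose (carrier (P (m + l))) f (G l)) (H (m + l)))"
    using yoneda_eq[OF f(1,3) G] yoneda_eq[OF fG f(5) H] by (simp add: f add.commute[of l m])
  also have "compose (carrier (P (n + (m + l)))) (compose (carrier (P (m + l))) f (G l)) (H (m + l))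
      = compose (carrier (P (n + m + l))) f (K l)"
    using bimod_homD(1)[OF Hh, of _ "m + l"] by (auto simp: compose_def K_def fun_eq_iff add.assoc)
  also have "cls (n + (m + l)) \<dots> = yon l (n + m) X (yon m n Y W)"
    using yoneda_eq[OF f(3,5) H] yoneda_eq[OF f(1) gH K] by (simp add: f add.assoc)
  finally show ?thesis by (simp add: add.commute)
qed

lemma eps_cocycle: "\<epsilon> \<in> Z 0"
  using eps_hom eps_d by (simp add: mem_cocycles)

lemma yoneda_one_right:
  assumes X: "X \<in> carrier (ExtG m)"
  shows "yon m 0 X (cls 0 \<epsilon>) = X"
proof -
  obtain f where f: "f \<in> Z m" "X = cls m f" by (rule ext_group_cases[OF X])
  have I: "(\<lambda>i. \<lambda>x\<in>carrier (P i). x) \<in> lifts 0 \<epsilon>"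
    unfolding mem_lifts by (auto simp: d_closed intro!: bimod_hom_restrict[OF P_bimodule])
  have "compose (carrier (P m)) f (\<lambda>x\<in>carrier (P m). x) = f"
    using bimod_homD(2)[OF cocycle_hom[OF f(1)]] by (auto simp: compose_def fun_eq_iff extensional_def)
  then show ?thesis using yoneda_eq[OF f(1) eps_cocycle I] f by simp
qed

lemma yoneda_one_left:
  assumes Y: "Y \<in> carrier (ExtG n)"
  shows "yon 0 n (cls 0 \<epsilon>) Y = Y"
proof -
  obtain g F where g: "g \<in> Z n" "Y = cls n g" and F: "F \<in> lifts n g"
    using ext_group_cases[OF Y] lifts_exist by metis
  have "compose (carrier (P n)) \<epsilon> (F 0) = g"
    using bimod_homD(2)[OF cocycle_hom[OF g(1)]] liftsD(2)[OF F]
    by (auto simp: compose_def fun_eq_iff extensional_def)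
  then show ?thesis using yoneda_eq[OF eps_cocycle g(1) F] g by simp
qed

lemma yoneda_zero:
  assumes "X \<in> carrier (ExtG n)"
  shows "yon m n \<zero>\<^sub>(ExtG m) X = \<zero>\<^sub>(ExtG (m + n))" "yon n m X \<zero>\<^sub>(ExtG m) = \<zero>\<^sub>(ExtG (n + m))"
proof -
  have "(\<lambda>Y. yon m n Y X) \<in> add_hom (ExtG m) (ExtG (m + n))"
    using assms by (intro add_homI) (auto simp: yoneda_closed yoneda_add_left)
  from add_hom_zero[OF ext_group_abelian ext_group_abelian this]
  show "yon m n \<zero>\<^sub>(ExtG m) X = \<zero>\<^sub>(ExtG (m + n))" .
  have "(\<lambda>Y. yon n m X Y) \<in> add_hom (ExtG m) (ExtG (n + m))"
    using assms by (intro add_homI) (auto simp: yoneda_closed yoneda_add_right)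
  from add_hom_zero[OF ext_group_abelian ext_group_abelian this]
  show "yon n m X \<zero>\<^sub>(ExtG m) = \<zero>\<^sub>(ExtG (n + m))" .
qed

subsection \<open>The ring structure\<close>

abbreviation "E \<equiv> ext_algebra A M P d \<epsilon>"

lemma E_simps:
  "carrier E = {x. (\<forall>n. x n \<in> carrier (ExtG n)) \<and> finite {n. x n \<noteq> \<zero>\<^sub>(ExtG n)}}"
  "x \<otimes>\<^sub>E y = (\<lambda>n. \<Oplus>\<^sub>(ExtG n) i\<in>{..n}. yon i (n - i) (x i) (y (n - i)))"
  "\<one>\<^sub>E = in_degree A M P d 0 (cls 0 \<epsilon>)" "\<zero>\<^sub>E = (\<lambda>n. \<zero>\<^sub>(ExtG n))"
  "x \<oplus>\<^sub>E y = (\<lambda>n. x n \<oplus>\<^sub>(ExtG n) y n)"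
  "c \<odot>\<^sub>E x = (\<lambda>n. \<Union>f\<in>x n. cls n (\<lambda>u\<in>carrier (P n). scal A M c (f u)))"
  unfolding ext_algebra_def using res by (simp_all add: scal_def)

lemma E_component: "x \<in> carrier E ==> x n \<in> carrier (ExtG n)"
  by (simp add: E_simps)

lemma E_abelian_group: "abelian_group E"
proof (rule abelian_groupI)
  note grp = ext_group_abelian
  have z: "\<zero>\<^sub>(ExtG n) \<in> carrier (ExtG n)" for n by (rule abelian_monoid.zero_closed) (rule abelian_group.axioms(1)[OF grp])
  have lz: "\<zero>\<^sub>(ExtG n) \<oplus>\<^sub>(ExtG n) X = X" if "X \<in> carrier (ExtG n)" for n X
    by (rule abelian_monoid.l_zero[OF abelian_group.axioms(1)[OF grp] that])
  have cl: "X \<oplus>\<^sub>(ExtG n) Y \<in> carrier (ExtG n)" if "X \<in> carrier (ExtG n)" "Y \<in> carrier (ExtG n)" for n X Y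
    by (rule abelian_monoid.a_closed[OF abelian_group.axioms(1)[OF grp] that])
  fix x assume x: "x \<in> carrier E"
  show "\<zero>\<^sub>E \<oplus>\<^sub>E x = x" using E_component[OF x] by (simp add: E_simps lz)
  let ?y = "\<lambda>n. \<ominus>\<^sub>(ExtG n) x n"
  have neg: "?y n \<in> carrier (ExtG n)" "?y n \<oplus>\<^sub>(ExtG n) x n = \<zero>\<^sub>(ExtG n)" for n
    using abelian_group.a_inv_closed[OF grp E_component[OF x]] abelian_group.l_neg[OF grp E_component[OF x]]
    by auto
  have neg0: "?y n = \<zero>\<^sub>(ExtG n)" if "x n = \<zero>\<^sub>(ExtG n)" for n
  proof -
    interpret X: abelian_group "ExtG n" by (rule grp)
    show ?thesis using that by simp
  qed
  have "finite {n. ?y n \<noteq> \<zero>\<^sub>(ExtG n)}"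
    by (rule finite_subset[of _ "{n. x n \<noteq> \<zero>\<^sub>(ExtG n)}"]) (use neg0 x in \<open>auto simp: E_simps(1)\<close>)
  then have "?y \<in> carrier E" using neg by (simp add: E_simps(1))
  moreover have "?y \<oplus>\<^sub>E x = \<zero>\<^sub>E" using neg by (simp add: E_simps)
  ultimately show "\<exists>y\<in>carrier E. y \<oplus>\<^sub>E x = \<zero>\<^sub>E" by blast
  fix y assume y: "y \<in> carrier E"
  have "finite {n. x n \<oplus>\<^sub>(ExtG n) y n \<noteq> \<zero>\<^sub>(ExtG n)}"
    by (rule finite_subset[of _ "{n. x n \<noteq> \<zero>\<^sub>(ExtG n)} \<union> {n. y n \<noteq> \<zero>\<^sub>(ExtG n)}"])
      (use lz z x y in \<open>auto simp: E_simps(1)\<close>)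
  then show "x \<oplus>\<^sub>E y \<in> carrier E"
    using cl E_component[OF x] E_component[OF y] by (simp add: E_simps(1,5))
  show "x \<oplus>\<^sub>E y = y \<oplus>\<^sub>E x"
    unfolding E_simps
    by (rule ext) (rule abelian_monoid.a_comm[OF abelian_group.axioms(1)[OF grp] E_component[OF x] E_component[OF y]])
  fix w assume w: "w \<in> carrier E"
  show "x \<oplus>\<^sub>E y \<oplus>\<^sub>E w = x \<oplus>\<^sub>E (y \<oplus>\<^sub>E w)"
    unfolding E_simps
    by (rule ext) (rule abelian_monoid.a_assoc[OF abelian_group.axioms(1)[OF grp] E_component[OF x] E_component[OF y] E_component[OF w]])
next
  have "\<zero>\<^sub>(ExtG n) \<in> carrier (ExtG n)" for n
    by (rule abelian_monoid.zero_closed) (rule abelian_group.axioms(1)[OF ext_group_abelian])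
  then show "\<zero>\<^sub>E \<in> carrier E" by (simp add: E_simps)
qed

sublocale E: abelian_group E by (rule E_abelian_group)

abbreviation "indeg \<equiv> in_degree A M P d"

lemma ext_zero_closed: "\<zero>\<^sub>(ExtG n) \<in> carrier (ExtG n)"
  by (rule abelian_monoid.zero_closed) (rule abelian_group.axioms(1)[OF ext_group_abelian])

lemma in_degree_closed: "X \<in> carrier (ExtG n) ==> indeg n X \<in> carrier E"
  using ext_zero_closed
  by (auto simp: E_simps(1) in_degree_def intro: finite_subset[of _ "{n}"])

lemma E_induct [consumes 1, case_names zero hom add]:
  assumes x: "x \<in> carrier E" and zero: "Q \<zero>\<^sub>E"
    and hom: "\<And>n X. X \<in> carrier (ExtG n) ==> Q (indeg n X)"
    and add: "\<And>x y. x \<in> carrier E ==> y \<in> carrier E ==> Q x ==> Q y ==> Q (x \<oplus>\<^sub>E y)"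
  shows "Q x"
proof -
  define cut where "cut S = (\<lambda>n. if n \<in> S then x n else \<zero>\<^sub>(ExtG n))" for S
  have rz: "X \<oplus>\<^sub>(ExtG n) \<zero>\<^sub>(ExtG n) = X" "\<zero>\<^sub>(ExtG n) \<oplus>\<^sub>(ExtG n) X = X" if "X \<in> carrier (ExtG n)" for n X
    using abelian_monoid.r_zero[OF abelian_group.axioms(1)[OF ext_group_abelian] that]
      abelian_monoid.l_zero[OF abelian_group.axioms(1)[OF ext_group_abelian] that] by auto
  have "Q (cut S) \<and> cut S \<in> carrier E" if "finite S" for S using that
  proof (induction S)
    case empty
    have "cut {} = \<zero>\<^sub>E" by (simp add: cut_def E_simps)
    then show ?case using zero by simp
  next
    case (insert n S)
    have "cut (insert n S) = indeg n (x n) \<oplus>\<^sub>E cut S"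
      using insert(2) rz E_component[OF x] ext_zero_closed
      by (auto simp: cut_def in_degree_def E_simps(5) fun_eq_iff)
    then show ?case
      using insert add[OF in_degree_closed[OF E_component[OF x]], of "cut S" n] hom[OF E_component[OF x]]
        in_degree_closed[OF E_component[OF x], of n] by auto
  qed
  moreover have "cut {n. x n \<noteq> \<zero>\<^sub>(ExtG n)} = x" by (auto simp: cut_def fun_eq_iff)
  ultimately show ?thesis using x by (metis (no_types, lifting) E_simps(1) mem_Collect_eq)
qed

text \<open>Ring identities are checked on homogeneous elements, one argument at a time: with the
  other arguments fixed, both sides are additive.\<close>

lemma E_hom_eq:
  assumes "abelian_group G" "f \<in> add_hom E G" "g \<in> add_hom E G" "x \<in> carrier E"
    and "\<And>n X. X \<in> carrier (ExtG n) ==> f (indeg n X) = g (indeg n X)"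
  shows "f x = g x"
  using assms(4)
  by (induction rule: E_induct)
    (simp_all add: assms(5) add_hom_add[OF assms(2)] add_hom_add[OF assms(3)]
      add_hom_zero[OF E_abelian_group assms(1,2)] add_hom_zero[OF E_abelian_group assms(1,3)])

lemma yoneda_term_closed:
  assumes "x \<in> carrier E" "y \<in> carrier E" "i \<le> n"
  shows "yon i (n - i) (x i) (y (n - i)) \<in> carrier (ExtG n)"
  using yoneda_closed[OF E_component[OF assms(1)] E_component[OF assms(2)], of i "n - i"] assms(3) by simp

lemma E_mult_closed:
  assumes x: "x \<in> carrier E" and y: "y \<in> carrier E"
  shows "x \<otimes>\<^sub>E y \<in> carrier E"
proof -
  have cl: "(x \<otimes>\<^sub>E y) n \<in> carrier (ExtG n)" for n
  proof -
    interpret G: abelian_group "ExtG n" by (rule ext_group_abelian)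
    show ?thesis unfolding E_simps by (intro G.finsum_closed) (use yoneda_term_closed[OF x y] in auto)
  qed
  obtain a b where ab: "\<And>n. x n \<noteq> \<zero>\<^sub>(ExtG n) ==> n \<le> a" "\<And>n. y n \<noteq> \<zero>\<^sub>(ExtG n) ==> n \<le> b"
    using x y finite_nat_set_iff_bounded_le[of "{n. x n \<noteq> \<zero>\<^sub>(ExtG n)}"]
      finite_nat_set_iff_bounded_le[of "{n. y n \<noteq> \<zero>\<^sub>(ExtG n)}"] by (auto simp: E_simps(1))
  have "(x \<otimes>\<^sub>E y) n = \<zero>\<^sub>(ExtG n)" if n: "n > a + b" for n
  proof -
    interpret G: abelian_group "ExtG n" by (rule ext_group_abelian)
    have "yon i (n - i) (x i) (y (n - i)) = \<zero>\<^sub>(ExtG n)" if i: "i \<in> {..n}" for i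
    proof (cases "i \<le> a")
      case True
      then have "y (n - i) = \<zero>\<^sub>(ExtG (n - i))" using ab(2)[of "n - i"] n by linarith
      then show ?thesis using yoneda_zero(2)[OF E_component[OF x], of i "n - i"] i by simp
    next
      case False
      then have "x i = \<zero>\<^sub>(ExtG i)" using ab(1)[of i] by linarith
      then show ?thesis using yoneda_zero(1)[OF E_component[OF y], of i "n - i"] i by simp
    qed
    then show ?thesis unfolding E_simps by (intro G.add.finprod_one_eqI) auto
  qed
  then have "{n. (x \<otimes>\<^sub>E y) n \<noteq> \<zero>\<^sub>(ExtG n)} \<subseteq> {..a + b}" by (auto simp: not_less[symmetric])
  then show ?thesis using cl finite_subset[OF _ finite_atMost] unfolding E_simps(1) by blast
qed

lemma E_distr:
  assumes x: "x \<in> carrier E" and x': "x' \<in> carrier E" and y: "y \<in> carrier E"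
  shows "(x \<oplus>\<^sub>E x') \<otimes>\<^sub>E y = x \<otimes>\<^sub>E y \<oplus>\<^sub>E x' \<otimes>\<^sub>E y"
    and "y \<otimes>\<^sub>E (x \<oplus>\<^sub>E x') = y \<otimes>\<^sub>E x \<oplus>\<^sub>E y \<otimes>\<^sub>E x'"
proof -
  have "((x \<oplus>\<^sub>E x') \<otimes>\<^sub>E y) n = (x \<otimes>\<^sub>E y \<oplus>\<^sub>E x' \<otimes>\<^sub>E y) n \<and>
      (y \<otimes>\<^sub>E (x \<oplus>\<^sub>E x')) n = (y \<otimes>\<^sub>E x \<oplus>\<^sub>E y \<otimes>\<^sub>E x') n" for n
  proof -
    interpret G: abelian_group "ExtG n" by (rule ext_group_abelian)
    have l: "yon i (n - i) (x i \<oplus>\<^sub>(ExtG i) x' i) (y (n - i))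
        = yon i (n - i) (x i) (y (n - i)) \<oplus>\<^sub>(ExtG n) yon i (n - i) (x' i) (y (n - i))" if "i \<le> n" for i
      using yoneda_add_left[OF E_component[OF x] E_component[OF x'] E_component[OF y], of i "n - i"] that
      by simp
    have r: "yon i (n - i) (y i) (x (n - i) \<oplus>\<^sub>(ExtG (n - i)) x' (n - i))
        = yon i (n - i) (y i) (x (n - i)) \<oplus>\<^sub>(ExtG n) yon i (n - i) (y i) (x' (n - i))" if "i \<le> n" for i
      using yoneda_add_right[OF E_component[OF y] E_component[OF x] E_component[OF x'], of i "n - i"] that
      by simp
    note cl = yoneda_term_closed[OF x y] yoneda_term_closed[OF x' y]
      yoneda_term_closed[OF y x] yoneda_term_closed[OF y x']
    have "(\<Oplus>\<^sub>(ExtG n) i\<in>{..n}. yon i (n - i) (x i \<oplus>\<^sub>(ExtG i) x' i) (y (n - i)))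
        = (\<Oplus>\<^sub>(ExtG n) i\<in>{..n}. yon i (n - i) (x i) (y (n - i)) \<oplus>\<^sub>(ExtG n) yon i (n - i) (x' i) (y (n - i)))"
      by (rule G.finsum_cong') (use l cl in auto)
    moreover have "(\<Oplus>\<^sub>(ExtG n) i\<in>{..n}. yon i (n - i) (y i) (x (n - i) \<oplus>\<^sub>(ExtG (n - i)) x' (n - i)))
        = (\<Oplus>\<^sub>(ExtG n) i\<in>{..n}. yon i (n - i) (y i) (x (n - i)) \<oplus>\<^sub>(ExtG n) yon i (n - i) (y i) (x' (n - i)))"
      by (rule G.finsum_cong') (use r cl in auto)
    ultimately show ?thesis unfolding E_simps
      using G.finsum_addf[of "\<lambda>i. yon i (n - i) (x i) (y (n - i))" "{..n}" "\<lambda>i. yon i (n - i) (x' i) (y (n - i))"]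
        G.finsum_addf[of "\<lambda>i. yon i (n - i) (y i) (x (n - i))" "{..n}" "\<lambda>i. yon i (n - i) (y i) (x' (n - i))"] cl
      by auto
  qed
  then show "(x \<oplus>\<^sub>E x') \<otimes>\<^sub>E y = x \<otimes>\<^sub>E y \<oplus>\<^sub>E x' \<otimes>\<^sub>E y"
    "y \<otimes>\<^sub>E (x \<oplus>\<^sub>E x') = y \<otimes>\<^sub>E x \<oplus>\<^sub>E y \<otimes>\<^sub>E x'" by blast+
qed

lemma in_degree_mult:
  assumes X: "X \<in> carrier (ExtG m)" and Y: "Y \<in> carrier (ExtG n)"
  shows "indeg m X \<otimes>\<^sub>E indeg n Y = indeg (m + n) (yon m n X Y)"
proof
  fix k
  interpret G: abelian_group "ExtG k" by (rule ext_group_abelian)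
  let ?t = "\<lambda>i. yon i (k - i) (indeg m X i) (indeg n Y (k - i))"
  have Xc: "indeg m X i \<in> carrier (ExtG i)" "indeg n Y i \<in> carrier (ExtG i)" for i
    using E_component in_degree_closed X Y by blast+
  have zero: "?t i = \<zero>\<^sub>(ExtG k)" if "i \<le> k" "i \<noteq> m \<or> k \<noteq> m + n" for i
  proof (cases "i = m")
    case True
    then have "indeg n Y (k - i) = \<zero>\<^sub>(ExtG (k - i))" using that by (auto simp: in_degree_def)
    then show ?thesis using yoneda_zero(2)[OF Xc(1), of i "k - i"] that by simp
  next
    case False
    then have "indeg m X i = \<zero>\<^sub>(ExtG i)" by (simp add: in_degree_def)
    then show ?thesis using yoneda_zero(1)[OF Xc(2), of i "k - i"] that by simp
  qed
  show "(indeg m X \<otimes>\<^sub>E indeg n Y) k = indeg (m + n) (yon m n X Y) k"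
  proof (cases "k = m + n")
    case True
    have "(\<Oplus>\<^sub>(ExtG k) i\<in>{..k}. ?t i) = (\<Oplus>\<^sub>(ExtG k) i\<in>{m}. ?t i)"
      by (rule G.add.finprod_mono_neutral_cong_right)
        (use True zero yoneda_term_closed[OF in_degree_closed[OF X] in_degree_closed[OF Y]] in auto)
    also have "\<dots> = ?t m"
    proof -
      have "?t m \<in> carrier (ExtG k)"
        by (rule yoneda_term_closed[OF in_degree_closed[OF X] in_degree_closed[OF Y]]) (use True in simp)
      then show ?thesis by (simp add: G.finsum_insert)
    qed
    also have "\<dots> = yon m n X Y" using True by (simp add: in_degree_def)
    finally show ?thesis using True by (simp add: E_simps(2) in_degree_def)
  next
    case False
    have "(\<Oplus>\<^sub>(ExtG k) i\<in>{..k}. ?t i) = \<zero>\<^sub>(ExtG k)"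
      by (rule G.add.finprod_one_eqI) (use False zero in auto)
    then show ?thesis using False by (simp add: E_simps(2) in_degree_def)
  qed
qed

lemma E_left_hom: "x \<in> carrier E ==> (\<lambda>y. x \<otimes>\<^sub>E y) \<in> add_hom E E"
  by (rule add_homI) (auto simp: E_mult_closed E_distr)

lemma E_right_hom: "x \<in> carrier E ==> (\<lambda>y. y \<otimes>\<^sub>E x) \<in> add_hom E E"
  by (rule add_homI) (auto simp: E_mult_closed E_distr)

lemma E_one_closed: "\<one>\<^sub>E \<in> carrier E"
  unfolding E_simps(3) by (rule in_degree_closed[OF cls_closed[OF eps_cocycle]])

lemma E_ring: "ring E"
proof (rule ringI[OF E_abelian_group monoidI])
  note grp = E_abelian_group and l = E_left_hom and r = E_right_hom
  have id: "(\<lambda>x. x) \<in> add_hom E E" by (auto simp: add_hom_def)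
  fix x assume x: "x \<in> carrier E"
  show "\<one>\<^sub>E \<otimes>\<^sub>E x = x"
    by (rule E_hom_eq[OF grp l[OF E_one_closed] id x])
      (simp add: E_simps(3) in_degree_mult cls_closed eps_cocycle yoneda_one_left)
  show "x \<otimes>\<^sub>E \<one>\<^sub>E = x"
    by (rule E_hom_eq[OF grp r[OF E_one_closed] id x])
      (simp add: E_simps(3) in_degree_mult cls_closed eps_cocycle yoneda_one_right)
  fix y z assume y: "y \<in> carrier E" and z: "z \<in> carrier E"
  have 1: "indeg n X \<otimes>\<^sub>E indeg m Y \<otimes>\<^sub>E z = indeg n X \<otimes>\<^sub>E (indeg m Y \<otimes>\<^sub>E z)"
    if X: "X \<in> carrier (ExtG n)" and Y: "Y \<in> carrier (ExtG m)" for n m X Y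
    by (rule E_hom_eq[OF grp l[OF E_mult_closed] add_hom_comp[OF l l] z])
      (simp_all add: X Y in_degree_closed in_degree_mult yoneda_closed yoneda_assoc add.assoc)
  have 2: "indeg n X \<otimes>\<^sub>E y \<otimes>\<^sub>E z = indeg n X \<otimes>\<^sub>E (y \<otimes>\<^sub>E z)" if X: "X \<in> carrier (ExtG n)" for n X
    by (rule E_hom_eq[OF grp add_hom_comp[OF l[OF in_degree_closed[OF X]] r[OF z]]
          add_hom_comp[OF r[OF z] l[OF in_degree_closed[OF X]]] y])
      (simp add: 1 X)
  show "x \<otimes>\<^sub>E y \<otimes>\<^sub>E z = x \<otimes>\<^sub>E (y \<otimes>\<^sub>E z)"
    by (rule E_hom_eq[OF grp add_hom_comp[OF r[OF y] r[OF z]] r[OF E_mult_closed[OF y z]] x]) (simp add: 2)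
qed (auto simp: E_mult_closed E_one_closed E_distr)

text \<open>The scalar multiple is a union over representatives; it collapses to one class because
  scalar multiples of coboundaries are coboundaries.\<close>

lemma E_smult_in_degree:
  assumes f: "f \<in> Z n"
  shows "c \<odot>\<^sub>E indeg n (cls n f) = indeg n (cls n (\<lambda>u\<in>carrier (P n). scal A M c (f u)))"
    and "(\<lambda>u\<in>carrier (P n). scal A M c (f u)) \<in> Z n"
proof -
  let ?s = "\<lambda>k f. \<lambda>u\<in>carrier (P k). scal A M c (f u)"
  have sh: "?s k f \<in> Hom k" if "f \<in> Hom k" for f k
    by (rule bimod_hom_scale[OF P_bimodule M_bimodule that])
  show sZ: "?s n f \<in> Z n" using f sh[OF cocycle_hom[OF f]] d_closed by (simp add: mem_cocycles)
  have B: "?s k g \<in> B k" if g: "g \<in> B k" for k g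
  proof (cases k)
    case 0
    then show ?thesis using g sh[OF coboundaries_hom[OF g]] by (simp add: mem_coboundaries_0)
  next
    case (Suc j)
    then obtain h where h: "h \<in> Hom j" "\<forall>x\<in>carrier (P k). g x = h (d k x)"
      using g by (auto simp: mem_coboundaries_Suc)
    then have "\<forall>x\<in>carrier (P k). ?s k g x = ?s j h (d k x)" using Suc d_closed by simp
    then show ?thesis using sh[OF coboundaries_hom[OF g]] sh[OF h(1)] Suc mem_coboundaries_Suc by blast
  qed
  have cong: "cls k (?s k g) = cls k (?s k f)" if f: "f \<in> Hom k" and g: "g \<in> cls k f" for k f g
  proof -
    have g': "g \<in> Hom k" "g \<ominus>\<^sub>(HG k) f \<in> B k" using g mem_cls_iff[OF f] by blast+
    have "?s k g \<ominus>\<^sub>(HG k) ?s k f = ?s k (g \<ominus>\<^sub>(HG k) f)"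
      unfolding HG_minus[OF sh[OF g'(1)] sh[OF f]] HG_minus[OF g'(1) f]
      using bimod_homD(1)[OF g'(1)] bimod_homD(1)[OF f]
        add_hom_minus[OF M.M.abelian_group_axioms M.M.abelian_group_axioms M.sc_add_hom]
      by (auto intro!: restrict_ext)
    then show ?thesis using cls_eq_iff[OF sh[OF g'(1)] sh[OF f]] B[OF g'(2)] by simp
  qed
  have un: "(\<Union>g\<in>cls k f. cls k (?s k g)) = cls k (?s k f)" if f: "f \<in> Hom k" for k f
    using cong[OF f] cls_self[OF f] by blast
  have z: "(\<Union>g\<in>\<zero>\<^sub>(ExtG k). cls k (?s k g)) = \<zero>\<^sub>(ExtG k)" for k
  proof -
    have "?s k (\<lambda>x\<in>carrier (P k). \<zero>\<^sub>M) = (\<lambda>x\<in>carrier (P k). \<zero>\<^sub>M)" by (auto simp: fun_eq_iff)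
    then show ?thesis using un[OF HG_zero, of k] cls_zero[of k] by simp
  qed
  show "c \<odot>\<^sub>E indeg n (cls n f) = indeg n (cls n (?s n f))"
    using un[OF cocycle_hom[OF f]] z by (auto simp: E_simps(6) in_degree_def fun_eq_iff)
qed

end

section \<open>The algebra \<open>\<Lambda>\<^sub>N\<close>\<close>

fun flip :: "arrow => arrow" where
  "flip Arr = Arr_bar" | "flip Arr_bar = Arr"

lemma flip_flip [simp]: "flip (flip x) = x" by (cases x) auto
lemma flip_neq [simp]: "flip x \<noteq> x" "x \<noteq> flip x" by (cases x; simp)+
lemma neq_flip: "x \<noteq> y \<longleftrightarrow> y = flip x" by (cases x; cases y) auto

fun alt :: "arrow => nat => arrow list" where
  "alt x 0 = []" | "alt x (Suc n) = alt (flip x) n @ [x]"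

text \<open>\<open>alt x n\<close> is the alternating word of length \<open>n\<close> that \<^emph>\<open>ends\<close> with \<open>x\<close>.\<close>

lemma length_alt [simp]: "length (alt x n) = n" by (induction n arbitrary: x) auto

lemma alt_eq_Nil [simp]: "alt x n = [] \<longleftrightarrow> n = 0" by (cases n) auto

lemma last_alt: "n > 0 ==> last (alt x n) = x" by (cases n) auto

lemma butlast_alt: "butlast (alt x n) = alt (flip x) (n - 1)" by (cases n) auto

lemma hd_alt: "n > 0 ==> hd (alt x n) = (if odd n then x else flip x)"
  by (induction n arbitrary: x) (auto simp: hd_append)

lemma alt_eq_iff: "alt x n = alt y m \<longleftrightarrow> n = m \<and> (n = 0 \<or> x = y)"
  by (metis length_alt last_alt alt.simps(1) neq0_conv)

lemma distinct_adj_alt [simp]: "distinct_adj (alt x n)"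
  by (induction n arbitrary: x) (auto simp: distinct_adj_append_iff last_alt)

lemma distinct_adj_imp_alt: "distinct_adj u ==> u = alt (last u) (length u)"
proof (induction u rule: rev_induct)
  case (snoc x u)
  have "distinct_adj u" "u \<noteq> [] ==> last u \<noteq> x"
    using snoc.prems by (auto simp: distinct_adj_append_iff)
  then show ?case using snoc.IH by (cases "u = []") (auto simp: neq_flip)
qed simp

text \<open>The left word must end with the letter that the right word does not begin with, and the
  first letter of an alternating word depends on the parity of its length.\<close>

lemma alt_append: "alt (if even n then x else flip x) m @ alt x n = alt x (m + n)"
proof (induction n arbitrary: x)
  case (Suc n)
  have "alt (if even (Suc n) then x else flip x) m @ alt x (Suc n)
      = (alt (if even n then flip x else flip (flip x)) m @ alt (flip x) n) @ [x]"
    by simp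
  then show ?case using Suc[of "flip x"] by simp
qed simp

lemma path_elt_mult: "path_elt u * path_elt v = path_elt (u @ v)"
  unfolding path_elt_def by (simp add: mult_single)

lemma path_elt_Nil: "path_elt [] = 1"
  unfolding path_elt_def by (simp flip: zero_path_def)

lemma path_elt_pow: "path_elt [y, x] ^ n = path_elt (alt x (2 * n))" if "y = flip x"
  by (induction n) (use that in \<open>simp_all add: path_elt_Nil path_elt_mult power_Suc2 del: power_Suc\<close>)

lemma lookup_path_mult:
  "lookup (f * g) (Path u) =
    (\<Sum>i\<le>length u. lookup f (Path (take i u)) * lookup g (Path (drop i u)))"
  for f g :: "path \<Rightarrow>\<^sub>0 'k::field"
  using subset_UNIV[of "keys f"]
proof (induction f rule: poly_mapping_add_induct)
  case (single k c)
  show ?case using subset_UNIV[of "keys g"]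
  proof (induction g rule: poly_mapping_add_induct)
    case (single l e)
    obtain v w where vw: "k = Path v" "l = Path w" by (cases k; cases l)
    show ?case
    proof (cases "u = v @ w")
      case True
      have "(\<Sum>i\<le>length u. lookup (single k c) (Path (take i u))
            * lookup (single l e) (Path (drop i u)))
          = (\<Sum>i\<le>length u. if i = length v then c * e else 0)"
      proof (rule sum.cong[OF refl])
        fix i assume "i \<in> {..length u}"
        then have "take i u \<noteq> v" if "i \<noteq> length v" using that by auto
        then show "lookup (single k c) (Path (take i u))
            * lookup (single l e) (Path (drop i u)) = (if i = length v then c * e else 0)"
          using True vw by (cases "i = length v") (auto simp: lookup_single when_def)
      qed
      then show ?thesis using True vw by (simp add: mult_single lookup_single)
    next
      case False
      have "(\<Sum>i\<le>length u. lookup (single k c) (Path (take i u))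
            * lookup (single l e) (Path (drop i u))) = 0"
        using False vw by (intro sum.neutral) (auto simp: lookup_single when_def)
      then show ?thesis using False vw by (simp add: mult_single lookup_single when_def)
    qed
  qed (simp_all add: distrib_left lookup_add sum.distrib)
qed (simp_all add: distrib_right lookup_add sum.distrib)

locale lambda_algebra =
  fixes N :: nat and field_type :: "'k::field itself"
  assumes N_gt: "N > 1"
begin

abbreviation L :: "('k, 'k lam) module" where "L \<equiv> Lambda N"
abbreviation I :: "(path \<Rightarrow>\<^sub>0 'k) set" where "I \<equiv> Lambda_ideal N"

definition lam :: "(path \<Rightarrow>\<^sub>0 'k) => 'k lam" where
  "lam f = I +>\<^sub>monoid_algebra f"

definition wd :: "arrow list => 'k lam" where
  "wd u = lam (path_elt u)"

definition normal :: "arrow list => bool" where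
  "normal u \<longleftrightarrow> distinct_adj u \<and> length u \<le> 2 * N"

lemma Lambda_ideal_eq: "I = Idl\<^bsub>monoid_algebra\<^esub> {path_elt [Arr, Arr], path_elt [Arr_bar, Arr_bar],
    path_elt (alt Arr_bar (2 * N)) - path_elt (alt Arr (2 * N))}"
  unfolding Lambda_ideal_def Let_def path_elt_mult by (simp add: path_elt_pow)

lemma ideal_I: "ideal I monoid_algebra"
  unfolding Lambda_ideal_eq by (rule monoid_algebra.genideal_ideal) simp

lemma I_gens: "path_elt [x, x] \<in> I" "path_elt (alt x (2 * N)) - path_elt (alt y (2 * N)) \<in> I"
proof -
  interpret Id: ideal I monoid_algebra by (rule ideal_I)
  have g: "path_elt [Arr, Arr] \<in> I" "path_elt [Arr_bar, Arr_bar] \<in> I"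
    "path_elt (alt Arr_bar (2 * N)) - path_elt (alt Arr (2 * N)) \<in> I"
    unfolding Lambda_ideal_eq by (rule subsetD[OF monoid_algebra.genideal_self]; simp)+
  then show "path_elt [x, x] \<in> I" by (cases x) auto
  have "path_elt (alt Arr (2 * N)) - path_elt (alt Arr_bar (2 * N)) \<in> I" "0 \<in> I"
    using Id.a_inv_closed[OF g(3)] Id.zero_closed by simp_all
  then show "path_elt (alt x (2 * N)) - path_elt (alt y (2 * N)) \<in> I"
    using g(3) by (cases x; cases y) auto
qed

sublocale k_algebra L
  unfolding Lambda_def by (rule quot_algebra_k_algebra[OF monoid_algebra.k_algebra_axioms ideal_I])

abbreviation L_mult (infixl "\<cdot>" 70) where "L_mult \<equiv> monoid.mult L"

lemmas L_simps = quot_algebra_simps[OF monoid_algebra.ring_axioms ideal_I, folded Lambda_def, simplified]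

lemma lam_closed [simp, intro]: "lam f \<in> carrier L"
  unfolding L_simps lam_def by simp

lemma lam_cases:
  assumes "x \<in> carrier L"
  obtains f where "x = lam f"
  using assms unfolding L_simps lam_def by auto

lemma lam_add: "lam (f + g) = lam f \<oplus>\<^sub>L lam g"
  unfolding lam_def L_simps ..

lemma lam_mult: "lam (f * g) = lam f \<cdot> lam g"
  unfolding lam_def L_simps ..

lemma lam_one: "lam 1 = \<one>\<^sub>L"
  unfolding lam_def L_simps ..

lemma lam_smult: "c \<odot>\<^sub>L lam f = lam (single 0 c * f)"
  unfolding lam_def Lambda_def by (subst quot_algebra_smult[OF monoid_algebra.k_algebra_axioms ideal_I]) simp_all

lemma lam_eq_iff: "lam f = lam g \<longleftrightarrow> f - g \<in> I"
  unfolding lam_def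
  using coset_eq_iff[OF monoid_algebra.is_abelian_group ideal.axioms(1)[OF ideal_I], of f g] by simp

lemma lam_zero: "lam 0 = \<zero>\<^sub>L"
  unfolding lam_def L_simps using coset_zero[OF monoid_algebra.is_abelian_group ideal.axioms(1)[OF ideal_I]] by simp

lemma lam_zero_iff: "lam f = \<zero>\<^sub>L \<longleftrightarrow> f \<in> I"
  using lam_eq_iff[of f 0] lam_zero by simp

lemma lam_uminus: "lam (- f) = \<ominus>\<^sub>L lam f"
  by (rule minus_equality[symmetric]) (auto simp: lam_zero simp flip: lam_add)

lemma lam_single: "lam (single (Path u) c) = c \<odot>\<^sub>L wd u"
  unfolding wd_def lam_smult path_elt_def by (simp add: mult_single zero_path_def)

lemma wd_closed [simp, intro]: "wd u \<in> carrier L"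
  unfolding wd_def by simp

lemma wd_mult: "wd u \<cdot> wd v = wd (u @ v)"
  unfolding wd_def by (simp flip: lam_mult add: path_elt_mult)

lemma wd_Nil: "wd [] = \<one>\<^sub>L"
  unfolding wd_def path_elt_Nil by (rule lam_one)

lemma Lambda_arrow_wd: "Lambda_arrow N x = wd [x]"
  unfolding Lambda_arrow_def wd_def lam_def ..

lemma wd_socle: "wd (alt x (2 * N)) = wd (alt y (2 * N))"
  unfolding wd_def lam_eq_iff by (rule I_gens)

lemma wd_square: "wd (u @ [x, x] @ v) = \<zero>\<^sub>L"
proof -
  have "wd [x, x] = \<zero>\<^sub>L" unfolding wd_def lam_zero_iff by (rule I_gens)
  then show ?thesis by (simp flip: wd_mult del: append.simps)
qed

text \<open>A word with two equal neighbours contains a generator of the ideal. An alternating word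
  of length above 2N ends in one of length 2N; exchanging that for the other word of length 2N puts
  two equal letters side by side.\<close>

lemma wd_not_normal:
  assumes "\<not> normal u"
  shows "wd u = \<zero>\<^sub>L"
proof (cases "distinct_adj u")
  case False
  then have "\<exists>v x w. u = v @ [x, x] @ w"
  proof (induction u rule: induct_list012)
    case (3 x y zs)
    show ?case
    proof (cases "x = y")
      case True
      then show ?thesis by (intro exI[of _ "[]"] exI[of _ x] exI[of _ zs]) simp
    next
      case False
      then obtain v z w where "y # zs = v @ [z, z] @ w" using 3 by auto
      then show ?thesis by (intro exI[of _ "x # v"] exI[of _ z] exI[of _ w]) simp
    qed
  qed auto
  then show ?thesis using wd_square by auto
next
  case True
  then obtain k where k: "length u = Suc k + 2 * N" using assms unfolding normal_def
    by (metis add.commute add_Suc_right less_imp_Suc_add not_le)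
  define x where "x = last u"
  have u: "u = alt x (Suc k + 2 * N)" using distinct_adj_imp_alt[OF True] k x_def by simp
  have "u = alt x (Suc k) @ alt x (2 * N)" unfolding u using alt_append[of "2 * N" x "Suc k"] by simp
  then have "wd u = wd (alt x (Suc k)) \<cdot> wd (alt (flip x) (2 * N))"
    unfolding wd_socle[of "flip x" x] wd_mult by simp
  also have "\<dots> = wd (alt x (Suc k) @ alt (flip x) (2 * N))" by (rule wd_mult)
  also have "alt (flip x) (2 * N) = x # tl (alt (flip x) (2 * N))"
    using hd_alt[of "2 * N" "flip x"] N_gt by (cases "alt (flip x) (2 * N)") auto
  also have "alt x (Suc k) @ x # tl (alt (flip x) (2 * N))
      = alt (flip x) k @ [x, x] @ tl (alt (flip x) (2 * N))" by simp
  finally show ?thesis by (simp add: wd_square del: append.simps)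
qed

subsection \<open>Coefficients of normal words\<close>

text \<open>Conditions that hold on the defining ideal, so that the coefficients involved descend to
  the quotient. There the two alternating words of length 2N are identified, which leaves only the
  sum of their coefficients.\<close>

definition vanish :: "(path \<Rightarrow>\<^sub>0 'k) => bool" where
  "vanish f \<longleftrightarrow> (\<forall>b. distinct_adj b \<and> length b < 2 * N \<longrightarrow> lookup f (Path b) = 0) \<and>
     lookup f (Path (alt Arr (2 * N))) + lookup f (Path (alt Arr_bar (2 * N))) = 0"

lemma distinct_adj_take_drop: "distinct_adj b ==> distinct_adj (take i b) \<and> distinct_adj (drop i b)"
  using distinct_adj_append_iff[of "take i b" "drop i b"] by simp

text \<open>A coefficient of a product is a sum over the ways to split the word, and the pieces of a
  short alternating word are short and alternating. For a word of length 2N only the split in which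
  f receives the whole word survives, with the same scalar for both such words.\<close>

lemma vanish_mult:
  assumes "vanish f"
  shows "vanish (g * f)" "vanish (f * g)"
proof -
  have z: "lookup f (Path b) = 0" if "distinct_adj b" "length b < 2 * N" for b
    using assms that unfolding vanish_def by blast
  have zt: "lookup f (Path (take i b)) = 0" "lookup f (Path (drop i b)) = 0"
    if "distinct_adj b" "length b < 2 * N" for b i
    using that distinct_adj_take_drop[OF that(1)] by (intro z; force)+
  have s: "lookup f (Path (alt Arr (2 * N))) = - lookup f (Path (alt Arr_bar (2 * N)))"
    using assms unfolding vanish_def by (simp add: add_eq_0_iff2)
  have l: "lookup (g * f) (Path (alt x (2 * N)))
      = lookup g (Path []) * lookup f (Path (alt x (2 * N)))" for x
  proof -
    have "lookup (g * f) (Path (alt x (2 * N))) = (\<Sum>i\<in>{0}. lookup g (Path (take i (alt x (2 * N))))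
        * lookup f (Path (drop i (alt x (2 * N)))))"
      unfolding lookup_path_mult
      by (rule sum.mono_neutral_right) (auto intro!: disjI2 z simp: distinct_adj_take_drop)
    then show ?thesis by simp
  qed
  have r: "lookup (f * g) (Path (alt x (2 * N)))
      = lookup f (Path (alt x (2 * N))) * lookup g (Path [])" for x
  proof -
    have "lookup (f * g) (Path (alt x (2 * N))) = (\<Sum>i\<in>{2 * N}. lookup f (Path (take i (alt x (2 * N))))
        * lookup g (Path (drop i (alt x (2 * N)))))"
      unfolding lookup_path_mult
      by (rule sum.mono_neutral_right) (auto intro!: disjI1 z simp: distinct_adj_take_drop)
    then show ?thesis by simp
  qed
  show "vanish (g * f)" "vanish (f * g)"
    unfolding vanish_def l r by (auto simp: lookup_path_mult zt s)
qed

lemma I_vanish: "f \<in> I ==> vanish f"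
proof -
  have g: "vanish (path_elt [x, x])" for x
    using N_gt alt_eq_iff unfolding vanish_def path_elt_def
    by (auto simp: lookup_single when_def) (metis distinct_adj_alt distinct_adj_Cons_Cons)+
  have g2: "vanish (path_elt (alt Arr_bar (2 * N)) - path_elt (alt Arr (2 * N)))"
    using N_gt unfolding vanish_def path_elt_def
    by (auto simp: lookup_single lookup_minus when_def alt_eq_iff)
  have "ideal {f. vanish f} monoid_algebra"
  proof (rule idealI[OF monoid_algebra.ring_axioms])
    have "additive_subgroup {f. vanish f} (monoid_algebra :: ('k, path \<Rightarrow>\<^sub>0 'k) module)"
      by (rule additive_subgroup_minusI[OF monoid_algebra.is_abelian_group])
        (auto simp: vanish_def lookup_minus add_eq_0_iff)
    then show "subgroup {f. vanish f} (add_monoid monoid_algebra)"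
      by (rule additive_subgroup.a_subgroup)
  qed (simp_all add: vanish_mult)
  from monoid_algebra.genideal_minimal[OF this] have "I \<subseteq> {f. vanish f}"
    unfolding Lambda_ideal_eq using g g2 by simp
  then show "f \<in> I ==> vanish f" by blast
qed

definition rp :: "'k lam => (path \<Rightarrow>\<^sub>0 'k)" where
  "rp x = (SOME f. lam f = x)"

definition coef :: "arrow list => 'k lam => 'k" where
  "coef b x = lookup (rp x) (Path b)"

lemma lam_rp: "x \<in> carrier L ==> lam (rp x) = x"
  unfolding rp_def by (metis (mono_tags, lifting) lam_cases someI)

lemma vanish_rp: "vanish (rp (lam f) - f)"
  by (rule I_vanish) (simp add: lam_eq_iff[symmetric] lam_rp)

text \<open>Only the coefficients of normal words shorter than the socle are well defined.\<close>

lemma coef_lam: "distinct_adj b ==> length b < 2 * N ==> coef b (lam f) = lookup f (Path b)"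
  using vanish_rp[of f] unfolding coef_def vanish_def by (auto simp: lookup_minus)

lemma coef_add:
  assumes "distinct_adj b" "length b < 2 * N" "x \<in> carrier L" "y \<in> carrier L"
  shows "coef b (x \<oplus>\<^sub>L y) = coef b x + coef b y"
  using assms(3,4) by (elim lam_cases) (simp add: coef_lam[OF assms(1,2)] lookup_add flip: lam_add)

lemma coef_uminus:
  assumes "distinct_adj b" "length b < 2 * N" "x \<in> carrier L"
  shows "coef b (\<ominus>\<^sub>L x) = - coef b x"
  using assms(3) by (elim lam_cases) (simp add: coef_lam[OF assms(1,2)] flip: lam_uminus)

lemma coef_zero: "distinct_adj b ==> length b < 2 * N ==> coef b \<zero>\<^sub>L = 0"
  using coef_lam[of b 0] by (simp add: lam_zero)

lemma coef_finsum:
  assumes "distinct_adj b" "length b < 2 * N" "finite S" "\<And>i. i \<in> S ==> x i \<in> carrier L"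
  shows "coef b (\<Oplus>\<^bsub>L\<^esub>i\<in>S. x i) = (\<Sum>i\<in>S. coef b (x i))"
  using assms(3,4)
proof (induction S)
  case (insert i S)
  have "finsum L x S \<in> carrier L" using insert by (intro finsum_closed) auto
  then show ?case using insert by (simp add: finsum_insert coef_add[OF assms(1,2)] Pi_iff)
qed (simp add: coef_zero[OF assms(1,2)])

lemma coef_mult:
  assumes "distinct_adj b" "length b < 2 * N" "x \<in> carrier L" "y \<in> carrier L"
  shows "coef b (x \<cdot> y) = (\<Sum>i\<le>length b. coef (take i b) x * coef (drop i b) y)"
proof -
  obtain f g where fg: "x = lam f" "y = lam g" using assms(3,4) by (metis lam_cases)
  show ?thesis unfolding fg lam_mult[symmetric] coef_lam[OF assms(1,2)] lookup_path_mult
    using assms(1,2) distinct_adj_take_drop[OF assms(1)]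
    by (intro sum.cong refl) (simp add: coef_lam)
qed

lemma coef_wd: "distinct_adj b ==> length b < 2 * N ==> coef b (wd u) = (if u = b then 1 else 0)"
  unfolding wd_def by (simp add: coef_lam path_elt_def lookup_single when_def)

lemma coef_wd_mult:
  assumes "distinct_adj b" "length b < 2 * N" "x \<in> carrier L"
  shows "coef b (wd u \<cdot> x) = (if take (length u) b = u then coef (drop (length u) b) x else 0)"
proof -
  have *: "coef (take i b) (wd u) = (if u = take i b then 1 else 0)" for i
    using assms distinct_adj_take_drop[OF assms(1)] by (intro coef_wd) auto
  show ?thesis
  proof (cases "take (length u) b = u")
    case True
    then have le: "length u \<le> length b" by (metis length_take min.cobounded1)
    have "(\<Sum>i\<le>length b. coef (take i b) (wd u) * coef (drop i b) x)
        = (\<Sum>i\<in>{length u}. coef (take i b) (wd u) * coef (drop i b) x)"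
      by (rule sum.mono_neutral_right) (use le * True in auto)
    then show ?thesis
      using True *[of "length u"] coef_mult[OF assms(1,2) wd_closed assms(3), of u] by simp
  next
    case False
    then have "u \<noteq> take i b" if "i \<le> length b" for i using that by auto
    then have "(\<Sum>i\<le>length b. coef (take i b) (wd u) * coef (drop i b) x) = 0"
      using * by (intro sum.neutral) simp
    then show ?thesis using False coef_mult[OF assms(1,2) wd_closed assms(3)] by simp
  qed
qed

lemma coef_mult_wd:
  assumes "distinct_adj b" "length b < 2 * N" "x \<in> carrier L"
  shows "coef b (x \<cdot> wd u)
    = (if length u \<le> length b \<and> drop (length b - length u) b = u then coef (take (length b - length u) b) x else 0)"
proof -
  have *: "coef (drop i b) (wd u) = (if u = drop i b then 1 else 0)" for i
    using assms distinct_adj_take_drop[OF assms(1)] by (intro coef_wd) auto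
  show ?thesis
  proof (cases "length u \<le> length b \<and> drop (length b - length u) b = u")
    case True
    have "(\<Sum>i\<le>length b. coef (take i b) x * coef (drop i b) (wd u))
        = (\<Sum>i\<in>{length b - length u}. coef (take i b) x * coef (drop i b) (wd u))"
      by (rule sum.mono_neutral_right) (use * True in auto)
    then show ?thesis
      using True *[of "length b - length u"] coef_mult[OF assms(1,2) assms(3) wd_closed, of u] by simp
  next
    case False
    then have "u \<noteq> drop i b" if "i \<le> length b" for i using that by auto
    then have "(\<Sum>i\<le>length b. coef (take i b) x * coef (drop i b) (wd u)) = 0"
      using * by (intro sum.neutral) simp
    then show ?thesis
      unfolding if_not_P[OF False] using coef_mult[OF assms(1,2) assms(3) wd_closed, of u] by simp
  qed
qed

lemma L_induct [consumes 1, case_names word add]: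
  assumes "x \<in> carrier L" and word: "\<And>c u. normal u ==> Q (c \<odot>\<^sub>L wd u)"
    and add: "\<And>x y. x \<in> carrier L ==> y \<in> carrier L ==> Q x ==> Q y ==> Q (x \<oplus>\<^sub>L y)"
  shows "Q x"
proof -
  obtain f where f: "x = lam f" using assms(1) by (rule lam_cases)
  have n: "normal []" by (simp add: normal_def)
  have z: "Q \<zero>\<^sub>L" using word[OF n, of 0] by (simp add: smult_zero_left)
  have "Q (lam f)" using subset_UNIV[of "keys f"]
  proof (induction f rule: poly_mapping_add_induct)
    case (single k c)
    obtain u where u: "k = Path u" by (cases k)
    show ?case using word[of u c] z wd_not_normal[of u] unfolding u lam_single
      by (cases "normal u") (auto simp: smult_zero_right)
  qed (use z assms(3) in \<open>auto simp: lam_zero lam_add\<close>)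
  then show ?thesis using f by simp
qed

subsection \<open>The augmentation and the filtration by length\<close>

abbreviation cst :: "'k lam => 'k" where "cst \<equiv> coef []"

lemma cst_simps:
  "x \<in> carrier L ==> y \<in> carrier L ==> cst (x \<oplus>\<^sub>L y) = cst x + cst y"
  "x \<in> carrier L ==> y \<in> carrier L ==> cst (x \<cdot> y) = cst x * cst y"
  "x \<in> carrier L ==> cst (\<ominus>\<^sub>L x) = - cst x"
  "cst \<zero>\<^sub>L = 0" "cst \<one>\<^sub>L = 1"
  "cst (wd u) = (if u = [] then 1 else 0)"
  using N_gt coef_add[of "[]"] coef_mult[of "[]"] coef_zero[of "[]"] coef_uminus[of "[]"] coef_wd[of "[]"]
  by (auto simp flip: wd_Nil)

lemma coef_smult:
  assumes "distinct_adj b" "length b < 2 * N" "x \<in> carrier L"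
  shows "coef b (c \<odot>\<^sub>L x) = c * coef b x"
proof -
  obtain f where f: "x = lam f" using assms(3) by (rule lam_cases)
  have "single 0 c * f = Poly_Mapping.map ((*) c) f" by (simp add: mult_map_scale_conv_mult)
  then show ?thesis unfolding f lam_smult by (simp add: coef_lam[OF assms(1,2)])
qed

text \<open>The j-th power of the radical, presented as the image of the combinations of words of
  length at least j.\<close>

definition Lge :: "nat => 'k lam set" where
  "Lge j = lam ` {f. \<forall>u. Path u \<in> keys f \<longrightarrow> j \<le> length u}"

lemma Lge_carrier: "x \<in> Lge j ==> x \<in> carrier L"
  unfolding Lge_def by auto

lemma Lge_0: "Lge 0 = carrier L"
  unfolding Lge_def using lam_cases by blast

lemma Lge_zero: "\<zero>\<^sub>L \<in> Lge j"
  unfolding Lge_def by (rule image_eqI[of _ lam 0]) (simp_all add: lam_zero)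

lemma Lge_add: "x \<in> Lge j ==> y \<in> Lge j ==> x \<oplus>\<^sub>L y \<in> Lge j"
  unfolding Lge_def
proof safe
  fix f g :: "path \<Rightarrow>\<^sub>0 'k"
  assume "\<forall>u. Path u \<in> keys f \<longrightarrow> j \<le> length u" "\<forall>u. Path u \<in> keys g \<longrightarrow> j \<le> length u"
  then show "lam f \<oplus>\<^sub>L lam g \<in> lam ` {f. \<forall>u. Path u \<in> keys f \<longrightarrow> j \<le> length u}"
    unfolding lam_add[symmetric] using keys_add[of f g] by blast
qed

lemma Lge_mult: "x \<in> Lge i ==> y \<in> Lge j ==> x \<cdot> y \<in> Lge (i + j)"
  unfolding Lge_def
proof safe
  fix f g :: "path \<Rightarrow>\<^sub>0 'k"
  assume f: "\<forall>u. Path u \<in> keys f \<longrightarrow> i \<le> length u" and g: "\<forall>u. Path u \<in> keys g \<longrightarrow> j \<le> length u"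
  have "i + j \<le> length u" if u: "Path u \<in> keys (f * g)" for u
  proof -
    obtain p q where pq: "Path u = p + q" "p \<in> keys f" "q \<in> keys g"
      using keys_mult[of f g] u by blast
    then show ?thesis using f g by (cases p; cases q) fastforce
  qed
  then show "lam f \<cdot> lam g \<in> lam ` {f. \<forall>u. Path u \<in> keys f \<longrightarrow> i + j \<le> length u}"
    unfolding lam_mult[symmetric] by blast
qed

lemma Lge_mult_left: "x \<in> carrier L ==> y \<in> Lge j ==> x \<cdot> y \<in> Lge j"
  using Lge_mult[of x 0 y j] by (simp add: Lge_0)

lemma Lge_mult_right: "x \<in> Lge j ==> y \<in> carrier L ==> x \<cdot> y \<in> Lge j"
  using Lge_mult[of x j y 0] by (simp add: Lge_0)

lemma Lge_wd: "wd u \<in> Lge (length u)"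
  unfolding Lge_def wd_def path_elt_def by (intro imageI) auto

lemma Lge_mono: "i \<le> j ==> Lge j \<subseteq> Lge i"
  unfolding Lge_def by fastforce

lemma Lge_cst: "x \<in> carrier L ==> cst x = 0 \<longleftrightarrow> x \<in> Lge 1"
proof
  assume "x \<in> carrier L" "cst x = 0"
  then obtain f where fx: "x = lam f" by (blast elim: lam_cases)
  then have f: "x = lam f" "lookup f (Path []) = 0"
    using coef_lam[of "[]" f] N_gt \<open>cst x = 0\<close> by simp_all
  have "1 \<le> length u" if "Path u \<in> keys f" for u
    using that f(2) by (cases u) (auto simp: in_keys_iff)
  then show "x \<in> Lge 1" unfolding Lge_def using f(1) by blast
next
  assume "x \<in> Lge 1"
  then obtain f where f: "x = lam f" "\<forall>u. Path u \<in> keys f \<longrightarrow> 1 \<le> length u" unfolding Lge_def by blast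
  have "lookup f (Path []) = 0" using f(2)[rule_format, of "[]"] by (auto simp: in_keys_iff)
  then show "cst x = 0" using coef_lam[of "[]" f] N_gt f(1) by simp
qed

lemma Lge_top: "x \<in> Lge (Suc (2 * N)) ==> x = \<zero>\<^sub>L"
proof -
  assume "x \<in> Lge (Suc (2 * N))"
  then obtain f where fx: "x = lam f" "\<forall>u. Path u \<in> keys f \<longrightarrow> Suc (2 * N) \<le> length u"
    unfolding Lge_def by blast
  have "p \<in> {Path u | u. Suc (2 * N) \<le> length u}" if "p \<in> keys f" for p
    using that fx(2) by (cases p) auto
  then have f: "x = lam f" "keys f \<subseteq> {Path u | u. Suc (2 * N) \<le> length u}"
    using fx(1) by blast+
  have "lam f = \<zero>\<^sub>L" using f(2)
  proof (induction f rule: poly_mapping_add_induct)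
    case (single k c)
    then obtain u where u: "k = Path u" "Suc (2 * N) \<le> length u" by blast
    then have "wd u = \<zero>\<^sub>L" by (intro wd_not_normal) (simp add: normal_def)
    then show ?case unfolding u lam_single by (simp add: smult_zero_right)
  qed (simp_all add: lam_zero lam_add)
  then show ?thesis using f by simp
qed

subsection \<open>Linear maps given on words\<close>

fun unpath :: "path => arrow list" where "unpath (Path u) = u"

text \<open>A function on words induces a linear map on the algebra if it kills the words that are
  not normal and agrees on the two words of length 2N. Evaluation at the chosen representative is
  then independent of the choice.\<close>

definition strip :: "(arrow list => 'k lam) => 'k lam => 'k lam" where
  "strip g x = lincomb L (regular_bimod L) (\<lambda>p. g (unpath p)) (rp x)"

context
  fixes g :: "arrow list => 'k lam"
  assumes g_closed: "\<And>u. g u \<in> carrier L" and g_zero: "\<And>u. \<not> normal u ==> g u = \<zero>\<^sub>L"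
    and g_socle: "g (alt Arr (2 * N)) = g (alt Arr_bar (2 * N))"
begin

interpretation R: k_bimodule L "regular_bimod L" by (rule regular_k_bimodule)

lemma scal_regular: "x \<in> carrier L ==> scal L (regular_bimod L) c x = c \<odot>\<^sub>L x"
  unfolding scal_def by (simp add: smult_left[symmetric])

abbreviation "lc \<equiv> lincomb L (regular_bimod L) (\<lambda>p. g (unpath p))"

lemma lc_simps:
  "lc f \<in> carrier L" "lc (f + h) = lc f \<oplus>\<^sub>L lc h" "lc (single p c) = c \<odot>\<^sub>L g (unpath p)"
  "lc (Poly_Mapping.map ((*) c) f) = c \<odot>\<^sub>L lc f"
  using R.lincomb_closed[of UNIV "\<lambda>p. g (unpath p)" f] R.lincomb_add[of UNIV "\<lambda>p. g (unpath p)" f h]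
    R.lincomb_single[of UNIV "\<lambda>p. g (unpath p)" p c] R.lincomb_scale[of UNIV "\<lambda>p. g (unpath p)" f c]
  by (simp_all add: g_closed scal_regular)

text \<open>The coefficients at the two alternating words of length 2N are opposite, and g agrees
  there. Without these two terms only words that are not normal remain, and g kills them.\<close>

lemma lc_vanish:
  assumes "vanish f"
  shows "lc f = \<zero>\<^sub>L"
proof -
  let ?s = "\<lambda>x. Path (alt x (2 * N))"
  define c where "c = lookup f (?s Arr)"
  define h where "h = f - single (?s Arr) c - single (?s Arr_bar) (- c)"
  have ne: "?s Arr \<noteq> ?s Arr_bar" using N_gt by (simp add: alt_eq_iff)
  have c': "lookup f (?s Arr_bar) = - c"
    using assms unfolding vanish_def c_def by (simp add: eq_neg_iff_add_eq_0 add.commute)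
  have "keys h \<subseteq> {Path u | u. \<not> normal u}"
  proof
    fix p assume p: "p \<in> keys h"
    obtain u where u: "p = Path u" by (cases p)
    have "\<not> normal u"
    proof
      assume nu: "normal u"
      have "lookup h (Path u) = 0"
      proof (cases "length u < 2 * N")
        case True
        then have "u \<noteq> alt x (2 * N)" for x by auto
        then show ?thesis using assms nu True unfolding vanish_def normal_def h_def
          by (auto simp: lookup_minus lookup_single when_def)
      next
        case False
        then have "u = alt (last u) (2 * N)" using nu distinct_adj_imp_alt unfolding normal_def by fastforce
        then show ?thesis using c' c_def ne unfolding h_def
          by (cases "last u") (auto simp: lookup_minus lookup_single when_def)
      qed
      then show False using p u by (simp add: in_keys_iff)
    qed
    then show "p \<in> {Path u | u. \<not> normal u}" using u by blast
  qed
  then have "lc h = \<zero>\<^sub>L"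
  proof (induction h rule: poly_mapping_add_induct)
    case (single k c)
    then show ?case by (auto simp: lc_simps g_zero smult_zero_right)
  qed (simp_all add: lc_simps)
  moreover have "f = h + (single (?s Arr) c + single (?s Arr_bar) (- c))"
    unfolding h_def by simp
  ultimately have "lc f = c \<odot>\<^sub>L g (alt Arr (2 * N)) \<oplus>\<^sub>L (- c) \<odot>\<^sub>L g (alt Arr (2 * N))"
    using lc_simps(1) by (simp add: lc_simps(2,3) g_socle g_closed smult_closed)
  also have "\<dots> = \<zero>\<^sub>L" using smult_add[OF g_closed, of c "- c"] by (simp add: smult_zero_left g_closed)
  finally show ?thesis .
qed

lemma strip_lam: "strip g (lam f) = lc f"
proof -
  have "lc (rp (lam f) - f + f) = lc (rp (lam f) - f) \<oplus>\<^sub>L lc f" by (rule lc_simps)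
  then show ?thesis unfolding strip_def using lc_vanish[OF vanish_rp] lc_simps(1) by simp
qed

lemma strip_closed: "x \<in> carrier L ==> strip g x \<in> carrier L"
  by (elim lam_cases) (simp add: strip_lam lc_simps)

lemma strip_add: "x \<in> carrier L ==> y \<in> carrier L ==> strip g (x \<oplus>\<^sub>L y) = strip g x \<oplus>\<^sub>L strip g y"
  by (elim lam_cases) (simp add: strip_lam lc_simps flip: lam_add)

lemma strip_smult: "x \<in> carrier L ==> strip g (c \<odot>\<^sub>L x) = c \<odot>\<^sub>L strip g x"
  by (elim lam_cases)
    (simp add: strip_lam lam_smult lc_simps flip: mult_map_scale_conv_mult)

lemma strip_wd: "strip g (wd u) = g u"
  unfolding wd_def strip_lam path_elt_def by (simp add: lc_simps smult_one g_closed)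

end

subsection \<open>Multiplication of normal words\<close>

definition m :: "arrow => nat => 'k lam" where
  "m x n = wd (alt x n)"

lemma m_closed [simp, intro]: "m x n \<in> carrier L"
  unfolding m_def by simp

lemma m_0: "m x 0 = \<one>\<^sub>L"
  unfolding m_def by (simp add: wd_Nil)

lemma normal_alt [simp]: "normal (alt x n) \<longleftrightarrow> n \<le> 2 * N"
  unfolding normal_def by simp

lemma m_big: "n > 2 * N ==> m x n = \<zero>\<^sub>L"
  unfolding m_def by (intro wd_not_normal) simp

lemma m_socle: "m x (2 * N) = m y (2 * N)"
  unfolding m_def by (rule wd_socle)

text \<open>A product of non-empty words can survive only if the last letter of the left one differs
  from the first letter of the right one; \<open>alt y l\<close> begins with y exactly when l is
  odd.\<close>

lemma m_mult:
  "m x k \<cdot> m y l = (if k = 0 then m y l else if l = 0 then m x k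
     else if x = (if even l then y else flip y) then m y (k + l) else \<zero>\<^sub>L)"
proof (cases "k = 0 \<or> l = 0 \<or> x = (if even l then y else flip y)")
  case True
  then show ?thesis unfolding m_def wd_mult using alt_append[of l y k] by (auto simp: wd_Nil)
next
  case False
  then have "\<not> normal (alt x k @ alt y l)"
    unfolding normal_def using last_alt[of k x] hd_alt[of l y]
    by (cases x; cases y) (auto simp: distinct_adj_append_iff)
  then show ?thesis using False unfolding m_def wd_mult by (simp add: wd_not_normal)
qed

lemma m_pow: "(m (flip x) 1 \<cdot> m x 1) [^]\<^sub>L k = m x (2 * k)"
proof (induction k)
  case (Suc k)
  have "(m (flip x) 1 \<cdot> m x 1) = m x 2" by (simp add: m_mult numeral_2_eq_2)
  then show ?case using Suc by (simp add: nat_pow_Suc m_mult)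
qed (simp add: m_0)

lemma Lambda_arrow_m: "Lambda_arrow N x = m x 1"
  unfolding Lambda_arrow_wd m_def by simp

lemma L_induct_m [consumes 1, case_names word add]:
  assumes "x \<in> carrier L" and word: "\<And>c x l. l \<le> 2 * N ==> Q (c \<odot>\<^sub>L m x l)"
    and add: "\<And>x y. x \<in> carrier L ==> y \<in> carrier L ==> Q x ==> Q y ==> Q (x \<oplus>\<^sub>L y)"
  shows "Q x"
  using assms(1)
proof (induction rule: L_induct)
  case (word c u)
  then have "u = alt (last u) (length u)" by (intro distinct_adj_imp_alt) (simp add: normal_def)
  then have "wd u = m (last u) (length u)" by (simp add: m_def)
  then show ?case using assms(2)[of "length u" c "last u"] word by (simp add: normal_def)
qed (rule add)

lemma m_Lge: "m x n \<in> Lge n"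
  unfolding m_def using Lge_wd[of "alt x n"] by simp

subsection \<open>A contraction of the one-sided resolution\<close>

text \<open>
  Tensoring the resolution with the simple module on the right leaves the differential
  \<open>e\<^sub>p\<^sub>,\<^sub>r \<mapsto> \<plusminus>(A e\<^sub>p\<^sub>-\<^sub>1\<^sub>,\<^sub>r + B e\<^sub>p\<^sub>,\<^sub>r\<^sub>-\<^sub>1)\<close>, where \<open>p + r\<close> is the degree and \<open>A\<close>, \<open>B\<close> depend only
  on \<open>s = p - r\<close>. The maps \<open>H1\<close> and \<open>H2\<close> below, from \<open>e\<^sub>p\<^sub>,\<^sub>r\<close> to \<open>e\<^sub>p\<^sub>+\<^sub>1\<^sub>,\<^sub>r\<close> and \<open>e\<^sub>p\<^sub>,\<^sub>r\<^sub>+\<^sub>1\<close>, contract it.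
\<close>

definition cA :: "int => 'k lam" where
  "cA s = (if s > 0 then m Arr 1 else m Arr (2 * N - 1))"

definition cB :: "int => 'k lam" where
  "cB s = (if s < 0 then m Arr_bar 1 else m Arr_bar (2 * N - 1))"

text \<open>The element of length 2N is represented by a word ending in either letter, so its value
  is a separate argument z.\<close>

definition strip_last :: "arrow => 'k lam => arrow list => 'k lam" where
  "strip_last x z u = (if \<not> normal u then \<zero>\<^sub>L else if length u = 2 * N then z
     else if u \<noteq> [] \<and> last u = x then wd (butlast u) else \<zero>\<^sub>L)"

text \<open>\<open>H1 s\<close> is a partial division by \<open>cA (s + 1)\<close> from the right
  and \<open>H2 s\<close> one by \<open>cB (s - 1)\<close>. The element of length 2N is divisible by
  both letters; it is handed to \<open>H1\<close> for s >= 0 and to \<open>H2\<close> for s < 0. In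
  the exceptional case s = -1 the divisor \<open>cA 0\<close> is the long word, whose quotient is
  1.\<close>

definition strip1 :: "int => arrow list => 'k lam" where
  "strip1 s u = (if s \<ge> 0 then strip_last Arr (m Arr_bar (2 * N - 1)) u
     else if s = -1 \<and> u = alt Arr (2 * N - 1) then \<one>\<^sub>L else \<zero>\<^sub>L)"

definition strip2 :: "int => arrow list => 'k lam" where
  "strip2 s u = (if s > 0 then \<zero>\<^sub>L else if s = 0 then strip_last Arr_bar \<zero>\<^sub>L u
     else strip_last Arr_bar (m Arr (2 * N - 1)) u)"

definition H1 :: "int => 'k lam => 'k lam" where
  "H1 s = strip (strip1 s)"

definition H2 :: "int => 'k lam => 'k lam" where
  "H2 s = strip (strip2 s)"

lemma cA_closed [simp, intro]: "cA s \<in> carrier L" and cB_closed [simp, intro]: "cB s \<in> carrier L"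
  unfolding cA_def cB_def by simp_all

lemma cA_Lge: "cA s \<in> Lge 1" and cB_Lge: "cB s \<in> Lge 1"
proof -
  have "m x k \<in> Lge 1" if "k \<ge> 1" for x k using m_Lge[of x k] Lge_mono[OF that] by blast
  then show "cA s \<in> Lge 1" "cB s \<in> Lge 1" unfolding cA_def cB_def using N_gt by auto
qed

lemma strip_conditions:
  "strip1 s u \<in> carrier L" "\<not> normal u ==> strip1 s u = \<zero>\<^sub>L"
  "strip1 s (alt Arr (2 * N)) = strip1 s (alt Arr_bar (2 * N))"
  "strip2 s u \<in> carrier L" "\<not> normal u ==> strip2 s u = \<zero>\<^sub>L"
  "strip2 s (alt Arr (2 * N)) = strip2 s (alt Arr_bar (2 * N))"
  unfolding strip1_def strip2_def strip_last_def using N_gt by (auto simp: alt_eq_iff del: equalityI)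

lemma H_closed: "x \<in> carrier L ==> H1 s x \<in> carrier L" "x \<in> carrier L ==> H2 s x \<in> carrier L"
  unfolding H1_def H2_def by (simp_all add: strip_closed strip_conditions)

lemma H_add:
  assumes "x \<in> carrier L" "y \<in> carrier L"
  shows "H1 s (x \<oplus>\<^sub>L y) = H1 s x \<oplus>\<^sub>L H1 s y" "H2 s (x \<oplus>\<^sub>L y) = H2 s x \<oplus>\<^sub>L H2 s y"
  unfolding H1_def H2_def using assms by (simp_all add: strip_add strip_conditions)

lemma H_smult:
  assumes "x \<in> carrier L"
  shows "H1 s (c \<odot>\<^sub>L x) = c \<odot>\<^sub>L H1 s x" "H2 s (c \<odot>\<^sub>L x) = c \<odot>\<^sub>L H2 s x"
  unfolding H1_def H2_def using assms by (simp_all add: strip_smult strip_conditions)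

lemma strip_last_alt:
  "strip_last y z (alt x l) = (if l > 2 * N then \<zero>\<^sub>L else if l = 2 * N then z
     else if l > 0 \<and> x = y then m (flip x) (l - 1) else \<zero>\<^sub>L)"
  unfolding strip_last_def m_def using last_alt[of l x] by (auto simp: butlast_alt del: equalityI)

lemma H_m:
  "H1 s (m x l) = (if l > 2 * N then \<zero>\<^sub>L else if s \<ge> 0 then
     (if l = 2 * N then m Arr_bar (2 * N - 1) else if l > 0 \<and> x = Arr then m Arr_bar (l - 1) else \<zero>\<^sub>L)
     else if s = -1 \<and> x = Arr \<and> l = 2 * N - 1 then \<one>\<^sub>L else \<zero>\<^sub>L)"
  "H2 s (m x l) = (if l > 2 * N \<or> s > 0 then \<zero>\<^sub>L else
     if l = 2 * N then (if s = 0 then \<zero>\<^sub>L else m Arr (2 * N - 1))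
     else if l > 0 \<and> x = Arr_bar then m Arr (l - 1) else \<zero>\<^sub>L)"
proof -
  have "H1 s (m x l) = strip1 s (alt x l)" "H2 s (m x l) = strip2 s (alt x l)"
    unfolding H1_def H2_def m_def by (simp_all add: strip_wd strip_conditions)
  then show "H1 s (m x l) = (if l > 2 * N then \<zero>\<^sub>L else if s \<ge> 0 then
     (if l = 2 * N then m Arr_bar (2 * N - 1) else if l > 0 \<and> x = Arr then m Arr_bar (l - 1) else \<zero>\<^sub>L)
     else if s = -1 \<and> x = Arr \<and> l = 2 * N - 1 then \<one>\<^sub>L else \<zero>\<^sub>L)"
    "H2 s (m x l) = (if l > 2 * N \<or> s > 0 then \<zero>\<^sub>L else
     if l = 2 * N then (if s = 0 then \<zero>\<^sub>L else m Arr (2 * N - 1))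
     else if l > 0 \<and> x = Arr_bar then m Arr (l - 1) else \<zero>\<^sub>L)"
    using N_gt unfolding strip1_def strip2_def strip_last_alt
    by (auto simp: alt_eq_iff del: equalityI)
qed

lemma H_one: "H1 s \<one>\<^sub>L = \<zero>\<^sub>L" "H2 s \<one>\<^sub>L = \<zero>\<^sub>L"
  using H_m[of s Arr 0] N_gt by (simp_all add: m_0)

lemma H_zero: "H1 s \<zero>\<^sub>L = \<zero>\<^sub>L" "H2 s \<zero>\<^sub>L = \<zero>\<^sub>L"
  using H_m[of s Arr "Suc (2 * N)"] by (simp_all add: m_big)

text \<open>These are the components of d h + h d that change p and r in opposite directions. With
  the signs of \<open>d0\<close> and \<open>h0\<close> the two sides cancel.\<close>

lemma H_cross_m:
  "H1 s (m x l) \<cdot> cB (s + 1) = H1 (s + 1) (m x l \<cdot> cB s)"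
  "H2 s (m x l) \<cdot> cA (s - 1) = H2 (s - 1) (m x l \<cdot> cA s)"
proof -
  have odd: "odd (2 * N - 1)" using N_gt by simp
  show "H1 s (m x l) \<cdot> cB (s + 1) = H1 (s + 1) (m x l \<cdot> cB s)"
    unfolding cB_def using N_gt odd
    by (cases x) (auto simp: m_mult H_m H_zero H_one m_big m_0 del: equalityI)
  show "H2 s (m x l) \<cdot> cA (s - 1) = H2 (s - 1) (m x l \<cdot> cA s)"
    unfolding cA_def using N_gt odd
    by (cases x) (auto simp: m_mult H_m H_zero H_one m_big m_0 del: equalityI)
qed

text \<open>For each word one of the four summands returns the word and the others vanish. Which one
  it is depends on the last letter, on the sign of s and on whether the length is extremal, whence
  the case distinction.\<close>

lemma H_diag_m:
  assumes "l \<le> 2 * N"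
  shows "H1 s (m x l) \<cdot> cA (s + 1) \<oplus>\<^sub>L H2 s (m x l) \<cdot> cB (s - 1)
     \<oplus>\<^sub>L H1 (s - 1) (m x l \<cdot> cA s) \<oplus>\<^sub>L H2 (s + 1) (m x l \<cdot> cB s) = m x l"
proof -
  have odd: "odd (2 * N - 1)" using N_gt by simp
  consider "l = 0" | "l = 1" | "l > 1" "Suc l < 2 * N" | "l = 2 * N" | "l = 2 * N - 1"
    using assms by linarith
  then show ?thesis
  proof cases
    case 1
    then show ?thesis unfolding cA_def cB_def using N_gt odd
      by (cases x) (auto simp: m_mult H_m H_zero H_one m_big m_0 del: equalityI)
  next
    case 2
    then show ?thesis unfolding cA_def cB_def using N_gt odd m_socle[of Arr Arr_bar]
      by (cases x) (auto simp: m_mult H_m H_zero H_one m_big m_0 del: equalityI)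
  next
    case 3
    then show ?thesis unfolding cA_def cB_def using N_gt odd m_socle[of Arr Arr_bar]
      by (cases x) (auto simp: m_mult H_m H_zero H_one m_big m_0 del: equalityI)
  next
    case 5
    have "Suc (2 * N - Suc (Suc 0)) = 2 * N - Suc 0" using N_gt by linarith
    then show ?thesis unfolding cA_def cB_def using 5 N_gt odd m_socle[of Arr Arr_bar]
      by (cases x) (auto simp: m_mult H_m H_zero H_one m_big m_0 del: equalityI)
  next
    case 4
    then show ?thesis unfolding cA_def cB_def using N_gt odd m_socle[of Arr Arr_bar]
      by (cases x) (auto simp: m_mult H_m H_zero H_one m_big m_0 del: equalityI)
  qed
qed

section \<open>The bimodule resolution\<close>

abbreviation Q :: "nat => ('k lam, int => ('k, 'k lam) tens) bimodule" where
  "Q n \<equiv> res_mod N n"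

definition t :: "nat => int => 'k lam => 'k lam => (int => ('k, 'k lam) tens)" where
  "t n r x y = summand_tensor L (res_index n) r x y"

lemma Q_bimodule: "k_bimodule L (Q n)"
  unfolding res_mod_def by (rule free_k_bimodule)

lemma Q_group: "abelian_group (Q n)"
proof -
  interpret F: k_bimodule L "Q n" by (rule Q_bimodule)
  show ?thesis by (rule F.M.abelian_group_axioms)
qed

lemma t_closed [simp, intro]: "x \<in> carrier L ==> y \<in> carrier L ==> t n r x y \<in> carrier (Q n)"
  unfolding t_def res_mod_def by (rule summand_tensor_closed)

lemma t_outside: "r < 0 \<or> r > int n ==> t n r x y = \<zero>\<^sub>(Q n)"
  unfolding t_def res_mod_def by (rule summand_tensor_outside) auto

lemma t_smult:
  assumes "a \<in> carrier L" "x \<in> carrier L" "y \<in> carrier L"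
  shows "a \<odot>\<^sub>(Q n) t n r x y = t n r (a \<cdot> x) y"
    and "t n r x y \<odot>\<^sup>r\<^sub>(Q n) a = t n r x (y \<cdot> a)"
  unfolding t_def res_mod_def by (rule summand_tensor_smult[OF assms])+

lemma t_balanced: "balanced L (Q n) (t n r)"
  unfolding t_def[abs_def] res_mod_def by (rule summand_tensor_balanced)

lemmas t_add_left = balancedD(2)[OF t_balanced]
  and t_add_right = balancedD(3)[OF t_balanced]
  and t_scal_left = balancedD(4)[OF t_balanced]
  and t_scal_right = balancedD(5)[OF t_balanced]

lemma t_zero_left: "y \<in> carrier L ==> t n r \<zero>\<^sub>L y = \<zero>\<^sub>(Q n)"
proof -
  assume y: "y \<in> carrier L"
  have "(\<lambda>x. t n r x y) \<in> add_hom L (Q n)" using y by (intro add_homI) (auto simp: t_add_left)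
  from add_hom_zero[OF is_abelian_group Q_group this] show ?thesis .
qed

lemma t_zero_right: "x \<in> carrier L ==> t n r x \<zero>\<^sub>L = \<zero>\<^sub>(Q n)"
proof -
  assume x: "x \<in> carrier L"
  have "(\<lambda>y. t n r x y) \<in> add_hom L (Q n)" using x by (intro add_homI) (auto simp: t_add_right)
  from add_hom_zero[OF is_abelian_group Q_group this] show ?thesis .
qed

lemma t_uminus_left: "x \<in> carrier L ==> y \<in> carrier L ==> t n r (\<ominus>\<^sub>L x) y = \<ominus>\<^sub>(Q n) t n r x y"
proof -
  assume x: "x \<in> carrier L" and y: "y \<in> carrier L"
  have "(\<lambda>x. t n r x y) \<in> add_hom L (Q n)" using y by (intro add_homI) (auto simp: t_add_left)
  from add_hom_inv[OF is_abelian_group Q_group this x] show ?thesis .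
qed

lemma Q_induct [consumes 1, case_names zero tensor add]:
  assumes "u \<in> carrier (Q n)" and "S \<zero>\<^sub>(Q n)"
    and "\<And>r x y. 0 \<le> r ==> r \<le> int n ==> x \<in> carrier L ==> y \<in> carrier L ==> S (t n r x y)"
    and "\<And>u v. u \<in> carrier (Q n) ==> v \<in> carrier (Q n) ==> S u ==> S v ==> S (u \<oplus>\<^sub>(Q n) v)"
  shows "S u"
  using assms free_induct[of u "res_index n" S] unfolding res_mod_def t_def by auto

lemma Q_hom_eq:
  assumes "abelian_group G" "f \<in> add_hom (Q n) G" "g \<in> add_hom (Q n) G" "u \<in> carrier (Q n)"
    and "\<And>r x y. 0 \<le> r ==> r \<le> int n ==> x \<in> carrier L ==> y \<in> carrier L ==> f (t n r x y) = g (t n r x y)"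
  shows "f u = g u"
  using assms free_hom_eq[of G f "res_index n" g u] unfolding res_mod_def t_def by auto

lemma Q_hom_tensor:
  assumes "h \<in> bimod_hom L (Q n) M" "x \<in> carrier L" "y \<in> carrier L"
  shows "h (t n r x y) = x \<odot>\<^sub>M h (t n r \<one>\<^sub>L \<one>\<^sub>L) \<odot>\<^sup>r\<^sub>M y"
  unfolding t_def using assms(1)[unfolded res_mod_def] assms(2,3) by (rule free_hom_tensor)

lemma alt_sign_closed:
  "abelian_group M ==> x \<in> carrier M ==> alt_sign M k x \<in> carrier M"
  unfolding alt_sign_def by (auto intro: abelian_group.a_inv_closed)

subsection \<open>The differential\<close>

lemma w_m: "Lambda_arrow N x \<cdot> (Lambda_arrow N (flip x) \<cdot> Lambda_arrow N x) [^]\<^sub>L (N - 1) = m x (2 * N - 1)"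
proof -
  have "Suc (2 * (N - 1)) = 2 * N - 1" using N_gt by linarith
  then show ?thesis unfolding Lambda_arrow_m m_pow by (auto simp: m_mult del: equalityI)
qed

text \<open>Since \<open>cA\<close> and \<open>cB\<close> exchange a letter for a word of length 2N
  - 1 according to the sign of s, the two cases outside the middle become one formula.\<close>

lemma res_diff_gen_off:
  assumes "int n \<noteq> 2 * r"
  defines "s \<equiv> int n - 2 * r" and "M \<equiv> Q (n - 1)"
  shows "res_diff_gen N n r =
    t (n - 1) r \<one>\<^sub>L (cA s) \<oplus>\<^sub>M alt_sign M (int n + r) (t (n - 1) r (cA s) \<one>\<^sub>L)
    \<oplus>\<^sub>M alt_sign M (int n + r) (t (n - 1) (r - 1) (cB s) \<one>\<^sub>L)
    \<oplus>\<^sub>M alt_sign M (int n) (t (n - 1) (r - 1) \<one>\<^sub>L (cB s))"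
  using assms(1) w_m[of Arr] w_m[of Arr_bar]
  unfolding res_diff_gen_def Let_def s_def M_def t_def cA_def cB_def
  by (auto simp: Lambda_arrow_m del: equalityI)

abbreviation mid_term :: "nat => int => nat => (int => ('k, 'k lam) tens)" where
  "mid_term j r k \<equiv>
      (m Arr (2 * k) \<odot>\<^sub>(Q j) (t j r \<one>\<^sub>L (m Arr 1) \<oplus>\<^sub>(Q j) alt_sign (Q j) r (t j (r - 1) (m Arr_bar 1) \<one>\<^sub>L)))
        \<odot>\<^sup>r\<^sub>(Q j) m Arr (2 * (N - k - 1))
      \<oplus>\<^sub>(Q j)
      (m Arr_bar (2 * k) \<odot>\<^sub>(Q j) (alt_sign (Q j) r (t j r (m Arr 1) \<one>\<^sub>L) \<oplus>\<^sub>(Q j) t j (r - 1) \<one>\<^sub>L (m Arr_bar 1)))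
        \<odot>\<^sup>r\<^sub>(Q j) m Arr_bar (2 * (N - k - 1))"

lemma mid_term_closed: "mid_term j r k \<in> carrier (Q j)"
proof -
  interpret F: k_bimodule L "Q j" by (rule Q_bimodule)
  show ?thesis
    by (intro F.M.a_closed alt_sign_closed[OF F.M.abelian_group_axioms] F.l_closed F.r_closed t_closed m_closed one_closed)
qed

lemma res_diff_gen_mid:
  "int n = 2 * r ==> res_diff_gen N n r = (\<Oplus>\<^sub>(Q (n - 1)) k\<in>{..N - 1}. mid_term (n - 1) r k)"
  using m_pow[of Arr] m_pow[of Arr_bar] unfolding res_diff_gen_def Let_def t_def
  by (simp add: Lambda_arrow_m)

lemma res_diff_gen_closed: "res_diff_gen N n r \<in> carrier (Q (n - 1))"
proof -
  obtain j where j: "n - 1 = j" by blast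
  interpret F: k_bimodule L "Q j" by (rule Q_bimodule)
  note cl = F.M.a_closed alt_sign_closed[OF F.M.abelian_group_axioms] F.l_closed F.r_closed
  show ?thesis
  proof (cases "int n = 2 * r")
    case True
    show ?thesis unfolding res_diff_gen_mid[OF True] j
      by (rule F.M.finsum_closed, rule Pi_I, rule mid_term_closed)
  next
    case False
    show ?thesis unfolding res_diff_gen_off[OF False] j
      by (intro cl t_closed cA_closed cB_closed one_closed)
  qed
qed

lemma res_diff:
  shows "res_diff N n \<in> bimod_hom L (Q n) (Q (n - 1))"
    and "0 \<le> r ==> r \<le> int n ==> res_diff N n (t n r \<one>\<^sub>L \<one>\<^sub>L) = res_diff_gen N n r"
proof -
  note fe = free_extend[OF Q_bimodule res_diff_gen_closed]
  show "res_diff N n \<in> bimod_hom L (Q n) (Q (n - 1))"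
    unfolding res_diff_def res_mod_def[of N n] by (rule fe(1))
  show "0 \<le> r ==> r \<le> int n ==> res_diff N n (t n r \<one>\<^sub>L \<one>\<^sub>L) = res_diff_gen N n r"
    unfolding res_diff_def t_def by (rule fe(2)) simp
qed

lemma res_diff_tensor:
  assumes "0 \<le> r" "r \<le> int n" "x \<in> carrier L" "y \<in> carrier L"
  shows "res_diff N n (t n r x y) = x \<odot>\<^sub>(Q (n - 1)) res_diff_gen N n r \<odot>\<^sup>r\<^sub>(Q (n - 1)) y"
  using Q_hom_tensor[OF res_diff(1) assms(3,4)] res_diff(2)[OF assms(1,2)] by simp

lemma reg_hom_add_hom: "f \<in> bimod_hom L (Q n) (regular_bimod L) ==> f \<in> add_hom (Q n) L"
  using bimod_hom_add_hom[of f L "Q n" "regular_bimod L"] by (simp add: add_hom_def)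

lemma reg_hom_alt_sign:
  assumes "f \<in> bimod_hom L (Q n) (regular_bimod L)" "z \<in> carrier (Q n)"
  shows "f (alt_sign (Q n) k z) = alt_sign L k (f z)"
  using add_hom_inv[OF Q_group is_abelian_group reg_hom_add_hom[OF assms(1)] assms(2)] by (simp add: alt_sign_def)

lemma reg_hom_gen_off:
  assumes f: "f \<in> bimod_hom L (Q n) (regular_bimod L)" and off: "int (Suc n) \<noteq> 2 * r"
  defines "v \<equiv> \<lambda>q. f (t n q \<one>\<^sub>L \<one>\<^sub>L)" and "s \<equiv> int (Suc n) - 2 * r"
  shows "f (res_diff_gen N (Suc n) r) = v r \<cdot> cA s \<oplus>\<^sub>L alt_sign L (int (Suc n) + r) (cA s \<cdot> v r)
        \<oplus>\<^sub>L alt_sign L (int (Suc n) + r) (cB s \<cdot> v (r - 1))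
        \<oplus>\<^sub>L alt_sign L (int (Suc n)) (v (r - 1) \<cdot> cB s)"
proof -
  interpret F: k_bimodule L "Q n" by (rule Q_bimodule)
  note fh = reg_hom_add_hom[OF f]
  have v: "v q \<in> carrier L" for q unfolding v_def by (rule add_hom_closed[OF fh]) simp
  have ft: "f (t n q x y) = x \<cdot> v q \<cdot> y" if "x \<in> carrier L" "y \<in> carrier L" for q x y
    using Q_hom_tensor[OF f that] unfolding v_def by simp
  have cl: "t n q (cA s) \<one>\<^sub>L \<in> carrier (Q n)" "t n q \<one>\<^sub>L (cA s) \<in> carrier (Q n)"
    "t n q (cB s) \<one>\<^sub>L \<in> carrier (Q n)" "t n q \<one>\<^sub>L (cB s) \<in> carrier (Q n)" for q by auto
  show ?thesis
    unfolding res_diff_gen_off[OF off] diff_Suc_1 s_def[symmetric]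
    by (simp add: add_hom_add[OF fh] cl alt_sign_closed[OF F.M.abelian_group_axioms]
        reg_hom_alt_sign[OF f] ft v del: of_nat_Suc)
qed

subsection \<open>Formal combinations of monomial tensors\<close>

type_synonym mono = "arrow \<times> nat"

text \<open>A pair stands for the alternating word with this last letter and this length. A product
  that vanishes because equal letters meet is given the length 2N + 1, where \<open>mv\<close> is
  zero.\<close>

fun mm :: "mono => mono => mono" where
  "mm (x, k) (y, l) = (if k = 0 then (y, l) else if l = 0 then (x, k)
     else if x = (if even l then y else flip y) then (y, k + l) else (y, Suc (2 * N)))"

abbreviation mv :: "mono => 'k lam" where "mv p \<equiv> m (fst p) (snd p)"

lemma mv_mm: "mv (mm p q) = mv p \<cdot> mv q"
  by (cases p; cases q) (simp add: m_mult m_big)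

text \<open>The unit and the element of length 2N are each described by two pairs; this picks one,
  so that equal elements get equal keys.\<close>

definition nx :: "mono => mono" where
  "nx p = (if snd p = 0 \<or> snd p = 2 * N then (Arr, snd p) else p)"

lemma mv_nx: "mv (nx p) = mv p"
  unfolding nx_def using m_socle by (auto simp: m_0 del: equalityI)

text \<open>Formal combinations turn the vanishing of the squared differential into an identity
  between finitely supported functions, where terms cancel without any carrier conditions.\<close>

definition mon :: "int => mono => mono => (int \<times> mono \<times> mono \<Rightarrow>\<^sub>0 'k)" where
  "mon r p q = (if snd p > 2 * N \<or> snd q > 2 * N then 0 else single (r, nx p, nx q) 1)"

definition tmono :: "nat => int \<times> mono \<times> mono => (int => ('k, 'k lam) tens)" where
  "tmono n = (\<lambda>(r, p, q). t n r (mv p) (mv q))"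

definition \<Theta> :: "nat => (int \<times> mono \<times> mono \<Rightarrow>\<^sub>0 'k) => (int => ('k, 'k lam) tens)" where
  "\<Theta> n = lincomb L (Q n) (tmono n)"

lemma tmono_closed: "tmono n p \<in> carrier (Q n)"
  unfolding tmono_def by (auto split: prod.splits)

lemma \<Theta>_simps:
  "\<Theta> n f \<in> carrier (Q n)" "\<Theta> n (f + g) = \<Theta> n f \<oplus>\<^sub>(Q n) \<Theta> n g" "\<Theta> n (- f) = \<ominus>\<^sub>(Q n) \<Theta> n f"
  "\<Theta> n 0 = \<zero>\<^sub>(Q n)"
proof -
  interpret F: k_bimodule L "Q n" by (rule Q_bimodule)
  show "\<Theta> n f \<in> carrier (Q n)"
    unfolding \<Theta>_def by (rule F.lincomb_closed[where K = UNIV]) (auto simp: tmono_closed)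
  show "\<Theta> n (f + g) = \<Theta> n f \<oplus>\<^sub>(Q n) \<Theta> n g"
    unfolding \<Theta>_def by (rule F.lincomb_add[where K = UNIV]) (auto simp: tmono_closed)
  show "\<Theta> n (- f) = \<ominus>\<^sub>(Q n) \<Theta> n f"
    unfolding \<Theta>_def by (rule F.lincomb_uminus[where K = UNIV]) (auto simp: tmono_closed)
  show "\<Theta> n 0 = \<zero>\<^sub>(Q n)" unfolding \<Theta>_def by simp
qed

lemma \<Theta>_mon: "\<Theta> n (mon r p q) = t n r (mv p) (mv q)"
proof -
  interpret F: k_bimodule L "Q n" by (rule Q_bimodule)
  have "\<Theta> n (single (r, nx p, nx q) 1) = F.sc 1 (tmono n (r, nx p, nx q))"
    unfolding \<Theta>_def by (rule F.lincomb_single[where K = UNIV]) (auto simp: tmono_closed)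
  also have "\<dots> = t n r (mv p) (mv q)" using tmono_closed by (simp add: tmono_def mv_nx)
  finally show ?thesis
    unfolding mon_def by (auto simp: m_big t_zero_left t_zero_right \<Theta>_simps del: equalityI)
qed

definition sgn_if :: "int => 'b::uminus => 'b" where
  "sgn_if k f = (if even k then f else - f)"

lemma \<Theta>_sgn: "\<Theta> n (sgn_if k f) = alt_sign (Q n) k (\<Theta> n f)"
  unfolding alt_sign_def sgn_if_def by (simp add: \<Theta>_simps)

lemma \<Theta>_sum: "finite S ==> \<Theta> n (\<Sum>i\<in>S. f i) = (\<Oplus>\<^sub>(Q n)i\<in>S. \<Theta> n (f i))"
proof (induction S rule: finite_induct)
  case empty
  interpret F: k_bimodule L "Q n" by (rule Q_bimodule)
  show ?case by (simp add: \<Theta>_simps)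
next
  case (insert i S)
  interpret F: k_bimodule L "Q n" by (rule Q_bimodule)
  show ?case using insert by (simp add: \<Theta>_simps F.M.finsum_insert)
qed

definition eA :: "int => mono" where
  "eA s = (Arr, if s > 0 then 1 else 2 * N - 1)"

definition eB :: "int => mono" where
  "eB s = (Arr_bar, if s < 0 then 1 else 2 * N - 1)"

lemma mv_eA: "mv (eA s) = cA s" and mv_eB: "mv (eB s) = cB s"
  unfolding eA_def eB_def cA_def cB_def by auto

definition dmid :: "int => mono => mono => nat => (int \<times> mono \<times> mono \<Rightarrow>\<^sub>0 'k)" where
  "dmid r p q k =
      (mon r (mm p (Arr, 2 * k)) (mm (Arr, 2 * (N - k - 1) + 1) q)
        + sgn_if r (mon (r - 1) (mm p (Arr_bar, 2 * k + 1)) (mm (Arr, 2 * (N - k - 1)) q)))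
      + (sgn_if r (mon r (mm p (Arr, 2 * k + 1)) (mm (Arr_bar, 2 * (N - k - 1)) q))
        + mon (r - 1) (mm p (Arr_bar, 2 * k)) (mm (Arr_bar, 2 * (N - k - 1) + 1) q))"

definition dmon :: "nat => int => mono => mono => (int \<times> mono \<times> mono \<Rightarrow>\<^sub>0 'k)" where
  "dmon n r p q = (let s = int n - 2 * r in
     if s = 0 then (\<Sum>k<N. dmid r p q k)
     else mon r p (mm (eA s) q) + sgn_if (int n + r) (mon r (mm p (eA s)) q)
       + sgn_if (int n + r) (mon (r - 1) (mm p (eB s)) q) + sgn_if (int n) (mon (r - 1) p (mm (eB s) q)))"

lemma alt_sign_smult:
  assumes "a \<in> carrier L" "z \<in> carrier (Q n)"
  shows "a \<odot>\<^sub>(Q n) alt_sign (Q n) k z = alt_sign (Q n) k (a \<odot>\<^sub>(Q n) z)"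
    and "alt_sign (Q n) k z \<odot>\<^sup>r\<^sub>(Q n) a = alt_sign (Q n) k (z \<odot>\<^sup>r\<^sub>(Q n) a)"
proof -
  interpret F: k_bimodule L "Q n" by (rule Q_bimodule)
  show "a \<odot>\<^sub>(Q n) alt_sign (Q n) k z = alt_sign (Q n) k (a \<odot>\<^sub>(Q n) z)"
    "alt_sign (Q n) k z \<odot>\<^sup>r\<^sub>(Q n) a = alt_sign (Q n) k (z \<odot>\<^sup>r\<^sub>(Q n) a)"
    unfolding alt_sign_def using add_hom_inv[OF Q_group Q_group F.l_add_hom[OF assms(1)] assms(2)]
      add_hom_inv[OF Q_group Q_group F.r_add_hom[OF assms(1)] assms(2)] by auto
qed

lemma res_diff_mon:
  assumes "n \<ge> 1"
  shows "res_diff N n (t n r (mv p) (mv q)) = \<Theta> (n - 1) (dmon n r p q)"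
proof -
  obtain j where j: "n - 1 = j" by blast
  interpret F: k_bimodule L "Q j" by (rule Q_bimodule)
  interpret G: k_bimodule L "Q n" by (rule Q_bimodule)
  note cl = alt_sign_closed[OF F.M.abelian_group_axioms] F.l_closed F.r_closed
  note sm = alt_sign_smult t_smult F.l_distr_vector F.r_distr_vector
  note off = res_diff_gen_off[of n r, unfolded j] and mid = res_diff_gen_mid[of n r, unfolded j]
    and hom = res_diff(1)[of n, unfolded j] and ten = res_diff_tensor[of r n "mv p" "mv q", unfolded j]
  consider "r < 0 \<or> r > int n" | "0 \<le> r" "r \<le> int n" "int n \<noteq> 2 * r" | "0 \<le> r" "r \<le> int n" "int n = 2 * r"
    by linarith
  then show ?thesis unfolding j
  proof cases
    \<comment> \<open>If r lies outside the range for degree n, then r and r - 1 both lie outside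
      the range for degree n - 1. Both sides are zero, so that the formula holds for every integer
      r.\<close>
    case 1
    then have r: "r < 0 \<or> int j < r" "r - 1 < 0 \<or> int j < r - 1" "int n - 2 * r \<noteq> 0"
      using assms j by auto
    have "res_diff N n (t n r (mv p) (mv q)) = \<zero>\<^sub>(Q j)"
      using t_outside[OF 1] add_hom_zero[OF G.M.abelian_group_axioms F.M.abelian_group_axioms
          bimod_hom_add_hom[OF hom]] by simp
    moreover have z: "alt_sign (Q j) k \<zero>\<^sub>(Q j) = \<zero>\<^sub>(Q j)" for k
      unfolding alt_sign_def using F.M.minus_equality[of "\<zero>\<^sub>(Q j)" "\<zero>\<^sub>(Q j)"] by auto
    then have "\<Theta> j (dmon n r p q) = \<zero>\<^sub>(Q j)"
      using t_outside[OF r(1)] t_outside[OF r(2)] r(3)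
      by (simp add: dmon_def Let_def \<Theta>_simps \<Theta>_sgn \<Theta>_mon)
    ultimately show "res_diff N n (t n r (mv p) (mv q)) = \<Theta> j (dmon n r p q)" by simp
  next
    case 2
    then show "res_diff N n (t n r (mv p) (mv q)) = \<Theta> j (dmon n r p q)"
      by (simp add: ten off dmon_def Let_def \<Theta>_simps \<Theta>_sgn \<Theta>_mon mv_mm mv_eA mv_eB sm cl
          del: fst_conv snd_conv)
  next
    case 3
    have term1: "\<Theta> j (dmid r p q k) =
        mv p \<odot>\<^sub>(Q j) (mid_term j r k) \<odot>\<^sup>r\<^sub>(Q j) mv q" for k
      by (simp add: dmid_def \<Theta>_simps \<Theta>_sgn \<Theta>_mon mv_mm sm cl)
        (simp add: m_mult m_0 m_assoc)
    have h: "(\<lambda>z. mv p \<odot>\<^sub>(Q j) z \<odot>\<^sup>r\<^sub>(Q j) mv q) \<in> add_hom (Q j) (Q j)"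
      by (rule add_hom_comp[OF F.l_add_hom[OF m_closed] F.r_add_hom[OF m_closed]])
    have "res_diff N n (t n r (mv p) (mv q)) = mv p \<odot>\<^sub>(Q j) res_diff_gen N n r \<odot>\<^sup>r\<^sub>(Q j) mv q"
      using 3 by (intro ten) auto
    also have "\<dots> = (\<Oplus>\<^sub>(Q j)k\<in>{..N - 1}. \<Theta> j (dmid r p q k))"
      unfolding mid[OF 3(3)] term1
      by (rule add_hom_finsum[OF F.M.abelian_group_axioms F.M.abelian_group_axioms h]) (use mid_term_closed in blast)
    also have "\<dots> = \<Theta> j (dmon n r p q)"
    proof -
      have "{..<N} = {..N - 1}" using N_gt by auto
      then show ?thesis using 3 by (simp add: dmon_def \<Theta>_sum)
    qed
    finally show "res_diff N n (t n r (mv p) (mv q)) = \<Theta> j (dmon n r p q)" .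
  qed
qed

text \<open>A relation between formal combinations, read as: g is one formal expression for the
  differential of f. It is compatible with sums and signs, so it can be computed termwise.\<close>

definition dd :: "nat => (int \<times> mono \<times> mono \<Rightarrow>\<^sub>0 'k) => (int \<times> mono \<times> mono \<Rightarrow>\<^sub>0 'k) => bool" where
  "dd n f g \<longleftrightarrow> res_diff N n (\<Theta> n f) = \<Theta> (n - 1) g"

lemma dd_mon: "n \<ge> 1 ==> dd n (mon r p q) (dmon n r p q)"
  unfolding dd_def \<Theta>_mon by (rule res_diff_mon)

lemma dd_add: "dd n f g ==> dd n f' g' ==> dd n (f + f') (g + g')"
  unfolding dd_def \<Theta>_simps using bimod_homD(3)[OF res_diff(1)[of n] \<Theta>_simps(1) \<Theta>_simps(1)] by simp

lemma dd_sgn: "dd n f g ==> dd n (sgn_if k f) (sgn_if k g)"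
  unfolding dd_def sgn_if_def
  using add_hom_inv[OF Q_group Q_group bimod_hom_add_hom[OF res_diff(1)[of n]] \<Theta>_simps(1)] by (simp add: \<Theta>_simps)

lemma dd_sum: "finite S ==> (\<And>i. i \<in> S ==> dd n (f i) (g i)) ==> dd n (\<Sum>i\<in>S. f i) (\<Sum>i\<in>S. g i)"
proof (induction S rule: finite_induct)
  case empty
  show ?case unfolding dd_def
    using add_hom_zero[OF Q_group Q_group bimod_hom_add_hom[OF res_diff(1)[of n]]] by (simp add: \<Theta>_simps)
qed (auto intro: dd_add)

section \<open>The square of the differential\<close>

lemma odd_W: obtains W where "2 * N = Suc W" "odd W" "W \<ge> 3"
proof (rule that[of "2 * N - 1"])
  show "2 * N = Suc (2 * N - 1)" "odd (2 * N - 1)" "2 * N - 1 \<ge> 3" using N_gt by auto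
qed

definition dmon2 :: "nat => int => (int \<times> mono \<times> mono \<Rightarrow>\<^sub>0 'k)" where
  "dmon2 n r = (let s = int n - 2 * r in
     dmon (n - 1) r (Arr, 0) (eA s) + sgn_if (int n + r) (dmon (n - 1) r (eA s) (Arr, 0))
       + sgn_if (int n + r) (dmon (n - 1) (r - 1) (eB s) (Arr, 0)) + sgn_if (int n) (dmon (n - 1) (r - 1) (Arr, 0) (eB s)))"

lemma dd_dmon_off:
  assumes "int n \<noteq> 2 * r" "n \<ge> 2"
  shows "dd (n - 1) (dmon n r (Arr, 0) (Arr, 0)) (dmon2 n r)"
proof -
  have 0: "mm p (Arr, 0) = p" "mm (Arr, 0) p = p" if "snd p > 0" for p using that by (cases p; simp)+
  have pos: "snd (eA s) > 0" "snd (eB s) > 0" for s using N_gt by (auto simp: eA_def eB_def)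
  have "dmon n r (Arr, 0) (Arr, 0) = mon r (Arr, 0) (eA (int n - 2 * r))
      + sgn_if (int n + r) (mon r (eA (int n - 2 * r)) (Arr, 0))
      + sgn_if (int n + r) (mon (r - 1) (eB (int n - 2 * r)) (Arr, 0))
      + sgn_if (int n) (mon (r - 1) (Arr, 0) (eB (int n - 2 * r)))"
    using assms(1) unfolding dmon_def Let_def by (simp only: 0 pos split: if_splits) auto
  then show ?thesis unfolding dmon2_def Let_def
    using assms(2) by (auto intro!: dd_add dd_sgn dd_mon)
qed

text \<open>Neither r nor r - 1 is the middle index of degree n - 1, so only the four-term formula
  enters and its terms vanish or cancel in pairs.\<close>

lemma dmon2_far:
  assumes "\<bar>int n - 2 * r\<bar> \<ge> 2" "n \<ge> 2"
  shows "dmon2 n r = 0"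
proof -
  obtain W where W: "2 * N = Suc W" "odd W" "W \<ge> 3" by (rule odd_W)
  have i: "int (n - 1) = int n - 1" using assms(2) by simp
  consider "int n - 2 * r \<ge> 2" | "int n - 2 * r \<le> -2" using assms(1) by linarith
  then show ?thesis
  proof cases
    case 1
    then show ?thesis
      unfolding dmon2_def dmon_def Let_def i using W
      by (cases "even n"; cases "even r") (simp_all add: eA_def eB_def sgn_if_def mon_def nx_def)
  next
    case 2
    then show ?thesis
      unfolding dmon2_def dmon_def Let_def i using W
      by (cases "even n"; cases "even r") (simp_all add: eA_def eB_def sgn_if_def mon_def nx_def)
  qed
qed

text \<open>Here r is the middle index of degree n - 1. The sums obtained from \<open>?a\<close> on
  the right and on the left share \<open>?S3\<close>, which cancels by sign, and contain
  \<open>?g\<close> with the index shifted by one. What is left are the two ends of a telescoping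
  sum and two extremal terms, and they cancel against the contribution of r - 1.\<close>

lemma dmon2_pos:
  assumes "int n = 2 * r + 1" "n \<ge> 2"
  shows "dmon2 n r = 0"
proof -
  obtain W where W: "2 * N = Suc W" "odd W" "W \<ge> 3" by (rule odd_W)
  have i: "int (n - 1) = int n - 1" using assms(2) by simp
  have wN: "Suc (2 * (N - Suc 0)) = W" using W(1) N_gt by linarith
  define \<rho> where "\<rho> = (sgn_if r :: (int \<times> mono \<times> mono \<Rightarrow>\<^sub>0 'k) => _)"
  let ?a = "(Arr, 1)" and ?w = "(Arr_bar, W)" and ?e = "(Arr, 0)" and ?s = "(Arr, 2 * N)"
  let ?S3 = "\<Sum>k<N. mon r (Arr, 2 * k + 1) (Arr, 2 * (N - k - 1) + 1)"
  let ?g = "\<lambda>k. mon (r - 1) (Arr_bar, 2 * k) (Arr, 2 * (N - k))"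
  have d0: "dmid r ?e ?a k = (if k = N - 1 then \<rho> (mon (r - 1) ?w ?a) else 0)
      + \<rho> (mon r (Arr, 2 * k + 1) (Arr, 2 * (N - k - 1) + 1)) + ?g k" if "k < N" for k
  proof -
    have e: "2 * (N - k - 1) + 2 = 2 * (N - k)" using that by auto
    have m1: "mon r (mm ?e (Arr, 2 * k)) (mm (Arr, 2 * (N - k - 1) + 1) ?a) = 0"
      using W by (auto simp: mon_def)
    have m2: "mon (r - 1) (mm ?e (Arr_bar, 2 * k + 1)) (mm (Arr, 2 * (N - k - 1)) ?a)
        = (if k = N - 1 then mon (r - 1) ?w ?a else 0)"
      using W that wN by (auto simp: mon_def)
    have m3: "mon r (mm ?e (Arr, 2 * k + 1)) (mm (Arr_bar, 2 * (N - k - 1)) ?a)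
        = mon r (Arr, 2 * k + 1) (Arr, 2 * (N - k - 1) + 1)" by simp
    have m4: "mon (r - 1) (mm ?e (Arr_bar, 2 * k)) (mm (Arr_bar, 2 * (N - k - 1) + 1) ?a) = ?g k"
      using e by (auto simp: mon_def nx_def)
    show ?thesis unfolding dmid_def m1 m2 m3 m4 \<rho>_def by (auto simp: sgn_if_def)
  qed
  have d1: "dmid r ?a ?e k = (if k = 0 then mon (r - 1) ?a ?w else 0)
      + mon r (Arr, 2 * k + 1) (Arr, 2 * (N - k - 1) + 1) + \<rho> (?g (Suc k))" if "k < N" for k
  proof -
    have m1: "mon r (mm ?a (Arr, 2 * k)) (mm (Arr, 2 * (N - k - 1) + 1) ?e)
        = mon r (Arr, 2 * k + 1) (Arr, 2 * (N - k - 1) + 1)" by simp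
    have m2: "mon (r - 1) (mm ?a (Arr_bar, 2 * k + 1)) (mm (Arr, 2 * (N - k - 1)) ?e) = ?g (Suc k)"
      by (auto simp: mon_def nx_def)
    have m3: "mon r (mm ?a (Arr, 2 * k + 1)) (mm (Arr_bar, 2 * (N - k - 1)) ?e) = 0"
      using W by (auto simp: mon_def)
    have m4: "mon (r - 1) (mm ?a (Arr_bar, 2 * k)) (mm (Arr_bar, 2 * (N - k - 1) + 1) ?e)
        = (if k = 0 then mon (r - 1) ?a ?w else 0)"
      using W that wN by (auto simp: mon_def nx_def)
    show ?thesis unfolding dmid_def m1 m2 m3 m4 \<rho>_def by (auto simp: sgn_if_def)
  qed
  have rs: "\<rho> (sum f S) = (\<Sum>k\<in>S. \<rho> (f k))" for f and S :: "nat set"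
    unfolding \<rho>_def sgn_if_def by (simp add: sum_negf)
  have D0: "(\<Sum>k<N. dmid r ?e ?a k) = \<rho> (mon (r - 1) ?w ?a) + \<rho> ?S3 + (\<Sum>k<N. ?g k)"
    using d0 N_gt by (simp add: sum.distrib rs)
  have D1: "(\<Sum>k<N. dmid r ?a ?e k) = mon (r - 1) ?a ?w + ?S3 + \<rho> (\<Sum>k<N. ?g (Suc k))"
    using d1 N_gt by (simp add: sum.distrib rs)
  have tele: "(\<Sum>k<N. ?g k) = ?g 0 - ?g N + (\<Sum>k<N. ?g (Suc k))"
    using sum_lessThan_telescope[of ?g N] by (simp add: sum_subtractf algebra_simps)
  have g0: "?g 0 = mon (r - 1) ?e ?s" "?g N = mon (r - 1) ?s ?e" by (auto simp: mon_def nx_def)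
  show ?thesis
    unfolding dmon2_def Let_def dmon_def i
    using W assms(1) D0 D1 tele g0
    apply (simp add: eA_def eB_def)
    apply (cases "even r"; simp add: \<rho>_def sgn_if_def mon_def nx_def algebra_simps)
    done
qed

text \<open>The same cancellation with the letters exchanged; now r - 1 is the middle index of
  degree n - 1.\<close>

lemma dmon2_neg:
  assumes "int n = 2 * r - 1" "n \<ge> 2"
  shows "dmon2 n r = 0"
proof -
  obtain W where W: "2 * N = Suc W" "odd W" "W \<ge> 3" by (rule odd_W)
  have wN: "Suc (2 * (N - Suc 0)) = W" using W(1) N_gt by linarith
  have i: "int (n - 1) = int n - 1" using assms(2) by simp
  define q where "q = r - 1"
  have r: "r = q + 1" by (simp add: q_def)
  define \<rho> where "\<rho> = (sgn_if q :: (int \<times> mono \<times> mono \<Rightarrow>\<^sub>0 'k) => _)"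
  let ?b = "(Arr_bar, 1)" and ?w = "(Arr, W)" and ?e = "(Arr, 0)" and ?s = "(Arr, 2 * N)"
  let ?S = "\<Sum>k<N. mon (q - 1) (Arr_bar, 2 * k + 1) (Arr_bar, 2 * (N - k - 1) + 1)"
  let ?g = "\<lambda>k. mon q (Arr, 2 * k) (Arr_bar, 2 * (N - k))"
  have d0: "dmid q ?b ?e k = (if k = 0 then mon q ?b ?w else 0) + \<rho> (?g (Suc k))
      + mon (q - 1) (Arr_bar, 2 * k + 1) (Arr_bar, 2 * (N - k - 1) + 1)" if "k < N" for k
  proof -
    have m1: "mon q (mm ?b (Arr, 2 * k)) (mm (Arr, 2 * (N - k - 1) + 1) ?e) = (if k = 0 then mon q ?b ?w else 0)"
      using W wN by (auto simp: mon_def)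
    have m2: "mon (q - 1) (mm ?b (Arr_bar, 2 * k + 1)) (mm (Arr, 2 * (N - k - 1)) ?e) = 0"
      using W that wN by (auto simp: mon_def)
    have m3: "mon q (mm ?b (Arr, 2 * k + 1)) (mm (Arr_bar, 2 * (N - k - 1)) ?e) = ?g (Suc k)"
      by (auto simp: mon_def nx_def)
    have m4: "mon (q - 1) (mm ?b (Arr_bar, 2 * k)) (mm (Arr_bar, 2 * (N - k - 1) + 1) ?e)
        = mon (q - 1) (Arr_bar, 2 * k + 1) (Arr_bar, 2 * (N - k - 1) + 1)"
      by (auto simp: mon_def nx_def)
    show ?thesis unfolding dmid_def m1 m2 m3 m4 \<rho>_def by (auto simp: sgn_if_def)
  qed
  have d1: "dmid q ?e ?b k = (if k = N - 1 then \<rho> (mon q ?w ?b) else 0) + ?g k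
      + \<rho> (mon (q - 1) (Arr_bar, 2 * k + 1) (Arr_bar, 2 * (N - k - 1) + 1))" if "k < N" for k
  proof -
    have e: "2 * (N - k - 1) + 2 = 2 * (N - k)" using that by auto
    have m1: "mon q (mm ?e (Arr, 2 * k)) (mm (Arr, 2 * (N - k - 1) + 1) ?b) = ?g k"
      using e by (auto simp: mon_def nx_def)
    have m2: "mon (q - 1) (mm ?e (Arr_bar, 2 * k + 1)) (mm (Arr, 2 * (N - k - 1)) ?b)
        = mon (q - 1) (Arr_bar, 2 * k + 1) (Arr_bar, 2 * (N - k - 1) + 1)" by simp
    have m3: "mon q (mm ?e (Arr, 2 * k + 1)) (mm (Arr_bar, 2 * (N - k - 1)) ?b)
        = (if k = N - 1 then mon q ?w ?b else 0)"
      using W that wN by (auto simp: mon_def)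
    have m4: "mon (q - 1) (mm ?e (Arr_bar, 2 * k)) (mm (Arr_bar, 2 * (N - k - 1) + 1) ?b) = 0"
      using W that wN by (auto simp: mon_def nx_def)
    show ?thesis unfolding dmid_def m1 m2 m3 m4 \<rho>_def by (auto simp: sgn_if_def)
  qed
  have rs: "\<rho> (sum f S) = (\<Sum>k\<in>S. \<rho> (f k))" for f and S :: "nat set"
    unfolding \<rho>_def sgn_if_def by (simp add: sum_negf)
  have D0: "(\<Sum>k<N. dmid q ?b ?e k) = mon q ?b ?w + \<rho> (\<Sum>k<N. ?g (Suc k)) + ?S"
    using d0 N_gt by (simp add: sum.distrib rs)
  have D1: "(\<Sum>k<N. dmid q ?e ?b k) = \<rho> (mon q ?w ?b) + (\<Sum>k<N. ?g k) + \<rho> ?S"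
    using d1 N_gt by (simp add: sum.distrib rs)
  have tele: "(\<Sum>k<N. ?g k) = ?g 0 - ?g N + (\<Sum>k<N. ?g (Suc k))"
    using sum_lessThan_telescope[of ?g N] by (simp add: sum_subtractf algebra_simps)
  have g0: "?g 0 = mon q ?e ?s" "?g N = mon q ?s ?e" by (auto simp: mon_def nx_def)
  show ?thesis
    unfolding dmon2_def Let_def dmon_def i r
    using W assms(1) D0 D1 tele g0
    apply (simp add: eA_def eB_def r)
    apply (cases "even q"; simp add: \<rho>_def sgn_if_def mon_def nx_def algebra_simps)
    done
qed

text \<open>The terms of the middle sum lie in the summands r and r - 1 of degree n - 1, where s is
  -1 and 1 and the four-term formula applies. Products of two long words arise only at k = 0 and k =
  N - 1 and cancel there; the terms \<open>?x\<close> and \<open>?y\<close> cancel for every k, and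
  the rest telescopes.\<close>

lemma dd_dmon_mid:
  assumes n: "int n = 2 * r" "n \<ge> 2"
  shows "dd (n - 1) (dmon n r (Arr, 0) (Arr, 0)) 0"
proof -
  obtain W where W: "2 * N = Suc W" "odd W" "W \<ge> 3" by (rule odd_W)
  have wN: "Suc (2 * (N - Suc 0)) = W" using W(1) N_gt by linarith
  have i: "int (n - 1) = 2 * r - 1" using n by simp
  define \<rho> where "\<rho> = (sgn_if r :: (int \<times> mono \<times> mono \<Rightarrow>\<^sub>0 'k) => _)"
  define ww where "ww = mon r (Arr, W) (Arr, W)"
  define vv where "vv = mon (r - 2) (Arr_bar, W) (Arr_bar, W)"
  let ?j = "\<lambda>k. N - k - 1"
  let ?g = "\<lambda>k. mon (r - 1) (Arr, 2 * k) (Arr, 2 * (N - k))"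
  let ?h = "\<lambda>k. mon (r - 1) (Arr_bar, 2 * k) (Arr_bar, 2 * (N - k))"
  let ?x = "\<lambda>k. mon (r - 1) (Arr_bar, 2 * k + 1) (Arr, 2 * ?j k + 1)"
  let ?y = "\<lambda>k. mon (r - 1) (Arr, 2 * k + 1) (Arr_bar, 2 * ?j k + 1)"
  let ?A = "\<lambda>k. dmon (n - 1) r (Arr, 2 * k) (Arr, 2 * ?j k + 1)"
  let ?B = "\<lambda>k. dmon (n - 1) (r - 1) (Arr_bar, 2 * k + 1) (Arr, 2 * ?j k)"
  let ?C = "\<lambda>k. dmon (n - 1) r (Arr, 2 * k + 1) (Arr_bar, 2 * ?j k)"
  let ?D = "\<lambda>k. dmon (n - 1) (r - 1) (Arr_bar, 2 * k) (Arr_bar, 2 * ?j k + 1)"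
  have dm: "dmid r (Arr, 0) (Arr, 0) k =
      (mon r (Arr, 2 * k) (Arr, 2 * ?j k + 1) + sgn_if r (mon (r - 1) (Arr_bar, 2 * k + 1) (Arr, 2 * ?j k)))
      + (sgn_if r (mon r (Arr, 2 * k + 1) (Arr_bar, 2 * ?j k)) + mon (r - 1) (Arr_bar, 2 * k) (Arr_bar, 2 * ?j k + 1))" for k
    unfolding dmid_def by (auto simp: mon_def nx_def)
  have "dmon n r (Arr, 0) (Arr, 0) = (\<Sum>k<N. dmid r (Arr, 0) (Arr, 0) k)"
    using n(1) by (simp add: dmon_def)
  moreover have "dd (n - 1) (\<Sum>k<N. dmid r (Arr, 0) (Arr, 0) k)
      (\<Sum>k<N. (?A k + \<rho> (?B k)) + (\<rho> (?C k) + ?D k))"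
    unfolding dm \<rho>_def using n(2) by (intro dd_sum dd_add dd_sgn dd_mon) auto
  moreover have "(?A k + \<rho> (?B k)) + (\<rho> (?C k) + ?D k) =
      (if k = N - 1 then \<rho> ww else 0) - (if k = 0 then \<rho> ww else 0)
      + ((if k = 0 then \<rho> vv else 0) - (if k = N - 1 then \<rho> vv else 0))
      + ((?g (Suc k) - ?g k) - (?h (Suc k) - ?h k))" if "k < N" for k
  proof -
    have e: "Suc (Suc (2 * (N - Suc k))) = 2 * (N - k)" using that by auto
    have A: "?A k = - (if k = 0 then \<rho> ww else 0) - \<rho> (?x k) - ?g k"
      unfolding dmon_def Let_def i ww_def \<rho>_def using W wN that e
      by (cases "even r") (auto simp: eA_def eB_def sgn_if_def mon_def nx_def)
    have B: "?B k = - (if k = N - 1 then vv else 0) + ?x k + \<rho> (?g (Suc k))"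
      unfolding dmon_def Let_def i vv_def \<rho>_def using W wN that e
      by (cases "even r") (auto simp: eA_def eB_def sgn_if_def mon_def nx_def)
    have C: "?C k = (if k = N - 1 then ww else 0) - \<rho> (?h (Suc k)) - ?y k"
      unfolding dmon_def Let_def i ww_def \<rho>_def using W wN that e
      by (cases "k = N - 1"; cases "even r") (auto simp: eA_def eB_def sgn_if_def mon_def nx_def)
    have D: "?D k = (if k = 0 then \<rho> vv else 0) + ?h k + \<rho> (?y k)"
      unfolding dmon_def Let_def i vv_def \<rho>_def using W wN that e
      by (cases "even r") (auto simp: eA_def eB_def sgn_if_def mon_def nx_def)
    show ?thesis unfolding A B C D unfolding \<rho>_def sgn_if_def by (cases "even r") auto
  qed
  moreover have "(\<Sum>k<N. (if k = N - 1 then \<rho> ww else 0) - (if k = 0 then \<rho> ww else 0)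
      + ((if k = 0 then \<rho> vv else 0) - (if k = N - 1 then \<rho> vv else 0))
      + ((?g (Suc k) - ?g k) - (?h (Suc k) - ?h k))) = 0"
  proof -
    \<comment> \<open>The ends of both telescopes involve only the unit and the element of length
      2N, which do not depend on the letter.\<close>
    have "?g 0 = ?h 0" "?g N = ?h N" by (auto simp: mon_def nx_def)
    then show ?thesis using N_gt sum_lessThan_telescope[of ?g N] sum_lessThan_telescope[of ?h N]
      by (simp add: sum.distrib sum_subtractf)
  qed
  ultimately show ?thesis by simp
qed

lemma res_diff_res_diff:
  assumes "n \<ge> 2" "z \<in> carrier (Q n)"
  shows "res_diff N (n - 1) (res_diff N n z) = \<zero>\<^sub>(Q (n - 2))"
proof -
  obtain j where j: "n = Suc (Suc j)" using assms(1) that[of "n - 2"] by simp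
  interpret F: k_bimodule L "Q j" by (rule Q_bimodule)
  interpret G: k_bimodule L "Q (Suc j)" by (rule Q_bimodule)
  have d1: "res_diff N n \<in> bimod_hom L (Q n) (Q (Suc j))" and d2: "res_diff N (Suc j) \<in> bimod_hom L (Q (Suc j)) (Q j)"
    using res_diff(1)[of n] res_diff(1)[of "Suc j"] j by simp_all
  have 0: "(\<lambda>z. \<zero>\<^sub>(Q j)) \<in> add_hom (Q n) (Q j)" by (auto simp: add_hom_def)
  have gen: "res_diff N (Suc j) (res_diff N n (t n r \<one>\<^sub>L \<one>\<^sub>L)) = \<zero>\<^sub>(Q j)" for r
  proof -
    have "dd (n - 1) (dmon n r (Arr, 0) (Arr, 0)) 0"
    proof (cases "int n = 2 * r")
      case True
      then show ?thesis using assms(1) by (rule dd_dmon_mid)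
    next
      case False
      consider "int n = 2 * r + 1" | "int n = 2 * r - 1" | "\<bar>int n - 2 * r\<bar> \<ge> 2" using False by linarith
      then have "dmon2 n r = 0"
        using dmon2_pos dmon2_neg dmon2_far assms(1) by cases simp_all
      then show ?thesis using dd_dmon_off[OF False assms(1)] by (simp only:)
    qed
    then show ?thesis
      using res_diff_mon[of n r "(Arr, 0)" "(Arr, 0)"] j unfolding dd_def
      by (simp add: \<Theta>_simps m_0)
  qed
  have "res_diff N (Suc j) (res_diff N n z) = \<zero>\<^sub>(Q j)"
  proof (rule Q_hom_eq[OF F.M.abelian_group_axioms add_hom_comp[OF bimod_hom_add_hom[OF d1] bimod_hom_add_hom[OF d2]] 0 assms(2)])
    fix r x y assume xy: "0 \<le> r" "r \<le> int n" "x \<in> carrier L" "y \<in> carrier L"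
    have c: "res_diff N n (t n r \<one>\<^sub>L \<one>\<^sub>L) \<in> carrier (Q (Suc j))" by (rule bimod_homD(1)[OF d1]) simp
    show "res_diff N (Suc j) (res_diff N n (t n r x y)) = \<zero>\<^sub>(Q j)"
      using xy c unfolding Q_hom_tensor[OF d1 xy(3,4)]
      by (simp add: bimod_homD(4,5)[OF d2] G.l_closed gen F.l_zero_vec F.r_zero_vec)
  qed
  then show ?thesis using j by simp
qed

subsection \<open>Exactness\<close>

lemma H_cross:
  assumes "x \<in> carrier L"
  shows "H1 s x \<cdot> cB (s + 1) = H1 (s + 1) (x \<cdot> cB s)"
    and "H2 s x \<cdot> cA (s - 1) = H2 (s - 1) (x \<cdot> cA s)"
  using assms
proof (induction rule: L_induct_m)
  case (word c x l)
  { case 1 show ?case by (simp add: H_smult H_closed smult_mult_left H_cross_m) }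
  { case 2 show ?case by (simp add: H_smult H_closed smult_mult_left H_cross_m) }
next
  case (add x y)
  { case 1 show ?case using add by (simp add: H_add H_closed l_distr) }
  { case 2 show ?case using add by (simp add: H_add H_closed l_distr) }
qed

lemma H_diag:
  assumes "x \<in> carrier L"
  shows "H1 s x \<cdot> cA (s + 1) \<oplus>\<^sub>L H2 s x \<cdot> cB (s - 1)
     \<oplus>\<^sub>L H1 (s - 1) (x \<cdot> cA s) \<oplus>\<^sub>L H2 (s + 1) (x \<cdot> cB s) = x"
  using assms
proof (induction rule: L_induct_m)
  case (word c x l)
  have c: "c \<odot>\<^sub>L a \<oplus>\<^sub>L c \<odot>\<^sub>L b = c \<odot>\<^sub>L (a \<oplus>\<^sub>L b)" if "a \<in> carrier L" "b \<in> carrier L" for a b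
    using that by (simp add: smult_distrib)
  show ?case using H_diag_m[OF word, of s x]
    by (simp add: H_smult H_closed smult_mult_left c)
next
  case (add x y)
  have "H1 s (x \<oplus>\<^sub>L y) \<cdot> cA (s + 1) \<oplus>\<^sub>L H2 s (x \<oplus>\<^sub>L y) \<cdot> cB (s - 1)
     \<oplus>\<^sub>L H1 (s - 1) ((x \<oplus>\<^sub>L y) \<cdot> cA s) \<oplus>\<^sub>L H2 (s + 1) ((x \<oplus>\<^sub>L y) \<cdot> cB s)
    = (H1 s x \<cdot> cA (s + 1) \<oplus>\<^sub>L H2 s x \<cdot> cB (s - 1)
     \<oplus>\<^sub>L H1 (s - 1) (x \<cdot> cA s) \<oplus>\<^sub>L H2 (s + 1) (x \<cdot> cB s))
    \<oplus>\<^sub>L (H1 s y \<cdot> cA (s + 1) \<oplus>\<^sub>L H2 s y \<cdot> cB (s - 1)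
     \<oplus>\<^sub>L H1 (s - 1) (y \<cdot> cA s) \<oplus>\<^sub>L H2 (s + 1) (y \<cdot> cB s))"
    using add(1,2) by (simp add: H_add H_closed l_distr a_ac)
  then show ?case using add by simp
qed

section \<open>The leading differential and its contraction\<close>

definition sg :: "nat => int => 'k" where
  "sg n r = (if even (int n + r) then 1 else -1)"

lemma sg_simps: "sg (Suc n) r = - sg n r" "sg n (r + 1) = - sg n r" "sg n (r - 1) = - sg n r"
  "sg n r * sg n r = 1"
  by (auto simp: sg_def)

lemma two_term_balanced:
  assumes \<phi>: "\<phi> \<in> add_hom L L" "\<And>c x. x \<in> carrier L ==> \<phi> (c \<odot>\<^sub>L x) = c \<odot>\<^sub>L \<phi> x"
    and \<psi>: "\<psi> \<in> add_hom L L" "\<And>c x. x \<in> carrier L ==> \<psi> (c \<odot>\<^sub>L x) = c \<odot>\<^sub>L \<psi> x"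
  shows "balanced L (Q n) (\<lambda>x y. t n r (\<phi> x) y \<oplus>\<^sub>(Q n) t n q (\<psi> x) y)"
proof -
  interpret F: k_bimodule L "Q n" by (rule Q_bimodule)
  show ?thesis
    by (rule balancedI)
      (simp_all add: add_hom_closed[OF \<phi>(1)] add_hom_closed[OF \<psi>(1)] add_hom_add[OF \<phi>(1)]
        add_hom_add[OF \<psi>(1)] \<phi>(2) \<psi>(2) t_add_left t_add_right t_scal_left t_scal_right F.sc_distr F.M.a_ac)
qed

text \<open>The terms of the differential that leave the right factor alone. At the middle index
  they are two of the four terms with k = N - 1, where both coefficients are words of length 2N -
  1.\<close>

definition d0 :: "nat => (int => ('k, 'k lam) tens) => (int => ('k, 'k lam) tens)" where
  "d0 j = free_lift (res_index (Suc j)) (Q j) (\<lambda>r x y.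
     t j r (sg (Suc j) r \<odot>\<^sub>L (x \<cdot> cA (int (Suc j) - 2 * r))) y
     \<oplus>\<^sub>(Q j) t j (r - 1) (sg (Suc j) r \<odot>\<^sub>L (x \<cdot> cB (int (Suc j) - 2 * r))) y)"

text \<open>The opposite signs of the two terms make all four terms of d0 h0 positive, while the two
  cross terms of h0 d0 become negative.\<close>

definition h0 :: "nat => (int => ('k, 'k lam) tens) => (int => ('k, 'k lam) tens)" where
  "h0 j = free_lift (res_index j) (Q (Suc j)) (\<lambda>r x y.
     t (Suc j) r ((- sg j r) \<odot>\<^sub>L H1 (int j - 2 * r) x) y
     \<oplus>\<^sub>(Q (Suc j)) t (Suc j) (r + 1) (sg j r \<odot>\<^sub>L H2 (int j - 2 * r) x) y)"

lemma smult_commute: "x \<in> carrier L ==> c \<odot>\<^sub>L (d \<odot>\<^sub>L x) = d \<odot>\<^sub>L (c \<odot>\<^sub>L x)"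
  using smult_mult[of x c d] smult_mult[of x d c] by (simp add: mult.commute)

lemma d0_balanced: "balanced L (Q j) (\<lambda>x y.
     t j r (c \<odot>\<^sub>L (x \<cdot> cA s)) y \<oplus>\<^sub>(Q j) t j q (e \<odot>\<^sub>L (x \<cdot> cB s)) y)"
  by (rule two_term_balanced)
    (auto intro!: add_homI simp: l_distr smult_distrib smult_closed smult_mult_left smult_commute
      del: equalityI)

lemma h0_balanced: "balanced L (Q j) (\<lambda>x y.
     t j r (c \<odot>\<^sub>L H1 s x) y \<oplus>\<^sub>(Q j) t j q (e \<odot>\<^sub>L H2 s x) y)"
  by (rule two_term_balanced)
    (auto intro!: add_homI simp: H_add H_smult H_closed smult_distrib smult_closed smult_commute
      del: equalityI)

lemma d0_hom: "d0 j \<in> add_hom (Q (Suc j)) (Q j)"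
  unfolding d0_def res_mod_def[of N "Suc j"] by (rule free_lift_add_hom[OF Q_bimodule d0_balanced])

lemma h0_hom: "h0 j \<in> add_hom (Q j) (Q (Suc j))"
  unfolding h0_def res_mod_def[of N j] by (rule free_lift_add_hom[OF Q_bimodule h0_balanced])

lemma d0_t:
  assumes "0 \<le> r" "r \<le> int (Suc j)" "x \<in> carrier L" "y \<in> carrier L"
  shows "d0 j (t (Suc j) r x y) =
     t j r (sg (Suc j) r \<odot>\<^sub>L (x \<cdot> cA (int (Suc j) - 2 * r))) y
     \<oplus>\<^sub>(Q j) t j (r - 1) (sg (Suc j) r \<odot>\<^sub>L (x \<cdot> cB (int (Suc j) - 2 * r))) y"
  unfolding d0_def t_def[of "Suc j"]
  by (rule free_lift_tensor[OF Q_bimodule d0_balanced]) (use assms in auto)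

lemma h0_t:
  assumes "0 \<le> r" "r \<le> int j" "x \<in> carrier L" "y \<in> carrier L"
  shows "h0 j (t j r x y) =
     t (Suc j) r ((- sg j r) \<odot>\<^sub>L H1 (int j - 2 * r) x) y
     \<oplus>\<^sub>(Q (Suc j)) t (Suc j) (r + 1) (sg j r \<odot>\<^sub>L H2 (int j - 2 * r) x) y"
  unfolding h0_def t_def[of j]
  by (rule free_lift_tensor[OF Q_bimodule h0_balanced]) (use assms in auto)

lemma smult_smult: "x \<in> carrier L ==> c \<odot>\<^sub>L (d \<odot>\<^sub>L x) = (c * d) \<odot>\<^sub>L x"
  by (simp add: smult_mult)

text \<open>At the extremal indices one of the two terms of d0 has no summand to land in. The
  vanishing of \<open>H1\<close> or \<open>H2\<close> there makes the formula for h0 d0 hold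
  nevertheless.\<close>

lemma H_vanish: "s < -1 ==> x \<in> carrier L ==> H1 s x = \<zero>\<^sub>L" "s > 0 ==> x \<in> carrier L ==> H2 s x = \<zero>\<^sub>L"
proof -
  show "H1 s x = \<zero>\<^sub>L" if s: "s < -1" and x: "x \<in> carrier L"
    using x s by (induction rule: L_induct_m) (simp_all add: H_smult H_m H_add smult_zero_right)
  show "H2 s x = \<zero>\<^sub>L" if s: "s > 0" and x: "x \<in> carrier L"
    using x s by (induction rule: L_induct_m) (simp_all add: H_smult H_m H_add smult_zero_right)
qed

lemma d0_h0_t:
  assumes r: "0 \<le> r" "r \<le> int j" and x: "x \<in> carrier L" and y: "y \<in> carrier L"
  defines "s \<equiv> int j - 2 * r"
  shows "d0 j (h0 j (t j r x y)) =
    (t j r (H1 s x \<cdot> cA (s + 1)) y \<oplus>\<^sub>(Q j) t j (r - 1) (H1 s x \<cdot> cB (s + 1)) y)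
    \<oplus>\<^sub>(Q j) (t j (r + 1) (H2 s x \<cdot> cA (s - 1)) y \<oplus>\<^sub>(Q j) t j r (H2 s x \<cdot> cB (s - 1)) y)"
proof -
  have i: "int (Suc j) - 2 * r = s + 1" "int (Suc j) - 2 * (r + 1) = s - 1" unfolding s_def by auto
  have cl: "c \<odot>\<^sub>L H1 s x \<in> carrier L" "c \<odot>\<^sub>L H2 s x \<in> carrier L" for c
    by (simp_all add: smult_closed H_closed x)
  have r1: "0 \<le> r + 1" "r + 1 \<le> int (Suc j)" "r \<le> int (Suc j)" using r by auto
  show ?thesis
    unfolding h0_t[OF r x y, folded s_def] add_hom_add[OF d0_hom t_closed[OF cl(1) y] t_closed[OF cl(2) y]]
      d0_t[OF r(1) r1(3) cl(1) y] d0_t[OF r1(1,2) cl(2) y] i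
    by (simp add: smult_mult_left H_closed x smult_smult sg_simps smult_one)
qed

lemma h0_d0_t:
  assumes r: "0 \<le> r" "r \<le> int (Suc j)" and x: "x \<in> carrier L" and y: "y \<in> carrier L"
  defines "s \<equiv> int (Suc j) - 2 * r"
  shows "h0 j (d0 j (t (Suc j) r x y)) =
    (t (Suc j) r (H1 (s - 1) (x \<cdot> cA s)) y
      \<oplus>\<^sub>(Q (Suc j)) t (Suc j) (r + 1) (\<ominus>\<^sub>L H2 (s - 1) (x \<cdot> cA s)) y)
    \<oplus>\<^sub>(Q (Suc j)) (t (Suc j) (r - 1) (\<ominus>\<^sub>L H1 (s + 1) (x \<cdot> cB s)) y
      \<oplus>\<^sub>(Q (Suc j)) t (Suc j) r (H2 (s + 1) (x \<cdot> cB s)) y)"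
proof -
  interpret F: k_bimodule L "Q (Suc j)" by (rule Q_bimodule)
  have z: "h0 j \<zero>\<^sub>(Q j) = \<zero>\<^sub>(Q (Suc j))" by (rule add_hom_zero[OF Q_group Q_group h0_hom])
  define u where "u = x \<cdot> cA s"
  define v where "v = x \<cdot> cB s"
  have uv: "u \<in> carrier L" "v \<in> carrier L" using x by (auto simp: u_def v_def)
  have i: "int j - 2 * r = s - 1" "int j - 2 * (r - 1) = s + 1" unfolding s_def by auto
  have m: "(-1) \<odot>\<^sub>L w = \<ominus>\<^sub>L w" if "w \<in> carrier L" for w using that by (rule smult_minus_one)
  have 1: "h0 j (t j r (sg (Suc j) r \<odot>\<^sub>L u) y) = t (Suc j) r (H1 (s - 1) u) y
      \<oplus>\<^sub>(Q (Suc j)) t (Suc j) (r + 1) (\<ominus>\<^sub>L H2 (s - 1) u) y"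
  proof (cases "r \<le> int j")
    case True
    show ?thesis unfolding h0_t[OF r(1) True smult_closed[OF uv(1)] y] i
      by (simp add: H_smult uv H_closed smult_smult sg_simps smult_one m)
  next
    case False
    then have "r > int j" "s - 1 < -1" "r + 1 > int (Suc j)" using r unfolding s_def by auto
    then show ?thesis using y by (simp add: t_outside z H_vanish uv t_zero_left)
  qed
  have 2: "h0 j (t j (r - 1) (sg (Suc j) r \<odot>\<^sub>L v) y) = t (Suc j) (r - 1) (\<ominus>\<^sub>L H1 (s + 1) v) y
      \<oplus>\<^sub>(Q (Suc j)) t (Suc j) r (H2 (s + 1) v) y"
  proof (cases "r \<ge> 1")
    case True
    then have "0 \<le> r - 1" "r - 1 \<le> int j" using r by auto
    then show ?thesis using h0_t[OF _ _ smult_closed[OF uv(2)] y, of "r - 1" j "sg (Suc j) r"] unfolding i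
      by (simp add: H_smult uv H_closed smult_smult sg_simps smult_one m)
  next
    case False
    then have "r - 1 < 0" "s + 1 > 0" using r unfolding s_def by auto
    then show ?thesis using y by (simp add: t_outside z H_vanish uv t_zero_left)
  qed
  show ?thesis
    unfolding d0_t[OF r x y] s_def[symmetric] u_def[symmetric] v_def[symmetric]
      add_hom_add[OF h0_hom t_closed[OF smult_closed[OF uv(1)] y] t_closed[OF smult_closed[OF uv(2)] y]] 1 2 ..
qed

lemma (in abelian_group) uminus_zero: "\<ominus> \<zero> = \<zero>"
  by (rule minus_equality) auto

lemma (in abelian_group) regroup_cancel:
  assumes "a \<in> carrier G" "b \<in> carrier G" "c \<in> carrier G" "e \<in> carrier G" "v \<in> carrier G" "w \<in> carrier G"
  shows "((a \<oplus> v) \<oplus> (w \<oplus> b)) \<oplus> ((c \<oplus> \<ominus> w) \<oplus> (\<ominus> v \<oplus> e)) = a \<oplus> b \<oplus> c \<oplus> e"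
proof -
  have "((a \<oplus> v) \<oplus> (w \<oplus> b)) \<oplus> ((c \<oplus> \<ominus> w) \<oplus> (\<ominus> v \<oplus> e))
      = (a \<oplus> b \<oplus> c \<oplus> e) \<oplus> (v \<oplus> \<ominus> v) \<oplus> (w \<oplus> \<ominus> w)"
    using assms by (simp only: a_ac a_closed a_inv_closed)
  then show ?thesis using assms by (simp add: r_neg)
qed

lemma contraction:
  assumes z: "z \<in> carrier (Q (Suc j))"
  shows "d0 (Suc j) (h0 (Suc j) z) \<oplus>\<^sub>(Q (Suc j)) h0 j (d0 j z) = z"
proof -
  interpret F: k_bimodule L "Q (Suc j)" by (rule Q_bimodule)
  have id: "(\<lambda>z. z) \<in> add_hom (Q (Suc j)) (Q (Suc j))" by (auto simp: add_hom_def)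
  show ?thesis
  proof (rule Q_hom_eq[OF Q_group add_hom_plus[OF Q_group add_hom_comp[OF h0_hom d0_hom] add_hom_comp[OF d0_hom h0_hom]] id z])
    fix r x y assume a: "0 \<le> r" "r \<le> int (Suc j)" "x \<in> carrier L" "y \<in> carrier L"
    define s where "s = int (Suc j) - 2 * r"
    have cl: "H1 q x \<in> carrier L" "H2 q x \<in> carrier L" "H1 q (x \<cdot> cA q') \<in> carrier L"
      "H2 q (x \<cdot> cA q') \<in> carrier L" "H1 q (x \<cdot> cB q') \<in> carrier L" "H2 q (x \<cdot> cB q') \<in> carrier L"
      for q q' using a(3) by (simp_all add: H_closed)
    show "d0 (Suc j) (h0 (Suc j) (t (Suc j) r x y)) \<oplus>\<^sub>(Q (Suc j)) h0 j (d0 j (t (Suc j) r x y)) = t (Suc j) r x y"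
      unfolding d0_h0_t[OF a] h0_d0_t[OF a] s_def[symmetric] H_cross[OF a(3)]
      using a(4) cl H_diag[OF a(3), of s]
      by (simp add: t_uminus_left F.M.regroup_cancel m_closed a(3) flip: t_add_left)
  qed
qed

text \<open>The filtration by the radical degree of the right factors. Its leading differential is \<open>d0\<close>.\<close>

inductive_set W :: "nat => nat => (int => ('k, 'k lam) tens) set" for n i where
  W_zero: "\<zero>\<^sub>(Q n) \<in> W n i"
| W_t: "x \<in> carrier L ==> y \<in> Lge i ==> 0 \<le> r ==> r \<le> int n ==> t n r x y \<in> W n i"
| W_add: "u \<in> W n i ==> v \<in> W n i ==> u \<oplus>\<^sub>(Q n) v \<in> W n i"

lemma W_t': "x \<in> carrier L ==> y \<in> Lge i ==> t n r x y \<in> W n i"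
  using W_t[of x y i r n] t_outside[of r n x y] W_zero[of n i] by (cases "0 \<le> r \<and> r \<le> int n") force+

lemma W_carrier: "z \<in> W n i ==> z \<in> carrier (Q n)"
proof (induction rule: W.induct)
  interpret F: k_bimodule L "Q n" by (rule Q_bimodule)
  { case W_zero show ?case by simp }
  { case (W_t x y r) then show ?case by (simp add: Lge_carrier) }
  { case (W_add u v) then show ?case by simp }
qed

lemma W_0: "W n 0 = carrier (Q n)"
proof (intro equalityI subsetI)
  fix z assume "z \<in> carrier (Q n)"
  then show "z \<in> W n 0" by (induction rule: Q_induct) (auto intro: W.intros simp: Lge_0)
qed (rule W_carrier)

lemma W_top: "z \<in> W n (Suc (2 * N)) ==> z = \<zero>\<^sub>(Q n)"
proof (induction rule: W.induct)
  interpret F: k_bimodule L "Q n" by (rule Q_bimodule)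
  { case (W_t x y r) then have "y = \<zero>\<^sub>L" by (intro Lge_top)
    then show ?case using W_t by (simp add: t_zero_right) }
  { case (W_add u v) then show ?case by simp }
qed simp

lemma W_uminus: "z \<in> W n i ==> \<ominus>\<^sub>(Q n) z \<in> W n i"
proof (induction rule: W.induct)
  interpret F: k_bimodule L "Q n" by (rule Q_bimodule)
  { case W_zero show ?case unfolding F.M.uminus_zero by (rule W.W_zero) }
  { case (W_t x y r) then show ?case using W.W_t[of "\<ominus>\<^sub>L x" y i r n] by (simp add: t_uminus_left Lge_carrier) }
  { case (W_add u v) then show ?case using W.W_add W_carrier by (simp add: F.M.minus_add) }
qed

lemma W_minus: "u \<in> W n i ==> v \<in> W n i ==> u \<ominus>\<^sub>(Q n) v \<in> W n i"
  unfolding a_minus_def by (intro W.W_add W_uminus)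

lemma W_mono: "z \<in> W n (Suc i) ==> z \<in> W n i"
  by (induction rule: W.induct) (use Lge_mono[of i "Suc i"] in \<open>auto intro: W.intros\<close>)

lemma W_smult:
  assumes "z \<in> W n i" "a \<in> carrier L"
  shows "a \<odot>\<^sub>(Q n) z \<in> W n i" "z \<odot>\<^sup>r\<^sub>(Q n) a \<in> W n i"
proof -
  interpret F: k_bimodule L "Q n" by (rule Q_bimodule)
  have "a \<odot>\<^sub>(Q n) z \<in> W n i \<and> z \<odot>\<^sup>r\<^sub>(Q n) a \<in> W n i" using assms(1)
  proof (induction rule: W.induct)
    case W_zero
    then show ?case using assms(2) by (simp add: F.l_zero_vec F.r_zero_vec W.W_zero)
  next
    case (W_t x y r)
    then show ?case using assms(2) by (simp add: t_smult Lge_carrier W.W_t Lge_mult_right)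
  next
    case (W_add u v)
    then show ?case using assms(2) W_carrier by (simp add: F.l_distr_vector F.r_distr_vector W.W_add)
  qed
  then show "a \<odot>\<^sub>(Q n) z \<in> W n i" "z \<odot>\<^sup>r\<^sub>(Q n) a \<in> W n i" by auto
qed

text \<open>The contraction changes left factors only, so it respects the filtration by right
  factors.\<close>

lemma h0_W: "z \<in> W n i ==> h0 n z \<in> W (Suc n) i"
proof (induction rule: W.induct)
  case W_zero
  then show ?case using add_hom_zero[OF Q_group Q_group h0_hom] W.W_zero by metis
next
  case (W_t x y r)
  then show ?case
    by (simp add: h0_t Lge_carrier) (intro W.W_add W_t'; simp add: smult_closed H_closed)
next
  case (W_add u v)
  then show ?case using add_hom_add[OF h0_hom W_carrier W_carrier] W.W_add by metis
qed

lemma m_Lge_Suc: "k > 0 ==> y \<in> Lge i ==> m x k \<cdot> y \<in> Lge (Suc i)"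
  using Lge_mult[OF m_Lge[of x k], of y i] Lge_mono[of "Suc i" "k + i"] by force

lemma alt_sign_t:
  assumes "x \<in> carrier L" "y \<in> carrier L"
  shows "alt_sign (Q n) (int k + r) (t n q x y) = t n q (sg k r \<odot>\<^sub>L x) y"
  using assms by (simp add: alt_sign_def sg_def smult_one smult_minus_one t_uminus_left)

lemma alt_sign_W: "z \<in> W n i ==> alt_sign (Q n) k z \<in> W n i"
  unfolding alt_sign_def by (simp add: W_uminus)

text \<open>Every term of the differential outside \<open>d0\<close> multiplies the right factor by
  a word of positive length.\<close>

lemma res_diff_leading_t:
  assumes r: "0 \<le> r" "r \<le> int (Suc j)" and x: "x \<in> carrier L" and y: "y \<in> Lge i"
  shows "\<exists>w\<in>W j (Suc i). res_diff N (Suc j) (t (Suc j) r x y) = d0 j (t (Suc j) r x y) \<oplus>\<^sub>(Q j) w"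
proof -
  interpret F: k_bimodule L "Q j" by (rule Q_bimodule)
  have yc: "y \<in> carrier L" by (rule Lge_carrier[OF y])
  note cl = alt_sign_closed[OF F.M.abelian_group_axioms] F.l_closed F.r_closed
  note sm = alt_sign_smult t_smult F.l_distr_vector F.r_distr_vector
  let ?s = "int (Suc j) - 2 * r"
  show ?thesis
  proof (cases "?s = 0")
    case False
    then have off: "int (Suc j) \<noteq> 2 * r" by simp
    let ?w = "t j r x (cA ?s \<cdot> y) \<oplus>\<^sub>(Q j) alt_sign (Q j) (int (Suc j)) (t j (r - 1) x (cB ?s \<cdot> y))"
    have "cA ?s \<cdot> y \<in> Lge (Suc i)" "cB ?s \<cdot> y \<in> Lge (Suc i)"
      using Lge_mult[OF cA_Lge y] Lge_mult[OF cB_Lge y] by simp_all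
    then have w: "?w \<in> W j (Suc i)" by (intro W.W_add alt_sign_W W_t' x)
    have "res_diff N (Suc j) (t (Suc j) r x y) = (t j r x (cA ?s \<cdot> y)
        \<oplus>\<^sub>(Q j) t j r (sg (Suc j) r \<odot>\<^sub>L (x \<cdot> cA ?s)) y
        \<oplus>\<^sub>(Q j) t j (r - 1) (sg (Suc j) r \<odot>\<^sub>L (x \<cdot> cB ?s)) y)
        \<oplus>\<^sub>(Q j) alt_sign (Q j) (int (Suc j)) (t j (r - 1) x (cB ?s \<cdot> y))"
      unfolding res_diff_tensor[OF r x yc] res_diff_gen_off[OF off] diff_Suc_1
      using x yc
      by (simp add: sm cl alt_sign_t smult_closed smult_mult_right smult_mult_left del: of_nat_Suc)
    also have "\<dots> = (t j r (sg (Suc j) r \<odot>\<^sub>L (x \<cdot> cA ?s)) y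
        \<oplus>\<^sub>(Q j) t j (r - 1) (sg (Suc j) r \<odot>\<^sub>L (x \<cdot> cB ?s)) y) \<oplus>\<^sub>(Q j) ?w"
      using x yc by (simp add: F.M.a_ac cl smult_closed del: of_nat_Suc)
    finally show ?thesis unfolding d0_t[OF r x yc] using w by blast
  next
    case True
    then have mid: "int (Suc j) = 2 * r" by simp
    have s0: "?s = 0" by (rule True)
    have sgn: "sg (Suc j) r = sg 0 r" using mid by (simp add: sg_def)
    let ?p = "\<lambda>k. t j r (x \<cdot> m Arr (2 * k)) (m Arr (2 * (N - k - 1) + 1) \<cdot> y)"
    let ?q = "\<lambda>k. t j (r - 1) (sg 0 r \<odot>\<^sub>L (x \<cdot> m Arr_bar (2 * k + 1))) (m Arr (2 * (N - k - 1)) \<cdot> y)"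
    let ?u = "\<lambda>k. t j r (sg 0 r \<odot>\<^sub>L (x \<cdot> m Arr (2 * k + 1))) (m Arr_bar (2 * (N - k - 1)) \<cdot> y)"
    let ?v = "\<lambda>k. t j (r - 1) (x \<cdot> m Arr_bar (2 * k)) (m Arr_bar (2 * (N - k - 1) + 1) \<cdot> y)"
    let ?T = "\<lambda>k. (?p k \<oplus>\<^sub>(Q j) ?q k) \<oplus>\<^sub>(Q j) (?u k \<oplus>\<^sub>(Q j) ?v k)"
    have Tc: "?T k \<in> carrier (Q j)" for k using x yc by (simp add: smult_closed)
    have mm: "m y 1 \<cdot> m y (2 * k) = m y (2 * k + 1)" "m (flip y) (2 * k) \<cdot> m y 1 = m y (2 * k + 1)"
      "m y (2 * k) \<cdot> m (flip y) 1 = m (flip y) (2 * k + 1)" for y k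
      by (auto simp: m_mult m_0 del: equalityI)
    have as: "alt_sign (Q j) r (t j q u v) = t j q (sg 0 r \<odot>\<^sub>L u) v" if "u \<in> carrier L" "v \<in> carrier L" for q u v
      using alt_sign_t[OF that, of j 0 r q] by simp
    have GT: "x \<odot>\<^sub>(Q j) mid_term j r k \<odot>\<^sup>r\<^sub>(Q j) y = ?T k" for k
      using x yc mm[of Arr] mm[of Arr_bar]
      by (simp add: sm cl as m_assoc[symmetric] smult_mult_right smult_mult_left smult_closed)
    have h: "(\<lambda>z. x \<odot>\<^sub>(Q j) z \<odot>\<^sup>r\<^sub>(Q j) y) \<in> add_hom (Q j) (Q j)"
      by (rule add_hom_comp[OF F.l_add_hom[OF x] F.r_add_hom[OF yc]])
    have "res_diff N (Suc j) (t (Suc j) r x y) = x \<odot>\<^sub>(Q j) (\<Oplus>\<^sub>(Q j)k\<in>{..N - 1}. mid_term j r k) \<odot>\<^sup>r\<^sub>(Q j) y"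
      unfolding res_diff_tensor[OF r x yc] res_diff_gen_mid[OF mid] diff_Suc_1 ..
    also have "\<dots> = (\<Oplus>\<^sub>(Q j)k\<in>{..N - 1}. ?T k)"
      unfolding GT[symmetric]
      by (rule add_hom_finsum[OF F.M.abelian_group_axioms F.M.abelian_group_axioms h]) (use mid_term_closed in blast)
    also have "{..N - 1} = insert (N - 1) {..<N - 1}" by auto
    also have "(\<Oplus>\<^sub>(Q j)k\<in>insert (N - 1) {..<N - 1}. ?T k) = ?T (N - 1) \<oplus>\<^sub>(Q j) (\<Oplus>\<^sub>(Q j)k\<in>{..<N - 1}. ?T k)"
      by (rule F.M.finsum_insert) (use Tc in \<open>simp_all only: Pi_iff finite_lessThan lessThan_iff less_irrefl not_False_eq_True ball_simps\<close>, blast)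
    \<comment> \<open>For k = N - 1 the even words on the right are empty: \<open>?q\<close> and
      \<open>?u\<close> leave y alone and make up \<open>d0\<close>, while \<open>?p\<close> and
      \<open>?v\<close> multiply y by a letter.\<close>
    also have "?T (N - 1) = d0 j (t (Suc j) r x y) \<oplus>\<^sub>(Q j) (?p (N - 1) \<oplus>\<^sub>(Q j) ?v (N - 1))"
    proof -
      have e: "2 * (N - 1) + 1 = 2 * N - 1" "N - (N - 1) - 1 = 0" using N_gt by auto
      have c: "cA ?s = m Arr (2 * (N - 1) + 1)" "cB ?s = m Arr_bar (2 * (N - 1) + 1)"
        unfolding s0 cA_def cB_def e by simp_all
      have q: "?q (N - 1) = t j (r - 1) (sg (Suc j) r \<odot>\<^sub>L (x \<cdot> cB ?s)) y"
        unfolding c sgn e(2) using yc by (simp add: m_0)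
      have u: "?u (N - 1) = t j r (sg (Suc j) r \<odot>\<^sub>L (x \<cdot> cA ?s)) y"
        unfolding c sgn e(2) using yc by (simp add: m_0)
      show ?thesis unfolding d0_t[OF r x yc] q u using x yc
        by (simp only: F.M.a_ac F.M.a_closed t_closed smult_closed m_closed cA_closed cB_closed m_closed monoid.m_closed[OF monoid_axioms])
    qed
    also have "d0 j (t (Suc j) r x y) \<oplus>\<^sub>(Q j) (?p (N - 1) \<oplus>\<^sub>(Q j) ?v (N - 1)) \<oplus>\<^sub>(Q j) (\<Oplus>\<^sub>(Q j)k\<in>{..<N - 1}. ?T k)
      = d0 j (t (Suc j) r x y) \<oplus>\<^sub>(Q j) ((?p (N - 1) \<oplus>\<^sub>(Q j) ?v (N - 1)) \<oplus>\<^sub>(Q j) (\<Oplus>\<^sub>(Q j)k\<in>{..<N - 1}. ?T k))"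
      using x yc Tc add_hom_closed[OF d0_hom t_closed[OF x yc]]
      by (intro F.M.a_assoc F.M.a_closed F.M.finsum_closed t_closed) (auto intro!: m_closed)
    finally have eq: "res_diff N (Suc j) (t (Suc j) r x y) = d0 j (t (Suc j) r x y)
      \<oplus>\<^sub>(Q j) ((?p (N - 1) \<oplus>\<^sub>(Q j) ?v (N - 1)) \<oplus>\<^sub>(Q j) (\<Oplus>\<^sub>(Q j)k\<in>{..<N - 1}. ?T k))" .
    have TW: "?T k \<in> W j (Suc i)" if "k < N - 1" for k
      using that x y by (intro W.W_add W_t' m_Lge_Suc smult_closed m_closed) auto
    have fW: "(\<Oplus>\<^sub>(Q j)k\<in>S. ?T k) \<in> W j (Suc i)" if "finite S" "S \<subseteq> {..<N - 1}" for S
      using that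
    proof (induction S rule: finite_induct)
      case empty
      show ?case by (simp add: W.W_zero)
    next
      case (insert k S)
      have "(\<Oplus>\<^sub>(Q j)k\<in>insert k S. ?T k) = ?T k \<oplus>\<^sub>(Q j) (\<Oplus>\<^sub>(Q j)k\<in>S. ?T k)"
        using insert Tc by (intro F.M.finsum_insert) auto
      then show ?case using insert TW[of k] W.W_add by simp
    qed
    have "?p (N - 1) \<in> W j (Suc i)" "?v (N - 1) \<in> W j (Suc i)"
      using x y by (intro W_t' m_Lge_Suc; auto)+
    then show ?thesis
      by (rule_tac bexI, rule_tac eq) (rule W.W_add[OF W.W_add fW[OF finite_lessThan order_refl]])
  qed
qed

lemma res_diff_leading:
  assumes "z \<in> W (Suc j) i"
  shows "\<exists>w\<in>W j (Suc i). res_diff N (Suc j) z = d0 j z \<oplus>\<^sub>(Q j) w"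
  using assms
proof (induction rule: W.induct)
  interpret F: k_bimodule L "Q j" by (rule Q_bimodule)
  have dh: "res_diff N (Suc j) \<in> bimod_hom L (Q (Suc j)) (Q j)" using res_diff(1)[of "Suc j"] by simp
  {
    case W_zero
    show ?case
      using add_hom_zero[OF Q_group Q_group d0_hom] add_hom_zero[OF Q_group Q_group bimod_hom_add_hom[OF dh]]
      by (intro bexI[OF _ W.W_zero]) simp
  next
    case (W_t x y r)
    then show ?case by (intro res_diff_leading_t)
  next
    case (W_add u v)
    then obtain a b where ab: "a \<in> W j (Suc i)" "b \<in> W j (Suc i)"
      "res_diff N (Suc j) u = d0 j u \<oplus>\<^sub>(Q j) a" "res_diff N (Suc j) v = d0 j v \<oplus>\<^sub>(Q j) b" by blast
    have uv: "u \<in> carrier (Q (Suc j))" "v \<in> carrier (Q (Suc j))" using W_add W_carrier by blast+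
    have "res_diff N (Suc j) (u \<oplus>\<^sub>(Q (Suc j)) v) = d0 j (u \<oplus>\<^sub>(Q (Suc j)) v) \<oplus>\<^sub>(Q j) (a \<oplus>\<^sub>(Q j) b)"
      using ab uv add_hom_closed[OF d0_hom] W_carrier
      by (simp add: bimod_homD(3)[OF dh] add_hom_add[OF d0_hom] F.M.a_ac)
    then show ?case using W.W_add[OF ab(1,2)] by blast
  }
qed

text \<open>By \<open>contraction\<close>, z is d0 h0 z + h0 d0 z. For a cycle, d0 z lies one step
  deeper, and d0 h0 z agrees with the boundary of h0 z up to one step.\<close>

lemma cycle_step:
  assumes z: "z \<in> W (Suc j) i" and cycle: "res_diff N (Suc j) z = \<zero>\<^sub>(Q j)"
  shows "z \<ominus>\<^sub>(Q (Suc j)) res_diff N (Suc (Suc j)) (h0 (Suc j) z) \<in> W (Suc j) (Suc i)"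
proof -
  interpret F: k_bimodule L "Q (Suc j)" by (rule Q_bimodule)
  interpret G: k_bimodule L "Q j" by (rule Q_bimodule)
  obtain w1 where w1: "w1 \<in> W (Suc j) (Suc i)"
    "res_diff N (Suc (Suc j)) (h0 (Suc j) z) = d0 (Suc j) (h0 (Suc j) z) \<oplus>\<^sub>(Q (Suc j)) w1"
    using res_diff_leading[OF h0_W[OF z]] by blast
  obtain w2 where w2: "w2 \<in> W j (Suc i)" "d0 j z \<oplus>\<^sub>(Q j) w2 = \<zero>\<^sub>(Q j)"
    using res_diff_leading[OF z] cycle by metis
  have zc: "z \<in> carrier (Q (Suc j))" by (rule W_carrier[OF z])
  have "d0 j z = \<ominus>\<^sub>(Q j) w2"
    using G.M.minus_equality[OF w2(2)] W_carrier[OF w2(1)] add_hom_closed[OF d0_hom zc] by simp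
  then have h: "h0 j (d0 j z) \<in> W (Suc j) (Suc i)" using h0_W[OF W_uminus[OF w2(1)]] by simp
  define a where "a = d0 (Suc j) (h0 (Suc j) z)"
  have a: "a \<in> carrier (Q (Suc j))"
    unfolding a_def by (rule add_hom_closed[OF d0_hom add_hom_closed[OF h0_hom zc]])
  have "z \<ominus>\<^sub>(Q (Suc j)) res_diff N (Suc (Suc j)) (h0 (Suc j) z)
      = (a \<oplus>\<^sub>(Q (Suc j)) h0 j (d0 j z)) \<ominus>\<^sub>(Q (Suc j)) (a \<oplus>\<^sub>(Q (Suc j)) w1)"
    using contraction[OF zc] w1(2) unfolding a_def by simp
  also have "\<dots> = (a \<oplus>\<^sub>(Q (Suc j)) \<ominus>\<^sub>(Q (Suc j)) a) \<oplus>\<^sub>(Q (Suc j)) (h0 j (d0 j z) \<oplus>\<^sub>(Q (Suc j)) \<ominus>\<^sub>(Q (Suc j)) w1)"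
    using a W_carrier[OF h] W_carrier[OF w1(1)]
    by (simp only: a_minus_def F.M.minus_add F.M.a_ac F.M.a_closed F.M.a_inv_closed)
  also have "\<dots> = h0 j (d0 j z) \<ominus>\<^sub>(Q (Suc j)) w1"
    using a W_carrier[OF h] W_carrier[OF w1(1)] by (simp add: F.M.r_neg a_minus_def)
  finally show ?thesis using W_minus[OF h w1(1)] by simp
qed

section \<open>The augmentation and the end of the resolution\<close>

lemma res_aug:
  shows "res_aug N \<in> bimod_hom L (Q 0) (regular_bimod L)"
    and "x \<in> carrier L ==> y \<in> carrier L ==> res_aug N (t 0 0 x y) = x \<cdot> y"
proof -
  have fe: "res_aug N \<in> bimod_hom L (Q 0) (regular_bimod L)" "res_aug N (t 0 0 \<one>\<^sub>L \<one>\<^sub>L) = \<one>\<^sub>L"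
    unfolding res_aug_def res_mod_def t_def
    using free_extend[OF regular_k_bimodule, of "res_index 0" "\<lambda>_. \<one>\<^sub>L"] by auto
  then show "res_aug N \<in> bimod_hom L (Q 0) (regular_bimod L)" by simp
  show "x \<in> carrier L ==> y \<in> carrier L ==> res_aug N (t 0 0 x y) = x \<cdot> y"
    using Q_hom_tensor[OF fe(1), of x y 0] fe(2) by simp
qed

text \<open>In degree 0 the contraction misses the constant term of the left factor x, so d0 h0
  recovers all of the tensor except the constant term of x times y on the right. This multiple of y
  differs from the product x y by an element one step deeper.\<close>

lemma res_aug_W: "z \<in> W 0 i ==> \<exists>w\<in>Lge (Suc i). z = d0 0 (h0 0 z) \<oplus>\<^sub>(Q 0) t 0 0 \<one>\<^sub>L (res_aug N z \<oplus>\<^sub>L w)"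
proof (induction rule: W.induct)
  interpret F: k_bimodule L "Q 0" by (rule Q_bimodule)
  {
    case W_zero
    have "res_aug N \<zero>\<^sub>(Q 0) = \<zero>\<^sub>L"
      using add_hom_zero[OF Q_group _ bimod_hom_add_hom[OF res_aug(1)]]
        k_bimodule.axioms(2)[OF regular_k_bimodule] unfolding bimodule_def by simp
    moreover have "d0 0 (h0 0 \<zero>\<^sub>(Q 0)) = \<zero>\<^sub>(Q 0)"
      using add_hom_zero[OF Q_group Q_group add_hom_comp[OF h0_hom d0_hom]] by simp
    ultimately show ?case by (intro bexI[OF _ Lge_zero]) (simp add: t_zero_right)
  next
    case (W_t x y r)
    then have r: "r = 0" and yc: "y \<in> carrier L" by (auto intro: Lge_carrier)
    define w where "w = (cst x \<odot>\<^sub>L \<one>\<^sub>L \<ominus>\<^sub>L x) \<cdot> y"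
    have cx: "cst x \<odot>\<^sub>L \<one>\<^sub>L \<in> carrier L" by auto
    have "cst (cst x \<odot>\<^sub>L \<one>\<^sub>L \<ominus>\<^sub>L x) = 0"
      using W_t(1) N_gt by (simp add: a_minus_def cst_simps coef_smult)
    then have "cst x \<odot>\<^sub>L \<one>\<^sub>L \<ominus>\<^sub>L x \<in> Lge 1" using Lge_cst[of "cst x \<odot>\<^sub>L \<one>\<^sub>L \<ominus>\<^sub>L x"] cx W_t(1) by simp
    then have w: "w \<in> Lge (Suc i)" unfolding w_def using Lge_mult W_t(2) by fastforce
    have aug: "res_aug N (t 0 r x y) \<oplus>\<^sub>L w = cst x \<odot>\<^sub>L y"
    proof -
      have "x \<oplus>\<^sub>L (cst x \<odot>\<^sub>L \<one>\<^sub>L \<ominus>\<^sub>L x) = cst x \<odot>\<^sub>L \<one>\<^sub>L"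
        using W_t(1) cx minus_add_cancel_right[OF cx W_t(1)] by (simp add: a_comm)
      then have "x \<cdot> y \<oplus>\<^sub>L w = (cst x \<odot>\<^sub>L \<one>\<^sub>L) \<cdot> y"
        unfolding w_def using W_t(1) cx yc by (simp flip: l_distr)
      then show ?thesis unfolding r using W_t(1) yc by (simp add: res_aug(2) smult_left[symmetric])
    qed
    have d: "H1 0 x \<cdot> cA 1 \<oplus>\<^sub>L H2 0 x \<cdot> cB (-1) \<oplus>\<^sub>L cst x \<odot>\<^sub>L \<one>\<^sub>L = x"
    proof -
      \<comment> \<open>This term of \<open>H_diag\<close> would pass through degree -1. Division by
        the word \<open>cA 0\<close> of length 2N - 1 leaves only the constant term of x.\<close>
      have "H1 (-1) (x \<cdot> cA 0) = cst x \<odot>\<^sub>L \<one>\<^sub>L" using W_t(1)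
      proof (induction rule: L_induct_m)
        case (word c x l)
        have "cst (m x l) = (if l = 0 then 1 else 0)" unfolding m_def by (simp add: cst_simps)
        then show ?case using N_gt word
          by (auto simp: smult_mult_left H_smult cA_def m_mult H_m coef_smult smult_zero_right
              smult_zero_left smult_one m_big H_zero del: equalityI)
      next
        case (add x y)
        then show ?case by (simp add: l_distr H_add cst_simps smult_add)
      qed
      then show ?thesis using H_diag[OF W_t(1), of 0] H_vanish(2)[of 1 "x \<cdot> cB 0"] W_t(1) cx
        by (simp add: H_closed)
    qed
    have "d0 0 (h0 0 (t 0 0 x y)) = t 0 0 (H1 0 x \<cdot> cA 1 \<oplus>\<^sub>L H2 0 x \<cdot> cB (-1)) y"
      using d0_h0_t[of 0 0 x y] W_t(1) yc by (simp add: t_outside H_closed t_add_left)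
    moreover have "t 0 0 \<one>\<^sub>L (cst x \<odot>\<^sub>L y) = t 0 0 (cst x \<odot>\<^sub>L \<one>\<^sub>L) y"
      using yc by (simp add: t_scal_left t_scal_right)
    ultimately have "d0 0 (h0 0 (t 0 0 x y)) \<oplus>\<^sub>(Q 0) t 0 0 \<one>\<^sub>L (cst x \<odot>\<^sub>L y) = t 0 0 x y"
      using d W_t(1) yc cx by (simp add: H_closed flip: t_add_left)
    then show ?case using w aug unfolding r by (metis (no_types, lifting))
  next
    case (W_add u v)
    then obtain a b where ab: "a \<in> Lge (Suc i)" "b \<in> Lge (Suc i)"
      "u = d0 0 (h0 0 u) \<oplus>\<^sub>(Q 0) t 0 0 \<one>\<^sub>L (res_aug N u \<oplus>\<^sub>L a)"
      "v = d0 0 (h0 0 v) \<oplus>\<^sub>(Q 0) t 0 0 \<one>\<^sub>L (res_aug N v \<oplus>\<^sub>L b)" by blast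
    have uv: "u \<in> carrier (Q 0)" "v \<in> carrier (Q 0)" using W_add W_carrier by blast+
    note dh = add_hom_comp[OF h0_hom d0_hom, of 0]
    have rc: "res_aug N u \<in> carrier L" "res_aug N v \<in> carrier L" using bimod_homD(1)[OF res_aug(1)] uv by auto
    note abc = Lge_carrier[OF ab(1)] Lge_carrier[OF ab(2)]
    have e: "res_aug N (u \<oplus>\<^sub>(Q 0) v) \<oplus>\<^sub>L (a \<oplus>\<^sub>L b) = (res_aug N u \<oplus>\<^sub>L a) \<oplus>\<^sub>L (res_aug N v \<oplus>\<^sub>L b)"
      using bimod_homD(3)[OF res_aug(1) uv] rc abc by (simp add: a_ac)
    have "d0 0 (h0 0 (u \<oplus>\<^sub>(Q 0) v)) \<oplus>\<^sub>(Q 0) t 0 0 \<one>\<^sub>L (res_aug N (u \<oplus>\<^sub>(Q 0) v) \<oplus>\<^sub>L (a \<oplus>\<^sub>L b))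
      = (d0 0 (h0 0 u) \<oplus>\<^sub>(Q 0) t 0 0 \<one>\<^sub>L (res_aug N u \<oplus>\<^sub>L a))
        \<oplus>\<^sub>(Q 0) (d0 0 (h0 0 v) \<oplus>\<^sub>(Q 0) t 0 0 \<one>\<^sub>L (res_aug N v \<oplus>\<^sub>L b))"
      unfolding e add_hom_add[OF dh uv] using rc abc add_hom_closed[OF dh] uv
      by (simp add: t_add_right F.M.a_ac)
    then show ?case using ab(3,4) Lge_add[OF ab(1,2)] by metis
  }
qed

text \<open>The argument of \<open>cycle_step\<close>, with \<open>res_aug_W\<close> in the place of
  the contraction.\<close>

lemma aug_cycle_step:
  assumes z: "z \<in> W 0 i" and cycle: "res_aug N z = \<zero>\<^sub>L"
  shows "z \<ominus>\<^sub>(Q 0) res_diff N (Suc 0) (h0 0 z) \<in> W 0 (Suc i)"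
proof -
  interpret F: k_bimodule L "Q 0" by (rule Q_bimodule)
  obtain w1 where w1: "w1 \<in> W 0 (Suc i)"
    "res_diff N (Suc 0) (h0 0 z) = d0 0 (h0 0 z) \<oplus>\<^sub>(Q 0) w1"
    using res_diff_leading[OF h0_W[OF z]] by blast
  obtain w where w: "w \<in> Lge (Suc i)" "z = d0 0 (h0 0 z) \<oplus>\<^sub>(Q 0) t 0 0 \<one>\<^sub>L (res_aug N z \<oplus>\<^sub>L w)"
    using res_aug_W[OF z] by blast
  have zc: "z \<in> carrier (Q 0)" by (rule W_carrier[OF z])
  define a where "a = d0 0 (h0 0 z)"
  define b where "b = t 0 0 \<one>\<^sub>L w"
  have a: "a \<in> carrier (Q 0)"
    unfolding a_def by (rule add_hom_closed[OF d0_hom add_hom_closed[OF h0_hom zc]])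
  have h: "b \<in> W 0 (Suc i)" unfolding b_def by (rule W_t'[OF one_closed w(1)])
  have zab: "z = a \<oplus>\<^sub>(Q 0) b" using w cycle Lge_carrier[OF w(1)] unfolding a_def b_def by simp
  have "z \<ominus>\<^sub>(Q 0) res_diff N (Suc 0) (h0 0 z) = (a \<oplus>\<^sub>(Q 0) b) \<ominus>\<^sub>(Q 0) (a \<oplus>\<^sub>(Q 0) w1)"
    using zab w1(2) unfolding a_def[symmetric] by simp
  also have "\<dots> = (a \<oplus>\<^sub>(Q 0) \<ominus>\<^sub>(Q 0) a) \<oplus>\<^sub>(Q 0) (b \<oplus>\<^sub>(Q 0) \<ominus>\<^sub>(Q 0) w1)"
    using a W_carrier[OF h] W_carrier[OF w1(1)]
    by (simp only: a_minus_def F.M.minus_add F.M.a_ac F.M.a_closed F.M.a_inv_closed)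
  also have "\<dots> = b \<ominus>\<^sub>(Q 0) w1"
    using a W_carrier[OF h] W_carrier[OF w1(1)] by (simp add: F.M.r_neg a_minus_def)
  finally show ?thesis using W_minus[OF h w1(1)] by simp
qed

definition cycle :: "nat => (int => ('k, 'k lam) tens) => bool" where
  "cycle n z \<longleftrightarrow> (if n = 0 then res_aug N z = \<zero>\<^sub>L else res_diff N n z = \<zero>\<^sub>(Q (n - 1)))"

lemma res_diff_Suc: "res_diff N (Suc n) \<in> bimod_hom L (Q (Suc n)) (Q n)"
  using res_diff(1)[of "Suc n"] by simp

text \<open>Degree 1 has no middle generator. At r = 0 and at r = 1 the same word occurs once on the
  left and once on the right, with opposite signs.\<close>

lemma res_aug_res_diff:
  assumes "z \<in> carrier (Q (Suc 0))"
  shows "res_aug N (res_diff N (Suc 0) z) = \<zero>\<^sub>L"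
proof -
  interpret F: k_bimodule L "Q 0" by (rule Q_bimodule)
  have 0: "(\<lambda>z. \<zero>\<^sub>L) \<in> add_hom (Q (Suc 0)) L" by (auto simp: add_hom_def)
  note aug = reg_hom_add_hom[OF res_aug(1)]
  note dh = bimod_hom_add_hom[OF res_diff_Suc[of 0]]
  have v: "res_aug N (t 0 q \<one>\<^sub>L \<one>\<^sub>L) = (if q = 0 then \<one>\<^sub>L else \<zero>\<^sub>L)" for q
    using t_outside[of q 0] add_hom_zero[OF Q_group is_abelian_group aug] res_aug(2)
    by (cases "q = 0") (auto simp: linorder_neq_iff del: equalityI)
  have gen: "res_aug N (res_diff_gen N (Suc 0) r) = \<zero>\<^sub>L" if "r = 0 \<or> r = 1" for r
  proof -
    have off: "int (Suc 0) \<noteq> 2 * r" using that by auto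
    show ?thesis unfolding reg_hom_gen_off[OF res_aug(1) off] v using that by (auto simp: alt_sign_def r_neg del: equalityI)
  qed
  show ?thesis
  proof (rule Q_hom_eq[OF is_abelian_group add_hom_comp[OF dh aug] 0 assms])
    fix r x y assume xy: "0 \<le> r" "r \<le> int (Suc 0)" "x \<in> carrier L" "y \<in> carrier L"
    have g: "res_diff_gen N (Suc 0) r \<in> carrier (Q 0)" using res_diff_gen_closed[of "Suc 0" r] by simp
    have "r = 0 \<or> r = 1" using xy by auto
    then show "res_aug N (res_diff N (Suc 0) (t (Suc 0) r x y)) = \<zero>\<^sub>L"
      using xy g res_diff_tensor[OF xy] gen[of r]
      by (simp add: bimod_homD(4,5)[OF res_aug(1)] F.l_closed)
  qed
qed

lemma cycle_res_diff: "z \<in> carrier (Q (Suc n)) ==> cycle n (res_diff N (Suc n) z)"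
  unfolding cycle_def using res_aug_res_diff res_diff_res_diff[of "Suc n" z] by (cases n) auto

lemma cycle_minus:
  assumes "u \<in> carrier (Q n)" "v \<in> carrier (Q n)" "cycle n u" "cycle n v"
  shows "cycle n (u \<ominus>\<^sub>(Q n) v)"
proof (cases n)
  case 0
  note aug = reg_hom_add_hom[OF res_aug(1)]
  show ?thesis using assms 0 add_hom_minus[OF Q_group is_abelian_group aug, of u v]
    by (simp add: cycle_def minus_eq)
next
  case (Suc k)
  interpret F: k_bimodule L "Q k" by (rule Q_bimodule)
  show ?thesis
    using assms Suc add_hom_minus[OF Q_group Q_group bimod_hom_add_hom[OF res_diff_Suc[of k]], of u v]
    by (simp add: cycle_def F.M.minus_eq)
qed

text \<open>Subtracting the boundary of h0 z moves a cycle one step down the filtration, which is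
  zero from step 2N + 1 on; k counts the steps that remain. That the preimage stays in step i is
  what \<open>radical_lift\<close> relies on.\<close>

lemma cycle_boundary:
  assumes "z \<in> W n i" "cycle n z"
  shows "\<exists>y\<in>W (Suc n) i. res_diff N (Suc n) y = z"
proof -
  interpret F: k_bimodule L "Q n" by (rule Q_bimodule)
  interpret G: k_bimodule L "Q (Suc n)" by (rule Q_bimodule)
  have "\<exists>y\<in>W (Suc n) i. res_diff N (Suc n) y = z"
    if "z \<in> W n i" "cycle n z" "i + k = Suc (2 * N)" for k i z
    using that
  proof (induction k arbitrary: i z)
    case 0
    then have "z = \<zero>\<^sub>(Q n)" using W_top by simp
    then show ?case
      using add_hom_zero[OF Q_group Q_group bimod_hom_add_hom[OF res_diff_Suc]] W.W_zero by metis
  next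
    case (Suc k)
    let ?y = "h0 n z"
    have y: "?y \<in> W (Suc n) i" by (rule h0_W[OF Suc.prems(1)])
    have zc: "z \<in> carrier (Q n)" "?y \<in> carrier (Q (Suc n))" using W_carrier Suc.prems(1) y by blast+
    have dy: "res_diff N (Suc n) ?y \<in> carrier (Q n)" by (rule bimod_homD(1)[OF res_diff_Suc zc(2)])
    let ?z = "z \<ominus>\<^sub>(Q n) res_diff N (Suc n) ?y"
    have "?z \<in> W n (Suc i)"
      using Suc.prems(1,2) cycle_step aug_cycle_step by (cases n) (auto simp: cycle_def)
    moreover have "cycle n ?z" by (rule cycle_minus[OF zc(1) dy Suc.prems(2) cycle_res_diff[OF zc(2)]])
    ultimately obtain y' where y': "y' \<in> W (Suc n) (Suc i)" "res_diff N (Suc n) y' = ?z"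
      using Suc.IH[of ?z "Suc i"] Suc.prems(3) by auto
    have "res_diff N (Suc n) (y' \<oplus>\<^sub>(Q (Suc n)) ?y) = z"
      using bimod_homD(3)[OF res_diff_Suc W_carrier[OF y'(1)] zc(2)] y'(2)
        F.M.minus_add_cancel_right[OF zc(1) dy] by simp
    then show ?case using W.W_add[OF W_mono[OF y'(1)] y] by blast
  qed
  from this[of z i "Suc (2 * N) - i"] show ?thesis
  proof (cases "i \<le> Suc (2 * N)")
    case False
    then have "z \<in> W n (Suc (2 * N))"
    proof -
      have "z \<in> W n (a + b) ==> z \<in> W n a" for a b by (induction b) (auto dest: W_mono)
      then show ?thesis using assms(1) False by (metis le_add_diff_inverse nat_le_linear)
    qed
    then have "z = \<zero>\<^sub>(Q n)" by (rule W_top)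
    then show ?thesis
      using add_hom_zero[OF Q_group Q_group bimod_hom_add_hom[OF res_diff_Suc]] W.W_zero by metis
  qed (use assms in auto)
qed

theorem res_projective_resolution:
  "projective_resolution L (regular_bimod L) Q (res_diff N) (res_aug N)"
  unfolding projective_resolution_def
proof (intro conjI allI)
  show "bimodule L (regular_bimod L)" using k_bimodule.axioms(2)[OF regular_k_bimodule] .
  show "projective_bimod L (Q n)" for n unfolding res_mod_def by (rule free_projective)
  show "res_diff N (Suc n) \<in> bimod_hom L (Q (Suc n)) (Q n)" for n by (rule res_diff_Suc)
  show "res_aug N \<in> bimod_hom L (Q 0) (regular_bimod L)" by (rule res_aug)
  show "res_aug N ` carrier (Q 0) = carrier (regular_bimod L)"
  proof (intro equalityI subsetI)
    fix x assume "x \<in> carrier (regular_bimod L)"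
    then have "x = res_aug N (t 0 0 x \<one>\<^sub>L)" "t 0 0 x \<one>\<^sub>L \<in> carrier (Q 0)" by (auto simp: res_aug(2))
    then show "x \<in> res_aug N ` carrier (Q 0)" by blast
  qed (use bimod_homD(1)[OF res_aug(1)] in auto)
  have ker: "z \<in> carrier (Q n) \<and> cycle n z \<longleftrightarrow> z \<in> res_diff N (Suc n) ` carrier (Q (Suc n))" for n z
    using cycle_boundary[of z n 0] cycle_res_diff bimod_homD(1)[OF res_diff_Suc] unfolding W_0 by blast
  show "a_kernel (Q 0) (regular_bimod L) (res_aug N) = res_diff N 1 ` carrier (Q 1)"
    using ker[of _ 0] unfolding a_kernel_def' cycle_def by auto
  show "a_kernel (Q (Suc n)) (Q n) (res_diff N (Suc n)) = res_diff N (Suc (Suc n)) ` carrier (Q (Suc (Suc n)))" for n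
    using ker[of _ "Suc n"] unfolding a_kernel_def' cycle_def by auto
qed

end

section \<open>Constant terms of cocycles\<close>

text \<open>
  In terms of \<open>p = i - q\<close> and \<open>p' = n - u\<close> the condition says that \<open>p - q\<close> and \<open>p' - u\<close> have the same
  sign: the monomials of bidegrees \<open>(p, q)\<close> and \<open>(p', u)\<close> do not involve both \<open>\<chi>\<^sub>2\<^sub>,\<^sub>0\<close> and \<open>\<chi>\<^sub>2\<^sub>,\<^sub>2\<close>.
\<close>

definition compatible :: "nat => int => nat => int => bool" where
  "compatible i q n u \<longleftrightarrow> (int i \<ge> 2 * q \<and> int n \<ge> 2 * u) \<or> (int i \<le> 2 * q \<and> int n \<le> 2 * u)"

context lambda_algebra
begin

sublocale X: ext_resolution L "regular_bimod L" Q "res_diff N" "res_aug N"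
  by unfold_locales (rule res_projective_resolution)

abbreviation gen :: "nat => int => (int => ('k, 'k lam) tens)" where
  "gen n r \<equiv> t n r \<one>\<^sub>L \<one>\<^sub>L"

text \<open>On the right, \<open>\<Lambda>\<^sub>N\<close> acts through the augmentation: homomorphisms to \<open>TB\<close> ignore the radical part of the
  right factors.\<close>

definition TB :: "('k lam, 'k lam) bimodule" where
  "TB = twist_bimod L (\<lambda>a. cst a \<odot>\<^sub>L \<one>\<^sub>L)"

lemma TB_bimodule: "k_bimodule L TB"
  unfolding TB_def
proof (rule twist_k_bimodule)
  show "(\<lambda>a. cst a \<odot>\<^sub>L \<one>\<^sub>L) \<in> ring_hom L L"
    by (rule ring_hom_memI)
      (auto simp: cst_simps smult_add smult_one smult_mult_left smult_mult del: equalityI)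
  show "cst (c \<odot>\<^sub>L \<one>\<^sub>L) \<odot>\<^sub>L \<one>\<^sub>L = c \<odot>\<^sub>L \<one>\<^sub>L" for c
    using N_gt by (simp add: coef_smult cst_simps)
qed

lemma TB_simps [simp]:
  "carrier TB = carrier L" "\<zero>\<^sub>TB = \<zero>\<^sub>L" "x \<oplus>\<^sub>TB y = x \<oplus>\<^sub>L y" "a \<odot>\<^sub>TB x = a \<cdot> x"
  "x \<in> carrier L ==> x \<odot>\<^sup>r\<^sub>TB a = cst a \<odot>\<^sub>L x"
  unfolding TB_def by (simp_all add: smult_right[symmetric])

text \<open>Coordinate q with the right factors made trivial: on the q-th summand, a tensor of x and
  y goes to x scaled by the constant term of y.\<close>

definition proj :: "nat => int => (int => ('k, 'k lam) tens) => 'k lam" where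
  "proj i q = free_extend L (res_index i) TB (\<lambda>r. if r = q then \<one>\<^sub>L else \<zero>\<^sub>L)"

lemma TB_hom_tensor:
  assumes "G \<in> bimod_hom L (Q n) TB" "x \<in> carrier L" "y \<in> carrier L"
  shows "G (t n r x y) = cst y \<odot>\<^sub>L (x \<cdot> G (gen n r))"
  using Q_hom_tensor[OF assms, of r] assms(2) bimod_homD(1)[OF assms(1), of "gen n r"] by simp

lemma proj:
  shows "proj i q \<in> bimod_hom L (Q i) TB"
    and "0 \<le> r ==> r \<le> int i ==> x \<in> carrier L ==> y \<in> carrier L ==>
      proj i q (t i r x y) = (if r = q then cst y \<odot>\<^sub>L x else \<zero>\<^sub>L)"
proof -
  note fe = free_extend[OF TB_bimodule, of "res_index i" "\<lambda>r. if r = q then \<one>\<^sub>L else \<zero>\<^sub>L"]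
  show h: "proj i q \<in> bimod_hom L (Q i) TB"
    unfolding proj_def res_mod_def by (rule fe(1)) simp
  have g: "0 \<le> r ==> r \<le> int i ==> proj i q (gen i r) = (if r = q then \<one>\<^sub>L else \<zero>\<^sub>L)"
    unfolding proj_def t_def by (rule fe(2)) simp_all
  show "0 \<le> r ==> r \<le> int i ==> x \<in> carrier L ==> y \<in> carrier L ==>
      proj i q (t i r x y) = (if r = q then cst y \<odot>\<^sub>L x else \<zero>\<^sub>L)"
    using TB_hom_tensor[OF h, of x y r] g by (simp add: smult_zero_right)
qed

lemma TB_hom_add_hom: "G \<in> bimod_hom L (Q n) TB ==> G \<in> add_hom (Q n) L"
  using bimod_hom_add_hom[of G L "Q n" TB] by (simp add: add_hom_def)

lemma TB_hom_W1:
  assumes G: "G \<in> bimod_hom L (Q n) TB" and "z \<in> W n 1"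
  shows "G z = \<zero>\<^sub>L"
  using assms(2)
proof (induction rule: W.induct)
  case W_zero
  show ?case by (rule add_hom_zero[OF Q_group is_abelian_group TB_hom_add_hom[OF G]])
next
  case (W_t x y r)
  then have y: "y \<in> carrier L" by (intro Lge_carrier)
  then have "cst y = 0" using Lge_cst[OF y] W_t(2) by (rule_tac iffD2)
  moreover have "G (gen n r) \<in> carrier L" using bimod_homD(1)[OF G, of "gen n r"] by simp
  ultimately show ?case
    unfolding TB_hom_tensor[OF G W_t(1) y] using W_t(1) by (simp add: smult_zero_left)
next
  case (W_add u v)
  then show ?case
    using add_hom_add[OF TB_hom_add_hom[OF G] W_carrier[OF W_add(1)] W_carrier[OF W_add(2)]] by simp
qed

text \<open>Beyond its leading part \<open>d0\<close>, the differential of a generator lies in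
  \<open>W j 1\<close>, which homomorphisms to \<open>TB\<close> kill.\<close>

lemma TB_hom_diff:
  assumes G: "G \<in> bimod_hom L (Q j) TB" and r: "0 \<le> r" "r \<le> int (Suc j)"
    and x: "x \<in> carrier L" "y \<in> carrier L"
  defines "s \<equiv> int (Suc j) - 2 * r"
  shows "G (res_diff N (Suc j) (t (Suc j) r x y)) = cst y \<odot>\<^sub>L (sg (Suc j) r \<odot>\<^sub>L
    (x \<cdot> (cA s \<cdot> G (gen j r) \<oplus>\<^sub>L cB s \<cdot> G (gen j (r - 1)))))"
proof -
  interpret F: k_bimodule L "Q j" by (rule Q_bimodule)
  have "gen (Suc j) r \<in> W (Suc j) 0" by (simp add: W_0)
  then obtain w where w: "w \<in> W j 1"
    "res_diff N (Suc j) (gen (Suc j) r) = d0 j (gen (Suc j) r) \<oplus>\<^sub>(Q j) w"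
    using res_diff_leading[of "gen (Suc j) r" j 0] by auto
  have dc: "d0 j (gen (Suc j) r) \<in> carrier (Q j)" by (rule add_hom_closed[OF d0_hom]) simp
  have gc: "G (gen j q) \<in> carrier L" for q using bimod_homD(1)[OF G, of "gen j q"] by simp
  let ?h = "sg (Suc j) r \<odot>\<^sub>L (cA s \<cdot> G (gen j r) \<oplus>\<^sub>L cB s \<cdot> G (gen j (r - 1)))"
  have "G (res_diff N (Suc j) (gen (Suc j) r)) = G (d0 j (gen (Suc j) r))"
    unfolding w(2) add_hom_add[OF TB_hom_add_hom[OF G] dc W_carrier[OF w(1)]] TB_hom_W1[OF G w(1)]
    using add_hom_closed[OF TB_hom_add_hom[OF G] dc] by simp
  also have "\<dots> = ?h"
  proof -
    have "G (t j q (c \<odot>\<^sub>L a) \<one>\<^sub>L) = c \<odot>\<^sub>L (a \<cdot> G (gen j q))" if "a \<in> carrier L" for q c a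
      using TB_hom_tensor[OF G smult_closed[OF that, of c] one_closed, of q] that gc
      by (simp add: cst_simps smult_one smult_mult_left smult_closed)
    then show ?thesis
      using d0_t[OF r one_closed one_closed] gc unfolding s_def
      by (simp add: add_hom_add[OF TB_hom_add_hom[OF G]] smult_closed smult_distrib)
  qed
  finally have *: "G (res_diff N (Suc j) (gen (Suc j) r)) = ?h" .
  have gg: "G (res_diff N (Suc j) (t (Suc j) r x y)) = cst y \<odot>\<^sub>L (x \<cdot> ?h)"
    using TB_hom_tensor[OF bimod_hom_compose[OF Q_bimodule res_diff_Suc G] x, of r] x *
    by (simp add: compose_def)
  show ?thesis unfolding gg using x gc by (simp add: smult_mult_right smult_closed)
qed

text \<open>For the target of a chain map: \<open>cA\<close> and \<open>cB\<close> are appended to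
  the left factors and so stand on the right. In \<open>TB_hom_diff\<close>, used for the source,
  they stand on the left of the value at a generator.\<close>

lemma proj_diff:
  assumes q: "0 \<le> q" "q \<le> int i" and z: "z \<in> carrier (Q (Suc i))"
  shows "proj i q (res_diff N (Suc i) z) =
    sg (Suc i) q \<odot>\<^sub>L (proj (Suc i) q z \<cdot> cA (int (Suc i) - 2 * q))
    \<oplus>\<^sub>L sg (Suc i) (q + 1) \<odot>\<^sub>L (proj (Suc i) (q + 1) z \<cdot> cB (int (Suc i) - 2 * (q + 1)))"
proof (rule Q_hom_eq[OF is_abelian_group _ _ z])
  note p = TB_hom_add_hom[OF proj(1)]
  show "(\<lambda>z. proj i q (res_diff N (Suc i) z)) \<in> add_hom (Q (Suc i)) L"
    by (rule add_hom_comp[OF bimod_hom_add_hom[OF res_diff_Suc] p])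
  show "(\<lambda>z. sg (Suc i) q \<odot>\<^sub>L (proj (Suc i) q z \<cdot> cA (int (Suc i) - 2 * q))
    \<oplus>\<^sub>L sg (Suc i) (q + 1) \<odot>\<^sub>L (proj (Suc i) (q + 1) z \<cdot> cB (int (Suc i) - 2 * (q + 1))))
    \<in> add_hom (Q (Suc i)) L"
    by (intro add_hom_plus[OF is_abelian_group] add_homI)
      (auto simp: add_hom_add[OF p] add_hom_closed[OF p] smult_closed smult_distrib l_distr del: equalityI)
  fix r x y assume r: "0 \<le> r" "r \<le> int (Suc i)" and x: "x \<in> carrier L" and y: "y \<in> carrier L"
  have e: "proj i q (gen i k) = (if k = q then \<one>\<^sub>L else \<zero>\<^sub>L)" for k
  proof (cases "0 \<le> k \<and> k \<le> int i")
    case True then show ?thesis by (simp add: proj(2) cst_simps smult_one)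
  next
    case False
    then show ?thesis using q t_outside[of k i] add_hom_zero[OF Q_group is_abelian_group p] by auto
  qed
  have c: "x \<cdot> cA s \<in> carrier L" "x \<cdot> cB s \<in> carrier L" for s using x by auto
  show "proj i q (res_diff N (Suc i) (t (Suc i) r x y)) =
    sg (Suc i) q \<odot>\<^sub>L (proj (Suc i) q (t (Suc i) r x y) \<cdot> cA (int (Suc i) - 2 * q))
    \<oplus>\<^sub>L sg (Suc i) (q + 1) \<odot>\<^sub>L (proj (Suc i) (q + 1) (t (Suc i) r x y) \<cdot> cB (int (Suc i) - 2 * (q + 1)))"
    unfolding TB_hom_diff[OF proj(1) r x y] e proj(2)[OF r x y]
    using x y c by (auto simp: smult_mult_left smult_commute smult_zero_right smult_closed del: equalityI)
qed

text \<open>A word can be split off at the end of \<open>alt z l\<close> only if it is not longer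
  and ends in the same letter. At equal length nothing but the constant term of x is left.\<close>

lemma coef_m_right:
  assumes "l < 2 * N" "k > 0" "x \<in> carrier L"
  shows "k = l ==> coef (alt z l) (x \<cdot> m z k) = cst x"
    and "k > l \<or> y \<noteq> z ==> coef (alt z l) (x \<cdot> m y k) = 0"
proof -
  have b: "distinct_adj (alt z l)" "length (alt z l) < 2 * N" using assms(1) by auto
  show "k = l ==> coef (alt z l) (x \<cdot> m z k) = cst x"
    unfolding m_def coef_mult_wd[OF b assms(3)] by simp
  show "k > l \<or> y \<noteq> z ==> coef (alt z l) (x \<cdot> m y k) = 0"
  proof (cases "k \<le> l")
    case True
    assume "k > l \<or> y \<noteq> z"
    moreover have "drop (l - k) (alt z l) = alt y k ==> last (alt z l) = last (alt y k)"
      using True assms(2) last_drop[of "l - k" "alt z l"] by simp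
    ultimately have "drop (l - k) (alt z l) \<noteq> alt y k"
      using last_alt[of k y] last_alt[of l z] True assms(2) by auto
    then show ?thesis unfolding m_def coef_mult_wd[OF b assms(3)] by simp
  next
    case False
    then show ?thesis unfolding m_def coef_mult_wd[OF b assms(3)] by simp
  qed
qed

text \<open>An alternating word of odd length begins with the letter it ends with, so that a prefix,
  too, is recognised by length and letter.\<close>

lemma coef_m_left:
  assumes "l < 2 * N" "odd k" "odd l" "x \<in> carrier L"
  shows "k = l ==> coef (alt z l) (m z k \<cdot> x) = cst x"
    and "k > l \<or> y \<noteq> z ==> coef (alt z l) (m y k \<cdot> x) = 0"
proof -
  have b: "distinct_adj (alt z l)" "length (alt z l) < 2 * N" using assms(1) by auto
  show "k = l ==> coef (alt z l) (m z k \<cdot> x) = cst x"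
    unfolding m_def coef_wd_mult[OF b assms(4)] by simp
  have "take k (alt z l) = alt y k ==> k \<le> l \<and> y = z"
  proof -
    assume a: "take k (alt z l) = alt y k"
    then have "k \<le> l" by (metis length_alt length_take min.cobounded1)
    moreover have "hd (alt z l) = hd (alt y k)"
      using a assms(2) by (metis hd_take odd_pos)
    ultimately show ?thesis using assms(2,3) by (simp add: hd_alt odd_pos)
  qed
  then show "k > l \<or> y \<noteq> z ==> coef (alt z l) (m y k \<cdot> x) = 0"
    unfolding m_def coef_wd_mult[OF b assms(4)] by auto
qed

section \<open>Constant terms of lifted chain maps\<close>

lemma lift_coeff_closed:
  assumes F: "F \<in> X.lifts n g"
  shows "proj i q (F i (gen (n + i) r)) \<in> carrier L"
  by (rule add_hom_closed[OF TB_hom_add_hom[OF proj(1)] bimod_homD(1)[OF X.liftsD(1)[OF F]]]) simp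

text \<open>The chain map equation at a generator, projected to the summand q: the differential of
  the target gives the left-hand side by \<open>proj_diff\<close>, that of the source the right-hand
  side by \<open>TB_hom_diff\<close>.\<close>

lemma lift_recursion:
  assumes F: "F \<in> X.lifts n g" and q: "0 \<le> q" "q \<le> int i" and r: "0 \<le> r" "r \<le> int (n + Suc i)"
  defines "a \<equiv> \<lambda>i r q. proj i q (F i (gen (n + i) r))" and "s \<equiv> int (n + Suc i) - 2 * r"
  shows "sg (Suc i) q \<odot>\<^sub>L (a (Suc i) r q \<cdot> cA (int (Suc i) - 2 * q))
      \<oplus>\<^sub>L sg (Suc i) (q + 1) \<odot>\<^sub>L (a (Suc i) r (q + 1) \<cdot> cB (int (Suc i) - 2 * (q + 1)))
    = sg (n + Suc i) r \<odot>\<^sub>L (cA s \<cdot> a i r q \<oplus>\<^sub>L cB s \<cdot> a i (r - 1) q)"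
proof -
  note Fh = X.liftsD(1)[OF F]
  have F1: "F i' (gen (n + i') r) \<in> carrier (Q i')" for i' r by (rule bimod_homD(1)[OF Fh]) simp
  have G: "compose (carrier (Q (n + i))) (proj i q) (F i) \<in> bimod_hom L (Q (n + i)) TB"
    by (rule X.compose_d_closed[OF proj(1) Fh])
  have ac: "a i r q \<in> carrier L" for i r q
    unfolding a_def by (rule lift_coeff_closed[OF F])
  have "proj i q (F i (res_diff N (Suc (n + i)) (gen (Suc (n + i)) r)))
    = sg (n + Suc i) r \<odot>\<^sub>L (cA s \<cdot> a i r q \<oplus>\<^sub>L cB s \<cdot> a i (r - 1) q)"
    using TB_hom_diff[OF G r(1) _ one_closed one_closed] r(2) ac
      bimod_homD(1)[OF res_diff_Suc, of "gen (Suc (n + i)) r" "n + i"]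
    unfolding s_def by (simp add: a_def compose_def cst_simps smult_one smult_closed)
  moreover have "F i (res_diff N (Suc (n + i)) (gen (Suc (n + i)) r)) = res_diff N (Suc i) (F (Suc i) (gen (n + Suc i) r))"
    using X.liftsD(3)[OF F, of "gen (n + Suc i) r" i] by simp
  ultimately show "sg (Suc i) q \<odot>\<^sub>L (a (Suc i) r q \<cdot> cA (int (Suc i) - 2 * q))
      \<oplus>\<^sub>L sg (Suc i) (q + 1) \<odot>\<^sub>L (a (Suc i) r (q + 1) \<cdot> cB (int (Suc i) - 2 * (q + 1)))
    = sg (n + Suc i) r \<odot>\<^sub>L (cA s \<cdot> a i r q \<oplus>\<^sub>L cB s \<cdot> a i (r - 1) q)"
    using proj_diff[OF q F1[of "Suc i" r]] by (simp add: a_def)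
qed

text \<open>In \<open>lift_recursion\<close>, read off the coefficient of the very word that
  multiplies the wanted term. The other side contributes its constant term if it is multiplied by
  the same word and nothing if by a longer one; a shorter multiplier would bring in unknown
  coefficients, which the conditions on s exclude. Terms with the other letter drop out because
  words of odd length begin and end with the same letter.\<close>

lemma lift_const_step:
  assumes F: "F \<in> X.lifts n g" and q: "0 \<le> q" "q \<le> int i" and r: "0 \<le> r" "r \<le> int (n + Suc i)"
  defines "c \<equiv> \<lambda>i r q. cst (proj i q (F i (gen (n + i) r)))"
    and "s \<equiv> int (n + Suc i) - 2 * r" and "s1 \<equiv> int (Suc i) - 2 * q" and "s2 \<equiv> int (Suc i) - 2 * (q + 1)"
  shows "s1 > 0 ==> sg (Suc i) q * c (Suc i) r q = (if s > 0 then sg (n + Suc i) r * c i r q else 0)"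
    and "s1 \<le> 0 ==> s \<le> 0 ==> sg (Suc i) q * c (Suc i) r q = sg (n + Suc i) r * c i r q"
    and "s2 < 0 ==> sg (Suc i) (q + 1) * c (Suc i) r (q + 1) = (if s < 0 then sg (n + Suc i) r * c i (r - 1) q else 0)"
    and "s2 \<ge> 0 ==> s \<ge> 0 ==> sg (Suc i) (q + 1) * c (Suc i) r (q + 1) = sg (n + Suc i) r * c i (r - 1) q"
proof -
  define a where "a = (\<lambda>i r q. proj i q (F i (gen (n + i) r)))"
  have a_app: "proj i q (F i (gen (n + i) r)) = a i r q" for i r q unfolding a_def ..
  have c: "c i r q = cst (a i r q)" for i r q unfolding c_def a_def ..
  note rec = lift_recursion[OF F q r, folded s_def s1_def s2_def, unfolded a_app]
  note ac = lift_coeff_closed[OF F, unfolded a_app]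
  have Lc: "cA k \<cdot> a i r q \<in> carrier L" "cB k \<cdot> a i r q \<in> carrier L"
    "a (Suc i) r q \<cdot> cA k \<in> carrier L" "a (Suc i) r q \<cdot> cB k \<in> carrier L" for k r q
    using ac by auto
  obtain e K :: nat where eK: "e = 1" "K = 2 * N - 1" by blast
  have nn: "e < 2 * N" "K < 2 * N" "odd e" "odd K" "e < K" "0 < e" "0 < K"
    using N_gt unfolding eK by auto
  have cAB: "cA k = m Arr (if k > 0 then e else K)" "cB k = m Arr_bar (if k < 0 then e else K)" for k
    unfolding cA_def cB_def eK by auto
  have eq: "sg (Suc i) q * coef b (a (Suc i) r q \<cdot> cA s1)
      + sg (Suc i) (q + 1) * coef b (a (Suc i) r (q + 1) \<cdot> cB s2)
    = sg (n + Suc i) r * (coef b (cA s \<cdot> a i r q) + coef b (cB s \<cdot> a i (r - 1) q))"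
    if b: "distinct_adj b" "length b < 2 * N" for b
    using arg_cong[OF rec, of "coef b"]
    unfolding coef_add[OF b smult_closed[OF Lc(3)] smult_closed[OF Lc(4)]] coef_smult[OF b Lc(3)]
      coef_smult[OF b Lc(4)] coef_smult[OF b a_closed[OF Lc(1,2)]] coef_add[OF b Lc(1,2)] .
  have R: "coef (alt z l) (a (Suc i) r q \<cdot> m y k)
      = (if k = l \<and> y = z then c (Suc i) r q else 0)"
    if "l < 2 * N" "k > 0" "k \<ge> l \<or> y \<noteq> z" for z l y k r q
    using that coef_m_right(1)[of l k "a (Suc i) r q" z] coef_m_right(2)[of l k "a (Suc i) r q" y z] ac
    unfolding c by auto
  have Lf: "coef (alt z l) (m y k \<cdot> a i r q) = (if k = l \<and> y = z then c i r q else 0)"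
    if "l < 2 * N" "odd k" "odd l" "k \<ge> l \<or> y \<noteq> z" for z l y k r q
    using that coef_m_left(1)[of l k "a i r q" z] coef_m_left(2)[of l k "a i r q" y z] ac
    unfolding c by auto
  have dl: "distinct_adj (alt z e)" "length (alt z e) < 2 * N" "distinct_adj (alt z K)" "length (alt z K) < 2 * N" for z
    using nn by simp_all
  show "s1 > 0 ==> sg (Suc i) q * c (Suc i) r q = (if s > 0 then sg (n + Suc i) r * c i r q else 0)"
    using eq[OF dl(1,2), of Arr] nn unfolding cAB by (simp add: R Lf split: if_splits)
  show "s1 \<le> 0 ==> s \<le> 0 ==> sg (Suc i) q * c (Suc i) r q = sg (n + Suc i) r * c i r q"
    using eq[OF dl(3,4), of Arr] nn unfolding cAB by (simp add: R Lf split: if_splits)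
  show "s2 < 0 ==> sg (Suc i) (q + 1) * c (Suc i) r (q + 1) = (if s < 0 then sg (n + Suc i) r * c i (r - 1) q else 0)"
    using eq[OF dl(1,2), of Arr_bar] nn unfolding cAB by (simp add: R Lf split: if_splits)
  show "s2 \<ge> 0 ==> s \<ge> 0 ==> sg (Suc i) (q + 1) * c (Suc i) r (q + 1) = sg (n + Suc i) r * c i (r - 1) q"
    using eq[OF dl(3,4), of Arr_bar] nn unfolding cAB by (simp add: R Lf split: if_splits)
qed

text \<open>Descent in i. One step either keeps q and r or lowers both by one, so r - q is
  invariant, and at i = 0 the constant term of g is left. Every step contributes the same sign, and
  a step on the wrong side of the diagonal gives zero.\<close>

lemma lift_const:
  assumes F: "F \<in> X.lifts n g" and q: "0 \<le> q" "q \<le> int i"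
  shows "cst (proj i q (F i (gen (n + i) r))) =
    (if compatible i q n (r - q) then sg n (r - q) ^ i * cst (g (gen n (r - q))) else 0)"
proof -
  note Fh = X.liftsD(1)[OF F]
  define c where "c = (\<lambda>i r q. cst (proj i q (F i (gen (n + i) r))))"
  have c_app: "cst (proj i q (F i (gen (n + i) r))) = c i r q" for i r q unfolding c_def ..
  have g: "g z = res_aug N (F 0 z)" if "z \<in> carrier (Q n)" for z
    using X.liftsD(2)[OF F that] by simp
  have pz: "proj i q \<zero>\<^sub>(Q i) = \<zero>\<^sub>L" for i q
    by (rule add_hom_zero[OF Q_group is_abelian_group TB_hom_add_hom[OF proj(1)]])
  have c_out: "c i r q = 0" if "r < 0 \<or> r > int (n + i)" for i r q
    unfolding c_def t_outside[OF that] using X.hom_zero[OF Fh] pz N_gt by (simp add: cst_simps)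
  have g_out: "cst (g (gen n u)) = 0" if "u < 0 \<or> u > int n" for u
  proof -
    have "res_aug N \<zero>\<^sub>(Q 0) = \<zero>\<^sub>L" by (rule add_hom_zero[OF Q_group is_abelian_group reg_hom_add_hom[OF res_aug(1)]])
    then show ?thesis
      using g[of "\<zero>\<^sub>(Q n)"] t_closed[of "\<one>\<^sub>L" "\<one>\<^sub>L" n u] X.hom_zero[OF Fh[of 0]]
      unfolding t_outside[OF that] by (simp add: cst_simps)
  qed
  have "c i r q = (if compatible i q n (r - q) then sg n (r - q) ^ i * cst (g (gen n (r - q))) else 0)"
    if "0 \<le> q" "q \<le> int i" for r
    using that
  proof (induction i arbitrary: r q)
    case 0
    have p: "cst (proj 0 0 z) = cst (res_aug N z)" if "z \<in> carrier (Q 0)" for z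
      using that
    proof (induction z rule: Q_induct)
      case zero
      then show ?case
        using pz add_hom_zero[OF Q_group is_abelian_group reg_hom_add_hom[OF res_aug(1)]] by simp
    next
      case (tensor r x y)
      then show ?case using res_aug(2)[of x y] proj(2)[of 0 0 x y 0] N_gt
        by (simp add: coef_smult cst_simps mult.commute)
    next
      case (add u v)
      then show ?case
        using add_hom_closed[OF reg_hom_add_hom[OF res_aug(1)]] add_hom_closed[OF TB_hom_add_hom[OF proj(1)]]
        by (simp add: add_hom_add[OF TB_hom_add_hom[OF proj(1)]] add_hom_add[OF reg_hom_add_hom[OF res_aug(1)]] cst_simps)
    qed
    have "c 0 r 0 = cst (g (gen n r))"
      unfolding c_def using p[of "F 0 (gen n r)"] g[of "gen n r"] bimod_homD(1)[OF Fh[of 0], of "gen n r"] by simp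
    then show ?case using 0 by (auto simp: compatible_def)
  next
    case (Suc i)
    show ?case
    proof (cases "0 \<le> r \<and> r \<le> int (n + Suc i)")
      case False
      then have "r - q < 0 \<or> r - q > int n" using Suc.prems by auto
      then show ?thesis using c_out[of r "Suc i" q] g_out[of "r - q"] False by auto
    next
      case True
      then have r: "0 \<le> r" "r \<le> int (n + Suc i)" by auto
      have sgc: "sg (Suc i) q * (sg (Suc i) q * x) = x" for x q by (simp add: sg_def)
      have sgs: "sg (Suc i) q * sg (n + Suc i) r = sg n (r - q)" for q
        by (auto simp: sg_def)
      have sgs': "sg n (r - q) ^ Suc i = sg (Suc i) q * (sg (n + Suc i) r * sg n (r - q) ^ i)" for q
        using sgs[of q] by (simp add: mult.assoc[symmetric])
      have conv: "c (Suc i) r q = sg (Suc i) q * x" if "sg (Suc i) q * c (Suc i) r q = x" for x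
        using sgc[of q "c (Suc i) r q"] that by simp
      \<comment> \<open>Off the diagonal of the target the letter coefficient decides, whatever the
        source. On the diagonal the divisor is a long word, and the sign on the source side
        determines which of the two steps applies.\<close>
      consider "int (Suc i) - 2 * q > 0" | "int (Suc i) - 2 * q < 0"
        | "int (Suc i) - 2 * q = 0" "int (n + Suc i) - 2 * r \<le> 0"
        | "int (Suc i) - 2 * q = 0" "int (n + Suc i) - 2 * r \<ge> 0" by linarith
      then show ?thesis
      proof cases
        case 1
        then have qi: "q \<le> int i" using Suc.prems by linarith
        show ?thesis
          using conv[OF lift_const_step(1)[OF F Suc.prems(1) qi r 1, unfolded c_app]]
            Suc.IH[OF Suc.prems(1) qi, of r] 1 unfolding sgs' by (auto simp: compatible_def)
      next
        case 2
        then have qi: "0 \<le> q - 1" "q - 1 \<le> int i" using Suc.prems by linarith+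
        show ?thesis
          using conv[OF lift_const_step(3)[OF F qi r, unfolded c_app diff_add_cancel]]
            Suc.IH[OF qi, of "r - 1"] 2 unfolding sgs' by (auto simp: compatible_def)
      next
        case 3
        then have qi: "q \<le> int i" using Suc.prems by linarith
        show ?thesis
          using conv[OF lift_const_step(2)[OF F Suc.prems(1) qi r _ 3(2), unfolded c_app]]
            Suc.IH[OF Suc.prems(1) qi, of r] 3 unfolding sgs' by (auto simp: compatible_def)
      next
        case 4
        then have qi: "0 \<le> q - 1" "q - 1 \<le> int i" using Suc.prems by linarith+
        show ?thesis
          using conv[OF lift_const_step(4)[OF F qi r, unfolded c_app diff_add_cancel]]
            Suc.IH[OF qi, of "r - 1"] 4 unfolding sgs' by (auto simp: compatible_def)
      qed
    qed
  qed
  then show ?thesis using q unfolding c_def by blast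
qed

section \<open>Parity restrictions on the constant terms of cocycles\<close>

lemma coef_mid:
  assumes v: "v \<in> carrier L" and k: "k \<le> N - 1"
  shows "coef (alt z (2 * N - 1)) ((m y (2 * k) \<cdot> (v \<cdot> m y 1)) \<cdot> m y (2 * (N - k - 1)))
      = (if z = y \<and> k = 0 then cst v else 0)"
    and "coef (alt z (2 * N - 1)) ((m y (2 * k) \<cdot> (m (flip y) 1 \<cdot> v)) \<cdot> m y (2 * (N - k - 1)))
      = (if z = flip y \<and> k = N - 1 then cst v else 0)"
proof -
  obtain K where K: "K = 2 * N - 1" by blast
  have nn: "K < 2 * N" "odd K" "0 < K" using N_gt unfolding K by auto
  \<comment> \<open>The letters around v have total length 2N - 1, the length of the word read off,
    so v can only contribute its constant term. The remaining word is alternating at one end of the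
    range of k and contains a square elsewhere.\<close>
  define l where "l = 2 * (N - k - 1)"
  have l: "l + 1 + 2 * k = K" "even l" using k N_gt unfolding l_def K by auto
  have 1: "(m y (2 * k) \<cdot> (v \<cdot> m y 1)) \<cdot> m y l
      = (m y (2 * k) \<cdot> v) \<cdot> (m y 1 \<cdot> m y l)"
    using v by (simp add: m_assoc)
  also have "m y 1 \<cdot> m y l = m y (l + 1)" using l by (auto simp: m_mult m_0 del: equalityI)
  finally have e1: "(m y (2 * k) \<cdot> (v \<cdot> m y 1)) \<cdot> m y l = (m y (2 * k) \<cdot> v) \<cdot> m y (l + 1)" .
  show "coef (alt z (2 * N - 1)) ((m y (2 * k) \<cdot> (v \<cdot> m y 1)) \<cdot> m y (2 * (N - k - 1)))
      = (if z = y \<and> k = 0 then cst v else 0)"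
    unfolding K[symmetric] l_def[symmetric] e1
  proof (cases "z = y")
    case False
    then show "coef (alt z K) ((m y (2 * k) \<cdot> v) \<cdot> m y (l + 1)) = (if z = y \<and> k = 0 then cst v else 0)"
      using coef_m_right(2)[OF nn(1), of "l + 1" "m y (2 * k) \<cdot> v" y z] v by simp
  next
    case True
    show "coef (alt z K) ((m y (2 * k) \<cdot> v) \<cdot> m y (l + 1)) = (if z = y \<and> k = 0 then cst v else 0)"
    proof (cases "k = 0")
      case k0: True
      then show ?thesis using coef_m_right(1)[OF nn(1), of "l + 1" v z] l True v by (simp add: m_0)
    next
      case False
      have b: "distinct_adj (alt z K)" "length (alt z K) < 2 * N" using nn by auto
      have t: "take (2 * k) (alt z K) \<noteq> alt y (2 * k)"
      proof
        assume "take (2 * k) (alt z K) = alt y (2 * k)"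
        then have "hd (alt z K) = hd (alt y (2 * k))" using False by (metis hd_take nat_0_less_mult_iff neq0_conv pos2)
        then show False using False nn True by (simp add: hd_alt)
      qed
      have "(m y (2 * k) \<cdot> v) \<cdot> m y (l + 1) = m y (2 * k) \<cdot> (v \<cdot> m y (l + 1))"
        using v by (simp add: m_assoc)
      then show ?thesis
        using coef_wd_mult[OF b, of "v \<cdot> m y (l + 1)" "alt y (2 * k)"] t v False by (simp add: m_def)
    qed
  qed
  have "(m y (2 * k) \<cdot> (m (flip y) 1 \<cdot> v)) \<cdot> m y l
      = ((m y (2 * k) \<cdot> m (flip y) 1) \<cdot> v) \<cdot> m y l"
    using v by (simp add: m_assoc)
  also have "m y (2 * k) \<cdot> m (flip y) 1 = m (flip y) (2 * k + 1)" by (auto simp: m_mult m_0 del: equalityI)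
  finally have e2: "(m y (2 * k) \<cdot> (m (flip y) 1 \<cdot> v)) \<cdot> m y l = (m (flip y) (2 * k + 1) \<cdot> v) \<cdot> m y l" .
  show "coef (alt z (2 * N - 1)) ((m y (2 * k) \<cdot> (m (flip y) 1 \<cdot> v)) \<cdot> m y (2 * (N - k - 1)))
      = (if z = flip y \<and> k = N - 1 then cst v else 0)"
    unfolding K[symmetric] l_def[symmetric] e2
  proof (cases "z = flip y")
    case False
    then show "coef (alt z K) ((m (flip y) (2 * k + 1) \<cdot> v) \<cdot> m y l) = (if z = flip y \<and> k = N - 1 then cst v else 0)"
      using coef_m_left(2)[OF nn(1) _ nn(2), of "2 * k + 1" "v \<cdot> m y l" "flip y" z] v by (simp add: m_assoc)
  next
    case True
    show "coef (alt z K) ((m (flip y) (2 * k + 1) \<cdot> v) \<cdot> m y l) = (if z = flip y \<and> k = N - 1 then cst v else 0)"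
    proof (cases "l = 0")
      case l0: True
      then have "k = N - 1" using k unfolding l_def by simp
      then show ?thesis using coef_m_left(1)[OF nn(1) _ nn(2), of "2 * k + 1" v z] l True v l0 by (simp add: m_0)
    next
      case False
      then have "k \<noteq> N - 1" unfolding l_def by auto
      then show ?thesis using coef_m_right(2)[OF nn(1), of l "m (flip y) (2 * k + 1) \<cdot> v" y z] False True v by simp
    qed
  qed
qed

definition sn :: "int => 'k" where
  "sn k = (if even k then 1 else - 1)"

lemma coef_alt_sign:
  "distinct_adj b ==> length b < 2 * N ==> x \<in> carrier L ==> coef b (alt_sign L k x) = sn k * coef b x"
  by (simp add: alt_sign_def sn_def coef_uminus)

text \<open>Left and right multiplication by the same word of odd length contribute the same
  constant term to the coefficient of that word, up to sign. At the middle generator these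
  contributions come from the two ends k = 0 and k = N - 1 of the sum.\<close>

lemma cocycle_coef:
  assumes f: "f \<in> X.Hom n" and r: "0 \<le> r" "r \<le> int (Suc n)"
    and zero: "f (res_diff N (Suc n) (gen (Suc n) r)) = \<zero>\<^sub>L"
  shows "(1 + sn (int (Suc n) + r)) * cst (f (gen n r)) = 0"
    and "(sn (int (Suc n)) + sn (int (Suc n) + r)) * cst (f (gen n (r - 1))) = 0"
proof -
  interpret F: k_bimodule L "Q n" by (rule Q_bimodule)
  note fh = reg_hom_add_hom[OF f]
  define v where "v = (\<lambda>q. f (gen n q))"
  have v: "v q \<in> carrier L" for q unfolding v_def by (rule add_hom_closed[OF fh]) simp
  have ft: "f (t n q x y) = x \<cdot> v q \<cdot> y" if "x \<in> carrier L" "y \<in> carrier L" for q x y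
    using Q_hom_tensor[OF f that] unfolding v_def by simp
  note sc = alt_sign_closed[OF F.M.abelian_group_axioms] alt_sign_closed[OF is_abelian_group]
  note add = add_hom_add[OF fh]
  obtain e K :: nat where eK: "e = 1" "K = 2 * N - 1" by blast
  have nn: "e < 2 * N" "K < 2 * N" "odd e" "odd K" "e < K" "0 < e" "0 < K"
    using N_gt unfolding eK by auto
  define s where "s = int (Suc n) - 2 * r"
  have "(1 + sn (int (Suc n) + r)) * cst (v r) = 0 \<and>
    (sn (int (Suc n)) + sn (int (Suc n) + r)) * cst (v (r - 1)) = 0"
  proof (cases "s = 0")
    case False
    then have off: "int (Suc n) \<noteq> 2 * r" unfolding s_def by simp
    have zz: "\<zero>\<^sub>L = v r \<cdot> cA s \<oplus>\<^sub>L alt_sign L (int (Suc n) + r) (cA s \<cdot> v r)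
        \<oplus>\<^sub>L alt_sign L (int (Suc n) + r) (cB s \<cdot> v (r - 1))
        \<oplus>\<^sub>L alt_sign L (int (Suc n)) (v (r - 1) \<cdot> cB s)"
      using zero unfolding res_diff(2)[OF r] reg_hom_gen_off[OF f off] v_def s_def by (rule sym)
    have eq: "0 = coef b (v r \<cdot> cA s) + sn (int (Suc n) + r) * coef b (cA s \<cdot> v r)
        + sn (int (Suc n) + r) * coef b (cB s \<cdot> v (r - 1))
        + sn (int (Suc n)) * coef b (v (r - 1) \<cdot> cB s)"
      if "distinct_adj b" "length b < 2 * N" for b
      using arg_cong[OF zz, of "coef b"] v
      by (simp add: coef_add[OF that] coef_alt_sign[OF that] sc coef_zero[OF that] del: of_nat_Suc)
    have cAB: "cA s = m Arr (if s > 0 then e else K)" "cB s = m Arr_bar (if s < 0 then e else K)"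
      unfolding cA_def cB_def eK by auto
    define l where "l = (if s > 0 then e else K)"
    define l' where "l' = (if s < 0 then e else K)"
    have ll: "l < 2 * N" "odd l" "0 < l" "l' < 2 * N" "odd l'" "0 < l'" using nn unfolding l_def l'_def by auto
    have "0 = cst (v r) + sn (int (Suc n) + r) * cst (v r)"
      using eq[of "alt Arr l"] ll coef_m_right(1)[OF ll(1,3) v, of Arr] coef_m_left(1)[OF ll(1,2,2) v, of Arr]
        coef_m_right(2)[OF ll(1,6) v, of Arr_bar Arr] coef_m_left(2)[OF ll(1,5,2) v, of Arr_bar Arr]
      unfolding cAB l_def[symmetric] l'_def[symmetric] by (simp del: of_nat_Suc)
    moreover have "0 = sn (int (Suc n) + r) * cst (v (r - 1)) + sn (int (Suc n)) * cst (v (r - 1))"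
      using eq[of "alt Arr_bar l'"] ll coef_m_right(1)[OF ll(4,6) v, of Arr_bar] coef_m_left(1)[OF ll(4,5,5) v, of Arr_bar]
        coef_m_right(2)[OF ll(4,3) v, of Arr Arr_bar] coef_m_left(2)[OF ll(4,2,5) v, of Arr Arr_bar]
      unfolding cAB l_def[symmetric] l'_def[symmetric] by (simp del: of_nat_Suc)
    ultimately show ?thesis by (simp add: algebra_simps del: of_nat_Suc)
  next
    case True
    then have mid: "int (Suc n) = 2 * r" unfolding s_def by simp
    let ?A = "\<lambda>k. (m Arr (2 * k) \<cdot> (v r \<cdot> m Arr 1)) \<cdot> m Arr (2 * (N - k - 1))"
    let ?B = "\<lambda>k. (m Arr (2 * k) \<cdot> (m Arr_bar 1 \<cdot> v (r - 1))) \<cdot> m Arr (2 * (N - k - 1))"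
    let ?C = "\<lambda>k. (m Arr_bar (2 * k) \<cdot> (m Arr 1 \<cdot> v r)) \<cdot> m Arr_bar (2 * (N - k - 1))"
    let ?D = "\<lambda>k. (m Arr_bar (2 * k) \<cdot> (v (r - 1) \<cdot> m Arr_bar 1)) \<cdot> m Arr_bar (2 * (N - k - 1))"
    have sg1: "a \<cdot> alt_sign L r x = alt_sign L r (a \<cdot> x)" "alt_sign L r x \<cdot> a = alt_sign L r (x \<cdot> a)"
      if "a \<in> carrier L" "x \<in> carrier L" for a x
      using that by (auto simp: alt_sign_def r_minus l_minus del: equalityI)
    have fG: "f (mid_term n r k) = (?A k \<oplus>\<^sub>L alt_sign L r (?B k)) \<oplus>\<^sub>L (alt_sign L r (?C k) \<oplus>\<^sub>L ?D k)" for k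
      using v by (simp add: add sc F.l_closed F.r_closed reg_hom_alt_sign[OF f] bimod_homD(4,5)[OF f] ft
          sg1 l_distr r_distr)
    have fGc: "f (mid_term n r k) \<in> carrier L" for k by (rule add_hom_closed[OF fh mid_term_closed])
    have "\<zero>\<^sub>L = (\<Oplus>\<^bsub>L\<^esub>k\<in>{..N - 1}. f (mid_term n r k))"
      using zero unfolding res_diff(2)[OF r] res_diff_gen_mid[OF mid] diff_Suc_1
      by (subst add_hom_finsum[OF Q_group is_abelian_group fh, symmetric]) (use mid_term_closed in simp_all)
    from arg_cong[OF this, of "coef (alt z K)" for z]
    have zz: "0 = (\<Sum>k\<in>{..N - 1}. coef (alt z K) (f (mid_term n r k)))" for z
      using nn fGc by (simp add: coef_zero coef_finsum)
    have "coef (alt z K) (f (mid_term n r k)) = coef (alt z K) (?A k) + sn r * coef (alt z K) (?B k)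
        + (sn r * coef (alt z K) (?C k) + coef (alt z K) (?D k))" for k z
      unfolding fG using nn v by (simp add: coef_add coef_alt_sign sc)
    from zz[unfolded this] have eq: "0 = (\<Sum>k\<in>{..N - 1}. coef (alt z K) (?A k) + sn r * coef (alt z K) (?B k)
        + (sn r * coef (alt z K) (?C k) + coef (alt z K) (?D k)))" for z .
    have sum: "(\<Sum>k\<in>{..N - 1}. (if k = 0 then c else 0) + (if k = N - 1 then d else 0)) = c + d" for c d :: 'k
      by (simp add: sum.distrib)
    have "coef (alt z K) (?A k) + sn r * coef (alt z K) (?B k)
        + (sn r * coef (alt z K) (?C k) + coef (alt z K) (?D k))
      = (if k = 0 then cst (v (if z = Arr then r else r - 1)) else 0)
        + (if k = N - 1 then sn r * cst (v (if z = Arr then r else r - 1)) else 0)"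
      if k: "k \<in> {..N - 1}" for k z
    proof -
      have k': "k \<le> N - 1" using k by simp
      show ?thesis
        unfolding coef_mid(1)[OF v k', folded eK(2)] coef_mid(2)[OF v k', of _ Arr, unfolded flip.simps, folded eK(2)]
          coef_mid(2)[OF v k', of _ Arr_bar, unfolded flip.simps, folded eK(2)]
        by (cases z) auto
    qed
    from trans[OF eq sum.cong[OF refl this], unfolded sum]
    have "0 = cst (v (if z = Arr then r else r - 1)) + sn r * cst (v (if z = Arr then r else r - 1))" for z .
    from this[of Arr] this[of Arr_bar]
    have "cst (v r) + sn r * cst (v r) = 0" "cst (v (r - 1)) + sn r * cst (v (r - 1)) = 0"
      by auto
    moreover have "sn (int (Suc n)) = 1" "sn (int (Suc n) + r) = sn r" using mid unfolding sn_def by auto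
    ultimately show ?thesis by (simp add: algebra_simps del: of_nat_Suc)
  qed
  then show "(1 + sn (int (Suc n) + r)) * cst (f (gen n r)) = 0"
    "(sn (int (Suc n)) + sn (int (Suc n) + r)) * cst (f (gen n (r - 1))) = 0"
    unfolding v_def by auto
qed

section \<open>Constant terms of cohomology classes\<close>

lemma cst_gen_outside: "f \<in> X.Hom n ==> r < 0 \<or> r > int n ==> cst (f (gen n r)) = 0"
  using add_hom_zero[OF Q_group is_abelian_group reg_hom_add_hom, of f n] N_gt
  by (simp add: t_outside cst_simps)

text \<open>After taking constant terms both actions become scalar, so only the two-sided
  augmentation of z enters; \<open>proj\<close> followed by \<open>cst\<close> computes its
  coordinates.\<close>

lemma cst_expand:
  assumes f: "f \<in> X.Hom n" and z: "z \<in> carrier (Q n)"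
  shows "cst (f z) = (\<Sum>q\<in>{0..int n}. cst (proj n q z) * cst (f (gen n q)))"
  using z
proof (induction z rule: Q_induct)
  case zero
  then show ?case
    using add_hom_zero[OF Q_group is_abelian_group TB_hom_add_hom[OF proj(1)]]
      add_hom_zero[OF Q_group is_abelian_group reg_hom_add_hom[OF f]] by (simp add: cst_simps)
next
  case (tensor r x y)
  have v: "f (gen n r) \<in> carrier L" by (rule add_hom_closed[OF reg_hom_add_hom[OF f]]) simp
  have "cst (proj n q (t n r x y)) = (if q = r then cst x * cst y else 0)" for q
    using tensor N_gt by (simp add: proj(2) coef_smult cst_simps mult.commute)
  moreover have "cst (f (t n r x y)) = cst x * cst (f (gen n r)) * cst y"
    using Q_hom_tensor[OF f tensor(3,4), of r] tensor v by (simp add: cst_simps)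
  ultimately show ?case using tensor(1,2) by (simp add: if_distrib[of "\<lambda>x. x * _"] mult_ac cong: if_cong)
next
  case (add u v)
  then show ?case
    using add_hom_closed[OF reg_hom_add_hom[OF f]] add_hom_closed[OF TB_hom_add_hom[OF proj(1)]]
    by (simp add: add_hom_add[OF TB_hom_add_hom[OF proj(1)]] add_hom_add[OF reg_hom_add_hom[OF f]]
        cst_simps algebra_simps sum.distrib)
qed

text \<open>Minimality of the resolution: all coefficients of the differential lie in the
  radical.\<close>

lemma cst_coboundary:
  assumes "f \<in> X.B n"
  shows "cst (f (gen n r)) = 0"
proof (cases "0 \<le> r \<and> r \<le> int n")
  case False
  then show ?thesis using cst_gen_outside[OF X.coboundaries_hom[OF assms]] by auto
next
  case r: True
  show ?thesis
  proof (cases n)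
    case 0
    then show ?thesis using assms by (simp add: X.mem_coboundaries_0 cst_simps)
  next
    case (Suc j)
    then obtain g where g: "g \<in> X.Hom j" "f (gen n r) = g (res_diff N (Suc j) (gen (Suc j) r))"
      using assms t_closed[OF one_closed one_closed, of n r] unfolding Suc X.mem_coboundaries_Suc by auto
    have d: "res_diff N (Suc j) (gen (Suc j) r) \<in> carrier (Q j)" by (rule bimod_homD(1)[OF res_diff_Suc]) simp
    have "cst (proj j q (res_diff N (Suc j) (gen (Suc j) r))) = 0" for q
    proof -
      have p: "proj j q (gen j k) \<in> carrier L" for k by (rule add_hom_closed[OF TB_hom_add_hom[OF proj(1)]]) simp
      have "cst (cA k) = 0" "cst (cB k) = 0" for k
        using N_gt unfolding cA_def cB_def m_def by (auto simp: cst_simps)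
      then show ?thesis using TB_hom_diff[OF proj(1)[of j q], of r "\<one>\<^sub>L" "\<one>\<^sub>L"] r Suc p N_gt
        by (simp add: coef_smult cst_simps smult_closed)
    qed
    then show ?thesis unfolding g(2) cst_expand[OF g(1) d] by simp
  qed
qed

text \<open>Coboundaries have no constant terms, so the choice of the representative does not matter.\<close>

definition C :: "'k hoch => nat => int => 'k" where
  "C x n r = cst ((SOME f. f \<in> x n) (gen n r))"

lemma C_cls:
  assumes f: "f \<in> X.Z n" and x: "x n = X.cls n f"
  shows "C x n r = cst (f (gen n r))"
proof -
  define f' where "f' = (SOME f. f \<in> x n)"
  have fh: "f \<in> X.Hom n" by (rule X.cocycle_hom[OF f])
  have "f' \<in> x n" unfolding f'_def x by (rule someI[of "\<lambda>f. f \<in> _", OF X.cls_self[OF fh]])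
  then have f': "f' \<in> X.Hom n" "f' \<ominus>\<^sub>(X.HG n) f \<in> X.B n" unfolding x X.mem_cls_iff[OF fh] by auto
  have v: "f (gen n r) \<in> carrier L" "f' (gen n r) \<in> carrier L"
    by (rule add_hom_closed[OF reg_hom_add_hom[OF fh]], simp) (rule add_hom_closed[OF reg_hom_add_hom[OF f'(1)]], simp)
  have "(f' \<ominus>\<^sub>(X.HG n) f) (gen n r) = f' (gen n r) \<ominus>\<^sub>(regular_bimod L) f (gen n r)"
    unfolding X.HG_minus[OF f'(1) fh] by simp
  also have "\<dots> = f' (gen n r) \<ominus>\<^sub>L f (gen n r)"
    unfolding a_minus_def a_inv_def regular_bimod_def by (simp add: m_inv_def)
  finally have "(f' \<ominus>\<^sub>(X.HG n) f) (gen n r) = f' (gen n r) \<ominus>\<^sub>L f (gen n r)" .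
  then have "cst (f' (gen n r)) = cst (f (gen n r))"
    using cst_coboundary[OF f'(2), of r] v by (simp add: a_minus_def cst_simps)
  then show ?thesis unfolding C_def f'_def .
qed

lemma E_cocycle:
  assumes "x \<in> carrier X.E"
  obtains f where "f \<in> X.Z n" "x n = X.cls n f"
  using X.ext_group_cases[OF X.E_component[OF assms, of n]] by blast

lemma C_zero: "x n = \<zero>\<^sub>(X.ExtG n) ==> C x n r = 0"
  using C_cls[OF additive_subgroup.zero_closed[OF X.cocycles_subgroup], of x n r] X.cls_zero[of n]
  by (simp add: cst_simps hom_group_simps)

lemma C_indeg: "C (X.indeg n Y) k r = (if k = n then C (\<lambda>_. Y) n r else 0)"
proof (cases "k = n")
  case False
  then show ?thesis using C_zero[of "X.indeg n Y" k r] by (simp add: in_degree_def)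
qed (simp add: C_def in_degree_def)

lemma C_indeg_cls: "f \<in> X.Z n ==> C (X.indeg n (X.cls n f)) k r = (if k = n then cst (f (gen n r)) else 0)"
  using C_cls[of f n "\<lambda>_. X.cls n f" r] by (simp add: C_indeg)

lemma C_add:
  assumes "x \<in> carrier X.E" "y \<in> carrier X.E"
  shows "C (x \<oplus>\<^sub>X.E y) n r = C x n r + C y n r"
proof -
  obtain f where f: "f \<in> X.Z n" "x n = X.cls n f" using assms(1) by (rule E_cocycle)
  obtain g where g: "g \<in> X.Z n" "y n = X.cls n g" using assms(2) by (rule E_cocycle)
  note fg = X.cocycle_hom[OF f(1)] X.cocycle_hom[OF g(1)]
  have "(x \<oplus>\<^sub>X.E y) n = X.cls n (\<lambda>u\<in>carrier (Q n). f u \<oplus>\<^sub>L g u)"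
    using X.cls_plus[OF fg] f g by (simp add: X.E_simps)
  from C_cls[where x="x \<oplus>\<^sub>X.E y", OF _ this] C_cls[where x=x, OF f] C_cls[where x=y, OF g]
  show ?thesis
    using X.HG_plus_cocycle[OF f(1) g(1)] add_hom_closed[OF reg_hom_add_hom[OF fg(1)]]
      add_hom_closed[OF reg_hom_add_hom[OF fg(2)]]
    by (simp add: cst_simps)
qed

lemma E_smult_component:
  assumes "x \<in> carrier X.E" "f \<in> X.Z n" "x n = X.cls n f"
  shows "(c \<odot>\<^sub>X.E x) n = X.cls n (\<lambda>u\<in>carrier (Q n). scal L (regular_bimod L) c (f u))"
proof -
  have "(c \<odot>\<^sub>X.E x) n = (c \<odot>\<^sub>X.E X.indeg n (X.cls n f)) n"
    using assms by (simp add: X.E_simps in_degree_def)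
  also have "\<dots> = X.cls n (\<lambda>u\<in>carrier (Q n). scal L (regular_bimod L) c (f u))"
    unfolding X.E_smult_in_degree(1)[OF assms(2)] by (simp add: in_degree_def)
  finally show ?thesis .
qed

lemma E_smult_closed:
  assumes x: "x \<in> carrier X.E"
  shows "c \<odot>\<^sub>X.E x \<in> carrier X.E"
proof -
  have "(c \<odot>\<^sub>X.E x) n \<in> carrier (X.ExtG n)" for n
  proof -
    obtain f where f: "f \<in> X.Z n" "x n = X.cls n f" using x by (rule E_cocycle)
    show ?thesis unfolding E_smult_component[OF x f]
      by (rule X.cls_closed[OF X.E_smult_in_degree(2)[OF f(1)]])
  qed
  moreover have "(c \<odot>\<^sub>X.E x) n = \<zero>\<^sub>(X.ExtG n)" if "x n = \<zero>\<^sub>(X.ExtG n)" for n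
  proof -
    have z: "\<zero>\<^sub>(X.HG n) \<in> X.Z n" using X.cocycles_subgroup[of n] by (rule additive_subgroup.zero_closed)
    have "x n = X.cls n (\<zero>\<^sub>(X.HG n))" using that X.cls_zero by simp
    from E_smult_component[OF x z this, of c] show ?thesis
      using X.cls_zero[of n] by (simp add: hom_group_simps X.M.sc_zero_vec[simplified] cong: restrict_cong)
  qed
  then have "{n. (c \<odot>\<^sub>X.E x) n \<noteq> \<zero>\<^sub>(X.ExtG n)} \<subseteq> {n. x n \<noteq> \<zero>\<^sub>(X.ExtG n)}" by blast
  moreover have "finite {n. x n \<noteq> \<zero>\<^sub>(X.ExtG n)}" using x by (simp add: X.E_simps)
  ultimately show ?thesis using finite_subset by (simp add: X.E_simps(1)) blast
qed

lemma C_smult: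
  assumes x: "x \<in> carrier X.E"
  shows "C (c \<odot>\<^sub>X.E x) n r = c * C x n r"
proof -
  obtain f where f: "f \<in> X.Z n" "x n = X.cls n f" using x by (rule E_cocycle)
  have v: "f (gen n r) \<in> carrier L" by (rule add_hom_closed[OF reg_hom_add_hom[OF X.cocycle_hom[OF f(1)]]]) simp
  have "scal L (regular_bimod L) c (f (gen n r)) = c \<odot>\<^sub>L f (gen n r)"
    unfolding scal_def using v by (simp add: smult_left[symmetric])
  then show ?thesis
    using C_cls[of _ n "c \<odot>\<^sub>X.E x" r, OF X.E_smult_in_degree(2)[OF f(1)] E_smult_component[OF x f]]
      C_cls[of f n x r, OF f] v N_gt
    by (simp add: coef_smult)
qed

lemma C_one: "C \<one>\<^sub>X.E n r = (if n = 0 \<and> r = 0 then 1 else 0)"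
proof -
  have "cst (res_aug N (gen 0 r)) = (if r = 0 then 1 else 0)"
    using res_aug(2)[of "\<one>\<^sub>L" "\<one>\<^sub>L"] cst_gen_outside[OF res_aug(1), of r]
    by (cases "r = 0") (auto simp: cst_simps linorder_neq_iff)
  then show ?thesis unfolding X.E_simps(3) C_indeg_cls[OF X.eps_cocycle] by auto
qed

section \<open>The classes \<chi>_{n,r} for even n and r\<close>

definition chi_cochain :: "nat => int => (int => ('k, 'k lam) tens) => 'k lam" where
  "chi_cochain n r = free_extend L (res_index n) (regular_bimod L) (\<lambda>s. if s = r then \<one>\<^sub>L else \<zero>\<^sub>L)"

lemma chi_eq: "chi N n r = X.indeg n (X.cls n (chi_cochain n r))"
  unfolding chi_def Let_def chi_cochain_def ..

lemma chi_cochain: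
  shows "chi_cochain n r \<in> X.Hom n"
    and "chi_cochain n r (gen n s) = (if s = r \<and> 0 \<le> s \<and> s \<le> int n then \<one>\<^sub>L else \<zero>\<^sub>L)"
proof -
  note fe = free_extend[OF regular_k_bimodule, of "res_index n" "\<lambda>s. if s = r then \<one>\<^sub>L else \<zero>\<^sub>L"]
  show h: "chi_cochain n r \<in> X.Hom n"
    unfolding chi_cochain_def res_mod_def by (rule fe(1)) simp
  have in_range: "chi_cochain n r (gen n s) = (if s = r then \<one>\<^sub>L else \<zero>\<^sub>L)" if "0 \<le> s" "s \<le> int n"
    using that unfolding chi_cochain_def t_def by (intro fe(2)) simp_all
  have "chi_cochain n r (gen n s) = \<zero>\<^sub>L" if "s < 0 \<or> s > int n"
    unfolding t_outside[OF that] by (rule add_hom_zero[OF Q_group is_abelian_group reg_hom_add_hom[OF h]])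
  with in_range show "chi_cochain n r (gen n s) = (if s = r \<and> 0 \<le> s \<and> s \<le> int n then \<one>\<^sub>L else \<zero>\<^sub>L)"
    by (cases "0 \<le> s \<and> s \<le> int n") auto
qed

text \<open>Degree n + 1 is odd, so the middle formula does not occur. The differential meets the
  value 1 only at the generators r and r + 1, where for even n and r the same word appears on the
  left and on the right with opposite signs.\<close>

lemma chi_cocycle:
  assumes n: "even n" and r: "even r"
  shows "chi_cochain n r \<in> X.Z n"
  unfolding X.mem_cocycles
proof (intro conjI ballI)
  let ?f = "chi_cochain n r"
  note f = chi_cochain(1)[of n r]
  note fh = reg_hom_add_hom[OF f]
  interpret F: k_bimodule L "Q n" by (rule Q_bimodule)
  show "?f \<in> X.Hom n" by (rule f)
  have 0: "(\<lambda>z. \<zero>\<^sub>L) \<in> add_hom (Q (Suc n)) L" by (auto simp: add_hom_def)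
  have gen: "?f (res_diff_gen N (Suc n) s) = \<zero>\<^sub>L" for s
  proof -
    define v where "v = (\<lambda>q. ?f (gen n q))"
    define k where "k = int (Suc n) - 2 * s"
    have off: "int (Suc n) \<noteq> 2 * s" using n by presburger
    have "?f (res_diff_gen N (Suc n) s)
        = v s \<cdot> cA k \<oplus>\<^sub>L alt_sign L (int (Suc n) + s) (cA k \<cdot> v s)
        \<oplus>\<^sub>L alt_sign L (int (Suc n) + s) (cB k \<cdot> v (s - 1))
        \<oplus>\<^sub>L alt_sign L (int (Suc n)) (v (s - 1) \<cdot> cB k)"
      unfolding reg_hom_gen_off[OF f off] v_def k_def ..
    also have "\<dots> = \<zero>\<^sub>L"
    proof (cases "s = r")
      case True
      then have "v (s - 1) = \<zero>\<^sub>L" "v s = \<one>\<^sub>L \<or> v s = \<zero>\<^sub>L" unfolding v_def chi_cochain(2) by auto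
      then show ?thesis using n r True by (auto simp: alt_sign_def r_neg del: equalityI)
    next
      case False
      then have "v s = \<zero>\<^sub>L" "v (s - 1) = \<one>\<^sub>L \<or> v (s - 1) = \<zero>\<^sub>L" "s - 1 \<noteq> r ==> v (s - 1) = \<zero>\<^sub>L"
        unfolding v_def chi_cochain(2) by auto
      then show ?thesis using n r by (cases "s = r + 1") (auto simp: alt_sign_def r_neg del: equalityI)
    qed
    finally show ?thesis .
  qed
  fix z assume z: "z \<in> carrier (Q (Suc n))"
  have "?f (res_diff N (Suc n) z) = \<zero>\<^sub>L"
  proof (rule Q_hom_eq[OF is_abelian_group add_hom_comp[OF bimod_hom_add_hom[OF res_diff_Suc] fh] 0 z])
    fix s x y assume xy: "0 \<le> s" "s \<le> int (Suc n)" "x \<in> carrier L" "y \<in> carrier L"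
    have g: "res_diff_gen N (Suc n) s \<in> carrier (Q n)" using res_diff_gen_closed[of "Suc n" s] by simp
    show "?f (res_diff N (Suc n) (t (Suc n) s x y)) = \<zero>\<^sub>L"
      unfolding res_diff_tensor[OF xy] using xy g gen[of s] by (simp add: bimod_homD(4,5)[OF f] F.l_closed)
  qed
  then show "?f (res_diff N (Suc n) z) = \<zero>\<^sub>(regular_bimod L)" by simp
qed

section \<open>Nilpotent classes\<close>

lemma W_rsmult_Lge:
  assumes "z \<in> W n i" "y \<in> Lge j"
  shows "z \<odot>\<^sup>r\<^sub>(Q n) y \<in> W n (i + j)"
  using assms(1)
proof (induction rule: W.induct)
  interpret F: k_bimodule L "Q n" by (rule Q_bimodule)
  note y = Lge_carrier[OF assms(2)]
  { case W_zero show ?case using F.r_zero_vec[OF y] W.W_zero by simp }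
  { case (W_t x y' r)
    then show ?case using t_smult(2)[OF y _ Lge_carrier[OF W_t(2)], of x n r] W.W_t[OF _ Lge_mult[OF _ assms(2)]] by simp }
  { case (W_add u v)
    then show ?case using F.r_distr_vector[OF y] W_carrier W.W_add by simp }
qed

text \<open>A cocycle with values in the radical lifts to a chain map that raises the radical filtration of
  the right factors; its powers vanish because the radical of \<open>\<Lambda>\<^sub>N\<close> is nilpotent.\<close>

lemma radical_lift:
  assumes g: "g \<in> X.Z n" and zero: "\<And>r. cst (g (gen n r)) = 0"
  shows "\<exists>F\<in>X.lifts n g. \<forall>i r. F i (gen (n + i) r) \<in> W i 1"
proof -
  note gh = X.cocycle_hom[OF g]
  define D where "D = (\<lambda>i. {F \<in> bimod_hom L (Q (n + i)) (Q i). \<forall>r. F (gen (n + i) r) \<in> W i 1})"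
  have fe: "\<exists>F\<in>D i. \<forall>r\<in>{0..int (n + i)}. F (gen (n + i) r) = y r"
    if y: "\<And>r. r \<in> {0..int (n + i)} ==> y r \<in> W i 1" for i y
  proof -
    let ?F = "free_extend L (res_index (n + i)) (Q i) y"
    have F: "?F \<in> bimod_hom L (Q (n + i)) (Q i)" "\<And>r. r \<in> {0..int (n + i)} ==> ?F (gen (n + i) r) = y r"
      unfolding res_mod_def[of N "n + i"] t_def
      using free_extend[OF Q_bimodule, of "res_index (n + i)" y i] W_carrier[OF y] by auto
    have "?F (gen (n + i) r) \<in> W i 1" for r
    proof (cases "r \<in> {0..int (n + i)}")
      case True
      then show ?thesis using F(2) y by simp
    next
      case False
      then have "gen (n + i) r = \<zero>\<^sub>(Q (n + i))" by (intro t_outside) auto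
      then show ?thesis using X.hom_zero[OF F(1)] W.W_zero by simp
    qed
    then show ?thesis using F unfolding D_def by blast
  qed
  have "\<exists>F\<in>X.lifts n g. \<forall>i. F i \<in> D i"
  proof (rule X.lifts_exist_in[OF g])
    show "D i \<subseteq> bimod_hom L (Q (n + i)) (Q i)" for i unfolding D_def by auto
    have v: "g (gen n r) \<in> Lge 1" for r
      using add_hom_closed[OF reg_hom_add_hom[OF gh], of "gen n r"] Lge_cst zero[of r] by simp
    obtain F where F: "F \<in> D 0" "\<forall>r\<in>{0..int n}. F (gen n r) = t 0 0 \<one>\<^sub>L (g (gen n r))"
      using fe[of 0 "\<lambda>r. t 0 0 \<one>\<^sub>L (g (gen n r))"] W_t'[OF one_closed v] by auto
    have Fh: "F \<in> bimod_hom L (Q n) (Q 0)" using F(1) unfolding D_def by simp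
    have "res_aug N (F z) = g z" if "z \<in> carrier (Q n)" for z
    proof (rule Q_hom_eq[OF is_abelian_group add_hom_comp[OF bimod_hom_add_hom[OF Fh] reg_hom_add_hom[OF res_aug(1)]]
          reg_hom_add_hom[OF gh] that])
      fix r x y assume xy: "0 \<le> r" "r \<le> int n" "x \<in> carrier L" "y \<in> carrier L"
      interpret F0: k_bimodule L "Q 0" by (rule Q_bimodule)
      have gc: "g (gen n r) \<in> carrier L" by (rule Lge_carrier[OF v])
      show "res_aug N (F (t n r x y)) = g (t n r x y)"
        unfolding Q_hom_tensor[OF Fh xy(3,4)] Q_hom_tensor[OF gh xy(3,4)]
        using F(2) xy gc by (simp add: bimod_homD(4,5)[OF res_aug(1)] F0.l_closed res_aug(2))
    qed
    then show "\<exists>F\<in>D 0. \<forall>x\<in>carrier (Q n). res_aug N (F x) = g x" using F(1) by blast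
    fix i F
    assume F: "F \<in> D i" and im: "\<And>x. x \<in> carrier (Q (n + Suc i)) ==>
      F (res_diff N (n + Suc i) x) \<in> res_diff N (Suc i) ` carrier (Q (Suc i))"
    have Fh: "F \<in> bimod_hom L (Q (n + i)) (Q i)" using F unfolding D_def by simp
    have dh: "res_diff N (n + Suc i) \<in> bimod_hom L (Q (n + Suc i)) (Q (n + i))" using X.d_hom'[of n i] by simp
    interpret Fi: k_bimodule L "Q i" by (rule Q_bimodule)
    have FW: "F z \<in> W i 1" if "z \<in> carrier (Q (n + i))" for z
      using that
    proof (induction z rule: Q_induct)
      case zero
      then show ?case using X.hom_zero[OF Fh] W.W_zero by simp
    next
      case (tensor r x y)
      have "F (gen (n + i) r) \<in> W i 1" using F unfolding D_def by simp
      then show ?case unfolding Q_hom_tensor[OF Fh tensor(3,4)] using tensor by (intro W_smult)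
    next
      case (add u v)
      then show ?case using bimod_homD(3)[OF Fh add(1,2)] W.W_add by simp
    qed
    \<comment> \<open>Exactness respects the filtration, so the values of the next component can
      again be chosen in step 1.\<close>
    have "\<exists>y\<in>W (Suc i) 1. res_diff N (Suc i) y = F (res_diff N (n + Suc i) (gen (n + Suc i) r))" for r
    proof (rule cycle_boundary)
      show "F (res_diff N (n + Suc i) (gen (n + Suc i) r)) \<in> W i 1"
        by (rule FW[OF bimod_homD(1)[OF dh]]) simp
      show "cycle i (F (res_diff N (n + Suc i) (gen (n + Suc i) r)))"
        using im[OF t_closed[OF one_closed one_closed], of r] cycle_res_diff by auto
    qed
    then obtain y where y: "\<And>r. y r \<in> W (Suc i) 1"
      "\<And>r. res_diff N (Suc i) (y r) = F (res_diff N (n + Suc i) (gen (n + Suc i) r))" by metis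
    obtain F' where F': "F' \<in> D (Suc i)" "\<forall>r\<in>{0..int (n + Suc i)}. F' (gen (n + Suc i) r) = y r"
      using fe[of "Suc i" y] y(1) by auto
    have F'h: "F' \<in> bimod_hom L (Q (n + Suc i)) (Q (Suc i))" using F'(1) unfolding D_def by simp
    have "res_diff N (Suc i) (F' z) = F (res_diff N (n + Suc i) z)" if "z \<in> carrier (Q (n + Suc i))" for z
    proof (rule Q_hom_eq[OF Q_group add_hom_comp[OF bimod_hom_add_hom[OF F'h] bimod_hom_add_hom[OF res_diff_Suc]]
          add_hom_comp[OF bimod_hom_add_hom[OF dh] bimod_hom_add_hom[OF Fh]] that])
      fix r x z assume xy: "0 \<le> r" "r \<le> int (n + Suc i)" "x \<in> carrier L" "z \<in> carrier L"
      note h1 = bimod_hom_compose[OF Q_bimodule F'h res_diff_Suc] and h2 = bimod_hom_compose[OF Q_bimodule dh Fh]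
      show "res_diff N (Suc i) (F' (t (n + Suc i) r x z)) = F (res_diff N (n + Suc i) (t (n + Suc i) r x z))"
        using Q_hom_tensor[OF h1 xy(3,4), of r] Q_hom_tensor[OF h2 xy(3,4), of r] F'(2) y(2) xy
        by (simp add: compose_def)
    qed
    then show "\<exists>F'\<in>D (Suc i). \<forall>x\<in>carrier (Q (n + Suc i)). res_diff N (Suc i) (F' x) = F (res_diff N (n + Suc i) x)"
      using F'(1) by blast
  qed
  then show ?thesis unfolding D_def by blast
qed

lemma radical_nilpotent:
  assumes g: "g \<in> X.Z n" and zero: "\<And>r. cst (g (gen n r)) = 0"
  shows "X.indeg n (X.cls n g) [^]\<^sub>X.E Suc (2 * N) = \<zero>\<^sub>X.E"
proof -
  obtain F where F: "F \<in> X.lifts n g" "\<And>i r. F i (gen (n + i) r) \<in> W i 1"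
    using radical_lift[OF assms] by blast
  let ?x = "X.indeg n (X.cls n g)"
  \<comment> \<open>Each further factor composes with a component of F and gains one step of the
    filtration. Starting from the augmentation, the power 2N + 1 takes values in words that are
    longer than any normal word.\<close>
  have "\<exists>f\<in>X.Z (k * n). ?x [^]\<^sub>X.E k = X.indeg (k * n) (X.cls (k * n) f) \<and>
      (\<forall>j. \<forall>z\<in>W (k * n) j. f z \<in> Lge (j + k))" for k
  proof (induction k)
    case 0
    have "res_aug N z \<in> Lge j" if "z \<in> W 0 j" for z j
      using that
    proof (induction rule: W.induct)
      case W_zero
      show ?case using add_hom_zero[OF Q_group is_abelian_group reg_hom_add_hom[OF res_aug(1)]] Lge_zero by simp
    next
      case (W_t x y r)
      then have "r = 0" by simp
      then show ?case using W_t res_aug(2)[of x y] Lge_carrier[of y j] Lge_mult_left[of x y j] by simp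
    next
      case (W_add u v)
      then show ?case
        using add_hom_add[OF reg_hom_add_hom[OF res_aug(1)] W_carrier[OF W_add(1)] W_carrier[OF W_add(2)]] Lge_add by simp
    qed
    then show ?case using X.eps_cocycle by (intro bexI[of _ "res_aug N"]) (simp_all add: X.E_simps(3))
  next
    case (Suc k)
    then obtain f where f: "f \<in> X.Z (k * n)" "?x [^]\<^sub>X.E k = X.indeg (k * n) (X.cls (k * n) f)"
      "\<And>j z. z \<in> W (k * n) j ==> f z \<in> Lge (j + k)" by blast
    let ?f = "compose (carrier (Q (n + k * n))) f (F (k * n))"
    note Fh = X.liftsD(1)[OF F(1)]
    have "?x [^]\<^sub>X.E Suc k = X.indeg (n + k * n) (X.cls (n + k * n) ?f)"
      using X.in_degree_mult[OF X.cls_closed[OF f(1)] X.cls_closed[OF g]] X.yoneda_eq[OF f(1) g F(1)] f(2)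
      by (simp add: add.commute)
    moreover have "?f \<in> X.Z (n + k * n)" by (rule X.lift_cocycle[OF F(1) f(1)])
    moreover have "F i z \<in> W i (Suc j)" if "z \<in> W (n + i) j" for i j z
      using that
    proof (induction rule: W.induct)
      case W_zero
      show ?case using X.hom_zero[OF Fh] W.W_zero by simp
    next
      case (W_t x y r)
      note y = Lge_carrier[OF W_t(2)]
      show ?case unfolding Q_hom_tensor[OF Fh W_t(1) y]
        using W_rsmult_Lge[OF W_smult(1)[OF F(2) W_t(1)] W_t(2)] by simp
    next
      case (W_add u v)
      then show ?case using bimod_homD(3)[OF Fh W_carrier[OF W_add(1)] W_carrier[OF W_add(2)]] W.W_add by simp
    qed
    then have "?f z \<in> Lge (j + Suc k)" if "z \<in> W (n + k * n) j" for j z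
      using f(3)[of "F (k * n) z" "Suc j"] that W_carrier[OF that] by (simp add: compose_def)
    ultimately show ?case by (intro bexI[of _ ?f]) simp_all
  qed
  from this[of "Suc (2 * N)"] obtain f where f: "f \<in> X.Z (Suc (2 * N) * n)"
    "?x [^]\<^sub>X.E Suc (2 * N) = X.indeg (Suc (2 * N) * n) (X.cls (Suc (2 * N) * n) f)"
    "\<And>j z. z \<in> W (Suc (2 * N) * n) j ==> f z \<in> Lge (j + Suc (2 * N))" by blast
  define k where "k = Suc (2 * N) * n"
  note f = f[folded k_def]
  have "f z = \<zero>\<^sub>L" if "z \<in> carrier (Q k)" for z
    using f(3)[of z 0] that Lge_top by (simp add: W_0)
  moreover have "f \<in> extensional (carrier (Q k))"
    using X.cocycle_hom[OF f(1)] unfolding bimod_hom_def PiE_def by blast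
  ultimately have "f = \<zero>\<^sub>(X.HG k)" by (intro extensionalityI[of _ "carrier (Q k)"]) (auto simp: hom_group_simps)
  then have "X.cls k f = \<zero>\<^sub>(X.ExtG k)" using X.cls_zero[of k] by metis
  then show ?thesis unfolding f(2) by (simp add: in_degree_def X.E_simps(4) fun_eq_iff)
qed

end

section \<open>Products of constant terms in characteristic different from two\<close>

locale lambda_algebra_odd = lambda_algebra N field_type
  for N :: nat and field_type :: "'k::field itself" +
  assumes two_neq_zero: "(2::'k) \<noteq> 0"
begin

text \<open>The factors in \<open>cocycle_coef\<close> are sums of two signs, hence 0 or plus or
  minus 2. The first equation at r = u forces n + u to be even, the second at r = u + 1 forces n to
  be even.\<close>

lemma cocycle_even:
  assumes f: "f \<in> X.Z n" and u: "cst (f (gen n u)) \<noteq> 0"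
  shows "even n" "even u"
proof -
  note fh = X.cocycle_hom[OF f]
  have r: "0 \<le> u" "u \<le> int n" using cst_gen_outside[OF fh, of u] u by force+
  have z: "f (res_diff N (Suc n) (gen (Suc n) q)) = \<zero>\<^sub>L" for q
    using f by (simp add: X.mem_cocycles)
  have "1 + sn (int (Suc n) + u) = 0" "sn (int (Suc n)) + sn (int (Suc n) + (u + 1)) = 0"
    using cocycle_coef(1)[OF fh r(1) _ z] cocycle_coef(2)[OF fh _ _ z, of "u + 1"] r u by auto
  then show "even n" "even u" using two_neq_zero by (auto simp: sn_def split: if_splits)
qed

lemma C_even: "x \<in> carrier X.E ==> C x n r \<noteq> 0 ==> 0 \<le> r \<and> r \<le> int n \<and> even n \<and> even r"
proof -
  assume x: "x \<in> carrier X.E" and C: "C x n r \<noteq> 0"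
  obtain f where f: "f \<in> X.Z n" "x n = X.cls n f" using x by (rule E_cocycle)
  have c: "cst (f (gen n r)) \<noteq> 0" using C C_cls[of f n x r, OF f] by simp
  show ?thesis using cocycle_even[OF f(1) c] cst_gen_outside[OF X.cocycle_hom[OF f(1)], of r] c by force
qed

text \<open>Evaluating f on the lift of g at a generator and expanding by \<open>cst_expand\<close>
  gives a convolution over q, whose coefficients are known from \<open>lift_const\<close>.\<close>

lemma C_mult:
  assumes f: "f \<in> X.Z k" and g: "g \<in> X.Z n"
  defines "x \<equiv> X.indeg k (X.cls k f)" and "y \<equiv> X.indeg n (X.cls n g)"
  shows "x \<otimes>\<^sub>X.E y \<in> X.indeg (k + n) ` carrier (X.ExtG (k + n))"
    and "C (x \<otimes>\<^sub>X.E y) (k + n) r =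
      (\<Sum>q\<in>{0..int k}. if compatible k q n (r - q) then C x k q * C y n (r - q) else 0)"
proof -
  obtain F where F: "F \<in> X.lifts n g" using X.lifts_exist[OF g] by blast
  let ?h = "compose (carrier (Q (n + k))) f (F k)"
  have h: "?h \<in> X.Z (n + k)" by (rule X.lift_cocycle[OF F f])
  have xy: "x \<otimes>\<^sub>X.E y = X.indeg (k + n) (X.cls (n + k) ?h)"
    unfolding x_def y_def X.in_degree_mult[OF X.cls_closed[OF f] X.cls_closed[OF g]] X.yoneda_eq[OF f g F] ..
  show "x \<otimes>\<^sub>X.E y \<in> X.indeg (k + n) ` carrier (X.ExtG (k + n))"
    unfolding xy using X.cls_closed[OF h] by (simp add: add.commute)
  have Fg: "F k (gen (n + k) r) \<in> carrier (Q k)" by (rule bimod_homD(1)[OF X.liftsD(1)[OF F]]) simp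
  have "C (x \<otimes>\<^sub>X.E y) (k + n) r = cst (f (F k (gen (n + k) r)))"
    unfolding xy using C_indeg_cls[OF h, of "n + k" r] by (simp add: add.commute compose_def)
  also have "\<dots> = (\<Sum>q\<in>{0..int k}. cst (proj k q (F k (gen (n + k) r))) * cst (f (gen k q)))"
    by (rule cst_expand[OF X.cocycle_hom[OF f] Fg])
  also have "\<dots> = (\<Sum>q\<in>{0..int k}. if compatible k q n (r - q) then C x k q * C y n (r - q) else 0)"
  proof (rule sum.cong[OF refl])
    fix q assume "q \<in> {0..int k}"
    then have q: "0 \<le> q" "q \<le> int k" by auto
    \<comment> \<open>A non-zero constant term forces n and r - q to be even, so the sign in
      \<open>lift_const\<close> is trivial.\<close>
    have "sg n (r - q) = 1" if "cst (g (gen n (r - q))) \<noteq> 0"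
      using cocycle_even[OF g that] by (simp add: sg_def)
    then show "cst (proj k q (F k (gen (n + k) r))) * cst (f (gen k q))
      = (if compatible k q n (r - q) then C x k q * C y n (r - q) else 0)"
      unfolding lift_const[OF F q] x_def y_def C_indeg_cls[OF f] C_indeg_cls[OF g]
      by (cases "cst (g (gen n (r - q))) = 0") auto
  qed
  finally show "C (x \<otimes>\<^sub>X.E y) (k + n) r =
      (\<Sum>q\<in>{0..int k}. if compatible k q n (r - q) then C x k q * C y n (r - q) else 0)" .
qed

lemma C_chi: "even n ==> even r ==> C (chi N n r) k s = (if k = n \<and> s = r \<and> 0 \<le> r \<and> r \<le> int n then 1 else 0)"
  unfolding chi_eq C_indeg_cls[OF chi_cocycle] chi_cochain(2) by (auto simp: cst_simps)

end

section \<open>The polynomial ring modulo \<open>\<chi>\<^sub>2\<^sub>,\<^sub>0 \<chi>\<^sub>2\<^sub>,\<^sub>2\<close>\<close>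

text \<open>An order on the variables induces one on the monomials, and leading terms then make the
  polynomial ring a domain. This enters in \<open>rel_ideal_radical\<close> and
  \<open>trunc_prime\<close>.\<close>

instantiation indet :: linorder
begin

fun indet_rank :: "indet => nat" where
  "indet_rank X20 = 0" | "indet_rank X22 = 1" | "indet_rank X42 = 2"

definition less_eq_indet :: "indet => indet => bool" where
  "less_eq_indet x y \<longleftrightarrow> indet_rank x \<le> indet_rank y"

definition less_indet :: "indet => indet => bool" where
  "less_indet x y \<longleftrightarrow> indet_rank x < indet_rank y"

instance
proof
  fix x y z :: indet
  show "x < y \<longleftrightarrow> x \<le> y \<and> \<not> y \<le> x" "x \<le> x" "x \<le> y ==> y \<le> z ==> x \<le> z" "x \<le> y \<or> y \<le> x"
    unfolding less_eq_indet_def less_indet_def by auto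
  show "x \<le> y ==> y \<le> x ==> x = y" unfolding less_eq_indet_def by (cases x; cases y) auto
qed

end

type_synonym monom = "indet \<Rightarrow>\<^sub>0 nat"

lemma UNIV_indet: "UNIV = {X20, X22, X42}"
  using indet.exhaust by auto

text \<open>The substitution that sets the variables in \<open>S\<close> to zero.\<close>

definition trunc :: "indet set => (monom \<Rightarrow>\<^sub>0 'k::field) => (monom \<Rightarrow>\<^sub>0 'k)" where
  "trunc S f = (\<Sum>\<mu>\<in>keys f.
     if keys \<mu> \<inter> S = {} then single \<mu> (lookup f \<mu>) else 0)"

lemma lookup_trunc:
  "lookup (trunc S f) \<mu> =
    (if keys \<mu> \<inter> S = {} then lookup f \<mu> else 0)"
proof -
  have "lookup (trunc S f) \<mu> = (\<Sum>\<nu>\<in>keys f.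
      if \<nu> = \<mu> then (if keys \<mu> \<inter> S = {} then lookup f \<mu> else 0) else 0)"
    unfolding trunc_def lookup_sum by (rule sum.cong) (auto simp: lookup_single when_def)
  then show ?thesis by (auto simp: in_keys_iff)
qed

lemma trunc_simps:
  "trunc S 0 = 0" "trunc S 1 = 1" "trunc S (f + g) = trunc S f + trunc S g" "trunc S (f - g) = trunc S f - trunc S g"
  "trunc S (single \<mu> c) = (if keys \<mu> \<inter> S = {} then single \<mu> c else 0)"
  by (intro poly_mapping_eqI; simp add: lookup_trunc lookup_add lookup_minus lookup_single lookup_one when_def)+

lemma keys_plus_nat: "keys (\<mu> + \<nu>) = keys \<mu> \<union> keys \<nu>" for \<mu> \<nu> :: monom
  by (auto simp: in_keys_iff lookup_add)

lemma trunc_mult: "trunc S (f * g) = trunc S f * trunc S g"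
  using subset_UNIV[of "keys f"]
proof (induction f rule: poly_mapping_add_induct)
  case (single \<mu> c)
  show ?case using subset_UNIV[of "keys g"]
  proof (induction g rule: poly_mapping_add_induct)
    case (single \<nu> d)
    show ?case by (auto simp: mult_single trunc_simps keys_plus_nat)
  qed (simp_all add: trunc_simps algebra_simps)
qed (simp_all add: trunc_simps algebra_simps)

lemma rel_ideal_ideal: "ideal rel_ideal monoid_algebra"
  unfolding rel_ideal_def by (rule monoid_algebra.genideal_ideal) simp

lemma trunc_ideal: "ideal {f. trunc S f = 0} monoid_algebra"
proof (rule idealI)
  show "ring (monoid_algebra :: ('a, monom \<Rightarrow>\<^sub>0 'a) module)" by (rule monoid_algebra.ring_axioms)
  have "additive_subgroup {f :: monom \<Rightarrow>\<^sub>0 'a. trunc S f = 0} monoid_algebra"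
    by (rule additive_subgroupI'[OF monoid_algebra.is_abelian_group])
      (auto simp: trunc_simps diff_0[symmetric] simp del: diff_0)
  then show "subgroup {f :: monom \<Rightarrow>\<^sub>0 'a. trunc S f = 0} (add_monoid monoid_algebra)"
    by (rule additive_subgroup.a_subgroup)
qed (auto simp: trunc_mult)

text \<open>The ideal (x y) is the intersection of (x) and (y): a polynomial killed by both
  substitutions has only monomials divisible by x and by y.\<close>

lemma rel_ideal_iff: "f \<in> rel_ideal \<longleftrightarrow> trunc {X20} f = 0 \<and> trunc {X22} f = 0"
proof
  assume "f \<in> rel_ideal"
  moreover have "rel_ideal \<subseteq> {f. trunc {v} f = 0}" if "v = X20 \<or> v = X22" for v
    unfolding rel_ideal_def using that
    by (intro monoid_algebra.genideal_minimal[OF trunc_ideal])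
      (auto simp: trunc_mult indet_poly_def trunc_simps)
  ultimately show "trunc {X20} f = 0 \<and> trunc {X22} f = 0" by blast
next
  assume t: "trunc {X20} f = 0 \<and> trunc {X22} f = 0"
  interpret Id: ideal rel_ideal "monoid_algebra :: ('a, monom \<Rightarrow>\<^sub>0 'a) module" by (rule rel_ideal_ideal)
  have gen: "indet_poly X20 * indet_poly X22 \<in> (rel_ideal :: (monom \<Rightarrow>\<^sub>0 'a) set)"
    unfolding rel_ideal_def using monoid_algebra.genideal_self by auto
  have K: "keys f \<subseteq> {\<mu>. lookup \<mu> X20 \<noteq> 0 \<and> lookup \<mu> X22 \<noteq> 0}"
  proof
    fix \<mu> assume "\<mu> \<in> keys f"
    then have "lookup f \<mu> \<noteq> 0" by (simp add: in_keys_iff)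
    then have "\<not> keys \<mu> \<inter> {X20} = {}" "\<not> keys \<mu> \<inter> {X22} = {}"
      using t lookup_trunc[of "{X20}" f \<mu>] lookup_trunc[of "{X22}" f \<mu>] by (auto split: if_splits)
    then show "\<mu> \<in> {\<mu>. lookup \<mu> X20 \<noteq> 0 \<and> lookup \<mu> X22 \<noteq> 0}" by (auto simp: in_keys_iff)
  qed
  then show "f \<in> rel_ideal"
  proof (induction f rule: poly_mapping_add_induct)
    case zero
    show ?case using Id.zero_closed by simp
  next
    case (add f g)
    then show ?case using Id.a_closed by simp
  next
    case (single \<mu> c)
    let ?xy = "single X20 1 + single X22 1 :: monom"
    have "\<mu> = ?xy + (\<mu> - ?xy)"
    proof (rule poly_mapping_eqI)
      fix v
      show "lookup \<mu> v = lookup (?xy + (\<mu> - ?xy)) v"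
        using single by (cases v) (simp_all add: lookup_add lookup_minus lookup_single when_def)
    qed
    then have "single \<mu> c = (indet_poly X20 * indet_poly X22) * single (\<mu> - ?xy) c"
      unfolding indet_poly_def by (simp add: mult_single)
    then show ?case using Id.I_r_closed[OF gen] by simp
  qed
qed

text \<open>The ideal is an intersection of kernels of homomorphisms to a domain.\<close>

lemma rel_ideal_radical: "f ^ k \<in> rel_ideal ==> f \<in> rel_ideal" for f :: "monom \<Rightarrow>\<^sub>0 'k::field"
proof -
  have "trunc S (f ^ k) = trunc S f ^ k" for S by (induction k) (simp_all add: trunc_simps trunc_mult)
  then show "f ^ k \<in> rel_ideal ==> f \<in> rel_ideal" unfolding rel_ideal_iff by (metis power_not_zero)
qed

text \<open>The monomial with \<open>\<chi>\<^sub>2\<^sub>,\<^sub>0\<close> of bidegree \<open>(2, 0)\<close>, \<open>\<chi>\<^sub>2\<^sub>,\<^sub>2\<close> of bidegree \<open>(0, 2)\<close> and \<open>\<chi>\<^sub>4\<^sub>,\<^sub>2\<close> of bidegree \<open>(2, 2)\<close> that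
  has bidegree \<open>(n - r, r)\<close>; it is the intended one only for even \<open>n\<close> and \<open>r\<close>.\<close>

definition mon_deg :: "nat => int => monom" where
  "mon_deg n r = single X20 (nat (int n - 2 * r) div 2)
     + single X22 (nat (2 * r - int n) div 2)
     + single X42 (nat (min r (int n - r)) div 2)"

lemma lookup_mon_deg:
  "lookup (mon_deg n r) X20 = nat (int n - 2 * r) div 2"
  "lookup (mon_deg n r) X22 = nat (2 * r - int n) div 2"
  "lookup (mon_deg n r) X42 = nat (min r (int n - r)) div 2"
  unfolding mon_deg_def by (simp_all add: lookup_add lookup_single when_def)

lemma monom_eqI:
  "lookup \<mu> X20 = lookup \<nu> X20 ==> lookup \<mu> X22 = lookup \<nu> X22 ==> lookup \<mu> X42 = lookup \<nu> X42 ==> \<mu> = \<nu>"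
  for \<mu> \<nu> :: monom
  by (rule poly_mapping_eqI, rule_tac y=k in indet.exhaust) simp_all

text \<open>The three exponents are linear functions of (n, r) on each side of the diagonal n = 2r,
  and compatible bidegrees lie on a common side.\<close>

lemma mon_deg_add:
  assumes "0 \<le> q" "q \<le> int k" "0 \<le> u" "u \<le> int n" "even k" "even n" "even q" "even u" "compatible k q n u"
  shows "mon_deg k q + mon_deg n u = mon_deg (k + n) (q + u)"
proof -
  obtain a b c d where e: "int k = 2 * a" "int n = 2 * b" "q = 2 * c" "u = 2 * d"
    using assms(5-8) by (metis dvdE even_of_nat)
  have n: "nat (int k - 2 * q) = 2 * nat (a - 2 * c)" "nat (2 * q - int k) = 2 * nat (2 * c - a)"
    "nat (min q (int k - q)) = 2 * nat (min c (a - c))"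
    "nat (int n - 2 * u) = 2 * nat (b - 2 * d)" "nat (2 * u - int n) = 2 * nat (2 * d - b)"
    "nat (min u (int n - u)) = 2 * nat (min d (b - d))"
    "nat (int (k + n) - 2 * (q + u)) = 2 * nat (a + b - 2 * (c + d))"
    "nat (2 * (q + u) - int (k + n)) = 2 * nat (2 * (c + d) - (a + b))"
    "nat (min (q + u) (int (k + n) - (q + u))) = 2 * nat (min (c + d) (a + b - (c + d)))"
    unfolding of_nat_add e by (auto simp: min_def)
  have comp: "(a \<ge> 2 * c \<and> b \<ge> 2 * d) \<or> (a \<le> 2 * c \<and> b \<le> 2 * d)"
    using assms(9) unfolding compatible_def e by auto
  have r: "0 \<le> c" "c \<le> a" "0 \<le> d" "d \<le> b" using assms(1-4) unfolding e by auto
  show ?thesis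
    using comp r by (intro monom_eqI; simp only: lookup_add lookup_mon_deg n nonzero_mult_div_cancel_left) auto
qed

text \<open>Strictly opposite sides of the diagonal: one factor contains \<open>X20\<close>, the
  other \<open>X22\<close>.\<close>

lemma mon_deg_incompatible:
  assumes "even k" "even n" "even q" "even u" "\<not> compatible k q n u"
  shows "single (mon_deg k q + mon_deg n u) c \<in> rel_ideal"
proof -
  have "lookup (mon_deg k q + mon_deg n u) X20 \<noteq> 0" "lookup (mon_deg k q + mon_deg n u) X22 \<noteq> 0"
    using assms unfolding compatible_def by (auto simp: lookup_add lookup_mon_deg elim!: evenE)
  then show ?thesis unfolding rel_ideal_iff trunc_simps by (auto simp: in_keys_iff)
qed

lemma mon_deg_inj:
  assumes "mon_deg k q = mon_deg n u" "0 \<le> q" "q \<le> int k" "0 \<le> u" "u \<le> int n" "even k" "even n" "even q" "even u"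
  shows "k = n \<and> q = u"
proof -
  obtain a b c d where e: "int k = 2 * a" "int n = 2 * b" "q = 2 * c" "u = 2 * d"
    using assms(6-9) by (metis dvdE even_of_nat)
  have n: "nat (int k - 2 * q) = 2 * nat (a - 2 * c)" "nat (2 * q - int k) = 2 * nat (2 * c - a)"
    "nat (min q (int k - q)) = 2 * nat (min c (a - c))"
    "nat (int n - 2 * u) = 2 * nat (b - 2 * d)" "nat (2 * u - int n) = 2 * nat (2 * d - b)"
    "nat (min u (int n - u)) = 2 * nat (min d (b - d))"
    unfolding e by (auto simp: min_def)
  have r: "0 \<le> c" "c \<le> a" "0 \<le> d" "d \<le> b" using assms(2-5) unfolding e by auto
  have "nat (a - 2 * c) = nat (b - 2 * d)" "nat (2 * c - a) = nat (2 * d - b)" "nat (min c (a - c)) = nat (min d (b - d))"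
    using arg_cong[OF assms(1), of "\<lambda>\<mu>. lookup \<mu> X20"] arg_cong[OF assms(1), of "\<lambda>\<mu>. lookup \<mu> X22"]
      arg_cong[OF assms(1), of "\<lambda>\<mu>. lookup \<mu> X42"]
    unfolding lookup_mon_deg n by simp_all
  then have "a = b" "c = d" using r by auto
  then show ?thesis using e by auto
qed

lemma mon_deg_normal: "\<not> (lookup (mon_deg n r) X20 \<noteq> 0 \<and> lookup (mon_deg n r) X22 \<noteq> 0)"
  unfolding lookup_mon_deg by auto

lemma normal_mon_deg:
  assumes "lookup \<mu> X20 = 0 \<or> lookup \<mu> X22 = 0"
  obtains n r where "\<mu> = mon_deg n r" "even n" "even r" "0 \<le> r" "r \<le> int n"
proof -
  \<comment> \<open>The bidegree of the monomial, from the degrees (2,0), (2,2) and (4,2) of the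
    three generators.\<close>
  define n where "n = 2 * (lookup \<mu> X20 + lookup \<mu> X22 + 2 * lookup \<mu> X42)"
  define r where "r = 2 * int (lookup \<mu> X22 + lookup \<mu> X42)"
  have e: "nat (int n - 2 * r) = 2 * (lookup \<mu> X20 - lookup \<mu> X22)" "nat (2 * r - int n) = 2 * (lookup \<mu> X22 - lookup \<mu> X20)"
    "nat (min r (int n - r)) = 2 * (lookup \<mu> X42 + min (lookup \<mu> X22) (lookup \<mu> X20))"
    unfolding n_def r_def by (auto simp: min_def)
  have "\<mu> = mon_deg n r"
    by (rule monom_eqI; simp only: lookup_mon_deg e nonzero_mult_div_cancel_left) (use assms in auto)
  then show thesis by (rule that) (auto simp: n_def r_def)
qed

section \<open>Krull dimension\<close>

text \<open>Gaussian elimination: an equation with a non-zero coefficient at i0 expresses this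
  unknown by the others and is substituted into the remaining equations.\<close>

lemma homogeneous_system:
  fixes A :: "'j => 'i => 'k::field"
  assumes "finite J" "finite I" "card J < card I"
  shows "\<exists>c. (\<exists>i\<in>I. c i \<noteq> 0) \<and> (\<forall>j\<in>J. (\<Sum>i\<in>I. c i * A j i) = 0)"
  using assms
proof (induction J arbitrary: I A rule: finite_induct)
  case empty
  then obtain i where "i \<in> I" by fastforce
  then show ?case by (intro exI[of _ "\<lambda>_. 1"]) auto
next
  case (insert j J)
  show ?case
  proof (cases "\<forall>i\<in>I. A j i = 0")
    case True
    then show ?thesis using insert.IH[of I A] insert.prems insert.hyps by auto
  next
    case False
    then obtain i0 where i0: "i0 \<in> I" "A j i0 \<noteq> 0" by blast
    let ?I = "I - {i0}" and ?A = "\<lambda>j' i. A j' i - A j' i0 * A j i / A j i0"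
    have "card J < card ?I" using insert i0 by simp
    from insert.IH[OF _ this, of ?A] insert.prems(1) obtain c where
      c: "\<exists>i\<in>?I. c i \<noteq> 0" "\<And>j'. j' \<in> J ==> (\<Sum>i\<in>?I. c i * ?A j' i) = 0" by blast
    define s where "s = (\<Sum>i\<in>?I. c i * A j i)"
    define c' where "c' = c(i0 := - (s / A j i0))"
    have split: "(\<Sum>i\<in>I. c' i * A j' i) = - (s / A j i0) * A j' i0 + (\<Sum>i\<in>?I. c i * A j' i)" for j'
      using insert.prems(1) i0(1) by (subst sum.remove[of I i0]) (auto simp: c'_def intro!: sum.cong)
    have "(\<Sum>i\<in>I. c' i * A j i) = 0" unfolding split using i0(2) by (simp add: s_def)
    moreover have "(\<Sum>i\<in>I. c' i * A j' i) = 0" if "j' \<in> J" for j'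
    proof -
      have "(\<Sum>i\<in>?I. c i * ?A j' i) = (\<Sum>i\<in>?I. c i * A j' i - (A j' i0 / A j i0) * (c i * A j i))"
        by (rule sum.cong) (auto simp: field_simps)
      also have "\<dots> = (\<Sum>i\<in>?I. c i * A j' i) - (A j' i0 / A j i0) * s"
        unfolding s_def sum_subtractf sum_distrib_left ..
      finally show ?thesis using c(2)[OF that] unfolding split by (simp add: field_simps)
    qed
    moreover have "\<exists>i\<in>I. c' i \<noteq> 0"
    proof -
      obtain i where "i \<in> ?I" "c i \<noteq> 0" using c(1) by blast
      then show ?thesis by (intro bexI[of _ i]) (auto simp: c'_def)
    qed
    ultimately show ?thesis by blast
  qed
qed

text \<open>Bounding the exponents one by one, and not the total degree, makes the admissible
  monomials in two variables a square that is easy to count.\<close>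

definition in_box :: "nat => (monom \<Rightarrow>\<^sub>0 'k::field) => bool" where
  "in_box d f \<longleftrightarrow> (\<forall>\<mu>\<in>keys f. \<forall>v. lookup \<mu> v \<le> d)"

lemma in_box_exists: "\<exists>d. in_box d f"
proof -
  let ?S = "(\<lambda>(\<mu>, v). lookup \<mu> v) ` (keys f \<times> UNIV)"
  have "finite ?S" by (auto simp: UNIV_indet)
  then have "\<forall>x\<in>?S. x \<le> Max ?S" by simp
  then show ?thesis unfolding in_box_def by (intro exI[of _ "Max ?S"]) auto
qed

lemma in_box_mono: "in_box d f ==> d \<le> e ==> in_box e f"
  unfolding in_box_def using order_trans by blast

lemma in_box_mult: "in_box d f ==> in_box e g ==> in_box (d + e) (f * g)"
  unfolding in_box_def
proof (intro ballI allI)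
  fix \<mu> v
  assume f: "\<forall>\<mu>\<in>keys f. \<forall>v. lookup \<mu> v \<le> d"
    and g: "\<forall>\<mu>\<in>keys g. \<forall>v. lookup \<mu> v \<le> e" and "\<mu> \<in> keys (f * g)"
  then obtain a b where "a \<in> keys f" "b \<in> keys g" "\<mu> = a + b"
    using keys_mult[of f g] by blast
  then show "lookup \<mu> v \<le> d + e" using f g by (simp add: lookup_add add_mono)
qed

lemma in_box_power: "in_box d f ==> in_box (n * d) (f ^ n)"
  by (induction n) (auto intro: in_box_mult simp: in_box_def[of 0])

abbreviation const :: "'k::field => (monom \<Rightarrow>\<^sub>0 'k)" where
  "const \<equiv> single 0"

text \<open>Modulo a variable only two variables remain, so the many products of powers of three
  polynomials satisfy a linear relation.\<close>

lemma algebraic_relation: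
  fixes f0 f1 f2 :: "monom \<Rightarrow>\<^sub>0 'k::field"
  shows "\<exists>D c. (\<exists>i\<le>D. \<exists>j\<le>D. \<exists>k\<le>D. c i j k \<noteq> 0) \<and>
    trunc {v} (\<Sum>i\<le>D. f0 ^ i * (\<Sum>j\<le>D. f1 ^ j * (\<Sum>k\<le>D. f2 ^ k * const (c i j k)))) = 0"
proof -
  obtain d0 d1 d2 where "in_box d0 f0" "in_box d1 f1" "in_box d2 f2" using in_box_exists by metis
  define d where "d = d0 + d1 + d2"
  have box: "in_box d f0" "in_box d f1" "in_box d f2"
    using \<open>in_box d0 f0\<close> \<open>in_box d1 f1\<close> \<open>in_box d2 f2\<close> unfolding d_def by (auto elim!: in_box_mono)
  \<comment> \<open>This gives (e + 1)^2 <= 9 (d + 1)^2 (D + 1)^2 = D (D + 1)^2 < (D + 1)^3, that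
    is, fewer monomials in two variables than products of powers.\<close>
  define D where "D = 9 * (d + 1)\<^sup>2"
  \<comment> \<open>Each of the three powers has exponents at most D d.\<close>
  define e where "e = 3 * (D * d)"
  let ?F = "\<lambda>(i, j, k). f0 ^ i * (f1 ^ j * f2 ^ k)"
  let ?I = "{..D} \<times> {..D} \<times> {..D}"
  \<comment> \<open>The monomials without v are the ones that the substitution keeps; each gives one
    linear equation for the coefficients of the relation.\<close>
  let ?J = "{\<mu>. \<forall>x. lookup \<mu> x \<le> e \<and> (x = v \<longrightarrow> lookup \<mu> x = 0)} :: monom set"
  obtain u w where uw: "UNIV = {v, u, w}" by (cases v) (auto simp: UNIV_indet)
  have inj: "inj_on (\<lambda>\<mu>. (lookup \<mu> u, lookup \<mu> w)) ?J"
  proof (rule inj_onI)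
    fix \<mu> \<nu> assume a: "\<mu> \<in> ?J" "\<nu> \<in> ?J"
      "(lookup \<mu> u, lookup \<mu> w) = (lookup \<nu> u, lookup \<nu> w)"
    show "\<mu> = \<nu>"
    proof (rule poly_mapping_eqI)
      fix x
      have "x = v \<or> x = u \<or> x = w" using uw by blast
      then show "lookup \<mu> x = lookup \<nu> x" using a by auto
    qed
  qed
  have sub: "(\<lambda>\<mu>. (lookup \<mu> u, lookup \<mu> w)) ` ?J \<subseteq> {..e} \<times> {..e}" by auto
  have finJ: "finite ?J" by (rule inj_on_finite[OF inj sub]) simp
  have "card ?J \<le> card ({..e} \<times> {..e})" by (rule card_inj_on_le[OF inj sub]) simp
  also have "\<dots> = (e + 1)\<^sup>2" by (simp add: power2_eq_square)
  also have "\<dots> \<le> (3 * (d + 1) * (D + 1))\<^sup>2"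
    unfolding e_def by (intro power_mono) (simp_all add: algebra_simps)
  also have "\<dots> = 9 * (d + 1)\<^sup>2 * (D + 1)\<^sup>2" unfolding power_mult_distrib by simp
  also have "\<dots> = D * (D + 1)\<^sup>2" unfolding D_def[symmetric] ..
  also have "\<dots> < (D + 1) * (D + 1)\<^sup>2" by simp
  also have "\<dots> = card ?I" by (simp add: power2_eq_square)
  finally have card: "card ?J < card ?I" .
  obtain c where c: "\<exists>i\<in>?I. c i \<noteq> 0"
    "\<And>\<mu>. \<mu> \<in> ?J ==> (\<Sum>i\<in>?I. c i * lookup (?F i) \<mu>) = 0"
    using homogeneous_system[OF finJ _ card, of "\<lambda>\<mu> i. lookup (?F i) \<mu>"] by auto
  have Fbox: "in_box e (?F p)" if "p \<in> ?I" for p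
  proof -
    obtain i j k where ijk: "p = (i, j, k)" by (cases p)
    have p: "p = (i, j, k)" "i \<le> D" "j \<le> D" "k \<le> D" using that unfolding ijk by auto
    have "in_box (i * d + (j * d + k * d)) (?F p)"
      unfolding p prod.case by (intro in_box_mult in_box_power box)
    moreover have "i * d + (j * d + k * d) \<le> D * d + (D * d + D * d)" using p by (intro add_mono mult_right_mono) auto
    ultimately show ?thesis unfolding e_def by (elim in_box_mono) simp
  qed
  have "(\<Sum>i\<le>D. f0 ^ i * (\<Sum>j\<le>D. f1 ^ j * (\<Sum>k\<le>D. f2 ^ k * const (c (i, j, k)))))
    = (\<Sum>p\<in>?I. const (c p) * ?F p)"
    unfolding sum.cartesian_product' sum_distrib_left prod.case
    by (intro sum.cong refl) (simp add: mult_ac)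
  moreover have "trunc {v} (\<Sum>p\<in>?I. const (c p) * ?F p) = 0"
  proof (rule poly_mapping_eqI)
    fix \<mu>
    have "lookup (\<Sum>p\<in>?I. const (c p) * ?F p) \<mu> = 0" if v: "v \<notin> keys \<mu>"
    proof (cases "\<mu> \<in> ?J")
      case True
      then show ?thesis using c(2)[OF True] by (simp add: lookup_sum flip: mult_map_scale_conv_mult)
    next
      case False
      then obtain x where "\<not> lookup \<mu> x \<le> e" using v by (auto simp: in_keys_iff)
      then have "\<mu> \<notin> keys (?F p)" if "p \<in> ?I" for p
        using Fbox[OF that] unfolding in_box_def by blast
      then show ?thesis by (simp add: lookup_sum in_keys_iff flip: mult_map_scale_conv_mult)
    qed
    then show "lookup (trunc {v} (\<Sum>p\<in>?I. const (c p) * ?F p)) \<mu> = lookup 0 \<mu>"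
      by (simp add: lookup_trunc)
  qed
  ultimately show ?thesis using c(1) by (intro exI[of _ D] exI[of _ "\<lambda>i j k. c (i, j, k)"]) auto
qed

abbreviation MP :: "('k::field, monom \<Rightarrow>\<^sub>0 'k) module" where
  "MP \<equiv> monoid_algebra"

text \<open>The sum is f^a times a cofactor. As no power of f lies in the prime p, the cofactor
  does; it is g a plus a multiple of f, and f lies in the larger ideal q.\<close>

lemma prime_cancel_lowest:
  fixes f :: "monom \<Rightarrow>\<^sub>0 'k::field"
  assumes p: "primeideal p MP" and q: "ideal q MP" "p \<subseteq> q" "f \<in> q" "f \<notin> p"
    and sum: "(\<Sum>i\<le>D. f ^ i * g i) \<in> p" and a: "a \<le> D" "\<And>i. i < a ==> g i = 0"
  shows "g a \<in> q"
proof -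
  interpret p: primeideal p MP by (rule p)
  interpret q: ideal q MP by (rule q)
  have "(\<Sum>i\<le>D. f ^ i * g i) = (\<Sum>i\<in>{a..D}. f ^ i * g i)"
    by (rule sum.mono_neutral_right) (use a in auto)
  also have "\<dots> = (\<Sum>i\<le>D - a. f ^ (i + a) * g (i + a))"
    using sum.shift_bounds_cl_nat_ivl[of "\<lambda>i. f ^ i * g i" 0 a "D - a"] a(1) by (simp add: atLeast0AtMost)
  also have "\<dots> = f ^ a * (\<Sum>i\<le>D - a. f ^ i * g (i + a))"
    by (simp add: sum_distrib_left power_add mult_ac)
  finally have "f ^ a * (\<Sum>i\<le>D - a. f ^ i * g (i + a)) \<in> p" using sum by simp
  moreover have "f ^ k \<notin> p" for k
  proof (induction k)
    case 0
    show ?case using p.I_notcarr p.one_imp_carrier by auto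
  next
    case (Suc k)
    then show ?case using p.I_prime[of f "f ^ k"] q(4) by auto
  qed
  ultimately have "(\<Sum>i\<le>D - a. f ^ i * g (i + a)) \<in> p"
    using p.I_prime[of "f ^ a" "\<Sum>i\<le>D - a. f ^ i * g (i + a)"] by auto
  moreover have "(\<Sum>i\<le>D - a. f ^ i * g (i + a)) = g a + f * (\<Sum>i<D - a. f ^ i * g (Suc i + a))"
    unfolding sum.atMost_shift by (simp add: sum_distrib_left mult_ac)
  ultimately have "g a + f * (\<Sum>i<D - a. f ^ i * g (Suc i + a)) \<in> q" using q(2) by auto
  moreover have "f * (\<Sum>i<D - a. f ^ i * g (Suc i + a)) \<in> q" using q.I_r_closed[OF q(3)] by simp
  ultimately show ?thesis
    using q.a_closed[OF _ q.a_inv_closed, of "g a + f * (\<Sum>i<D - a. f ^ i * g (Suc i + a))"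
        "f * (\<Sum>i<D - a. f ^ i * g (Suc i + a))"] by simp
qed

text \<open>One of the two variables of the relation lies in \<open>p 0\<close>, and with it every
  polynomial that vanishes when this variable is set to zero. The elements f0, f1, f2 witness the
  three strict inclusions. Their relation is nested so that each use of
  \<open>prime_cancel_lowest\<close> strips one of the three powers and moves up one prime, until a
  non-zero scalar lies in \<open>p 3\<close>.\<close>

lemma no_long_prime_chain:
  assumes p: "\<And>i. i \<le> 3 ==> primeideal (p i) (MP :: ('k::field, monom \<Rightarrow>\<^sub>0 'k) module)"
    and chain: "\<And>i. i < 3 ==> p i \<subset> p (Suc i)" and rel: "rel_ideal \<subseteq> p 0"
  shows False
proof -
  have id: "ideal (p i) MP" if "i \<le> 3" for i using primeideal.axioms(1)[OF p[OF that]] .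
  have "indet_poly X20 * indet_poly X22 \<in> (rel_ideal :: (monom \<Rightarrow>\<^sub>0 'k) set)"
    unfolding rel_ideal_def using monoid_algebra.genideal_self by auto
  then have "indet_poly X20 * indet_poly X22 \<in> p 0" using rel by blast
  then obtain v where v: "indet_poly v \<in> p 0" using primeideal.I_prime[OF p[of 0]] by auto
  interpret p0: ideal "p 0" MP using id[of 0] by simp
  have trunc_p0: "f \<in> p 0" if "trunc {v} f = 0" for f
  proof -
    have "keys f \<subseteq> {\<mu>. v \<in> keys \<mu>}"
    proof
      fix \<mu> assume "\<mu> \<in> keys f"
      then show "\<mu> \<in> {\<mu>. v \<in> keys \<mu>}"
        using lookup_trunc[of "{v}" f \<mu>] that by (auto simp: in_keys_iff split: if_splits)
    qed
    then show ?thesis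
    proof (induction f rule: poly_mapping_add_induct)
      case zero
      show ?case using p0.zero_closed by simp
    next
      case (add f g)
      then show ?case using p0.a_closed by simp
    next
      case (single \<mu> c)
      let ?v = "single v 1 :: monom"
      have "\<mu> = ?v + (\<mu> - ?v)"
      proof (rule poly_mapping_eqI)
        fix x
        show "lookup \<mu> x = lookup (?v + (\<mu> - ?v)) x"
          using single by (cases "x = v") (simp_all add: lookup_add lookup_minus lookup_single when_def in_keys_iff)
      qed
      then have "single \<mu> c = indet_poly v * single (\<mu> - ?v) c"
        unfolding indet_poly_def by (simp add: mult_single)
      then show ?case using p0.I_r_closed[OF v] by simp
    qed
  qed
  obtain f0 f1 f2 where f: "f0 \<in> p 1" "f0 \<notin> p 0" "f1 \<in> p 2" "f1 \<notin> p 1" "f2 \<in> p 3" "f2 \<notin> p 2"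
    using chain[of 0] chain[of 1] chain[of 2] by (auto simp: numeral_eq_Suc)
  obtain D c where c: "\<exists>i\<le>D. \<exists>j\<le>D. \<exists>k\<le>D. c i j k \<noteq> 0"
    "trunc {v} (\<Sum>i\<le>D. f0 ^ i * (\<Sum>j\<le>D. f1 ^ j * (\<Sum>k\<le>D. f2 ^ k * const (c i j k)))) = 0"
    using algebraic_relation[of v f0 f1 f2] by blast
  define a where "a = (LEAST i. \<exists>j\<le>D. \<exists>k\<le>D. c i j k \<noteq> 0)"
  have a: "\<exists>j\<le>D. \<exists>k\<le>D. c a j k \<noteq> 0" unfolding a_def by (rule LeastI_ex) (use c(1) in blast)
  have a0: "i < a ==> j \<le> D ==> k \<le> D ==> c i j k = 0" for i j k using not_less_Least unfolding a_def by blast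
  have aD: "a \<le> D" using c(1) a0 by (metis not_le_imp_less order_trans less_imp_le linorder_not_less)
  define b where "b = (LEAST j. \<exists>k\<le>D. c a j k \<noteq> 0)"
  have b: "\<exists>k\<le>D. c a b k \<noteq> 0" unfolding b_def by (rule LeastI_ex) (use a in blast)
  have b0: "j < b ==> k \<le> D ==> c a j k = 0" for j k using not_less_Least unfolding b_def by blast
  have bD: "b \<le> D" using a b0 by (metis not_le_imp_less order_trans less_imp_le linorder_not_less)
  define e where "e = (LEAST k. c a b k \<noteq> 0)"
  have e: "c a b e \<noteq> 0" unfolding e_def by (rule LeastI_ex) (use b in blast)
  have e0: "k < e ==> c a b k = 0" for k using not_less_Least unfolding e_def by blast
  have eD: "e \<le> D" using b e0 by (metis not_le_imp_less order_trans less_imp_le linorder_not_less)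
  let ?g = "\<lambda>i j. \<Sum>k\<le>D. f2 ^ k * const (c i j k)"
  let ?h = "\<lambda>i. \<Sum>j\<le>D. f1 ^ j * ?g i j"
  have s0: "(\<Sum>i\<le>D. f0 ^ i * ?h i) \<in> p 0" by (rule trunc_p0[OF c(2)])
  have s1: "?h a \<in> p 1"
    by (rule prime_cancel_lowest[OF p[of 0] id[of 1] _ f(1,2) s0 aD])
      (use chain[of 0] a0 in \<open>auto simp: single_zero\<close>)
  have s2: "?g a b \<in> p 2"
    by (rule prime_cancel_lowest[OF p[of 1] id[of 2] _ f(3,4) s1 bD])
      (use chain[of 1] b0 in \<open>auto simp: single_zero numeral_eq_Suc\<close>)
  have "const (c a b e) \<in> p 3"
    by (rule prime_cancel_lowest[OF p[of 2] id[of 3] _ f(5,6) s2 eD])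
      (use chain[of 2] e0 in \<open>auto simp: single_zero numeral_eq_Suc\<close>)
  then have "const (c a b e) * const (1 / c a b e) \<in> p 3" using ideal.I_r_closed[OF id[of 3]] by simp
  then have "\<one>\<^sub>MP \<in> p 3" using e by (simp add: mult_single)
  then show False using primeideal.I_notcarr[OF p[of 3]] ideal.one_imp_carrier[OF id[of 3]] by simp
qed

section \<open>The quotient by the nilpotent elements\<close>

text \<open>The first isomorphism theorem in the inverse direction: a fibre of \<psi> is, as a set,
  a coset of the kernel, so the inverse of the induced map sends an element to its fibre.\<close>

lemma quot_algebra_iso:
  fixes A :: "('k::field, 'a) module" and B :: "('k, 'b) module"
  assumes A: "ring A" and N: "ideal N A" and B: "ring B" and h: "\<psi> \<in> ring_hom A B"
    and surj: "\<psi> ` carrier A = carrier B" and ker: "\<And>x. x \<in> carrier A ==> \<psi> x = \<zero>\<^sub>B \<longleftrightarrow> x \<in> N"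
    and sm: "\<And>c x. x \<in> carrier A ==> c \<odot>\<^sub>A x \<in> carrier A"
      "\<And>c x. x \<in> carrier A ==> \<psi> (c \<odot>\<^sub>A x) = c \<odot>\<^sub>B \<psi> x"
  defines "\<phi> \<equiv> \<lambda>Y. {x \<in> carrier A. \<psi> x = Y}"
  shows "\<phi> \<in> algebra_iso B (quot_algebra A N)" and "x \<in> carrier A ==> \<phi> (\<psi> x) = N +>\<^sub>A x"
proof -
  interpret A: ring A by (rule A)
  interpret B: ring B by (rule B)
  note simps = quot_algebra_simps[OF A N]
  have ah: "\<psi> \<in> add_hom A B" using ring_hom_closed[OF h] ring_hom_add[OF h] by (intro add_homI)
  have eq: "\<psi> y = \<psi> x \<longleftrightarrow> y \<in> N +>\<^sub>A x" if "x \<in> carrier A" "y \<in> carrier A" for x y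
    using ker[of "y \<ominus>\<^sub>A x"] that add_hom_minus[OF A.is_abelian_group B.is_abelian_group ah that(2,1)]
      B.minus_eq_zero[of "\<psi> y" "\<psi> x"] ring_hom_closed[OF h]
      mem_coset_iff[OF A.is_abelian_group ideal.axioms(1)[OF N] that(1), of y]
    by (simp add: A.minus_closed)
  have coset: "\<phi> (\<psi> x) = N +>\<^sub>A x" if "x \<in> carrier A" for x
    using eq[OF that] mem_coset_iff[OF A.is_abelian_group ideal.axioms(1)[OF N] that] unfolding \<phi>_def by blast
  then show "x \<in> carrier A ==> \<phi> (\<psi> x) = N +>\<^sub>A x" .
  have cases: "\<exists>x\<in>carrier A. Y = \<psi> x" if "Y \<in> carrier B" for Y using that surj by blast
  have iso: "\<phi> \<in> ring_iso B (quot_algebra A N)"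
  proof (rule ring_iso_memI)
    show "\<phi> Y \<in> carrier (quot_algebra A N)" if "Y \<in> carrier B" for Y
      using cases[OF that] coset unfolding simps by auto
    fix Y Z assume "Y \<in> carrier B" "Z \<in> carrier B"
    then obtain x y where xy: "x \<in> carrier A" "Y = \<psi> x" "y \<in> carrier A" "Z = \<psi> y" using cases by metis
    show "\<phi> (Y \<otimes>\<^sub>B Z) = \<phi> Y \<otimes>\<^sub>(quot_algebra A N) \<phi> Z"
      using coset[of "x \<otimes>\<^sub>A y"] xy ring_hom_mult[OF h xy(1,3)] simps(5)[OF xy(1,3)] coset by simp
    show "\<phi> (Y \<oplus>\<^sub>B Z) = \<phi> Y \<oplus>\<^sub>(quot_algebra A N) \<phi> Z"
      using coset[of "x \<oplus>\<^sub>A y"] xy ring_hom_add[OF h xy(1,3)] simps(4)[OF xy(1,3)] coset by simp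
  next
    show "\<phi> \<one>\<^sub>B = \<one>\<^sub>(quot_algebra A N)"
      using coset[OF A.one_closed] ring_hom_one[OF h] simps(3) by simp
    have "inj_on \<phi> (carrier B)" using cases unfolding \<phi>_def by (intro inj_onI) blast
    moreover have "\<phi> ` carrier B = carrier (quot_algebra A N)"
      unfolding simps surj[symmetric] image_image using coset by simp
    ultimately show "bij_betw \<phi> (carrier B) (carrier (quot_algebra A N))" unfolding bij_betw_def by blast
  qed
  have "\<phi> (c \<odot>\<^sub>B Y) = c \<odot>\<^sub>(quot_algebra A N) \<phi> Y" if Y: "Y \<in> carrier B" for c Y
  proof -
    obtain x where x: "x \<in> carrier A" "Y = \<psi> x" using cases[OF Y] by blast
    have "N +>\<^sub>A (c \<odot>\<^sub>A y) = \<phi> (c \<odot>\<^sub>B Y)" if "y \<in> \<phi> Y" for y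
      using that coset[OF sm(1), of y c] sm(2)[of y c] unfolding \<phi>_def by simp
    moreover have "x \<in> \<phi> Y" using x unfolding \<phi>_def by simp
    ultimately show ?thesis unfolding quot_algebra_def by auto
  qed
  then show "\<phi> \<in> algebra_iso B (quot_algebra A N)" using iso unfolding algebra_iso_def by blast
qed

abbreviation cl :: "(monom \<Rightarrow>\<^sub>0 'k::field) => (monom \<Rightarrow>\<^sub>0 'k) set" where
  "cl f \<equiv> rel_ideal +>\<^sub>monoid_algebra f"

lemmas poly_quot_simps =
  quot_algebra_simps[OF monoid_algebra.ring_axioms rel_ideal_ideal, folded poly_quot_def, simplified]

lemma poly_quot_ring: "ring poly_quot"
  unfolding poly_quot_def by (rule quot_algebra_ring[OF monoid_algebra.ring_axioms rel_ideal_ideal])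

lemma cl_eq_iff: "cl f = cl g \<longleftrightarrow> f - g \<in> rel_ideal"
  using coset_eq_iff[OF monoid_algebra.is_abelian_group ideal.axioms(1)[OF rel_ideal_ideal], of f g] by simp

lemma cl_eq_zero_iff: "cl f = \<zero>\<^sub>poly_quot \<longleftrightarrow> f \<in> rel_ideal"
  unfolding poly_quot_simps(2)
  using cl_eq_iff[of f 0] coset_zero[OF monoid_algebra.is_abelian_group ideal.axioms(1)[OF rel_ideal_ideal]]
  by (metis diff_zero monoid_algebra_simps(4))

lemma cl_pow: "cl f [^]\<^sub>poly_quot k = cl (f ^ k)" for k :: nat
proof -
  interpret R: ring poly_quot by (rule poly_quot_ring)
  show ?thesis by (induction k) (simp_all add: poly_quot_simps mult.commute)
qed

lemma rel_ideal_sum: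
  fixes f :: "'i => (monom \<Rightarrow>\<^sub>0 'k::field)"
  assumes "\<And>i. i \<in> S ==> f i \<in> rel_ideal"
  shows "(\<Sum>i\<in>S. f i) \<in> rel_ideal"
proof -
  interpret Id: ideal rel_ideal "MP :: ('k, monom \<Rightarrow>\<^sub>0 'k) module" by (rule rel_ideal_ideal)
  show ?thesis
    using assms Id.zero_closed Id.a_closed by (induction S rule: infinite_finite_induct) simp_all
qed

lemma single_sum: "single k (\<Sum>i\<in>S. f i) = (\<Sum>i\<in>S. single k (f i))"
  by (induction S rule: infinite_finite_induct) (simp_all add: single_zero single_add)

lemma (in ext_resolution) E_mem_subgroup:
  assumes H: "additive_subgroup H E" and x: "x \<in> carrier E" and comp: "\<And>n. indeg n (x n) \<in> H"
  shows "x \<in> H"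
proof -
  have "x \<in> H" if "finite S" "{n. x n \<noteq> \<zero>\<^sub>(ExtG n)} \<subseteq> S" "x \<in> carrier E" "\<And>n. indeg n (x n) \<in> H" for S x
    using that
  proof (induction S arbitrary: x rule: finite_induct)
    case empty
    then have "x = \<zero>\<^sub>E" by (auto simp: E_simps fun_eq_iff)
    then show ?case using additive_subgroup.zero_closed[OF H] by simp
  next
    case (insert k S)
    let ?x = "x(k := \<zero>\<^sub>(ExtG k))"
    have "finite {n. ?x n \<noteq> \<zero>\<^sub>(ExtG n)}"
      using insert.prems(2) by (auto simp: E_simps elim: rev_finite_subset)
    then have xc: "?x \<in> carrier E" using insert.prems(2) ext_zero_closed by (simp add: E_simps)
    have "indeg k \<zero>\<^sub>(ExtG k) = \<zero>\<^sub>E" by (auto simp: in_degree_def E_simps fun_eq_iff)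
    then have z: "indeg k \<zero>\<^sub>(ExtG k) \<in> H" using additive_subgroup.zero_closed[OF H] by simp
    have "?x \<in> H"
      by (rule insert.IH[OF _ xc]) (use insert.prems z in auto)
    moreover have "x = indeg k (x k) \<oplus>\<^sub>E ?x"
    proof
      fix n
      interpret G: abelian_group "ExtG n" by (rule ext_group_abelian)
      show "x n = (indeg k (x k) \<oplus>\<^sub>E ?x) n"
        using E_component[OF insert.prems(2), of n] G.r_zero[of "x n"] G.l_zero[of "x n"]
        by (cases "n = k") (simp_all add: E_simps(5) in_degree_def)
    qed
    ultimately show ?case using additive_subgroup.a_closed[OF H insert.prems(3)[of k]] by metis
  qed
  from this[OF _ order_refl x comp] show ?thesis using x by (simp add: E_simps)
qed

section \<open>The homomorphism from cohomology to the polynomial quotient\<close>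

context lambda_algebra_odd
begin

definition P :: "'k hoch => (monom \<Rightarrow>\<^sub>0 'k)" where
  "P x = (\<Sum>n\<in>{n. x n \<noteq> \<zero>\<^sub>(X.ExtG n)}. \<Sum>r\<in>{0..int n}. single (mon_deg n r) (C x n r))"

text \<open>Only the class of \<open>P x\<close> is multiplicative: in a product of polynomials the
  incompatible pairs contribute monomials in \<open>rel_ideal\<close>, while the Yoneda product
  drops them.\<close>

definition \<Psi> :: "'k hoch => (monom \<Rightarrow>\<^sub>0 'k) set" where
  "\<Psi> x = cl (P x)"

lemma P_superset:
  assumes "finite S" "{n. x n \<noteq> \<zero>\<^sub>(X.ExtG n)} \<subseteq> S"
  shows "P x = (\<Sum>n\<in>S. \<Sum>r\<in>{0..int n}. single (mon_deg n r) (C x n r))"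
  unfolding P_def using assms C_zero by (intro sum.mono_neutral_left) (auto simp: single_zero)

lemma E_support: "x \<in> carrier X.E ==> finite {n. x n \<noteq> \<zero>\<^sub>(X.ExtG n)}"
  by (simp add: X.E_simps)

lemma P_add:
  assumes x: "x \<in> carrier X.E" and y: "y \<in> carrier X.E"
  shows "P (x \<oplus>\<^sub>X.E y) = P x + P y"
proof -
  let ?S = "{n. x n \<noteq> \<zero>\<^sub>(X.ExtG n)} \<union> {n. y n \<noteq> \<zero>\<^sub>(X.ExtG n)} \<union> {n. (x \<oplus>\<^sub>X.E y) n \<noteq> \<zero>\<^sub>(X.ExtG n)}"
  have fin: "finite ?S" using E_support[OF x] E_support[OF y] E_support[OF X.E.a_closed[OF x y]] by blast
  have "P x = (\<Sum>n\<in>?S. \<Sum>r\<in>{0..int n}. single (mon_deg n r) (C x n r))"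
    "P y = (\<Sum>n\<in>?S. \<Sum>r\<in>{0..int n}. single (mon_deg n r) (C y n r))"
    "P (x \<oplus>\<^sub>X.E y) = (\<Sum>n\<in>?S. \<Sum>r\<in>{0..int n}. single (mon_deg n r) (C (x \<oplus>\<^sub>X.E y) n r))"
    by (rule P_superset[OF fin]; blast)+
  then show ?thesis unfolding C_add[OF x y] by (simp add: single_add sum.distrib)
qed

lemma P_smult:
  assumes x: "x \<in> carrier X.E"
  shows "P (c \<odot>\<^sub>X.E x) = single 0 c * P x"
proof -
  let ?S = "{n. x n \<noteq> \<zero>\<^sub>(X.ExtG n)} \<union> {n. (c \<odot>\<^sub>X.E x) n \<noteq> \<zero>\<^sub>(X.ExtG n)}"
  have fin: "finite ?S" using E_support[OF x] E_support[OF E_smult_closed[OF x]] by blast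
  have "P x = (\<Sum>n\<in>?S. \<Sum>r\<in>{0..int n}. single (mon_deg n r) (C x n r))"
    "P (c \<odot>\<^sub>X.E x) = (\<Sum>n\<in>?S. \<Sum>r\<in>{0..int n}. single (mon_deg n r) (C (c \<odot>\<^sub>X.E x) n r))"
    by (rule P_superset[OF fin]; blast)+
  then show ?thesis unfolding C_smult[OF x] by (simp add: sum_distrib_left mult_single)
qed

lemma P_indeg: "P (X.indeg n Y) = (\<Sum>r\<in>{0..int n}. single (mon_deg n r) (C (X.indeg n Y) n r))"
proof -
  have "{k. X.indeg n Y k \<noteq> \<zero>\<^sub>(X.ExtG k)} \<subseteq> {n}" by (auto simp: in_degree_def)
  from P_superset[OF _ this] show ?thesis by simp
qed

lemma lookup_P:
  assumes x: "x \<in> carrier X.E" and r: "even n" "even r" "0 \<le> r" "r \<le> int n"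
  shows "lookup (P x) (mon_deg n r) = C x n r"
proof -
  let ?S = "insert n {n. x n \<noteq> \<zero>\<^sub>(X.ExtG n)}"
  have fin: "finite ?S" using E_support[OF x] by simp
  have Px: "P x = (\<Sum>k\<in>?S. \<Sum>q\<in>{0..int k}. single (mon_deg k q) (C x k q))"
    by (rule P_superset[OF fin]) auto
  have "lookup (single (mon_deg k q) (C x k q)) (mon_deg n r)
      = (if k = n \<and> q = r then C x n r else 0)" for k q
    using mon_deg_inj[of k q n r] C_even[OF x, of k q] r
    by (cases "C x k q = 0") (auto simp: lookup_single when_def)
  then have "lookup (P x) (mon_deg n r)
    = (\<Sum>k\<in>?S. \<Sum>q\<in>{0..int k}. if k = n \<and> q = r then C x n r else 0)"
    unfolding Px lookup_sum by simp
  also have "\<dots> = (\<Sum>k\<in>?S. if k = n then C x n r else 0)"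
    using r by (intro sum.cong) auto
  also have "\<dots> = C x n r" using fin by simp
  finally show ?thesis .
qed

text \<open>The monomials \<open>mon_deg n r\<close> never contain both \<open>X20\<close> and
  \<open>X22\<close>, and they are distinct for distinct even bidegrees. So no coefficient of
  \<open>P x\<close> disappears modulo \<open>rel_ideal\<close>.\<close>

lemma P_rel_ideal_iff:
  assumes x: "x \<in> carrier X.E"
  shows "P x \<in> rel_ideal \<longleftrightarrow> (\<forall>n r. C x n r = 0)"
proof
  assume P: "P x \<in> rel_ideal"
  show "\<forall>n r. C x n r = 0"
  proof (intro allI, rule ccontr)
    fix n r assume "C x n r \<noteq> 0"
    then have r: "even n" "even r" "0 \<le> r" "r \<le> int n" and c: "C x n r \<noteq> 0" using C_even[OF x] by blast+
    have "lookup (P x) (mon_deg n r) = 0"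
      using P mon_deg_normal[of n r] lookup_trunc[of "{X20}" "P x" "mon_deg n r"]
        lookup_trunc[of "{X22}" "P x" "mon_deg n r"] unfolding rel_ideal_iff
      by (auto simp: in_keys_iff split: if_splits)
    then show False using lookup_P[OF x r] c by simp
  qed
next
  assume "\<forall>n r. C x n r = 0"
  then have "P x = 0" unfolding P_def by (simp add: single_zero)
  then show "P x \<in> rel_ideal" by (simp add: rel_ideal_iff trunc_simps)
qed

lemma \<Psi>_add_hom: "\<Psi> \<in> add_hom X.E poly_quot"
  by (rule add_homI) (auto simp: \<Psi>_def P_add poly_quot_simps)

lemma \<Psi>_mult_homogeneous:
  assumes f: "f \<in> X.Z k" and g: "g \<in> X.Z n"
  defines "x \<equiv> X.indeg k (X.cls k f)" and "y \<equiv> X.indeg n (X.cls n g)"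
  shows "\<Psi> (x \<otimes>\<^sub>X.E y) = \<Psi> x \<otimes>\<^sub>poly_quot \<Psi> y"
proof -
  have xc: "x \<in> carrier X.E" "y \<in> carrier X.E"
    unfolding x_def y_def by (intro X.in_degree_closed X.cls_closed f g)+
  let ?s = "\<lambda>q u. single (mon_deg (k + n) (q + u))
    (if compatible k q n u then C x k q * C y n u else 0)"
  obtain Y where Y: "x \<otimes>\<^sub>X.E y = X.indeg (k + n) Y" using C_mult(1)[OF f g] unfolding x_def y_def by blast
  have "P (x \<otimes>\<^sub>X.E y) = (\<Sum>r\<in>{0..int (k + n)}. single (mon_deg (k + n) r) (C (x \<otimes>\<^sub>X.E y) (k + n) r))"
    unfolding Y by (rule P_indeg)
  also have "\<dots> = (\<Sum>r\<in>{0..int (k + n)}. \<Sum>q\<in>{0..int k}. ?s q (r - q))"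
    using C_mult(2)[OF f g] unfolding x_def[symmetric] y_def[symmetric] by (simp add: single_sum)
  also have "\<dots> = (\<Sum>q\<in>{0..int k}. \<Sum>r\<in>{0..int (k + n)}. ?s q (r - q))" by (rule sum.swap)
  \<comment> \<open>Substitution of r = q + u; for u outside its range the constant term of y is
    zero.\<close>
  also have "\<dots> = (\<Sum>q\<in>{0..int k}. \<Sum>u\<in>{0..int n}. ?s q u)"
  proof (rule sum.cong[OF refl])
    fix q assume q: "q \<in> {0..int k}"
    have "(\<Sum>r\<in>{0..int (k + n)}. ?s q (r - q)) = (\<Sum>r\<in>(\<lambda>u. q + u) ` {0..int n}. ?s q (r - q))"
    proof (rule sum.mono_neutral_right)
      show "(\<lambda>u. q + u) ` {0..int n} \<subseteq> {0..int (k + n)}" using q by auto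
      show "\<forall>r\<in>{0..int (k + n)} - (\<lambda>u. q + u) ` {0..int n}. ?s q (r - q) = 0"
      proof
        fix r assume "r \<in> {0..int (k + n)} - (\<lambda>u. q + u) ` {0..int n}"
        then have "r - q \<notin> {0..int n}" by (metis DiffD2 add.commute diff_add_cancel image_eqI)
        then have "C y n (r - q) = 0" using C_even[OF xc(2), of n "r - q"] by auto
        then show "?s q (r - q) = 0" by (simp add: single_zero)
      qed
    qed simp
    also have "\<dots> = (\<Sum>u\<in>{0..int n}. ?s q u)" by (subst sum.reindex) (simp_all add: inj_on_def cong: if_cong)
    finally show "(\<Sum>r\<in>{0..int (k + n)}. ?s q (r - q)) = (\<Sum>u\<in>{0..int n}. ?s q u)" .
  qed
  finally have Pxy: "P (x \<otimes>\<^sub>X.E y) = (\<Sum>q\<in>{0..int k}. \<Sum>u\<in>{0..int n}. ?s q u)" .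
  have PP: "P x * P y = (\<Sum>q\<in>{0..int k}. \<Sum>u\<in>{0..int n}.
      single (mon_deg k q + mon_deg n u) (C x k q * C y n u))"
    unfolding x_def y_def P_indeg sum_product by (simp add: mult_single)
  \<comment> \<open>For a compatible pair with non-zero coefficients the two monomials agree; for an
    incompatible one the product monomial already lies in \<open>rel_ideal\<close>.\<close>
  have "?s q u - single (mon_deg k q + mon_deg n u) (C x k q * C y n u) \<in> rel_ideal" for q u
  proof (cases "C x k q * C y n u = 0")
    case True
    then show ?thesis unfolding True if_cancel by (simp add: single_zero rel_ideal_iff trunc_simps)
  next
    case False
    then have "C x k q \<noteq> 0" "C y n u \<noteq> 0" by auto
    with C_even[OF xc(1)] C_even[OF xc(2)] have
      e: "0 \<le> q" "q \<le> int k" "even k" "even q" "0 \<le> u" "u \<le> int n" "even n" "even u" by blast+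
    show ?thesis
    proof (cases "compatible k q n u")
      case True
      then show ?thesis using mon_deg_add[of q k u n] e by (simp add: rel_ideal_iff trunc_simps)
    next
      case False
      then show ?thesis
        using mon_deg_incompatible[OF e(3,7,4,8) False, of "- (C x k q * C y n u)"] by (simp add: single_zero single_uminus)
    qed
  qed
  then have "P (x \<otimes>\<^sub>X.E y) - P x * P y \<in> rel_ideal"
    unfolding Pxy PP sum_subtractf[symmetric] by (intro rel_ideal_sum)
  then show ?thesis unfolding \<Psi>_def by (simp add: poly_quot_simps cl_eq_iff)
qed

lemma \<Psi>_mult:
  assumes "x \<in> carrier X.E" "y \<in> carrier X.E"
  shows "\<Psi> (x \<otimes>\<^sub>X.E y) = \<Psi> x \<otimes>\<^sub>poly_quot \<Psi> y"
proof -
  interpret R: ring poly_quot by (rule poly_quot_ring)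
  note hc = add_hom_closed[OF \<Psi>_add_hom] and ha = add_hom_add[OF \<Psi>_add_hom]
  have hom1: "(\<lambda>x. \<Psi> x \<otimes>\<^sub>poly_quot \<Psi> y) \<in> add_hom X.E poly_quot" if "y \<in> carrier X.E" for y
    using that by (intro add_homI) (auto simp: hc ha R.l_distr simp del: poly_quot_simps)
  have hom2: "(\<lambda>y. \<Psi> x \<otimes>\<^sub>poly_quot \<Psi> y) \<in> add_hom X.E poly_quot" if "x \<in> carrier X.E" for x
    using that by (intro add_homI) (auto simp: hc ha R.r_distr simp del: poly_quot_simps)
  show ?thesis
  proof (rule X.E_hom_eq[OF R.is_abelian_group add_hom_comp[OF X.E_right_hom[OF assms(2)] \<Psi>_add_hom] hom1[OF assms(2)] assms(1)])
    fix k X assume X: "X \<in> carrier (X.ExtG k)"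
    note xc = X.in_degree_closed[OF X]
    show "\<Psi> (X.indeg k X \<otimes>\<^sub>X.E y) = \<Psi> (X.indeg k X) \<otimes>\<^sub>poly_quot \<Psi> y"
    proof (rule X.E_hom_eq[OF R.is_abelian_group add_hom_comp[OF X.E_left_hom[OF xc] \<Psi>_add_hom] hom2[OF xc] assms(2)])
      fix n Y assume Y: "Y \<in> carrier (X.ExtG n)"
      obtain f where f: "f \<in> X.Z k" "X = X.cls k f" using X by (rule X.ext_group_cases)
      obtain g where g: "g \<in> X.Z n" "Y = X.cls n g" using Y by (rule X.ext_group_cases)
      show "\<Psi> (X.indeg k X \<otimes>\<^sub>X.E X.indeg n Y) = \<Psi> (X.indeg k X) \<otimes>\<^sub>poly_quot \<Psi> (X.indeg n Y)"
        unfolding f(2) g(2) by (rule \<Psi>_mult_homogeneous[OF f(1) g(1)])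
    qed
  qed
qed

lemma P_one: "P \<one>\<^sub>X.E = 1"
proof -
  have "mon_deg 0 0 = 0" by (rule monom_eqI) (simp_all add: lookup_mon_deg)
  then show ?thesis using C_one[of 0 0] unfolding X.E_simps(3) P_indeg by simp
qed

lemma \<Psi>_ring_hom: "\<Psi> \<in> ring_hom X.E poly_quot"
  using add_hom_closed[OF \<Psi>_add_hom] add_hom_add[OF \<Psi>_add_hom] \<Psi>_mult P_one
  by (intro ring_hom_memI) (simp_all add: \<Psi>_def poly_quot_simps)

lemma \<Psi>_zero_iff: "x \<in> carrier X.E ==> \<Psi> x = \<zero>\<^sub>poly_quot \<longleftrightarrow> (\<forall>n r. C x n r = 0)"
  unfolding \<Psi>_def cl_eq_zero_iff by (rule P_rel_ideal_iff)

lemma \<Psi>_smult: "x \<in> carrier X.E ==> \<Psi> (c \<odot>\<^sub>X.E x) = c \<odot>\<^sub>poly_quot \<Psi> x"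
  unfolding \<Psi>_def P_smult poly_quot_def
  by (subst quot_algebra_smult[OF monoid_algebra.k_algebra_axioms rel_ideal_ideal]) simp_all

lemma chi_closed: "even n ==> even r ==> chi N n r \<in> carrier X.E"
  unfolding chi_eq by (intro X.in_degree_closed X.cls_closed chi_cocycle)

lemma P_chi:
  assumes "even n" "even r" "0 \<le> r" "r \<le> int n"
  shows "P (chi N n r) = single (mon_deg n r) 1"
proof -
  have "P (chi N n r) = (\<Sum>s\<in>{0..int n}. single (mon_deg n s) (C (chi N n r) n s))"
    unfolding chi_eq by (rule P_indeg)
  also have "\<dots> = (\<Sum>s\<in>{0..int n}. if s = r then single (mon_deg n r) 1 else 0)"
    using assms by (intro sum.cong) (auto simp: C_chi single_zero)
  finally show ?thesis using assms by simp
qed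

text \<open>A monomial that does not contain both \<open>X20\<close> and \<open>X22\<close> is
  \<open>mon_deg n r\<close> for some even n and r, and \<open>chi N n r\<close> maps to it; all
  other monomials are zero in the target. Thus the classes of all even bidegrees serve as
  preimages.\<close>

lemma \<Psi>_surj: "\<Psi> ` carrier X.E = carrier poly_quot"
proof (intro equalityI subsetI)
  fix Y assume "Y \<in> carrier (poly_quot :: ('k, (monom \<Rightarrow>\<^sub>0 'k) set) module)"
  then obtain f where f: "Y = cl f" by (auto simp: poly_quot_simps)
  have "\<exists>x\<in>carrier X.E. cl f = \<Psi> x" using subset_UNIV[of "keys f"]
  proof (induction f rule: poly_mapping_add_induct)
    case zero
    show ?case
      using add_hom_zero[OF X.E_abelian_group ring.is_abelian_group[OF poly_quot_ring] \<Psi>_add_hom]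
      by (intro bexI[of _ "\<zero>\<^sub>X.E"]) (simp_all add: cl_eq_zero_iff rel_ideal_iff trunc_simps)
  next
    case (single \<mu> c)
    show ?case
    proof (cases "lookup \<mu> X20 = 0 \<or> lookup \<mu> X22 = 0")
      case True
      then obtain n r where nr: "\<mu> = mon_deg n r" "even n" "even r" "0 \<le> r" "r \<le> int n" by (rule normal_mon_deg)
      have "P (c \<odot>\<^sub>X.E chi N n r) = single \<mu> c"
        using P_smult[OF chi_closed[OF nr(2,3)], of c] P_chi[OF nr(2-5)] nr(1) by (simp add: mult_single)
      then show ?thesis using E_smult_closed[OF chi_closed[OF nr(2,3)]] unfolding \<Psi>_def by metis
    next
      case False
      then have "single \<mu> c \<in> rel_ideal" by (auto simp: rel_ideal_iff trunc_simps in_keys_iff)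
      then show ?thesis
        using add_hom_zero[OF X.E_abelian_group ring.is_abelian_group[OF poly_quot_ring] \<Psi>_add_hom] cl_eq_zero_iff[THEN iffD2]
        by (intro bexI[of _ "\<zero>\<^sub>X.E"]) simp_all
    qed
  next
    case (add f g)
    then obtain x y where xy: "x \<in> carrier X.E" "cl f = \<Psi> x" "y \<in> carrier X.E" "cl g = \<Psi> y" by blast
    have "\<Psi> (x \<oplus>\<^sub>X.E y) = cl (f + g)"
      using add_hom_add[OF \<Psi>_add_hom xy(1,3)] xy(2,4)[symmetric] by (simp add: poly_quot_simps)
    then show ?case using X.E.a_closed[OF xy(1,3)] by blast
  qed
  then show "Y \<in> \<Psi> ` carrier X.E" unfolding f by blast
qed (use add_hom_closed[OF \<Psi>_add_hom] in blast)

text \<open>The ideal is generated by homogeneous elements, whereas an element of the kernel may be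
  inhomogeneous. It is therefore split into its components, which have no constant terms
  either.\<close>

lemma HH_nil_eq: "HH_nil N = {x \<in> carrier X.E. \<Psi> x = \<zero>\<^sub>poly_quot}"
proof -
  interpret E: ring X.E by (rule X.E_ring)
  interpret R: ring poly_quot by (rule poly_quot_ring)
  interpret h: ring_hom_ring X.E poly_quot \<Psi>
    by (intro ring_hom_ringI2 X.E_ring poly_quot_ring \<Psi>_ring_hom)
  let ?J = "{x \<in> carrier X.E. \<Psi> x = \<zero>\<^sub>poly_quot}"
  let ?G = "{x \<in> carrier X.E. homogeneous L (regular_bimod L) Q (res_diff N) x \<and> (\<exists>k::nat. x [^]\<^sub>X.E k = \<zero>\<^sub>X.E)}"
  have nil: "HH_nil N = Idl\<^bsub>X.E\<^esub> ?G" unfolding HH_nil_def nilpotent_ideal_def ..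
  have J: "ideal ?J X.E" using h.kernel_is_ideal unfolding a_kernel_def' .
  have "?G \<subseteq> ?J"
  proof
    fix x assume "x \<in> ?G"
    then obtain k :: nat where x: "x \<in> carrier X.E" "x [^]\<^sub>X.E k = \<zero>\<^sub>X.E" by blast
    have "\<Psi> x [^]\<^sub>poly_quot k = \<zero>\<^sub>poly_quot"
      using h.hom_nat_pow[OF x(1), of k] x(2) h.hom_zero by metis
    then have "\<Psi> x = \<zero>\<^sub>poly_quot" unfolding \<Psi>_def cl_pow cl_eq_zero_iff by (rule rel_ideal_radical)
    then show "x \<in> ?J" using x(1) by simp
  qed
  then have "HH_nil N \<subseteq> ?J" unfolding nil by (rule E.genideal_minimal[OF J])
  moreover have "?J \<subseteq> HH_nil N"
  proof
    fix x assume "x \<in> ?J"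
    then have x: "x \<in> carrier X.E" and C0: "\<And>n r. C x n r = 0" using \<Psi>_zero_iff by auto
    have Gc: "?G \<subseteq> carrier X.E" by blast
    show "x \<in> HH_nil N"
    proof (rule X.E_mem_subgroup[OF _ x])
      show "additive_subgroup (HH_nil N) X.E" unfolding nil using E.genideal_ideal[OF Gc] by (rule ideal.axioms(1))
      fix n
      obtain f where f: "f \<in> X.Z n" "x n = X.cls n f" using x by (rule E_cocycle)
      have "cst (f (gen n r)) = 0" for r using C_cls[of f n x r, OF f] C0 by simp
      from radical_nilpotent[OF f(1) this]
      have "X.indeg n (x n) [^]\<^sub>X.E Suc (2 * N) = \<zero>\<^sub>X.E" unfolding f(2) .
      moreover have "X.indeg n (x n) \<in> carrier X.E" unfolding f(2) by (intro X.in_degree_closed X.cls_closed f)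
      moreover have "homogeneous L (regular_bimod L) Q (res_diff N) (X.indeg n (x n))"
        unfolding homogeneous_def by (intro exI[of _ n]) (simp add: in_degree_def)
      ultimately have "X.indeg n (x n) \<in> ?G" by blast
      then show "X.indeg n (x n) \<in> HH_nil N" unfolding nil using E.genideal_self[OF Gc] by blast
    qed
  qed
  ultimately show ?thesis by blast
qed

definition \<Phi> :: "(monom \<Rightarrow>\<^sub>0 'k) set => 'k hoch set" where
  "\<Phi> Y = {x \<in> carrier X.E. \<Psi> x = Y}"

lemma HH_nil_ideal: "ideal (HH_nil N) X.E"
proof -
  interpret h: ring_hom_ring X.E poly_quot \<Psi>
    by (intro ring_hom_ringI2 X.E_ring poly_quot_ring \<Psi>_ring_hom)
  show ?thesis unfolding HH_nil_eq using h.kernel_is_ideal unfolding a_kernel_def' .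
qed

lemma \<Phi>_iso:
  shows "\<Phi> \<in> algebra_iso poly_quot (HH_red N)" and "x \<in> carrier X.E ==> \<Phi> (\<Psi> x) = HH_nil N +>\<^sub>X.E x"
proof -
  have ker: "\<Psi> x = \<zero>\<^sub>poly_quot \<longleftrightarrow> x \<in> HH_nil N" if "x \<in> carrier X.E" for x
    using that unfolding HH_nil_eq by simp
  show "\<Phi> \<in> algebra_iso poly_quot (HH_red N)" unfolding \<Phi>_def[abs_def] HH_red_def HH_def
    by (rule quot_algebra_iso(1)[where \<psi>=\<Psi>])
      (simp_all only: X.E_ring HH_nil_ideal poly_quot_ring \<Psi>_ring_hom \<Psi>_surj ker E_smult_closed \<Psi>_smult)
  show "x \<in> carrier X.E ==> \<Phi> (\<Psi> x) = HH_nil N +>\<^sub>X.E x" unfolding \<Phi>_def[abs_def]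
    by (rule quot_algebra_iso(2)[where \<psi>=\<Psi>])
      (simp_all only: X.E_ring HH_nil_ideal poly_quot_ring \<Psi>_ring_hom \<Psi>_surj ker E_smult_closed \<Psi>_smult)
qed

lemma \<Phi>_chi:
  assumes "even n" "even r" "0 \<le> r" "r \<le> int n"
  shows "\<Phi> (cl (single (mon_deg n r) 1)) = chi_red N n r"
  using \<Phi>_iso(2)[OF chi_closed[OF assms(1,2)]] unfolding \<Psi>_def P_chi[OF assms] chi_red_def HH_def .

end

section \<open>The main theorem\<close>

lemma MP_cring: "cring (MP :: ('k::field, monom \<Rightarrow>\<^sub>0 'k) module)"
  using monoid_algebra.ring_axioms monoid_algebra.monoid_axioms
  by (intro cring.intro comm_monoid.intro comm_monoid_axioms.intro) (simp_all add: mult.commute)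

text \<open>The substitution is a homomorphism to a domain, and its kernel is proper as 1 is
  fixed.\<close>

lemma trunc_prime: "primeideal {f. trunc S f = 0} (MP :: ('k::field, monom \<Rightarrow>\<^sub>0 'k) module)"
proof (rule primeidealI[OF trunc_ideal MP_cring])
  have "(1 :: monom \<Rightarrow>\<^sub>0 'k) \<notin> {f. trunc S f = 0}" by (simp add: trunc_simps)
  then show "carrier MP \<noteq> {f :: monom \<Rightarrow>\<^sub>0 'k. trunc S f = 0}" by auto
qed (simp add: trunc_mult)

lemma indet_poly_neq_zero: "indet_poly v \<noteq> (0 :: monom \<Rightarrow>\<^sub>0 'k::field)"
proof
  assume "indet_poly v = (0 :: monom \<Rightarrow>\<^sub>0 'k)"
  then have "lookup (indet_poly v) (single v 1) = (0 :: 'k)" by simp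
  then show False unfolding indet_poly_def by simp
qed

lemma trunc_indet_poly: "trunc S (indet_poly v) = (if v \<in> S then 0 else indet_poly v)"
  unfolding indet_poly_def by (simp add: trunc_simps)

lemma rel_ideal_trunc: "X20 \<in> S ==> rel_ideal \<subseteq> {f. trunc S f = 0}"
  unfolding rel_ideal_def
  by (rule monoid_algebra.genideal_minimal[OF trunc_ideal])
    (simp add: trunc_mult indet_poly_def trunc_simps)

text \<open>Commutativity, finite generation and dimension are derived from a surjection of the
  polynomial ring with kernel \<open>rel_ideal\<close>, independently of what the elements of
  \<open>R\<close> are.\<close>

locale poly_presentation = R: ring R for R :: "('k::field, 'a) module" (structure) +
  fixes h :: "(monom \<Rightarrow>\<^sub>0 'k) => 'a"
  assumes h_hom: "h \<in> ring_hom MP R" and h_surj: "range h = carrier R"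
    and h_ker: "h f = \<zero> \<longleftrightarrow> f \<in> rel_ideal"
begin

lemma h_closed [simp, intro]: "h f \<in> carrier R"
  and h_mult: "h (f * g) = h f \<otimes> h g" and h_add: "h (f + g) = h f \<oplus> h g" and h_one: "h 1 = \<one>"
  using ring_hom_closed[OF h_hom, of f] ring_hom_mult[OF h_hom, of f g] ring_hom_add[OF h_hom, of f g]
    ring_hom_one[OF h_hom] by simp_all

lemma h_zero: "h 0 = \<zero>"
  by (simp add: h_ker rel_ideal_iff trunc_simps)

lemma h_uminus: "h (- f) = \<ominus> h f"
  by (rule R.minus_equality[symmetric]) (simp_all flip: h_add add: h_zero)

lemma h_cases: "x \<in> carrier R ==> \<exists>f. x = h f"
  using h_surj by blast

lemma cring: "cring R"
proof (intro cring.intro comm_monoid.intro comm_monoid_axioms.intro R.ring_axioms R.monoid_axioms)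
  fix x y assume "x \<in> carrier R" "y \<in> carrier R"
  then obtain f g where "x = h f" "y = h g" using h_cases by metis
  then show "x \<otimes> y = y \<otimes> x" by (simp flip: h_mult add: mult.commute)
qed

lemma prime_pullback:
  assumes "primeideal I R"
  shows "primeideal {f. h f \<in> I} MP"
proof (rule primeidealI[OF _ MP_cring])
  interpret I: primeideal I R by (rule assms)
  have "additive_subgroup {f. h f \<in> I} MP"
    by (rule additive_subgroupI'[OF monoid_algebra.is_abelian_group]) (auto simp: h_add h_zero h_uminus)
  then show "ideal {f. h f \<in> I} MP"
    by (intro idealI monoid_algebra.ring_axioms additive_subgroup.a_subgroup)
      (auto simp: h_mult intro: I.I_l_closed I.I_r_closed)
  have "h 1 \<notin> I" unfolding h_one using I.I_notcarr I.one_imp_carrier by blast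
  then show "carrier MP \<noteq> {f. h f \<in> I}" by auto
  show "a \<otimes>\<^sub>MP b \<in> {f. h f \<in> I} ==> a \<in> {f. h f \<in> I} \<or> b \<in> {f. h f \<in> I}" for a b
    using I.I_prime[of "h a" "h b"] by (simp add: h_mult)
qed

text \<open>As J contains the kernel of h, membership in J can be tested after applying h.\<close>

lemma prime_image:
  assumes J: "primeideal J MP" and rel: "rel_ideal \<subseteq> J"
  shows "primeideal (h ` J) R" and "h f \<in> h ` J \<longleftrightarrow> f \<in> J"
proof -
  interpret J: primeideal J MP by (rule J)
  have mem: "h f \<in> h ` J \<longleftrightarrow> f \<in> J" for f
  proof
    assume "h f \<in> h ` J"
    then obtain g where g: "g \<in> J" "h f = h g" by blast
    have "h (f + - g) = \<zero>" unfolding h_add h_uminus g(2) by (simp add: R.r_neg)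
    then have "f + - g \<in> J" unfolding h_ker using rel by blast
    then show "f \<in> J" using J.a_closed[of "f + - g" g] g(1) by simp
  qed simp
  then show "h f \<in> h ` J \<longleftrightarrow> f \<in> J" .
  show "primeideal (h ` J) R"
  proof (rule primeidealI[OF _ cring])
    have "additive_subgroup (h ` J) R"
    proof (rule additive_subgroupI'[OF R.is_abelian_group])
      show "\<zero> \<in> h ` J" using J.zero_closed h_zero by (metis image_eqI monoid_algebra_simps(4))
      show "x \<in> h ` J ==> y \<in> h ` J ==> x \<oplus> y \<in> h ` J" for x y
        using J.a_closed by (auto simp flip: h_add)
      show "x \<in> h ` J ==> \<ominus> x \<in> h ` J" for x
        using J.a_inv_closed by (auto simp flip: h_uminus)
    qed auto
    then show "ideal (h ` J) R"
    proof (intro idealI R.ring_axioms additive_subgroup.a_subgroup)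
      fix a x assume "a \<in> h ` J" "x \<in> carrier R"
      then obtain f g where "a = h f" "f \<in> J" "x = h g" using h_cases by blast
      then show "x \<otimes> a \<in> h ` J" "a \<otimes> x \<in> h ` J"
        using J.I_l_closed[of f g] J.I_r_closed[of f g] by (simp_all flip: h_mult)
    qed
    have "1 \<notin> J" using J.I_notcarr J.one_imp_carrier by auto
    then show "carrier R \<noteq> h ` J" using mem[of 1] h_closed[of 1] by metis
    show "a \<in> h ` J \<or> b \<in> h ` J" if ab: "a \<in> carrier R" "b \<in> carrier R" "a \<otimes> b \<in> h ` J" for a b
    proof -
      obtain f g where fg: "a = h f" "b = h g" using ab(1,2) h_cases by metis
      have "f * g \<in> J" using ab(3) unfolding fg h_mult[symmetric] mem .
      then show ?thesis unfolding fg mem using J.I_prime[of f g] by simp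
    qed
  qed
qed

text \<open>Preimages of primes are primes containing \<open>rel_ideal\<close>, and surjectivity
  keeps inclusions strict; so \<open>no_long_prime_chain\<close> bounds the length of a chain in
  \<open>R\<close>.\<close>

lemma krull_dim: "krull_dim R = 2"
proof (rule antisym)
  show "krull_dim R \<le> 2"
    unfolding krull_dim_def
  proof (rule Sup_least, safe)
    fix n p assume p: "\<forall>i\<le>n. primeideal (p i) R" "\<forall>i<n. p i \<subset> p (Suc i)"
    have "n \<le> 2"
    proof (rule ccontr)
      assume "\<not> n \<le> 2"
      show False
      proof (rule no_long_prime_chain[of "\<lambda>i. {f. h f \<in> p i}"])
        show "primeideal {f. h f \<in> p i} MP" if "i \<le> 3" for i
          using that p(1) \<open>\<not> n \<le> 2\<close> by (intro prime_pullback) auto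
        show "{f. h f \<in> p i} \<subset> {f. h f \<in> p (Suc i)}" if "i < 3" for i
        proof -
          have i: "p i \<subset> p (Suc i)" "primeideal (p (Suc i)) R" using that p \<open>\<not> n \<le> 2\<close> by auto
          then obtain x where x: "x \<in> p (Suc i)" "x \<notin> p i" by blast
          have "x \<in> carrier R"
            using x(1) additive_subgroup.a_subset[OF ideal.axioms(1)[OF primeideal.axioms(1)[OF i(2)]]] by blast
          then obtain f where "x = h f" using h_cases by blast
          then show ?thesis using x i(1) by blast
        qed
        have "\<zero> \<in> p 0"
          using p(1) additive_subgroup.zero_closed[OF ideal.axioms(1)[OF primeideal.axioms(1)]] by blast
        then show "rel_ideal \<subseteq> {f. h f \<in> p 0}" by (auto simp flip: h_ker)
      qed
    qed
    then show "enat n \<le> 2" by (simp add: numeral_eq_enat)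
  qed
  \<comment> \<open>The variables set to zero along the chain: first \<open>X20\<close>, then also
    \<open>X22\<close>, then all three. The kernels of these substitutions all contain
    \<open>rel_ideal\<close>.\<close>
  define V where "V = (\<lambda>i::nat. if i = 0 then {X20} else if i = 1 then {X20, X22} else UNIV)"
  let ?J = "\<lambda>i. {f :: monom \<Rightarrow>\<^sub>0 'k. trunc (V i) f = 0}"
  have V: "X20 \<in> V i" for i unfolding V_def by auto
  note prime = prime_image[OF trunc_prime rel_ideal_trunc[OF V]]
  have "\<exists>p. (\<forall>i\<le>2. primeideal (p i) R) \<and> (\<forall>i<2. p i \<subset> p (Suc i))"
  proof (intro exI[of _ "\<lambda>i. h ` ?J i"] conjI allI impI)
    show "primeideal (h ` ?J i) R" for i by (rule prime(1))
    fix i :: nat assume "i < 2"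
    then have "\<exists>v. v \<in> V (Suc i) - V i" and sub: "V i \<subseteq> V (Suc i)"
      unfolding V_def by (auto simp: less_2_cases_iff)
    then obtain v where v: "v \<in> V (Suc i)" "v \<notin> V i" by blast
    have "trunc (V (Suc i)) f = 0" if "trunc (V i) f = 0" for f :: "monom \<Rightarrow>\<^sub>0 'k"
    proof (rule poly_mapping_eqI)
      fix \<mu>
      have "lookup (trunc (V i) f) \<mu> = 0" using that by simp
      then show "lookup (trunc (V (Suc i)) f) \<mu> = lookup 0 \<mu>"
        using sub by (auto simp: lookup_trunc split: if_splits)
    qed
    then have "h ` ?J i \<subseteq> h ` ?J (Suc i)" by blast
    moreover have "h (indet_poly v) \<in> h ` ?J (Suc i)" "h (indet_poly v) \<notin> h ` ?J i"
      using v unfolding prime(2) by (simp_all add: trunc_indet_poly indet_poly_neq_zero)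
    ultimately show "h ` ?J i \<subset> h ` ?J (Suc i)" by blast
  qed
  then show "2 \<le> krull_dim R"
    unfolding krull_dim_def by (intro Sup_upper) (auto simp: numeral_eq_enat)
qed

lemma finitely_generated:
  assumes const: "\<And>c. h (const c) = c \<odot> \<one>"
  shows "finitely_generated_algebra R"
proof -
  let ?S = "h ` range indet_poly"
  let ?G = "generate_ring R (?S \<union> range (\<lambda>c. c \<odot> \<one>))"
  have sub: "?S \<union> range (\<lambda>c. c \<odot> \<one>) \<subseteq> carrier R" by (auto simp flip: const)
  have pow: "h (f ^ k) \<in> ?G" if "h f \<in> ?G" for f k
    using that by (induction k) (auto simp: h_one h_mult intro: generate_ring.intros)
  have "h f \<in> ?G" for f using subset_UNIV[of "keys f"]
  proof (induction f rule: poly_mapping_add_induct)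
    case zero
    show ?case unfolding h_zero by (rule R.zero_in_generate)
  next
    case (add f g)
    then show ?case unfolding h_add by (intro generate_ring.eng_add)
  next
    case (single \<mu> c)
    let ?p = "\<lambda>v. indet_poly v ^ lookup \<mu> v :: monom \<Rightarrow>\<^sub>0 'k"
    have pw: "indet_poly v ^ k = (single (single v k) 1 :: monom \<Rightarrow>\<^sub>0 'k)" for v k
    proof (induction k)
      case (Suc k)
      have "single v 1 + single v k = (single v (Suc k) :: monom)"
        by (simp flip: single_add)
      then show ?case using Suc by (simp add: indet_poly_def mult_single)
    qed (simp add: single_zero)
    have "\<mu> = single X20 (lookup \<mu> X20) + (single X22 (lookup \<mu> X22)
        + single X42 (lookup \<mu> X42))"
      by (rule monom_eqI) (simp_all add: lookup_add lookup_single when_def)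
    then have eq: "single \<mu> c = const c * (?p X20 * (?p X22 * ?p X42))"
      unfolding pw by (simp add: mult_single)
    have c: "h (const c) \<in> ?G" unfolding const by (rule generate_ring.incl, rule UnI2, rule rangeI)
    have p: "h (?p v) \<in> ?G" for v by (rule pow, rule generate_ring.incl, rule UnI1, rule imageI, rule rangeI)
    show ?case unfolding eq h_mult by (rule generate_ring.eng_mult[OF c generate_ring.eng_mult[OF p generate_ring.eng_mult[OF p p]]])
  qed
  then have "range h \<subseteq> ?G" by (rule image_subsetI)
  then have G: "?G = carrier R"
    using R.generate_ring_incl[OF sub] unfolding h_surj by (rule_tac equalityI)
  have "finite ?S" by (simp add: UNIV_indet)
  then show ?thesis
    unfolding finitely_generated_algebra_def using G sub by (intro exI[of _ ?S] conjI) simp_all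
qed

end

lemma cl_ring_hom: "cl \<in> ring_hom MP poly_quot"
  by (rule ring_hom_memI) (simp_all add: poly_quot_simps)

lemma algebra_iso_presentation:
  assumes R: "ring R" and \<phi>: "\<phi> \<in> algebra_iso poly_quot R"
  shows "poly_presentation R (\<lambda>f. \<phi> (cl f))" and "\<phi> (cl (const c)) = c \<odot>\<^sub>R \<one>\<^sub>R"
proof -
  interpret R: ring R by (rule R)
  have iso: "\<phi> \<in> ring_iso poly_quot R" using \<phi> unfolding algebra_iso_def by simp
  then have hom: "\<phi> \<in> ring_hom poly_quot R" and bij: "bij_betw \<phi> (carrier poly_quot) (carrier R)"
    unfolding ring_iso_def by auto
  interpret h: ring_hom_ring poly_quot R \<phi> by (intro ring_hom_ringI2 poly_quot_ring R hom)
  have c: "cl f \<in> carrier poly_quot" for f by (simp add: poly_quot_simps)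
  show "poly_presentation R (\<lambda>f. \<phi> (cl f))"
  proof (intro poly_presentation.intro poly_presentation_axioms.intro R)
    show "(\<lambda>f. \<phi> (cl f)) \<in> ring_hom MP R" using ring_hom_trans[OF cl_ring_hom hom] by (simp add: comp_def)
    show "range (\<lambda>f. \<phi> (cl f)) = carrier R"
      using bij_betw_imp_surj_on[OF bij] by (simp add: poly_quot_simps image_image)
    fix f
    have "\<phi> (cl f) = \<zero>\<^sub>R \<longleftrightarrow> cl f = \<zero>\<^sub>poly_quot"
      using inj_on_eq_iff[OF bij_betw_imp_inj_on[OF bij] c[of f] h.R.zero_closed] h.hom_zero by simp
    then show "\<phi> (cl f) = \<zero>\<^sub>R \<longleftrightarrow> f \<in> rel_ideal" unfolding cl_eq_zero_iff .
  qed
  have "c \<odot>\<^sub>poly_quot cl 1 = cl (const c)"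
    unfolding poly_quot_def by (subst quot_algebra_smult[OF monoid_algebra.k_algebra_axioms rel_ideal_ideal]) simp_all
  moreover have "\<phi> (c \<odot>\<^sub>poly_quot cl 1) = c \<odot>\<^sub>R \<phi> (cl 1)" using \<phi> c unfolding algebra_iso_def by blast
  moreover have "\<phi> (cl 1) = \<one>\<^sub>R" using h.hom_one by (simp add: poly_quot_simps)
  ultimately show "\<phi> (cl (const c)) = c \<odot>\<^sub>R \<one>\<^sub>R" by simp
qed

theorem corollary7p7:
  fixes N :: nat
  assumes "N > 1" and "CHAR('k::field) \<noteq> 2"
  shows "(\<exists>\<phi> \<in> algebra_iso poly_quot (HH_red N :: ('k, 'k hoch set) module).
            \<phi> (poly_class X20) = chi_red N 2 0 \<and>
            \<phi> (poly_class X22) = chi_red N 2 2 \<and>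
            \<phi> (poly_class X42) = chi_red N 4 2)
       \<and> cring (HH_red N :: ('k, 'k hoch set) module)
       \<and> finitely_generated_algebra (HH_red N :: ('k, 'k hoch set) module)
       \<and> krull_dim (HH_red N :: ('k, 'k hoch set) module) = 2"
proof -
  have "(2::'k) \<noteq> 0"
  proof
    assume "(2::'k) = 0"
    then have "CHAR('k) dvd 2" using of_nat_eq_0_iff_char_dvd[of 2, where 'a='k] by simp
    then have "CHAR('k) \<le> 2" "CHAR('k) \<noteq> 0" by (auto dest: dvd_imp_le intro!: Nat.gr0I)
    moreover have "CHAR('k) \<noteq> Suc 0" by (rule CHAR_not_1)
    ultimately show False using assms(2) by linarith
  qed
  then interpret lambda_algebra_odd N "TYPE('k)"
    using assms(1) by unfold_locales
  have red: "ring (HH_red N :: ('k, 'k hoch set) module)"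
    unfolding HH_red_def HH_def by (rule quot_algebra_ring[OF X.E_ring HH_nil_ideal])
  have cls: "poly_class X20 = cl (single (mon_deg 2 0) (1::'k))"
    "poly_class X22 = cl (single (mon_deg 2 2) (1::'k))"
    "poly_class X42 = cl (single (mon_deg 4 2) (1::'k))"
    unfolding poly_class_def indet_poly_def mon_deg_def by (simp_all add: single_zero)
  interpret R: poly_presentation "HH_red N" "\<lambda>f. \<Phi> (cl f)"
    by (rule algebra_iso_presentation(1)[OF red \<Phi>_iso(1)])
  show ?thesis
  proof (intro conjI bexI[of _ \<Phi>])
    show "\<Phi> (poly_class X20) = chi_red N 2 0" "\<Phi> (poly_class X22) = chi_red N 2 2" "\<Phi> (poly_class X42) = chi_red N 4 2"
      unfolding cls by (simp_all add: \<Phi>_chi)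
    show "\<Phi> \<in> algebra_iso poly_quot (HH_red N)" by (rule \<Phi>_iso(1))
    show "cring (HH_red N :: ('k, 'k hoch set) module)" by (rule R.cring)
    show "finitely_generated_algebra (HH_red N :: ('k, 'k hoch set) module)"
      by (rule R.finitely_generated[OF algebra_iso_presentation(2)[OF red \<Phi>_iso(1)]])
    show "krull_dim (HH_red N :: ('k, 'k hoch set) module) = 2" by (rule R.krull_dim)
  qed
qed

end
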